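(* Suppose we are given, for some fixed $K\ge1$, the following data: (i) an $A(\infty)$-algebra $\mathbf V=(V,\partial,m_2,m_3,\dots)$, (ii) an $A(K)$-algebra $\mathbf W=(W,\partial,n_2,n_3,\dots,n_K)$, and (iii) a morphism $\{F_n:V^{\otimes n}\to W\}_{n\le K}:\mathbf V_K\to\mathbf W$ of $A(K)$-algebras. Suppose that the chain map $F_1:(V,\partial)\to(W,\partial)$ is a quasi-isomorphism. Then these data can be extended to an $A(\infty)$-structure on $(W,\partial)$ and to an $A(\infty)$-homomorphism from $\mathbf V$ to this $A(\infty)$-algebra; that is, there are $n_{i}$ and $F_i$, $i>K$, such that $(W,\partial,n_2,n_3,\dots)$ is an $A(\infty)$-algebra and $\{F_n\}_{n\ge1}$ is an $A(\infty)$-homomorphism. A similar statement, with $A(\infty)$, $A(K)$ replaced by $C(\infty)$, $C(K)$ (balanced strongly homotopy associative algebras) or by $L(\infty)$, $L(K)$ (strongly homotopy Lie algebras) and the corresponding morphisms, also holds.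
   Context: The base field $\mathbf k$ has characteristic zero; signs follow the Koszul convention; differentials have degree $-1$. $\delta$ denotes the induced differential on $\mathrm{Hom}(W^{\otimes n},W)$, $\mathrm{Hom}(V^{\otimes n},W)$, etc. For $1\le K\le\infty$, an $A(K)$-algebra is $(W,\partial,n_2,n_3,\dots,n_K)$ with $(W,\partial)$ a chain complex and $n_i:W^{\otimes i}\to W$ of degree $i-2$ such that for all finite $n$ with $2\le n\le K$ $$\delta(n_n)=\sum_{i+j=n+1,\ i,j\ge2}\ \sum_{s=0}^{n-j}(-1)^{i+s(j+1)}\,n_i(1^{\otimes s}\otimes n_j\otimes1^{\otimes i-s-1}).$$ A morphism $(V,\partial,m_2,\dots,m_K)\to(W,\partial,n_2,\dots,n_K)$ of $A(K)$-algebras is a sequence $F_i:V^{\otimes i}\to W$ of degree $i-1$, $1\le i\le K$ ($i$ finite), such that for all finite $n$ with $1\le n\le K$ $$\delta(F_n)=-\sum_{k=2}^n\ \sum_{r_1+\dots+r_k=n}(-1)^{\sum_{1\le i<j\le k}r_i(r_j+1)}n_k(F_{r_1}\otimes\dots\otimes F_{r_k})-\sum_{i+j=n+1,\ i\ge1,\ j\ge2}\ \sum_{s=0}^{n-j}(-1)^{i+s(j+1)}F_i(1^{\otimes s}\otimes m_j\otimes1^{\otimes i-s-1}).$$ For $K=\infty$ these are $A(\infty)$-algebras and $A(\infty)$-homomorphisms. $\mathbf V_K$ is the $A(K)$-algebra obtained from an $A(\infty)$-algebra $\mathbf V$ by forgetting all operations of arity $>K$. A $C(K)$-algebra (balanced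 $A(K)$-algebra) is an $A(K)$-algebra each of whose operations $n_i$ vanishes on all signed shuffles $\sum_\sigma\mathrm{sgn}(\sigma)\,(\text{Koszul sign})\,w_{\sigma^{-1}(1)}\otimes\dots\otimes w_{\sigma^{-1}(i)}$, the sum over $(p,i-p)$-shuffles, $1\le p\le i-1$; morphisms of $C(K)$-algebras are $A(K)$-morphisms whose components $F_i$ also vanish on these signed shuffles. An $L(K)$-algebra is a chain complex $(W,\partial)$ with degree $-1$ maps $q_i:S^i(\uparrow W)\to\uparrow W$, $1\le i\le K$, on the symmetric powers of the suspension, $q_1$ being the differential of $\uparrow W$ induced by $\partial$, such that the coderivation $Q$ of the cofree conilpotent cocommutative coalgebra $\bigoplus_{n\ge1}S^n(\uparrow W)$ with components $q_i$ (and $0$ for $i>K$) satisfies: the component $S^n(\uparrow W)\to\uparrow W$ of $Q^2$ is zero for all finite $n\le K$. A morphism of $L(K)$-algebras $V\to W$ is a family of degree $0$ maps $\varphi_i:S^i(\uparrow V)\to\uparrow W$, $i\le K$, such that for the induced coalgebra map $\Phi$ the component $S^n(\uparrow V)\to\uparrow W$ of $\Phi Q_V-Q_W\Phi$ is zero for all finite $n\le K$. $L(\infty)$ is the case $K=\infty$; $F_1$ corresponds to $\varphi_1$. *)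

theory Defs
  imports Complex_Main "HOL-Combinatorics.Permutations" "HOL-Library.Extended_Nat"
    "HOL-Library.Poly_Mapping"
begin

section \<open>Chain complexes\<close>

text \<open>
  A graded vector space is a vector space (the whole type \<open>'v\<close>, with scalar multiplication
  \<open>smul\<close>) that is the internal direct sum of the subspaces \<open>grade d\<close>, \<open>d\<close> an integer.
\<close>

record ('k, 'v) complex_data =
  smul :: "'k \<Rightarrow> 'v \<Rightarrow> 'v"
  grade :: "int \<Rightarrow> 'v set"
  bd :: "'v \<Rightarrow> 'v"

definition chain_complex :: "('k::field, 'v::ab_group_add) complex_data \<Rightarrow> bool" where
  "chain_complex V \<longleftrightarrow>
     vector_space (smul V) \<and>
     (\<forall>d. module.subspace (smul V) (grade V d)) \<and>
     (\<forall>v. \<exists>!c. finite {d. c d \<noteq> 0} \<and> (\<forall>d. c d \<in> grade V d) \<and> v = (\<Sum>d | c d \<noteq> 0. c d)) \<and>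
     Vector_Spaces.linear (smul V) (smul V) (bd V) \<and>
     (\<forall>d. \<forall>x\<in>grade V d. bd V x \<in> grade V (d - 1)) \<and>
     (\<forall>x. bd V (bd V x) = 0)"

text \<open>Multiplication by \<open>(-1)^e\<close>.\<close>

definition ksgn :: "int \<Rightarrow> 'v::ab_group_add \<Rightarrow> 'v" where
  "ksgn e x = (if even e then x else - x)"

definition cycles :: "('k, 'v::ab_group_add) complex_data \<Rightarrow> int \<Rightarrow> 'v set" where
  "cycles V d = {x \<in> grade V d. bd V x = 0}"

definition homologous :: "('k, 'v::ab_group_add) complex_data \<Rightarrow> int \<Rightarrow> ('v \<times> 'v) set" where
  "homologous V d =
     {(x, y). x \<in> cycles V d \<and> y \<in> cycles V d \<and> x - y \<in> bd V ` grade V (d + 1)}"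

definition homology :: "('k, 'v::ab_group_add) complex_data \<Rightarrow> int \<Rightarrow> 'v set set" where
  "homology V d = cycles V d // homologous V d"

definition chain_map ::
  "('k::field, 'v::ab_group_add) complex_data \<Rightarrow> ('k, 'w::ab_group_add) complex_data
    \<Rightarrow> ('v \<Rightarrow> 'w) \<Rightarrow> bool" where
  "chain_map V W f \<longleftrightarrow>
     Vector_Spaces.linear (smul V) (smul W) f \<and>
     (\<forall>d. \<forall>x\<in>grade V d. f x \<in> grade W d) \<and>
     (\<forall>x. bd W (f x) = f (bd V x))"

text \<open>The map induced by \<open>f\<close> on homology sends a class \<open>c\<close> to the class containing \<open>f ` c\<close>.\<close>

definition quasi_iso ::
  "('k::field, 'v::ab_group_add) complex_data \<Rightarrow> ('k, 'w::ab_group_add) complex_data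
    \<Rightarrow> ('v \<Rightarrow> 'w) \<Rightarrow> bool" where
  "quasi_iso V W f \<longleftrightarrow>
     chain_map V W f \<and>
     (\<forall>d. bij_betw (\<lambda>c. homologous W d `` (f ` c)) (homology V d) (homology W d))"

section \<open>Multilinear maps\<close>

text \<open>
  A linear map \<open>f\<close> from the \<open>n\<close>-th tensor power of \<open>V\<close> to \<open>W\<close> is represented by the
  corresponding multilinear map, applied to the list of its \<open>n\<close> arguments; its values on lists of
  other lengths are irrelevant.  Formulas with Koszul signs are evaluated on lists \<open>xs\<close> of
  homogeneous elements, with \<open>ds\<close> the list of their degrees.
\<close>

definition homogeneous ::
  "('k, 'v) complex_data \<Rightarrow> int list \<Rightarrow> 'v list \<Rightarrow> bool" where
  "homogeneous V ds xs \<longleftrightarrow> list_all2 (\<lambda>d x. x \<in> grade V d) ds xs"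

definition multi_hom ::
  "('k::field, 'v::ab_group_add) complex_data \<Rightarrow> ('k, 'w::ab_group_add) complex_data
    \<Rightarrow> nat \<Rightarrow> int \<Rightarrow> ('v list \<Rightarrow> 'w) \<Rightarrow> bool" where
  "multi_hom V W n e f \<longleftrightarrow>
     (\<forall>us vs. length us + length vs + 1 = n \<longrightarrow>
        Vector_Spaces.linear (smul V) (smul W) (\<lambda>x. f (us @ x # vs))) \<and>
     (\<forall>ds xs. length xs = n \<and> homogeneous V ds xs \<longrightarrow> f xs \<in> grade W (sum_list ds + e))"

text \<open>The differential of a multilinear map \<open>f\<close> of degree \<open>e\<close>:
  \<open>\<delta> f = \<partial> f - (-1)^e \<Sum> f (1 \<otimes> \<dots> \<otimes> \<partial> \<otimes> \<dots> \<otimes> 1)\<close>.\<close>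

definition hom_diff ::
  "('k, 'v::ab_group_add) complex_data \<Rightarrow> ('k, 'w::ab_group_add) complex_data
    \<Rightarrow> int \<Rightarrow> ('v list \<Rightarrow> 'w) \<Rightarrow> int list \<Rightarrow> 'v list \<Rightarrow> 'w" where
  "hom_diff V W e f ds xs =
     bd W (f xs) -
     ksgn e (\<Sum>s<length xs. ksgn (sum_list (take s ds)) (f (xs[s := bd V (xs ! s)])))"

text \<open>\<open>f (1^s \<otimes> g \<otimes> 1 \<otimes> \<dots> \<otimes> 1)\<close> for \<open>g\<close> of arity \<open>j\<close> and degree \<open>e\<close>.\<close>

definition insert_op ::
  "('v list \<Rightarrow> 'w::ab_group_add) \<Rightarrow> nat \<Rightarrow> ('v list \<Rightarrow> 'v) \<Rightarrow> nat \<Rightarrow> int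
    \<Rightarrow> int list \<Rightarrow> 'v list \<Rightarrow> 'w" where
  "insert_op f s g j e ds xs =
     ksgn (e * sum_list (take s ds)) (f (take s xs @ g (take j (drop s xs)) # drop (s + j) xs))"

fun blocks :: "nat list \<Rightarrow> 'a list \<Rightarrow> 'a list list" where
  "blocks [] xs = []"
| "blocks (r # rs) xs = take r xs # blocks rs (drop r xs)"

text \<open>\<open>f (F\<^sub>r\<^sub>1 \<otimes> \<dots> \<otimes> F\<^sub>r\<^sub>k)\<close> for \<open>F\<^sub>r\<close> of arity \<open>r\<close> and degree \<open>r - 1\<close>:
  each \<open>F\<^sub>r\<close> moves past the arguments of all the factors to its left.\<close>

definition tensor_op ::
  "('w list \<Rightarrow> 'w::ab_group_add) \<Rightarrow> (nat \<Rightarrow> 'v list \<Rightarrow> 'w) \<Rightarrow> nat list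
    \<Rightarrow> int list \<Rightarrow> 'v list \<Rightarrow> 'w" where
  "tensor_op f F rs ds xs =
     ksgn (\<Sum>b<length rs. (int (rs ! b) - 1) * sum_list (take (sum_list (take b rs)) ds))
       (f (map2 F rs (blocks rs xs)))"

section \<open>\<open>A(K)\<close>-algebras\<close>

text \<open>
  The operations are given as a family indexed by all natural numbers, of which only those of
  arity \<open>2, \<dots>, K\<close> are constrained, and only those are part of the structure.  Thus the
  truncation of an \<open>A(\<infinity>)\<close>-algebra to an \<open>A(K)\<close>-algebra is represented by the same family.
  The same applies to the morphisms, and to \<open>L(K)\<close>-algebras below.
\<close>

definition A_algebra ::
  "enat \<Rightarrow> ('k::field, 'w::ab_group_add) complex_data \<Rightarrow> (nat \<Rightarrow> 'w list \<Rightarrow> 'w) \<Rightarrow> bool" where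
  "A_algebra K W n \<longleftrightarrow>
     chain_complex W \<and>
     (\<forall>i\<ge>2. enat i \<le> K \<longrightarrow> multi_hom W W i (int i - 2) (n i)) \<and>
     (\<forall>N\<ge>2. enat N \<le> K \<longrightarrow> (\<forall>ds xs. length xs = N \<and> homogeneous W ds xs \<longrightarrow>
        hom_diff W W (int N - 2) (n N) ds xs =
        (\<Sum>(i, j) | i + j = N + 1 \<and> 2 \<le> i \<and> 2 \<le> j. \<Sum>s = 0..N - j.
           ksgn (int (i + s * (j + 1))) (insert_op (n i) s (n j) j (int j - 2) ds xs))))"

definition A_morphism ::
  "enat \<Rightarrow> ('k::field, 'v::ab_group_add) complex_data \<Rightarrow> ('k, 'w::ab_group_add) complex_data
    \<Rightarrow> (nat \<Rightarrow> 'v list \<Rightarrow> 'v) \<Rightarrow> (nat \<Rightarrow> 'w list \<Rightarrow> 'w) \<Rightarrow> (nat \<Rightarrow> 'v list \<Rightarrow> 'w) \<Rightarrow> bool" where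
  "A_morphism K V W m n F \<longleftrightarrow>
     (\<forall>i\<ge>1. enat i \<le> K \<longrightarrow> multi_hom V W i (int i - 1) (F i)) \<and>
     (\<forall>N\<ge>1. enat N \<le> K \<longrightarrow> (\<forall>ds xs. length xs = N \<and> homogeneous V ds xs \<longrightarrow>
        hom_diff V W (int N - 1) (F N) ds xs =
        - (\<Sum>k = 2..N. \<Sum>rs | length rs = k \<and> sum_list rs = N \<and> (\<forall>r\<in>set rs. 1 \<le> r).
             ksgn (int (\<Sum>b<k. \<Sum>a<b. rs ! a * (rs ! b + 1))) (tensor_op (n k) F rs ds xs))
        - (\<Sum>(i, j) | i + j = N + 1 \<and> 1 \<le> i \<and> 2 \<le> j. \<Sum>s = 0..N - j.
             ksgn (int (i + s * (j + 1))) (insert_op (F i) s (m j) j (int j - 2) ds xs))))"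

section \<open>\<open>C(K)\<close>-algebras\<close>

definition shuffle_perms :: "nat \<Rightarrow> nat \<Rightarrow> (nat \<Rightarrow> nat) set" where
  "shuffle_perms p n =
     {\<sigma>. \<sigma> permutes {..<n} \<and> strict_mono_on {..<p} \<sigma> \<and> strict_mono_on {p..<n} \<sigma>}"

definition perm_koszul :: "(nat \<Rightarrow> nat) \<Rightarrow> int list \<Rightarrow> int" where
  "perm_koszul \<sigma> ds =
     (\<Sum>(a, b) | a < b \<and> b < length ds \<and> \<sigma> b < \<sigma> a. ds ! a * ds ! b)"

definition vanishes_on_shuffles ::
  "('k::field, 'v::ab_group_add) complex_data \<Rightarrow> ('k, 'w::ab_group_add) complex_data
    \<Rightarrow> nat \<Rightarrow> ('v list \<Rightarrow> 'w) \<Rightarrow> bool" where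
  "vanishes_on_shuffles V W n f \<longleftrightarrow>
     (\<forall>p ds xs. 1 \<le> p \<and> p < n \<and> length xs = n \<and> homogeneous V ds xs \<longrightarrow>
        (\<Sum>\<sigma>\<in>shuffle_perms p n.
           smul W (of_int (sign \<sigma>)) (ksgn (perm_koszul \<sigma> ds) (f (permute_list (inv \<sigma>) xs)))) = 0)"

definition C_algebra ::
  "enat \<Rightarrow> ('k::field, 'w::ab_group_add) complex_data \<Rightarrow> (nat \<Rightarrow> 'w list \<Rightarrow> 'w) \<Rightarrow> bool" where
  "C_algebra K W n \<longleftrightarrow>
     A_algebra K W n \<and> (\<forall>i\<ge>2. enat i \<le> K \<longrightarrow> vanishes_on_shuffles W W i (n i))"

definition C_morphism ::
  "enat \<Rightarrow> ('k::field, 'v::ab_group_add) complex_data \<Rightarrow> ('k, 'w::ab_group_add) complex_data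
    \<Rightarrow> (nat \<Rightarrow> 'v list \<Rightarrow> 'v) \<Rightarrow> (nat \<Rightarrow> 'w list \<Rightarrow> 'w) \<Rightarrow> (nat \<Rightarrow> 'v list \<Rightarrow> 'w) \<Rightarrow> bool" where
  "C_morphism K V W m n F \<longleftrightarrow>
     A_morphism K V W m n F \<and> (\<forall>i\<ge>1. enat i \<le> K \<longrightarrow> vanishes_on_shuffles V W i (F i))"

section \<open>The cofree conilpotent cocommutative coalgebra\<close>

definition fscale :: "'k::field \<Rightarrow> ('a \<Rightarrow>\<^sub>0 'k) \<Rightarrow> ('a \<Rightarrow>\<^sub>0 'k)" where
  "fscale c p = Poly_Mapping.map ((*) c) p"

lemma lookup_fscale [simp]: "Poly_Mapping.lookup (fscale c p) a = c * Poly_Mapping.lookup p a"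
  by (simp add: fscale_def Poly_Mapping.map.rep_eq when_def)

lemma vector_space_fscale: "vector_space (fscale :: 'k::field \<Rightarrow> ('a \<Rightarrow>\<^sub>0 'k) \<Rightarrow> _)"
  by unfold_locales (auto intro!: poly_mapping_eqI simp: lookup_add algebra_simps)

definition fgen :: "'a \<Rightarrow> 'a \<Rightarrow>\<^sub>0 'k::field" where
  "fgen a = Poly_Mapping.single a 1"

text \<open>The linear extension of \<open>f\<close> from the basis to the free vector space.\<close>

definition lin_ext :: "('k::field \<Rightarrow> 'v \<Rightarrow> 'v) \<Rightarrow> ('a \<Rightarrow> 'v::ab_group_add) \<Rightarrow> ('a \<Rightarrow>\<^sub>0 'k) \<Rightarrow> 'v" where
  "lin_ext s f p = (\<Sum>a\<in>Poly_Mapping.keys p. s (Poly_Mapping.lookup p a) (f a))"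

definition ftensor :: "('a \<Rightarrow>\<^sub>0 'k::field) \<Rightarrow> ('b \<Rightarrow>\<^sub>0 'k) \<Rightarrow> ('a \<times> 'b \<Rightarrow>\<^sub>0 'k)" where
  "ftensor p q =
     (\<Sum>a\<in>Poly_Mapping.keys p. \<Sum>b\<in>Poly_Mapping.keys q.
        Poly_Mapping.single (a, b) (Poly_Mapping.lookup p a * Poly_Mapping.lookup q b))"

text \<open>
  The sum \<open>S(U)\<close> of the symmetric powers \<open>S^n(U)\<close>, \<open>n \<ge> 1\<close>, is presented by generators and
  relations.  The word \<open>[(d\<^sub>1, x\<^sub>1), \<dots>, (d\<^sub>n, x\<^sub>n)]\<close>, with \<open>x\<^sub>i\<close> of degree \<open>d\<^sub>i\<close>, stands for
  the product of the \<open>x\<^sub>i\<close>; the relations are multilinearity and graded commutativity.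
  So \<open>S(U)\<close> is the quotient of \<open>sym_free U\<close> by \<open>sym_rel U\<close>, and its tensor square is the
  corresponding quotient by \<open>sym_rel2 U\<close>.  Linear maps between such quotients are given by linear
  lifts that preserve the relations, and two elements are equal if their difference is a relation.
\<close>

definition words :: "('k, 'v) complex_data \<Rightarrow> (int \<times> 'v) list set" where
  "words U = {w. w \<noteq> [] \<and> (\<forall>(d, x)\<in>set w. x \<in> grade U d)}"

definition wdeg :: "(int \<times> 'v) list \<Rightarrow> int" where
  "wdeg w = sum_list (map fst w)"

definition sym_free ::
  "('k::field, 'v) complex_data \<Rightarrow> ((int \<times> 'v) list \<Rightarrow>\<^sub>0 'k) set" where
  "sym_free U = module.span fscale (fgen ` words U)"

definition sym_gens ::
  "('k::field, 'v::ab_group_add) complex_data \<Rightarrow> ((int \<times> 'v) list \<Rightarrow>\<^sub>0 'k) set" where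
  "sym_gens U =
     {fgen (u @ (d, x + y) # w) - fgen (u @ (d, x) # w) - fgen (u @ (d, y) # w) | u w d x y.
        u @ (d, x) # w \<in> words U \<and> y \<in> grade U d} \<union>
     {fgen (u @ (d, smul U c x) # w) - fscale c (fgen (u @ (d, x) # w)) | u w d x c.
        u @ (d, x) # w \<in> words U} \<union>
     {fgen (u @ (d, x) # (e, y) # w) - ksgn (d * e) (fgen (u @ (e, y) # (d, x) # w)) | u w d x e y.
        u @ (d, x) # (e, y) # w \<in> words U}"

definition sym_rel ::
  "('k::field, 'v::ab_group_add) complex_data \<Rightarrow> ((int \<times> 'v) list \<Rightarrow>\<^sub>0 'k) set" where
  "sym_rel U = module.span fscale (sym_gens U)"

definition sym_rel2 ::
  "('k::field, 'v::ab_group_add) complex_data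
    \<Rightarrow> ((int \<times> 'v) list \<times> (int \<times> 'v) list \<Rightarrow>\<^sub>0 'k) set" where
  "sym_rel2 U = module.span fscale
     ({ftensor r (fgen w) | r w. r \<in> sym_gens U \<and> w \<in> words U} \<union>
      {ftensor (fgen w) r | r w. r \<in> sym_gens U \<and> w \<in> words U})"

text \<open>The (reduced) coproduct
  \<open>\<Delta>(x\<^sub>1 \<cdots> x\<^sub>n) = \<Sum> \<plusminus> x\<^sub>I \<otimes> x\<^sub>J\<close>, summed over the partitions of \<open>{1, \<dots>, n}\<close>
  into nonempty \<open>I\<close> and \<open>J\<close>, with the Koszul sign of moving the \<open>x\<^sub>i\<close>, \<open>i \<in> I\<close>, to the front.\<close>

definition coprod ::
  "((int \<times> 'v) list \<Rightarrow>\<^sub>0 'k::field) \<Rightarrow> ((int \<times> 'v) list \<times> (int \<times> 'v) list \<Rightarrow>\<^sub>0 'k)" where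
  "coprod = lin_ext fscale (\<lambda>w. \<Sum>I\<in>Pow {..<length w} - {{}, {..<length w}}.
     ksgn (\<Sum>i\<in>I. \<Sum>j\<in>{..<i} - I. fst (w ! i) * fst (w ! j)) (fgen (nths w I, nths w (- I))))"

text \<open>Linear maps \<open>S(U) \<rightarrow> S(X)\<close> of degree \<open>e\<close>.\<close>

definition sym_map ::
  "('k::field, 'v::ab_group_add) complex_data \<Rightarrow> ('k, 'w::ab_group_add) complex_data \<Rightarrow> int
    \<Rightarrow> (((int \<times> 'v) list \<Rightarrow>\<^sub>0 'k) \<Rightarrow> ((int \<times> 'w) list \<Rightarrow>\<^sub>0 'k)) \<Rightarrow> bool" where
  "sym_map U X e T \<longleftrightarrow>
     Vector_Spaces.linear fscale fscale T \<and>
     (\<forall>w\<in>words U. T (fgen w) \<in> module.span fscale (fgen ` {w' \<in> words X. wdeg w' = wdeg w + e})) \<and>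
     T ` sym_rel U \<subseteq> sym_rel X"

text \<open>Coderivations of degree \<open>-1\<close>: \<open>\<Delta> Q = (Q \<otimes> 1 + 1 \<otimes> Q) \<Delta>\<close>.\<close>

definition coderivation ::
  "('k::field, 'v::ab_group_add) complex_data
    \<Rightarrow> (((int \<times> 'v) list \<Rightarrow>\<^sub>0 'k) \<Rightarrow> ((int \<times> 'v) list \<Rightarrow>\<^sub>0 'k)) \<Rightarrow> bool" where
  "coderivation U Q \<longleftrightarrow>
     sym_map U U (- 1) Q \<and>
     (\<forall>p\<in>sym_free U.
        coprod (Q p) -
        lin_ext fscale
          (\<lambda>(a, b). ftensor (Q (fgen a)) (fgen b) + ksgn (wdeg a) (ftensor (fgen a) (Q (fgen b))))
          (coprod p)
        \<in> sym_rel2 U)"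

definition coalgebra_map ::
  "('k::field, 'v::ab_group_add) complex_data \<Rightarrow> ('k, 'w::ab_group_add) complex_data
    \<Rightarrow> (((int \<times> 'v) list \<Rightarrow>\<^sub>0 'k) \<Rightarrow> ((int \<times> 'w) list \<Rightarrow>\<^sub>0 'k)) \<Rightarrow> bool" where
  "coalgebra_map U X \<Phi> \<longleftrightarrow>
     sym_map U X 0 \<Phi> \<and>
     (\<forall>p\<in>sym_free U.
        coprod (\<Phi> p) - lin_ext fscale (\<lambda>(a, b). ftensor (\<Phi> (fgen a)) (\<Phi> (fgen b))) (coprod p)
        \<in> sym_rel2 X)"

text \<open>The projection \<open>S(U) \<rightarrow> S^1(U) = U\<close>.\<close>

definition proj1 ::
  "('k::field, 'v::ab_group_add) complex_data \<Rightarrow> ((int \<times> 'v) list \<Rightarrow>\<^sub>0 'k) \<Rightarrow> 'v" where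
  "proj1 U = lin_ext (smul U) (\<lambda>w. if length w = 1 then snd (hd w) else 0)"

definition has_components ::
  "enat \<Rightarrow> ('k::field, 'v::ab_group_add) complex_data \<Rightarrow> ('k, 'w::ab_group_add) complex_data
    \<Rightarrow> (((int \<times> 'v) list \<Rightarrow>\<^sub>0 'k) \<Rightarrow> ((int \<times> 'w) list \<Rightarrow>\<^sub>0 'k)) \<Rightarrow> (nat \<Rightarrow> 'v list \<Rightarrow> 'w) \<Rightarrow> bool" where
  "has_components K U X T t \<longleftrightarrow>
     (\<forall>w\<in>words U. proj1 X (T (fgen w)) =
        (if enat (length w) \<le> K then t (length w) (map snd w) else 0))"

section \<open>\<open>L(K)\<close>-algebras\<close>

text \<open>The suspension is the same vector space with shifted degrees; by the Koszul convention its
  differential is \<open>-\<partial>\<close>.\<close>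

definition susp :: "('k, 'v::ab_group_add) complex_data \<Rightarrow> ('k, 'v) complex_data" where
  "susp V = \<lparr>smul = smul V, grade = (\<lambda>d. grade V (d - 1)), bd = (\<lambda>x. - bd V x)\<rparr>"

text \<open>Linear maps \<open>S^n(U) \<rightarrow> X\<close> of degree \<open>e\<close>, as graded symmetric multilinear maps.\<close>

definition sym_hom ::
  "('k::field, 'v::ab_group_add) complex_data \<Rightarrow> ('k, 'w::ab_group_add) complex_data
    \<Rightarrow> nat \<Rightarrow> int \<Rightarrow> ('v list \<Rightarrow> 'w) \<Rightarrow> bool" where
  "sym_hom U X n e f \<longleftrightarrow>
     multi_hom U X n e f \<and>
     (\<forall>us vs c d. \<forall>x\<in>grade U c. \<forall>y\<in>grade U d. length us + length vs + 2 = n \<longrightarrow>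
        f (us @ x # y # vs) = ksgn (c * d) (f (us @ y # x # vs)))"

definition L_algebra ::
  "enat \<Rightarrow> ('k::field, 'w::ab_group_add) complex_data \<Rightarrow> (nat \<Rightarrow> 'w list \<Rightarrow> 'w) \<Rightarrow> bool" where
  "L_algebra K W q \<longleftrightarrow>
     chain_complex W \<and>
     (\<forall>i\<ge>1. enat i \<le> K \<longrightarrow> sym_hom (susp W) (susp W) i (- 1) (q i)) \<and>
     (\<forall>x. q 1 [x] = bd (susp W) x) \<and>
     (\<exists>Q. coderivation (susp W) Q \<and> has_components K (susp W) (susp W) Q q \<and>
        (\<forall>w\<in>words (susp W). enat (length w) \<le> K \<longrightarrow> proj1 (susp W) (Q (Q (fgen w))) = 0))"

definition L_morphism ::
  "enat \<Rightarrow> ('k::field, 'v::ab_group_add) complex_data \<Rightarrow> ('k, 'w::ab_group_add) complex_data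
    \<Rightarrow> (nat \<Rightarrow> 'v list \<Rightarrow> 'v) \<Rightarrow> (nat \<Rightarrow> 'w list \<Rightarrow> 'w) \<Rightarrow> (nat \<Rightarrow> 'v list \<Rightarrow> 'w) \<Rightarrow> bool" where
  "L_morphism K V W p q \<phi> \<longleftrightarrow>
     (\<forall>i\<ge>1. enat i \<le> K \<longrightarrow> sym_hom (susp V) (susp W) i 0 (\<phi> i)) \<and>
     (\<exists>QV QW \<Phi>.
        coderivation (susp V) QV \<and> has_components K (susp V) (susp V) QV p \<and>
        coderivation (susp W) QW \<and> has_components K (susp W) (susp W) QW q \<and>
        coalgebra_map (susp V) (susp W) \<Phi> \<and> has_components K (susp V) (susp W) \<Phi> \<phi> \<and>
        (\<forall>w\<in>words (susp V). enat (length w) \<le> K \<longrightarrow>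
           proj1 (susp W) (\<Phi> (QV (fgen w)) - QW (\<Phi> (fgen w))) = 0))"

end

theory Submission
  imports Defs
begin

text \<open>
  After suspension, an \<open>A(\<infinity>)\<close>-structure is a coderivation \<open>D\<close> of degree \<open>-1\<close> with \<open>D\<^sup>2 = 0\<close> on
  the tensor coalgebra, and a homomorphism is a map of coalgebras that commutes with the
  coderivations. For \<open>L(\<infinity>)\<close> the symmetric coalgebra takes the place of the tensor coalgebra, and
  for \<open>C(\<infinity>)\<close> the components vanish on shuffles in addition. So the three cases differ only in the
  coproduct (deconcatenation or unshuffling) and in the class of multilinear maps that are allowed
  as components.

  Suppose the structure and the morphism are known up to arity \<open>N\<close>. In arity \<open>N + 1\<close> the equations
  fail by a pair \<open>(R, E)\<close>, with \<open>R\<close> the component of \<open>D\<^sup>2\<close> and \<open>E\<close> that of the commutator of the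
  morphism with the coderivations. New components \<open>(r, \<psi>)\<close> of arity \<open>N + 1\<close> change the failure only
  by a differential: the equations become \<open>\<delta> r = - R\<close> and \<open>\<delta> \<psi> = E - r F\<close>, where \<open>r F\<close> is \<open>r\<close> with
  \<open>F = F\<^sub>1\<close> applied to all arguments. This says that \<open>(R, E)\<close> is a boundary in the mapping cone of
  composition with \<open>F\<close>. It is a cycle because of three identities: the square of an odd coderivation
  is a coderivation, and a coderivation composed with a coalgebra map on either side is a
  coderivation along that map (\<open>ins_ins\<close>, \<open>ins_cm\<close>, \<open>cm_ins\<close>).

  Over a field, \<open>F\<close> is a homotopy equivalence, and composition with it should be one too, so that
  the cone is acyclic (\<open>cone_acyclic\<close>). The difficulty is that the usual homotopy on tensor powers
  is not symmetric and destroys the conditions of the commutative and of the Lie case. Here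
  characteristic zero enters. Let \<open>P\<close> be a projection to representatives of the homology, with
  \<open>1 - P = \<partial> h + h \<partial>\<close>. The derivation that extends \<open>1 - P\<close> to words is null-homotopic through the
  derivation that extends \<open>h\<close>, which is compatible with permutations of the arguments. It is
  diagonalizable with eigenvalues \<open>0, \<dots>, n\<close> on words of length \<open>n\<close>, and the projection to its kernel
  is \<open>P\<close> in all arguments. Division by the nonzero eigenvalues gives \<open>exact_idem\<close>: up to a boundary of
  the same symmetry type, a cycle is unchanged by applying \<open>P\<close> to all arguments.

  The induction over the arity is \<open>extension_words\<close>. What remains is a translation. The signs of the
  \<open>A(K)\<close>-equations are the Koszul signs after suspension (\<open>ins_tagged\<close>, \<open>cm_tagged\<close>), and so are those
  of signed shuffles (\<open>vanishes_on_shuffles_sh\<close>). For \<open>L(K)\<close>-algebras, the coderivations and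
  coalgebra maps on the quotient coalgebra are determined by their components, since in
  characteristic zero an element whose reduced coproduct vanishes lies in \<open>S\<^sup>1\<close>
  (\<open>primitive_sym_rel\<close>); so they may be replaced by those given by explicit formulas.
\<close>

section \<open>Signs and additive maps\<close>

lemma ksgn_0 [simp]: "ksgn 0 x = x" by (simp add: ksgn_def)
lemma ksgn_of_0 [simp]: "ksgn e (0::'v::ab_group_add) = 0" by (simp add: ksgn_def)
lemma ksgn_ksgn: "ksgn a (ksgn b x) = ksgn (a + b) x" by (auto simp: ksgn_def)
lemma ksgn_plus: "ksgn e (x + y) = ksgn e x + ksgn e y" by (simp add: ksgn_def)
lemma ksgn_minus: "ksgn e (- x) = - ksgn e x" by (simp add: ksgn_def)
lemma ksgn_diff: "ksgn e (x - y) = ksgn e x - ksgn e y" by (simp add: ksgn_def)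
lemma ksgn_sum: "ksgn e (\<Sum>i\<in>A. f i) = (\<Sum>i\<in>A. ksgn e (f i))"
  by (simp add: ksgn_def sum_negf)
lemma ksgn_cong: "even a = even b \<Longrightarrow> x = y \<Longrightarrow> ksgn a x = ksgn b y" by (simp add: ksgn_def)
lemma ksgn_even: "even a \<Longrightarrow> ksgn a x = x" by (simp add: ksgn_def)
lemma ksgn_odd: "odd a \<Longrightarrow> ksgn a x = - x" by (simp add: ksgn_def)

lemma wdeg_Nil [simp]: "wdeg [] = 0" by (simp add: wdeg_def)
lemma wdeg_Cons [simp]: "wdeg (a # w) = fst a + wdeg w" by (simp add: wdeg_def)
lemma wdeg_append [simp]: "wdeg (u @ w) = wdeg u + wdeg w" by (simp add: wdeg_def)

definition addi :: "('a::ab_group_add \<Rightarrow> 'b::ab_group_add) \<Rightarrow> bool" where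
  "addi L \<longleftrightarrow> (\<forall>x y. L (x + y) = L x + L y)"

lemma addiI: "(\<And>x y. L (x + y) = L x + L y) \<Longrightarrow> addi L" by (simp add: addi_def)
lemma addi_add: "addi L \<Longrightarrow> L (x + y) = L x + L y" by (simp add: addi_def)
lemma addi_0: "addi L \<Longrightarrow> L 0 = 0" using addi_add[of L 0 0] by simp
lemma addi_minus: "addi L \<Longrightarrow> L (- x) = - L x"
  using addi_add[of L x "- x"] addi_0[of L] by (simp add: eq_neg_iff_add_eq_0 add.commute)
lemma addi_ksgn: "addi L \<Longrightarrow> L (ksgn e x) = ksgn e (L x)" by (simp add: ksgn_def addi_minus[of L])
lemma addi_uminus: "addi uminus" by (simp add: addi_def)
lemma addi_ksgn_fun: "addi (ksgn e)" by (simp add: addi_def ksgn_plus)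

definition addv :: "((int \<times> 'v::ab_group_add) list \<Rightarrow> 'y::ab_group_add) \<Rightarrow> bool" where
  "addv f \<longleftrightarrow> (\<forall>u d w. addi (\<lambda>x. f (u @ (d, x) # w)))"

lemma addv_addi: "addv f \<Longrightarrow> addi (\<lambda>x. f (u @ (d, x) # w))" by (simp add: addv_def)
lemma addv_addi0: "addv f \<Longrightarrow> addi (\<lambda>x. f ((d, x) # w))" using addv_addi[of f "[]"] by simp
lemma addv_Cons: "addv f \<Longrightarrow> addv (\<lambda>z. f (a # z))"
  using addv_addi[of f "a # _"] by (simp add: addv_def)
lemma addv_zero: "addv f \<Longrightarrow> f (u @ (d, 0) # w) = 0"
  by (rule addi_0[OF addv_addi])

section \<open>Splitting words\<close>

text \<open>\<open>spl s g w\<close> is the value of \<open>g\<close> on the coproduct of the word \<open>w\<close>, empty parts included. The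
  coproduct is deconcatenation (tensor coalgebra) if \<open>s\<close> is false, and unshuffling (symmetric
  coalgebra) if \<open>s\<close> is true. Passing a function instead of forming formal sums of words avoids
  quotients and tensor products altogether. The letters of a word carry their degrees in the
  suspension.\<close>

fun spl :: "bool \<Rightarrow> ((int \<times> 'v) list \<Rightarrow> (int \<times> 'v) list \<Rightarrow> 'y::ab_group_add) \<Rightarrow> (int \<times> 'v) list \<Rightarrow> 'y"
  where
  "spl s g [] = g [] []"
| "spl s g (a # w) = spl s (\<lambda>x y. g (a # x) y) w +
     (if s then spl s (\<lambda>x y. ksgn (fst a * wdeg x) (g x (a # y))) w else g [] (a # w))"

lemma spl_cong:
  assumes "\<And>x y. set x \<subseteq> set w \<Longrightarrow> set y \<subseteq> set w \<Longrightarrow> length x + length y = length w \<Longrightarrow>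
     wdeg x + wdeg y = wdeg w \<Longrightarrow> g x y = g' x y"
  shows "spl s g w = spl s g' w"
  using assms
proof (induct w arbitrary: g g')
  case (Cons a w)
  have 1: "spl s (\<lambda>x y. g (a # x) y) w = spl s (\<lambda>x y. g' (a # x) y) w"
    by (rule Cons(1), rule Cons(2)) auto
  have 2: "spl s (\<lambda>x y. ksgn (fst a * wdeg x) (g x (a # y))) w =
    spl s (\<lambda>x y. ksgn (fst a * wdeg x) (g' x (a # y))) w"
    by (rule Cons(1), rule arg_cong[where f = "ksgn _"], rule Cons(2)) auto
  have 3: "g [] (a # w) = g' [] (a # w)" by (rule Cons(2)) auto
  show ?case by (simp only: spl.simps 1 2 3)
qed simp

lemma spl_cong_length [fundef_cong]:
  assumes "w = w'" "\<And>x y. length x + length y = length w' \<Longrightarrow> g x y = g' x y"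
  shows "spl s g w = spl s g' w'"
  using spl_cong[of w g g' s] assms by auto

lemma spl_add: "spl s (\<lambda>x y. g x y + h x y) w = spl s g w + spl s h w"
  by (cases s; induct w arbitrary: g h) (simp_all add: ksgn_plus algebra_simps)

lemma spl_post: "addi L \<Longrightarrow> L (spl s g w) = spl s (\<lambda>x y. L (g x y)) w"
  by (cases s; induct w arbitrary: g) (simp_all add: addi_add[of L] addi_ksgn[of L])

lemma spl_ksgn: "spl s (\<lambda>x y. ksgn e (g x y)) w = ksgn e (spl s g w)"
  by (simp add: spl_post[OF addi_ksgn_fun])

lemma spl_minus: "spl s (\<lambda>x y. - g x y) w = - spl s g w"
  by (simp add: spl_post[OF addi_uminus])

lemma spl_diff: "spl s (\<lambda>x y. g x y - h x y) w = spl s g w - spl s h w"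
  using spl_add[of s g "\<lambda>x y. - h x y" w] by (simp add: spl_minus)

lemma spl_0: "spl s (\<lambda>x y. 0) w = 0"
  by (cases s; induct w) simp_all

lemma spl_right_nil: "spl s (\<lambda>x y. if y = [] then H x else 0) w = H w"
  by (cases s; induct w arbitrary: H) (simp_all add: spl_0)

lemma spl_left_nil: "spl s (\<lambda>x y. if x = [] then H y else 0) w = H w"
proof (induct w arbitrary: H)
  case (Cons a w)
  have "spl s (\<lambda>x y. ksgn (fst a * wdeg x) (if x = [] then H (a # y) else 0)) w
     = spl s (\<lambda>x y. if x = [] then H (a # y) else 0) w"
    by (rule spl_cong) simp
  with Cons[of "\<lambda>y. H (a # y)"] show ?case by (cases s) (simp_all add: spl_0)
qed simp

lemma spl_coassoc:
  "spl s (\<lambda>x y. spl s (\<lambda>x1 x2. g x1 x2 y) x) w = spl s (\<lambda>x y. spl s (\<lambda>y1 y2. g x y1 y2) y) w"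
proof (induct w arbitrary: g)
  case (Cons a w)
  note IH = Cons
  show ?case
  proof (cases s)
    case False
    then show ?thesis
      using IH[of "\<lambda>x. g (a # x)"] by (simp add: spl_add algebra_simps)
  next
    case True
    have A: "spl s (\<lambda>x y. ksgn (fst a * wdeg x) (spl s (\<lambda>x1 x2. g x1 x2 (a # y)) x)) w
      = spl s (\<lambda>x y. spl s (\<lambda>x1 x2. ksgn (fst a * (wdeg x1 + wdeg x2)) (g x1 x2 (a # y))) x) w"
      unfolding spl_ksgn[symmetric]
      by (intro spl_cong) (simp add: algebra_simps)
    have B: "spl s (\<lambda>x y. ksgn (fst a * wdeg x)
         (spl s (\<lambda>y1 y2. ksgn (fst a * wdeg y1) (g x y1 (a # y2))) y)) w
      = spl s (\<lambda>x y. spl s (\<lambda>y1 y2. ksgn (fst a * (wdeg x + wdeg y1)) (g x y1 (a # y2))) y) w"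
      unfolding spl_ksgn[symmetric] by (intro spl_cong) (simp add: ksgn_ksgn algebra_simps)
    have C: "spl s (\<lambda>x y. ksgn (fst a * wdeg x) (spl s (\<lambda>y1 y2. g x (a # y1) y2) y)) w
      = spl s (\<lambda>x y. spl s (\<lambda>y1 y2. ksgn (fst a * wdeg x) (g x (a # y1) y2)) y) w"
      by (simp only: spl_ksgn)
    have "spl s (\<lambda>x y. spl s (\<lambda>x1 x2. g x1 x2 y) x) (a # w)
      = spl s (\<lambda>x y. spl s (\<lambda>x1 x2. g (a # x1) x2 y) x) w
      + spl s (\<lambda>x y. spl s (\<lambda>x1 x2. ksgn (fst a * wdeg x1) (g x1 (a # x2) y)) x) w
      + spl s (\<lambda>x y. spl s (\<lambda>x1 x2. ksgn (fst a * (wdeg x1 + wdeg x2)) (g x1 x2 (a # y))) x) w"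
      using True A by (simp only: spl.simps if_True spl_add)
    also have "\<dots> = spl s (\<lambda>x y. spl s (\<lambda>y1 y2. g (a # x) y1 y2) y) w
      + spl s (\<lambda>x y. spl s (\<lambda>y1 y2. ksgn (fst a * wdeg x) (g x (a # y1) y2)) y) w
      + spl s (\<lambda>x y. spl s (\<lambda>y1 y2. ksgn (fst a * (wdeg x + wdeg y1)) (g x y1 (a # y2))) y) w"
      by (intro arg_cong2[where f = "(+)"] IH)
    also have "\<dots> = spl s (\<lambda>x y. spl s (\<lambda>y1 y2. g x y1 y2) y) (a # w)"
      using True B C by (simp only: spl.simps if_True spl_add ksgn_plus add.assoc)
    finally show ?thesis .
  qed
qed simp

lemma spl_cocomm: "spl True g w = spl True (\<lambda>x y. ksgn (wdeg x * wdeg y) (g y x)) w"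
proof (induct w arbitrary: g)
  case (Cons a w)
  have 1: "spl True (\<lambda>x y. g (a # x) y) w
    = spl True (\<lambda>x y. ksgn (fst a * wdeg x) (ksgn (wdeg x * wdeg (a # y)) (g (a # y) x))) w"
    by (subst Cons) (rule spl_cong, auto simp: ksgn_ksgn intro!: ksgn_cong)
  have 2: "spl True (\<lambda>x y. ksgn (fst a * wdeg x) (g x (a # y))) w
    = spl True (\<lambda>x y. ksgn (wdeg (a # x) * wdeg y) (g y (a # x))) w"
    by (subst Cons) (rule spl_cong, auto simp: ksgn_ksgn algebra_simps intro!: ksgn_cong)
  show ?case unfolding spl.simps if_True 1 2 by (simp add: add.commute)
qed simp

text \<open>By coassociativity and graded cocommutativity, the first two of three parts may trade places.\<close>

lemma spl_exchange:
  "spl True (\<lambda>x y. spl True (\<lambda>y1 y2. h x y1 y2) y) w =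
   spl True (\<lambda>x y. spl True (\<lambda>y1 y2. ksgn (wdeg x * wdeg y1) (h y1 x y2)) y) w"
  (is "?L = ?R")
proof -
  have "?L = spl True (\<lambda>x y. spl True (\<lambda>x1 x2. h x1 x2 y) x) w"
    by (rule spl_coassoc[symmetric])
  also have "\<dots> = spl True (\<lambda>x y. spl True (\<lambda>x1 x2. ksgn (wdeg x1 * wdeg x2) (h x2 x1 y)) x) w"
    by (rule spl_cong) (rule spl_cocomm)
  also have "\<dots> = ?R" by (rule spl_coassoc)
  finally show ?thesis .
qed

section \<open>Coderivations and coalgebra maps\<close>

text \<open>A multilinear map \<open>t\<close> of degree \<open>e\<close> contracts a word to a single letter.\<close>

definition hat :: "int \<Rightarrow> ((int \<times> 'v) list \<Rightarrow> 'w) \<Rightarrow> (int \<times> 'v) list \<Rightarrow> int \<times> 'w" where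
  "hat e t w = (wdeg w + e, t w)"

lemma fst_hat [simp]: "fst (hat e t w) = wdeg w + e" by (simp add: hat_def)

text \<open>The value of \<open>f\<close> on \<open>D w\<close>, where \<open>D\<close> is the coderivation of degree \<open>e\<close> with corestriction \<open>t\<close>.
  In the recursion, the first letter either is an argument of \<open>t\<close>, together with a part \<open>x\<close> of the
  remaining word, or it is passed by \<open>D\<close>. Only nonempty words are contracted.\<close>

primrec ins :: "bool \<Rightarrow> int \<Rightarrow> ((int \<times> 'v) list \<Rightarrow> 'v) \<Rightarrow> ((int \<times> 'v) list \<Rightarrow> 'y::ab_group_add)
   \<Rightarrow> (int \<times> 'v) list \<Rightarrow> 'y" where
  "ins s e t f [] = 0"
| "ins s e t f (a # w) = spl s (\<lambda>x y. f (hat e t (a # x) # y)) w +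
     ksgn (e * fst a) (ins s e t (\<lambda>z. f (a # z)) w)"


text \<open>The value of \<open>f\<close> on \<open>\<Phi> w\<close>, where \<open>\<Phi>\<close> is the map of coalgebras with corestriction \<open>\<phi>\<close>. The recursion
  splits off the block that contains the first letter, so that unordered partitions into blocks
  are counted once in the symmetric case.\<close>

function cm :: "bool \<Rightarrow> ((int \<times> 'v) list \<Rightarrow> 'w) \<Rightarrow> ((int \<times> 'w) list \<Rightarrow> 'y::ab_group_add)
   \<Rightarrow> (int \<times> 'v) list \<Rightarrow> 'y" where
  "cm s \<phi> f [] = f []"
| "cm s \<phi> f (a # w) = spl s (\<lambda>x y. cm s \<phi> (\<lambda>z. f (hat 0 \<phi> (a # x) # z)) y) w"
  by pat_completeness auto
termination by (relation "measure (\<lambda>(s, \<phi>, f, w). length w)") auto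

text \<open>The value of \<open>f\<close> on the coderivation along \<open>\<Phi>\<close> with corestriction \<open>r\<close>: exactly one block is
  contracted by \<open>r\<close>, all the others by \<open>\<phi>\<close>.\<close>

function cmd :: "bool \<Rightarrow> int \<Rightarrow> ((int \<times> 'v) list \<Rightarrow> 'w) \<Rightarrow> ((int \<times> 'v) list \<Rightarrow> 'w)
   \<Rightarrow> ((int \<times> 'w) list \<Rightarrow> 'y::ab_group_add) \<Rightarrow> (int \<times> 'v) list \<Rightarrow> 'y" where
  "cmd s e \<phi> r f [] = 0"
| "cmd s e \<phi> r f (a # w) = spl s (\<lambda>x y. cm s \<phi> (\<lambda>z. f (hat e r (a # x) # z)) y +
     ksgn (e * wdeg (a # x)) (cmd s e \<phi> r (\<lambda>z. f (hat 0 \<phi> (a # x) # z)) y)) w"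
  by pat_completeness auto
termination by (relation "measure (\<lambda>(s, e, \<phi>, r, f, w). length w)") auto

lemma ins_cong:
  assumes "set w \<subseteq> H" "\<And>x. x \<noteq> [] \<Longrightarrow> set x \<subseteq> H \<Longrightarrow> hat e t x \<in> H"
    and "\<And>z. z \<noteq> [] \<Longrightarrow> length z \<le> length w \<Longrightarrow> wdeg z = wdeg w + e \<Longrightarrow> set z \<subseteq> H \<Longrightarrow> f z = f' z"
    and "\<And>x. x \<noteq> [] \<Longrightarrow> length x \<le> length w \<Longrightarrow> set x \<subseteq> H \<Longrightarrow> t x = t' x"
  shows "ins s e t f w = ins s e t' f' w"
  using assms
proof (induct w arbitrary: f f')
  case (Cons a w)
  have 1: "spl s (\<lambda>x y. f (hat e t (a # x) # y)) w = spl s (\<lambda>x y. f' (hat e t' (a # x) # y)) w"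
  proof (rule spl_cong)
    fix x y assume *: "set x \<subseteq> set w" "set y \<subseteq> set w" "length x + length y = length w"
      "wdeg x + wdeg y = wdeg w"
    have "t (a # x) = t' (a # x)" by (rule Cons(5)) (use * Cons(2) in auto)
    then have "hat e t (a # x) = hat e t' (a # x)" by (simp add: hat_def)
    moreover have "f (hat e t (a # x) # y) = f' (hat e t (a # x) # y)"
    proof (rule Cons(4))
      have "hat e t (a # x) \<in> H" by (rule Cons(3)) (use * Cons(2) in auto)
      then show "set (hat e t (a # x) # y) \<subseteq> H" using * Cons(2) by auto
    qed (use * in auto)
    ultimately show "f (hat e t (a # x) # y) = f' (hat e t' (a # x) # y)" by simp
  qed
  have 2: "ins s e t (\<lambda>z. f (a # z)) w = ins s e t' (\<lambda>z. f' (a # z)) w"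
    by (rule Cons(1), use Cons(2) in simp, rule Cons(3), assumption, assumption,
        rule Cons(4), use Cons(2) in auto, rule Cons(5), auto)
  show ?case by (simp only: ins.simps 1 2)
qed simp

lemma ins_add: "ins s e t (\<lambda>z. f z + h z) w = ins s e t f w + ins s e t h w"
  by (induct w arbitrary: f h) (simp_all add: spl_add ksgn_plus algebra_simps)

lemma ins_post: "addi L \<Longrightarrow> L (ins s e t f w) = ins s e t (\<lambda>z. L (f z)) w"
  by (induct w arbitrary: f)
     (simp_all add: addi_0[of L] addi_add[of L] addi_ksgn[of L] spl_post[of L])

lemma ins_ksgn: "ins s e t (\<lambda>z. ksgn c (f z)) w = ksgn c (ins s e t f w)"
  by (simp add: ins_post[OF addi_ksgn_fun])

lemma ins_minus: "ins s e t (\<lambda>z. - f z) w = - ins s e t f w"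
  by (simp add: ins_post[OF addi_uminus])

lemma ins_diff: "ins s e t (\<lambda>z. f z - h z) w = ins s e t f w - ins s e t h w"
  using ins_add[of s e t f "\<lambda>z. - h z" w] by (simp add: ins_minus)

lemma ins_0: "ins s e t (\<lambda>z. 0) w = 0"
  by (induct w) (simp_all add: spl_0)

lemma cm_cong:
  assumes "set w \<subseteq> H" "\<And>x. x \<noteq> [] \<Longrightarrow> set x \<subseteq> H \<Longrightarrow> hat 0 \<phi> x \<in> H'"
    and "\<And>z. (w \<noteq> [] \<Longrightarrow> z \<noteq> []) \<Longrightarrow> length z \<le> length w \<Longrightarrow> wdeg z = wdeg w \<Longrightarrow> set z \<subseteq> H' \<Longrightarrow> f z = f' z"
    and "\<And>x. x \<noteq> [] \<Longrightarrow> length x \<le> length w \<Longrightarrow> set x \<subseteq> H \<Longrightarrow> \<phi> x = \<phi>' x"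
  shows "cm s \<phi> f w = cm s \<phi>' f' w"
  using assms
proof (induct "length w" arbitrary: w f f' rule: less_induct)
  case less
  show ?case
  proof (cases w)
    case Nil
    then show ?thesis using less(4)[of "[]"] by simp
  next
    case (Cons a v)
    have "spl s (\<lambda>x y. cm s \<phi> (\<lambda>z. f (hat 0 \<phi> (a # x) # z)) y) v =
      spl s (\<lambda>x y. cm s \<phi>' (\<lambda>z. f' (hat 0 \<phi>' (a # x) # z)) y) v"
    proof (rule spl_cong)
      fix x y assume *: "set x \<subseteq> set v" "set y \<subseteq> set v" "length x + length y = length v"
        "wdeg x + wdeg y = wdeg v"
      have "\<phi> (a # x) = \<phi>' (a # x)" by (rule less(5)) (use * less(2) Cons in auto)
      then have e: "hat 0 \<phi> (a # x) = hat 0 \<phi>' (a # x)" by (simp add: hat_def)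
      have h: "hat 0 \<phi> (a # x) \<in> H'" by (rule less(3)) (use * less(2) Cons in auto)
      show "cm s \<phi> (\<lambda>z. f (hat 0 \<phi> (a # x) # z)) y = cm s \<phi>' (\<lambda>z. f' (hat 0 \<phi>' (a # x) # z)) y"
        unfolding e[symmetric]
      proof (rule less(1))
        fix z assume "length z \<le> length y" "wdeg z = wdeg y" "set z \<subseteq> H'"
        then show "f (hat 0 \<phi> (a # x) # z) = f' (hat 0 \<phi> (a # x) # z)"
          by (intro less(4)) (use * Cons h in auto)
      qed (use * Cons less(2,3) in \<open>auto intro: less(5)\<close>)
    qed
    then show ?thesis by (simp add: Cons)
  qed
qed

lemma cm_add: "cm s \<phi> (\<lambda>z. f z + h z) w = cm s \<phi> f w + cm s \<phi> h w"
proof (induct "length w" arbitrary: w f h rule: less_induct)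
  case less
  show ?case
  proof (cases w)
    case (Cons a v)
    have "spl s (\<lambda>x y. cm s \<phi> (\<lambda>z. f (hat 0 \<phi> (a # x) # z) + h (hat 0 \<phi> (a # x) # z)) y) v
      = spl s (\<lambda>x y. cm s \<phi> (\<lambda>z. f (hat 0 \<phi> (a # x) # z)) y + cm s \<phi> (\<lambda>z. h (hat 0 \<phi> (a # x) # z)) y) v"
      by (rule spl_cong) (rule less, use Cons in simp)
    then show ?thesis by (simp add: Cons spl_add)
  qed simp
qed

lemma cm_post: "addi L \<Longrightarrow> L (cm s \<phi> f w) = cm s \<phi> (\<lambda>z. L (f z)) w"
proof (induct "length w" arbitrary: w f rule: less_induct)
  case less
  show ?case
  proof (cases w)
    case (Cons a v)
    have "spl s (\<lambda>x y. L (cm s \<phi> (\<lambda>z. f (hat 0 \<phi> (a # x) # z)) y)) v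
      = spl s (\<lambda>x y. cm s \<phi> (\<lambda>z. L (f (hat 0 \<phi> (a # x) # z))) y) v"
      by (rule spl_cong) (rule less, use Cons less in simp_all)
    then show ?thesis by (simp add: Cons spl_post[OF less(2)])
  qed simp
qed

lemma cm_add_fun: "cm s \<phi> (\<lambda>z. f z + h z) = (\<lambda>w. cm s \<phi> f w + cm s \<phi> h w)"
  by (rule ext) (rule cm_add)

lemma cm_ksgn: "cm s \<phi> (\<lambda>z. ksgn c (f z)) w = ksgn c (cm s \<phi> f w)"
  by (simp add: cm_post[OF addi_ksgn_fun])

lemma cm_ksgn_fun: "cm s \<phi> (\<lambda>z. ksgn c (f z)) = (\<lambda>w. ksgn c (cm s \<phi> f w))"
  by (rule ext) (rule cm_ksgn)

lemma cm_minus: "cm s \<phi> (\<lambda>z. - f z) w = - cm s \<phi> f w"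
  by (simp add: cm_post[OF addi_uminus])

lemma cm_diff: "cm s \<phi> (\<lambda>z. f z - h z) w = cm s \<phi> f w - cm s \<phi> h w"
  using cm_add[of s \<phi> f "\<lambda>z. - h z" w] by (simp add: cm_minus)

lemma cm_0: "cm s \<phi> (\<lambda>z. 0) w = 0"
  using cm_diff[of s \<phi> "\<lambda>z. 0" "\<lambda>z. 0" w] by simp

lemma cm_wdeg: "cm s \<phi> (\<lambda>z. h (wdeg z) z) w = cm s \<phi> (\<lambda>z. h (wdeg w) z) w"
  by (rule cm_cong[where H = UNIV and H' = UNIV]) auto

lemma addi_slot_cm: "addv f \<Longrightarrow> addi (\<lambda>v. cm s \<phi> (\<lambda>z. f ((d, v) # z)) y)"
  by (rule addiI) (simp add: addi_add[OF addv_addi0] cm_add)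

lemma ins_wdeg: "ins s e t (\<lambda>z. h (wdeg z) z) w = ins s e t (\<lambda>z. h (wdeg w + e) z) w"
  by (rule ins_cong[where H = UNIV]) auto

lemma cm_spl_comm:
  "cm s \<phi> (\<lambda>z. spl s' (\<lambda>x y. F z x y) v) w = spl s' (\<lambda>x y. cm s \<phi> (\<lambda>z. F z x y) w) v"
  by (cases s'; induct v arbitrary: F) (simp_all add: cm_add cm_ksgn)

text \<open>This is the coderivation property: the contracted letters lie in one of the two parts.\<close>

lemma ins_spl:
  "ins s e t (\<lambda>z. spl s g z) w =
   spl s (\<lambda>x y. ins s e t (\<lambda>x'. g x' y) x + ksgn (e * wdeg x) (ins s e t (\<lambda>y'. g x y') y)) w"
proof (induct w arbitrary: g)
  case (Cons a w)
  let ?h = "\<lambda>x. hat e t (a # x)"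
  have R3: "ksgn (e * fst a) (ins s e t (\<lambda>z. spl s (\<lambda>x y. g (a # x) y) z) w)
    = spl s (\<lambda>x y. ksgn (e * fst a) (ins s e t (\<lambda>z. g (a # z) y) x)) w
    + spl s (\<lambda>x y. ksgn (e * (fst a + wdeg x)) (ins s e t (\<lambda>z. g (a # x) z) y)) w"
    by (simp add: Cons ksgn_plus ksgn_ksgn spl_add distrib_left flip: spl_ksgn)
  show ?case
  proof (cases s)
    case False
    then have s: "s = False" by simp
    show ?thesis
      using R3 spl_coassoc[of s "\<lambda>x1 x2 y. g (?h x1 # x2) y" w] unfolding s
      by (simp add: spl_add ins_add ksgn_plus)
  next
    case True
    have R2: "spl s (\<lambda>x y. spl s (\<lambda>y1 y2. ksgn ((fst a + wdeg x + e) * wdeg y1) (g y1 (?h x # y2))) y) w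
      = spl s (\<lambda>x y. ksgn (fst a * wdeg x) (ksgn (e * wdeg x) (spl s (\<lambda>y1 y2. g x (?h y1 # y2)) y))) w"
      using True by (simp add: spl_exchange[of "\<lambda>x y1 y2. ksgn ((fst a + wdeg x + e) * wdeg y1) (g y1 (?h x # y2))"]
         ksgn_ksgn flip: spl_ksgn) (intro spl_cong ksgn_cong; auto)
    have IH: "ins s e t (\<lambda>z. spl s (\<lambda>x y. ksgn (fst a * wdeg x) (g x (a # y))) z) w
       = spl s (\<lambda>x y. ksgn (fst a * (wdeg x + e)) (ins s e t (\<lambda>x'. g x' (a # y)) x)
         + ksgn (e * wdeg x) (ksgn (fst a * wdeg x) (ins s e t (\<lambda>y'. g x (a # y')) y))) w"
      unfolding Cons ins_ksgn
      by (simp only: ins_wdeg[of s e t "\<lambda>d x'. ksgn (fst a * d) (g x' (a # _))"] ins_ksgn)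
    have R4: "ksgn (e * fst a) (ins s e t (\<lambda>z. spl s (\<lambda>x y. ksgn (fst a * wdeg x) (g x (a # y))) z) w)
      = spl s (\<lambda>x y. ksgn (fst a * wdeg x) (ins s e t (\<lambda>x'. g x' (a # y)) x)) w
      + spl s (\<lambda>x y. ksgn (fst a * wdeg x)
          (ksgn (e * wdeg x) (ksgn (e * fst a) (ins s e t (\<lambda>z. g x (a # z)) y)))) w"
      unfolding IH
      by (simp only: spl_ksgn[symmetric] spl_add[symmetric], rule spl_cong)
         (auto simp: ksgn_plus ksgn_ksgn intro!: arg_cong2[where f = "(+)"] ksgn_cong)
    have L: "ins s e t (\<lambda>z. spl s g z) (a # w) =
       spl s (\<lambda>x y. spl s (\<lambda>y1 y2. g (?h x # y1) y2) y) w
     + spl s (\<lambda>x y. spl s (\<lambda>y1 y2. ksgn ((fst a + wdeg x + e) * wdeg y1) (g y1 (?h x # y2))) y) w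
     + ksgn (e * fst a) (ins s e t (\<lambda>z. spl s (\<lambda>x y. g (a # x) y) z) w)
     + ksgn (e * fst a) (ins s e t (\<lambda>z. spl s (\<lambda>x y. ksgn (fst a * wdeg x) (g x (a # y))) z) w)"
      using True by (simp add: spl_add ins_add ksgn_plus)
    show ?thesis
      unfolding L R2 R3 R4 using True spl_coassoc[of s "\<lambda>x1 x2 y. g (?h x1 # x2) y" w]
      by (simp add: spl_add ksgn_plus)
  qed
qed simp

text \<open>This is compatibility with the coproduct: a splitting of the blocks splits the word itself.\<close>

lemma cm_spl:
  fixes \<phi> :: "(int \<times> 'a) list \<Rightarrow> 'b" and g :: "(int \<times> 'b) list \<Rightarrow> (int \<times> 'b) list \<Rightarrow> 'y::ab_group_add"
  shows "cm s \<phi> (\<lambda>z. spl s g z) w = spl s (\<lambda>x y. cm s \<phi> (\<lambda>x'. cm s \<phi> (\<lambda>y'. g x' y') y) x) w"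
proof (induct "length w" arbitrary: w g rule: less_induct)
  case less
  show ?case
  proof (cases w)
    case (Cons a v)
    let ?h = "\<lambda>x. hat 0 \<phi> (a # x)"
    have IH: "cm s \<phi> (\<lambda>z. spl s g z) y = spl s (\<lambda>x y. cm s \<phi> (\<lambda>x'. cm s \<phi> (\<lambda>y'. g x' y') y) x) y"
      if "length y \<le> length v" for g :: "(int \<times> 'b) list \<Rightarrow> (int \<times> 'b) list \<Rightarrow> 'y" and y
      using less that Cons by simp
    have R1: "spl s (\<lambda>x y. cm s \<phi> (\<lambda>z. spl s (\<lambda>z1 z2. g (?h x # z1) z2) z) y) v
      = spl s (\<lambda>x y. cm s \<phi> (\<lambda>x'. cm s \<phi> (\<lambda>y'. g x' y') y) (a # x)) v"
    proof -
      have "spl s (\<lambda>x y. cm s \<phi> (\<lambda>z. spl s (\<lambda>z1 z2. g (?h x # z1) z2) z) y) v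
        = spl s (\<lambda>x y. spl s (\<lambda>y1 y2. cm s \<phi> (\<lambda>z1. cm s \<phi> (\<lambda>z2. g (?h x # z1) z2) y2) y1) y) v"
        by (rule spl_cong) (rule IH, simp)
      then show ?thesis
        using spl_coassoc[of s "\<lambda>x y1 y2. cm s \<phi> (\<lambda>z1. cm s \<phi> (\<lambda>z2. g (?h x # z1) z2) y2) y1" v]
        by simp
    qed
    show ?thesis
    proof (cases s)
      case False
      then have s: "s = False" by simp
      show ?thesis using R1 unfolding Cons s by (simp add: cm_add_fun spl_add)
    next
      case True
      have "spl s (\<lambda>x y. cm s \<phi> (\<lambda>z. spl s (\<lambda>z1 z2. ksgn ((fst a + wdeg x) * wdeg z1) (g z1 (?h x # z2))) z) y) v
        = spl s (\<lambda>x y. spl s (\<lambda>y1 y2. ksgn ((fst a + wdeg x) * wdeg y1)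
            (cm s \<phi> (\<lambda>z1. cm s \<phi> (\<lambda>z2. g z1 (?h x # z2)) y2) y1)) y) v"
      proof (rule spl_cong)
        fix x y :: "(int \<times> 'a) list" assume *: "length x + length y = length v"
        have "cm s \<phi> (\<lambda>z1. cm s \<phi> (\<lambda>z2. ksgn ((fst a + wdeg x) * wdeg z1) (g z1 (?h x # z2))) y2) y1
          = ksgn ((fst a + wdeg x) * wdeg y1) (cm s \<phi> (\<lambda>z1. cm s \<phi> (\<lambda>z2. g z1 (?h x # z2)) y2) y1)"
          for y1 y2
          unfolding cm_ksgn
          by (simp only: cm_ksgn cm_wdeg[of s \<phi> "\<lambda>d z1. ksgn ((fst a + wdeg x) * d) (cm s \<phi> (\<lambda>z2. g z1 (?h x # z2)) y2)"])
        then show "cm s \<phi> (\<lambda>z. spl s (\<lambda>z1 z2. ksgn ((fst a + wdeg x) * wdeg z1) (g z1 (?h x # z2))) z) y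
          = spl s (\<lambda>y1 y2. ksgn ((fst a + wdeg x) * wdeg y1)
            (cm s \<phi> (\<lambda>z1. cm s \<phi> (\<lambda>z2. g z1 (?h x # z2)) y2) y1)) y"
          using * by (simp add: IH)
      qed
      also have "\<dots> = spl s (\<lambda>x y. spl s (\<lambda>y1 y2. ksgn (fst a * wdeg x)
            (cm s \<phi> (\<lambda>z1. cm s \<phi> (\<lambda>z2. g z1 (?h y1 # z2)) y2) x)) y) v"
        using True by (simp add: spl_exchange[of "\<lambda>x y1 y2. ksgn ((fst a + wdeg x) * wdeg y1)
            (cm True \<phi> (\<lambda>z1. cm True \<phi> (\<lambda>z2. g z1 (?h x # z2)) y2) y1)"] ksgn_ksgn)
          (intro spl_cong ksgn_cong; auto)
      also have "\<dots> = spl s (\<lambda>x y. ksgn (fst a * wdeg x)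
            (cm s \<phi> (\<lambda>x'. cm s \<phi> (\<lambda>y'. g x' y') (a # y)) x)) v"
        by (simp add: spl_ksgn cm_spl_comm)
      finally have R2: "spl s (\<lambda>x y. cm s \<phi> (\<lambda>z. spl s (\<lambda>z1 z2. ksgn ((fst a + wdeg x) * wdeg z1) (g z1 (?h x # z2))) z) y) v
        = \<dots>" .
      show ?thesis using True R1 R2 unfolding Cons by (simp add: cm_add_fun spl_add)
    qed
  qed simp
qed

lemma cm_spl_fun: "cm s \<phi> (spl s g) =
    (\<lambda>w. spl s (\<lambda>x y. cm s \<phi> (\<lambda>x'. cm s \<phi> (\<lambda>y'. g x' y') y) x) w)"
  by (rule ext) (rule cm_spl)

section \<open>The three composition identities\<close>

text \<open>If two disjoint groups of letters are contracted, the two orders of doing so cancel, because \<open>e\<close>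
  is odd. The nested contractions that remain form the coderivation with corestriction \<open>t D\<close>.\<close>

lemma ins_ins:
  assumes "odd e" "addv f"
  shows "ins s e t (ins s e t f) w = ins s (2 * e) (ins s e t t) f w"
  using assms(2)
proof (induct w arbitrary: f)
  case (Cons a w)
  let ?h = "\<lambda>x. hat e t (a # x)"
  define L where "L d y v = f ((fst a + d + 2 * e, v) # y)" for d y v
  have L: "addi (L d y)" for d y
    unfolding L_def using addv_addi0[OF Cons(2)] .
  have 1: "f (hat (2 * e) (ins s e t t) (a # x) # y)
    = spl s (\<lambda>x1 x2. f (hat e t (?h x1 # x2) # y)) x
    + ksgn (e * fst a) (ins s e t (\<lambda>x'. f (?h x' # y)) x)" for x y
  proof -
    have "f (hat (2 * e) (ins s e t t) (a # x) # y) = L (wdeg x) y (ins s e t t (a # x))"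
      by (simp add: L_def hat_def)
    also have "\<dots> = spl s (\<lambda>x1 x2. L (wdeg x) y (t (?h x1 # x2))) x
        + ksgn (e * fst a) (ins s e t (\<lambda>x'. L (wdeg x) y (t (a # x'))) x)"
      by (simp add: addi_add[OF L] addi_ksgn[OF L] spl_post[OF L] ins_post[OF L])
    also have "spl s (\<lambda>x1 x2. L (wdeg x) y (t (?h x1 # x2))) x
      = spl s (\<lambda>x1 x2. f (hat e t (?h x1 # x2) # y)) x"
      by (rule spl_cong) (auto simp: L_def hat_def algebra_simps intro!: arg_cong[where f = f])
    also have "ins s e t (\<lambda>x'. L (wdeg x) y (t (a # x'))) x = ins s e t (\<lambda>x'. f (?h x' # y)) x"
      by (rule ins_cong[where H = UNIV]) (auto simp: L_def hat_def algebra_simps intro!: arg_cong[where f = f])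
    finally show ?thesis .
  qed
  have "ins s e t (ins s e t f) (a # w) =
     spl s (\<lambda>x y. spl s (\<lambda>y1 y2. f (hat e t (?h x # y1) # y2)) y) w
   + spl s (\<lambda>x y. ksgn (e * (fst a + wdeg x + e)) (ins s e t (\<lambda>z. f (?h x # z)) y)) w
   + ksgn (e * fst a) (spl s (\<lambda>x y. ins s e t (\<lambda>x'. f (?h x' # y)) x) w)
   + ksgn (e * fst a) (spl s (\<lambda>x y. ksgn (e * wdeg x) (ins s e t (\<lambda>y'. f (?h x # y')) y)) w)
   + ksgn (e * fst a) (ksgn (e * fst a) (ins s e t (ins s e t (\<lambda>z. f (a # z))) w))"
    by (simp add: spl_add ins_add ins_ksgn ksgn_plus ins_spl)
  also have "spl s (\<lambda>x y. ksgn (e * (fst a + wdeg x + e)) (ins s e t (\<lambda>z. f (?h x # z)) y)) w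
    = - ksgn (e * fst a) (spl s (\<lambda>x y. ksgn (e * wdeg x) (ins s e t (\<lambda>y'. f (?h x # y')) y)) w)"
    unfolding spl_ksgn[symmetric] spl_minus[symmetric]
    by (rule spl_cong) (use assms in \<open>auto simp: ksgn_def\<close>)
  also have "spl s (\<lambda>x y. spl s (\<lambda>y1 y2. f (hat e t (?h x # y1) # y2)) y) w
    = spl s (\<lambda>x y. spl s (\<lambda>x1 x2. f (hat e t (?h x1 # x2) # y)) x) w"
    by (rule spl_coassoc[symmetric])
  finally show ?case
    by (simp add: 1 spl_add spl_ksgn ksgn_ksgn ksgn_even Cons addv_Cons)
qed simp

text \<open>Contracting some of the blocks of a partition amounts to contracting a larger block by \<open>q \<Phi>\<close>.\<close>

lemma cm_ins:
  assumes "addv f"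
  shows "cm s \<phi> (ins s e q f) w = cmd s e \<phi> (cm s \<phi> q) f w"
  using assms
proof (induct "length w" arbitrary: w f rule: less_induct)
  case less
  show ?case
  proof (cases w)
    case (Cons a v)
    let ?h = "\<lambda>x. hat 0 \<phi> (a # x)"
    define L where "L d y u = cm s \<phi> (\<lambda>z. f ((fst a + d + e, u) # z)) y" for d y u
    have L: "addi (L d y)" for d y
      unfolding L_def by (rule addi_slot_cm[OF less(2)])
    have 1: "cm s \<phi> (\<lambda>z. f (hat e (cm s \<phi> q) (a # x) # z)) y
      = spl s (\<lambda>x1 x2. cm s \<phi> (\<lambda>z1. cm s \<phi> (\<lambda>z2. f (hat e q (?h x1 # z1) # z2)) y) x2) x" for x y
    proof -
      have "cm s \<phi> (\<lambda>z. f (hat e (cm s \<phi> q) (a # x) # z)) y = L (wdeg x) y (cm s \<phi> q (a # x))"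
        by (simp add: L_def hat_def)
      also have "\<dots> = spl s (\<lambda>x1 x2. cm s \<phi> (\<lambda>z1. L (wdeg x) y (q (?h x1 # z1))) x2) x"
        by (simp add: spl_post[OF L] cm_post[OF L])
      also have "\<dots> = spl s (\<lambda>x1 x2. cm s \<phi> (\<lambda>z1. cm s \<phi> (\<lambda>z2. f (hat e q (?h x1 # z1) # z2)) y) x2) x"
        unfolding L_def
        by (rule spl_cong, rule cm_cong[where H = UNIV and H' = UNIV])
           (auto simp: hat_def algebra_simps intro!: cm_cong[where H = UNIV and H' = UNIV] arg_cong[where f = f])
      finally show ?thesis .
    qed
    have "cm s \<phi> (ins s e q f) w =
        spl s (\<lambda>x y. spl s (\<lambda>y1 y2. cm s \<phi> (\<lambda>z1. cm s \<phi> (\<lambda>z2. f (hat e q (?h x # z1) # z2)) y2) y1) y) v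
      + spl s (\<lambda>x y. ksgn (e * wdeg (a # x)) (cm s \<phi> (ins s e q (\<lambda>u. f (?h x # u))) y)) v"
      by (simp add: Cons cm_add_fun cm_ksgn_fun spl_add cm_spl_fun)
    also have "spl s (\<lambda>x y. ksgn (e * wdeg (a # x)) (cm s \<phi> (ins s e q (\<lambda>u. f (?h x # u))) y)) v
      = spl s (\<lambda>x y. ksgn (e * wdeg (a # x)) (cmd s e \<phi> (cm s \<phi> q) (\<lambda>u. f (?h x # u)) y)) v"
      by (rule spl_cong) (use less Cons in \<open>simp add: addv_Cons\<close>)
    finally show ?thesis
      by (simp add: Cons 1 spl_add spl_coassoc)
  qed simp
qed

text \<open>The letter produced by the coderivation falls into one of the blocks; collecting the terms by
  this block leaves one block contracted by \<open>\<phi> D\<close> and the others by \<open>\<phi>\<close>.\<close>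

lemma ins_cm:
  assumes "addv f"
  shows "ins s e p (cm s \<phi> f) w = cmd s e \<phi> (ins s e p \<phi>) f w"
  using assms
proof (induct "length w" arbitrary: w f rule: less_induct)
  case less
  show ?case
  proof (cases w)
    case (Cons a v)
    let ?h = "\<lambda>x. hat e p (a # x)" and ?k = "\<lambda>x. hat 0 \<phi> (a # x)"
    define L where "L d y u = cm s \<phi> (\<lambda>z. f ((fst a + d + e, u) # z)) y" for d y u
    have L: "addi (L d y)" for d y
      unfolding L_def by (rule addi_slot_cm[OF less(2)])
    have 1: "cm s \<phi> (\<lambda>z. f (hat e (ins s e p \<phi>) (a # x) # z)) y
      = spl s (\<lambda>x1 x2. cm s \<phi> (\<lambda>z. f (hat 0 \<phi> (?h x1 # x2) # z)) y) x
       + ksgn (e * fst a) (ins s e p (\<lambda>x'. cm s \<phi> (\<lambda>z. f (?k x' # z)) y) x)" for x y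
    proof -
      have "cm s \<phi> (\<lambda>z. f (hat e (ins s e p \<phi>) (a # x) # z)) y = L (wdeg x) y (ins s e p \<phi> (a # x))"
        by (simp add: L_def hat_def)
      also have "\<dots> = spl s (\<lambda>x1 x2. L (wdeg x) y (\<phi> (?h x1 # x2))) x
         + ksgn (e * fst a) (ins s e p (\<lambda>x'. L (wdeg x) y (\<phi> (a # x'))) x)"
        by (simp add: addi_add[OF L] addi_ksgn[OF L] spl_post[OF L] ins_post[OF L])
      also have "spl s (\<lambda>x1 x2. L (wdeg x) y (\<phi> (?h x1 # x2))) x
        = spl s (\<lambda>x1 x2. cm s \<phi> (\<lambda>z. f (hat 0 \<phi> (?h x1 # x2) # z)) y) x"
        unfolding L_def
        by (rule spl_cong, rule cm_cong[where H = UNIV and H' = UNIV])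
           (auto simp: hat_def algebra_simps intro!: arg_cong[where f = f])
      also have "ins s e p (\<lambda>x'. L (wdeg x) y (\<phi> (a # x'))) x
        = ins s e p (\<lambda>x'. cm s \<phi> (\<lambda>z. f (?k x' # z)) y) x"
        unfolding L_def
        by (rule ins_cong[where H = UNIV])
           (auto simp: hat_def algebra_simps intro!: cm_cong[where H = UNIV and H' = UNIV] arg_cong[where f = f])
      finally show ?thesis .
    qed
    have "ins s e p (cm s \<phi> f) w =
        spl s (\<lambda>x y. spl s (\<lambda>y1 y2. cm s \<phi> (\<lambda>z. f (hat 0 \<phi> (?h x # y1) # z)) y2) y) v
      + ksgn (e * fst a) (spl s (\<lambda>x y. ins s e p (\<lambda>x'. cm s \<phi> (\<lambda>z. f (?k x' # z)) y) x) v)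
      + ksgn (e * fst a) (spl s (\<lambda>x y. ksgn (e * wdeg x) (ins s e p (cm s \<phi> (\<lambda>z. f (?k x # z))) y)) v)"
      by (simp add: Cons ins_spl ksgn_plus spl_add)
    also have "spl s (\<lambda>x y. ksgn (e * wdeg x) (ins s e p (cm s \<phi> (\<lambda>z. f (?k x # z))) y)) v
      = spl s (\<lambda>x y. ksgn (e * wdeg x) (cmd s e \<phi> (ins s e p \<phi>) (\<lambda>u. f (?k x # u)) y)) v"
      by (rule spl_cong) (use less Cons in \<open>simp add: addv_Cons\<close>)
    also have "ksgn (e * fst a) \<dots>
      = spl s (\<lambda>x y. ksgn (e * wdeg (a # x)) (cmd s e \<phi> (ins s e p \<phi>) (\<lambda>u. f (?k x # u)) y)) v"
      by (simp add: ksgn_ksgn distrib_left flip: spl_ksgn)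
    also have "spl s (\<lambda>x y. spl s (\<lambda>y1 y2. cm s \<phi> (\<lambda>z. f (hat 0 \<phi> (?h x # y1) # z)) y2) y) v
      = spl s (\<lambda>x y. spl s (\<lambda>x1 x2. cm s \<phi> (\<lambda>z. f (hat 0 \<phi> (?h x1 # x2) # z)) y) x) v"
      by (rule spl_coassoc[symmetric])
    finally show ?thesis
      by (simp add: Cons 1 spl_add spl_ksgn)
  qed simp
qed

section \<open>Classes of functions of one letter\<close>

text \<open>Linearity in one letter has to be carried through all the recursions. As these build their results
  from sums and signs, the argument is made for any class of functions of one letter that is closed
  under both.\<close>

definition lcl :: "(('x \<Rightarrow> 'y::ab_group_add) \<Rightarrow> bool) \<Rightarrow> bool" where
  "lcl C \<longleftrightarrow> C (\<lambda>_. 0) \<and> (\<forall>L M. C L \<longrightarrow> C M \<longrightarrow> C (\<lambda>v. L v + M v)) \<and>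
     (\<forall>L e. C L \<longrightarrow> C (\<lambda>v. ksgn e (L v)))"

lemma lcl_0: "lcl C \<Longrightarrow> C (\<lambda>_. 0)" by (simp add: lcl_def)
lemma lcl_add: "lcl C \<Longrightarrow> C L \<Longrightarrow> C M \<Longrightarrow> C (\<lambda>v. L v + M v)" by (simp add: lcl_def)
lemma lcl_ksgn: "lcl C \<Longrightarrow> C L \<Longrightarrow> C (\<lambda>v. ksgn e (L v))" by (simp add: lcl_def)

lemma spl_class:
  assumes C: "lcl C" and "\<And>x y. C (\<lambda>v. G v x y)"
  shows "C (\<lambda>v. spl s (G v) w)"
  using assms(2)
proof (induct w arbitrary: G)
  case (Cons a w)
  have 1: "C (\<lambda>v. spl s (\<lambda>x y. G v (a # x) y) w)"
    by (rule Cons(1)[of "\<lambda>v x y. G v (a # x) y"]) (rule Cons(2))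
  have 2: "C (\<lambda>v. spl s (\<lambda>x y. ksgn (fst a * wdeg x) (G v x (a # y))) w)"
    by (rule Cons(1)[of "\<lambda>v x y. ksgn (fst a * wdeg x) (G v x (a # y))"]) (rule lcl_ksgn[OF C, OF Cons(2)])
  show ?case
    using lcl_add[OF C, OF 1 2] lcl_add[OF C, OF 1 Cons(2)[of "[]" "a # w"]] by (cases s) simp_all
qed simp

lemma ins_class:
  assumes C: "lcl C" and "\<And>z. C (\<lambda>v. F v z)"
  shows "C (\<lambda>v. ins s e t (F v) w)"
  using assms(2)
proof (induct w arbitrary: F)
  case Nil
  show ?case using lcl_0[OF C] by simp
next
  case (Cons a w)
  have 1: "C (\<lambda>v. spl s (\<lambda>x y. F v (hat e t (a # x) # y)) w)"
    by (rule spl_class[OF C, of "\<lambda>v x y. F v (hat e t (a # x) # y)"]) (rule Cons(2))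
  have 2: "C (\<lambda>v. ins s e t (\<lambda>z. F v (a # z)) w)"
    by (rule Cons(1)[of "\<lambda>v z. F v (a # z)"]) (rule Cons(2))
  show ?case using lcl_add[OF C, OF 1 lcl_ksgn[OF C, OF 2]] by simp
qed

lemma cm_class:
  assumes C: "lcl C" and "\<And>z. C (\<lambda>v. F v z)"
  shows "C (\<lambda>v. cm s \<phi> (F v) w)"
  using assms(2)
proof (induct "length w" arbitrary: F w rule: less_induct)
  case less
  show ?case
  proof (cases w)
    case Nil
    then show ?thesis using less(2)[of "[]"] by simp
  next
    case (Cons a u)
    \<comment> \<open>Only the splittings of \<open>u\<close> occur, so the induction hypothesis applies to their parts.\<close>
    let ?G = "\<lambda>v x y. if length y \<le> length u then cm s \<phi> (\<lambda>z. F v (hat 0 \<phi> (a # x) # z)) y else 0"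
    have "C (\<lambda>v. spl s (?G v) u)"
    proof (rule spl_class[OF C, of ?G])
      fix x y
      show "C (\<lambda>v. ?G v x y)"
      proof (cases "length y \<le> length u")
        case True
        have "C (\<lambda>v. cm s \<phi> (\<lambda>z. F v (hat 0 \<phi> (a # x) # z)) y)"
          by (rule less(1)[of y "\<lambda>v z. F v (hat 0 \<phi> (a # x) # z)"]) (use True Cons less(2) in auto)
        then show ?thesis using True by simp
      qed (simp add: lcl_0[OF C])
    qed
    moreover have "spl s (?G v) u = cm s \<phi> (F v) w" for v
      unfolding Cons cm.simps by (rule spl_cong) simp
    ultimately show ?thesis by simp
  qed
qed

lemma spl_slot:
  assumes C: "lcl C"
    and "\<And>x1 x2 y. C (\<lambda>v. g (x1 @ (d, v) # x2) y)" and "\<And>x y1 y2. C (\<lambda>v. g x (y1 @ (d, v) # y2))"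
  shows "C (\<lambda>v. spl s g (u @ (d, v) # w))"
  using assms(2,3)
proof (induct u arbitrary: g)
  case Nil
  have 1: "C (\<lambda>v. spl s (\<lambda>x y. g ((d, v) # x) y) w)"
    by (rule spl_class[OF C, of "\<lambda>v x y. g ((d, v) # x) y"]) (use Nil(1)[of "[]"] in simp)
  have 2: "C (\<lambda>v. spl s (\<lambda>x y. ksgn (d * wdeg x) (g x ((d, v) # y))) w)"
    by (rule spl_class[OF C, of "\<lambda>v x y. ksgn (d * wdeg x) (g x ((d, v) # y))"], rule lcl_ksgn[OF C])
       (use Nil(2)[of _ "[]"] in simp)
  show ?case using lcl_add[OF C, OF 1 2] lcl_add[OF C, OF 1 Nil(2)[of "[]" "[]" w]] by (cases s) simp_all
next
  case (Cons a u)
  have 1: "C (\<lambda>v. spl s (\<lambda>x y. g (a # x) y) (u @ (d, v) # w))"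
    by (rule Cons(1)[of "\<lambda>x y. g (a # x) y"]) (use Cons(2)[of "a # _"] Cons(3) in simp_all)
  have 2: "C (\<lambda>v. spl s (\<lambda>x y. ksgn (fst a * wdeg x) (g x (a # y))) (u @ (d, v) # w))"
  proof (rule Cons(1)[of "\<lambda>x y. ksgn (fst a * wdeg x) (g x (a # y))"])
    show "C (\<lambda>v. ksgn (fst a * wdeg (x1 @ (d, v) # x2)) (g (x1 @ (d, v) # x2) (a # y)))" for x1 x2 y
      using lcl_ksgn[OF C, OF Cons(2)[of x1 x2 "a # y"], of "fst a * (wdeg x1 + (d + wdeg x2))"] by simp
    show "C (\<lambda>v. ksgn (fst a * wdeg x) (g x (a # y1 @ (d, v) # y2)))" for x y1 y2
      using lcl_ksgn[OF C, OF Cons(3)[of x "a # y1" y2]] by simp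
  qed
  show ?case using lcl_add[OF C, OF 1 2] lcl_add[OF C, OF 1 Cons(3)[of "[]" "a # u" w]]
    by (cases s) simp_all
qed

lemma ins_slot:
  assumes C: "lcl C"
    and "\<And>x y. C (\<lambda>v. f (x @ (d, v) # y))"
    and "\<And>p x1 x2 y. C (\<lambda>v. f (p @ hat e t (x1 @ (d, v) # x2) # y))"
  shows "C (\<lambda>v. ins s e t f (u @ (d, v) # w))"
  using assms(2,3)
proof (induct u arbitrary: f)
  case Nil
  have 1: "C (\<lambda>v. spl s (\<lambda>x y. f (hat e t ((d, v) # x) # y)) w)"
    by (rule spl_class[OF C, of "\<lambda>v x y. f (hat e t ((d, v) # x) # y)"]) (use Nil(2)[of "[]" "[]"] in simp)
  have 2: "C (\<lambda>v. ins s e t (\<lambda>z. f ((d, v) # z)) w)"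
    by (rule ins_class[OF C, of "\<lambda>v z. f ((d, v) # z)"]) (use Nil(1)[of "[]"] in simp)
  show ?case using lcl_add[OF C, OF 1 lcl_ksgn[OF C, OF 2]] by simp
next
  case (Cons a u)
  have 1: "C (\<lambda>v. spl s (\<lambda>x y. f (hat e t (a # x) # y)) (u @ (d, v) # w))"
    by (rule spl_slot[OF C, of "\<lambda>x y. f (hat e t (a # x) # y)"])
       (use Cons(3)[of "[]" "a # _"] Cons(2)[of "hat e t (a # _) # _"] in simp_all)
  have 2: "C (\<lambda>v. ins s e t (\<lambda>z. f (a # z)) (u @ (d, v) # w))"
    by (rule Cons(1)[of "\<lambda>z. f (a # z)"]) (use Cons(2)[of "a # _"] Cons(3)[of "a # _"] in simp_all)
  show ?case using lcl_add[OF C, OF 1 lcl_ksgn[OF C, OF 2]] by simp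
qed

lemma cm_slot:
  assumes C: "lcl C"
    and "\<And>p x1 x2 y. C (\<lambda>v. f (p @ hat 0 \<phi> (x1 @ (d, v) # x2) # y))"
  shows "C (\<lambda>v. cm s \<phi> f (u @ (d, v) # w))"
  using assms(2)
proof (induct "length u + length w" arbitrary: u w f rule: less_induct)
  case less
  show ?case
  proof (cases u)
    case Nil
    have "C (\<lambda>v. spl s (\<lambda>x y. cm s \<phi> (\<lambda>z. f (hat 0 \<phi> ((d, v) # x) # z)) y) w)"
      by (rule spl_class[OF C, of "\<lambda>v x y. cm s \<phi> (\<lambda>z. f (hat 0 \<phi> ((d, v) # x) # z)) y"],
          rule cm_class[OF C, of "\<lambda>v z. f (hat 0 \<phi> ((d, v) # _) # z)"])
         (use less(2)[of "[]" "[]"] in simp)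
    then show ?thesis using Nil by simp
  next
    case (Cons a u')
    let ?b = "length u' + length w"
    let ?g = "\<lambda>x y. if length y \<le> Suc ?b then cm s \<phi> (\<lambda>z. f (hat 0 \<phi> (a # x) # z)) y else 0"
    have "C (\<lambda>v. spl s ?g (u' @ (d, v) # w))"
    proof (rule spl_slot[OF C, of ?g])
      fix x1 x2 y
      have "C (\<lambda>v. cm s \<phi> (\<lambda>z. f (hat 0 \<phi> (a # x1 @ (d, v) # x2) # z)) y)"
        by (rule cm_class[OF C, of "\<lambda>v z. f (hat 0 \<phi> (a # x1 @ (d, v) # x2) # z)"])
           (use less(2)[of "[]" "a # x1"] in simp)
      then show "C (\<lambda>v. ?g (x1 @ (d, v) # x2) y)"
        by (cases "length y \<le> Suc ?b") (simp_all add: lcl_0[OF C])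
    next
      fix x y1 y2
      show "C (\<lambda>v. ?g x (y1 @ (d, v) # y2))"
      proof (cases "length y1 + length y2 \<le> ?b")
        case True
        have "C (\<lambda>v. cm s \<phi> (\<lambda>z. f (hat 0 \<phi> (a # x) # z)) (y1 @ (d, v) # y2))"
          by (rule less(1)[of y1 y2 "\<lambda>z. f (hat 0 \<phi> (a # x) # z)"])
             (use True Cons less(2)[of "hat 0 \<phi> (a # x) # _"] in auto)
        with True show ?thesis by simp
      qed (simp add: lcl_0[OF C])
    qed
    moreover have "spl s ?g (u' @ (d, v) # w) = cm s \<phi> f (u @ (d, v) # w)" for v
      unfolding Cons append_Cons cm.simps by (rule spl_cong) simp
    ultimately show ?thesis by simp
  qed
qed

section \<open>Graded symmetric maps\<close>

definition graded_sym :: "((int \<times> 'v) list \<Rightarrow> 'y::ab_group_add) \<Rightarrow> bool" where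
  "graded_sym f \<longleftrightarrow> (\<forall>u a b w. f (u @ a # b # w) = ksgn (fst a * fst b) (f (u @ b # a # w)))"

lemma graded_symI:
  "(\<And>u a b w. f (u @ a # b # w) = ksgn (fst a * fst b) (f (u @ b # a # w))) \<Longrightarrow> graded_sym f"
  unfolding graded_sym_def by (intro allI)
lemma graded_symD: "graded_sym f \<Longrightarrow> f (u @ a # b # w) = ksgn (fst a * fst b) (f (u @ b # a # w))"
  unfolding graded_sym_def by (elim allE)
lemma graded_symD0: "graded_sym f \<Longrightarrow> f (a # b # w) = ksgn (fst a * fst b) (f (b # a # w))"
  using graded_symD[of f "[]" a b w] by simp
lemma graded_symD1: "graded_sym f \<Longrightarrow> f (c # u @ a # b # w) = ksgn (fst a * fst b) (f (c # u @ b # a # w))"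
  using graded_symD[of f "c # u" a b w] by simp
lemma graded_sym_Cons: "graded_sym f \<Longrightarrow> graded_sym (\<lambda>z. f (a # z))"
  by (rule graded_symI) (rule graded_symD1)

lemma graded_sym_spl:
  assumes "\<And>y. graded_sym (\<lambda>x. g x y)" "\<And>x. graded_sym (\<lambda>y. g x y)"
  shows "graded_sym (spl True g)"
proof -
  have "spl True g (u @ a # b # w) = ksgn (fst a * fst b) (spl True g (u @ b # a # w))" for u a b w
    using assms
  proof (induct u arbitrary: g)
    case Nil
    have 1: "spl True (\<lambda>x y. g (a # b # x) y) w
       = ksgn (fst a * fst b) (spl True (\<lambda>x y. g (b # a # x) y) w)"
      unfolding spl_ksgn[symmetric] by (rule spl_cong) (rule graded_symD0[OF Nil(1)])
    have 2: "spl True (\<lambda>x y. ksgn (fst b * wdeg x) (ksgn (fst a * wdeg x) (g x (a # b # y)))) w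
       = ksgn (fst a * fst b) (spl True (\<lambda>x y. ksgn (fst a * wdeg x) (ksgn (fst b * wdeg x) (g x (b # a # y)))) w)"
      unfolding spl_ksgn[symmetric]
      by (rule spl_cong) (simp add: graded_symD0[OF Nil(2), of _ a b] ksgn_ksgn algebra_simps)
    have 3: "spl True (\<lambda>x y. ksgn (fst b * wdeg x) (g (a # x) (b # y))) w
       = ksgn (fst a * fst b) (spl True (\<lambda>x y. ksgn (fst b * (fst a + wdeg x)) (g (a # x) (b # y))) w)" for a b
      unfolding spl_ksgn[symmetric] by (rule spl_cong) (auto simp: ksgn_ksgn intro!: ksgn_cong)
    have 4: "spl True (\<lambda>x y. ksgn (fst a * (fst b + wdeg x)) (g (b # x) (a # y))) w
       = ksgn (fst a * fst b) (spl True (\<lambda>x y. ksgn (fst a * wdeg x) (g (b # x) (a # y))) w)"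
      unfolding spl_ksgn[symmetric] by (rule spl_cong) (auto simp: ksgn_ksgn algebra_simps intro!: ksgn_cong)
    show ?case using 1 2 3[where a = a and b = b] 4 by (simp add: ksgn_plus)
  next
    case (Cons c u)
    have 1: "spl True (\<lambda>x y. g (c # x) y) (u @ a # b # w)
      = ksgn (fst a * fst b) (spl True (\<lambda>x y. g (c # x) y) (u @ b # a # w))"
      by (rule Cons(1)[of "\<lambda>x y. g (c # x) y"], rule graded_sym_Cons[OF Cons(2)], rule Cons(3))
    have 2: "spl True (\<lambda>x y. ksgn (fst c * wdeg x) (g x (c # y))) (u @ a # b # w)
      = ksgn (fst a * fst b) (spl True (\<lambda>x y. ksgn (fst c * wdeg x) (g x (c # y))) (u @ b # a # w))"
    proof (rule Cons(1))
      show "graded_sym (\<lambda>x. ksgn (fst c * wdeg x) (g x (c # y)))" for y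
        by (rule graded_symI, subst graded_symD[OF Cons(2)[of "c # y"]]) (auto simp: ksgn_ksgn intro!: ksgn_cong)
      show "graded_sym (\<lambda>y. ksgn (fst c * wdeg x) (g x (c # y)))" for x
        by (rule graded_symI, subst graded_symD1[OF Cons(3)[of x], where c = c]) (auto simp: ksgn_ksgn intro!: ksgn_cong)
    qed
    show ?case using 1 2 by (simp add: ksgn_plus)
  qed
  then show ?thesis by (rule graded_symI)
qed

lemma graded_sym_hat:
  assumes "graded_sym t" "addv f"
  shows "f (p @ hat e t (u @ a # b # w) # z) = ksgn (fst a * fst b) (f (p @ hat e t (u @ b # a # w) # z))"
proof -
  have "f (p @ (d, ksgn c x) # z) = ksgn c (f (p @ (d, x) # z))" for d c x
    using addi_ksgn[of "\<lambda>x. f (p @ (d, x) # z)" c x] addv_addi[OF assms(2), of p d z] by simp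
  then show ?thesis by (simp add: hat_def graded_symD[OF assms(1), of u a b] algebra_simps)
qed

lemma graded_sym_hat0:
  assumes "graded_sym t" "addv f"
  shows "f (hat e t (a # b # w) # z) = ksgn (fst a * fst b) (f (hat e t (b # a # w) # z))"
  using graded_sym_hat[OF assms, of "[]" e "[]" a b w z] by simp

lemma graded_sym_hat1:
  assumes "graded_sym t" "addv f"
  shows "f (hat e t (c # u @ a # b # w) # z) = ksgn (fst a * fst b) (f (hat e t (c # u @ b # a # w) # z))"
  using graded_sym_hat[OF assms, of "[]" e "c # u" a b w z] by simp

text \<open>Two adjacent letters are both arguments of \<open>t\<close>, or both passed by, and then the symmetry of \<open>t\<close> or of
  \<open>f\<close> applies; or they are separated, and then the terms for the two orders of the letters
  correspond to each other.\<close>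

lemma graded_sym_ins:
  assumes "graded_sym t" "addv f" "graded_sym f"
  shows "graded_sym (ins True e t f)"
proof -
  have "ins True e t f (u @ a # b # w) = ksgn (fst a * fst b) (ins True e t f (u @ b # a # w))" for u a b w
    using assms(2,3)
  proof (induct u arbitrary: f)
    case Nil
    have 1: "spl True (\<lambda>x y. f (hat e t (a # b # x) # y)) w
      = ksgn (fst a * fst b) (spl True (\<lambda>x y. f (hat e t (b # a # x) # y)) w)"
      unfolding spl_ksgn[symmetric]
      by (rule spl_cong) (rule graded_sym_hat0[OF assms(1) Nil(1)])
    have 2: "spl True (\<lambda>x y. ksgn (fst b * wdeg x) (f (hat e t (a # x) # b # y))) w
      = ksgn (fst a * fst b) (ksgn (e * fst b) (spl True (\<lambda>x y. f (b # hat e t (a # x) # y)) w))" for a b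
      unfolding spl_ksgn[symmetric]
      by (rule spl_cong) (subst graded_symD0[OF Nil(2)], auto simp: ksgn_ksgn algebra_simps intro!: ksgn_cong)
    have 3: "ksgn (e * fst a) (spl True (\<lambda>x y. f (a # hat e t (b # x) # y)) w)
      = ksgn (fst a * fst b) (spl True (\<lambda>x y. ksgn (fst a * wdeg x) (f (hat e t (b # x) # a # y))) w)"
      unfolding 2[where a = b and b = a] ksgn_ksgn by (rule ksgn_cong) auto
    have 4: "ins True e t (\<lambda>z. f (a # b # z)) w = ksgn (fst a * fst b) (ins True e t (\<lambda>z. f (b # a # z)) w)"
      unfolding ins_ksgn[symmetric] by (simp add: graded_symD0[OF Nil(2), of a b])
    show ?case
      by (simp add: spl_add ksgn_plus 1 4 2[where a = a and b = b] 3)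
         (simp add: ksgn_ksgn ksgn_cong algebra_simps)
  next
    case (Cons c u)
    have "graded_sym (spl True (\<lambda>x y. f (hat e t (c # x) # y)))"
    proof (rule graded_sym_spl)
      show "graded_sym (\<lambda>x. f (hat e t (c # x) # y))" for y
        by (rule graded_symI) (rule graded_sym_hat1[OF assms(1) Cons(2)])
      show "graded_sym (\<lambda>y. f (hat e t (c # x) # y))" for x by (rule graded_sym_Cons[OF Cons(3)])
    qed
    then have 1: "spl True (\<lambda>x y. f (hat e t (c # x) # y)) (u @ a # b # w)
      = ksgn (fst a * fst b) (spl True (\<lambda>x y. f (hat e t (c # x) # y)) (u @ b # a # w))"
      by (rule graded_symD)
    have 2: "ins True e t (\<lambda>z. f (c # z)) (u @ a # b # w)
      = ksgn (fst a * fst b) (ins True e t (\<lambda>z. f (c # z)) (u @ b # a # w))"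
      by (rule Cons(1)) (rule addv_Cons[OF Cons(2)], rule graded_sym_Cons[OF Cons(3)])
    show ?case by (simp add: 1 2 ksgn_plus ksgn_ksgn add.commute)
  qed
  then show ?thesis by (rule graded_symI)
qed

text \<open>The new case, compared to a single contraction, is that the two letters lead two different blocks:
  then the blocks are exchanged by the symmetry of \<open>f\<close>.\<close>

lemma graded_sym_cm:
  assumes "graded_sym \<phi>" "addv f" "graded_sym f"
  shows "graded_sym (cm True \<phi> f)"
proof -
  have "cm True \<phi> f (u @ a # b # w) = ksgn (fst a * fst b) (cm True \<phi> f (u @ b # a # w))" for u a b w
    using assms(2,3)
  proof (induct "length u + length w" arbitrary: u a b w f rule: less_induct)
    case less
    note IH = less(1) and ad = less(2) and sy = less(3)
    show ?case
    proof (cases u)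
      case Nil
      let ?h = "\<lambda>a x. hat 0 \<phi> (a # x)"
      have 1: "spl True (\<lambda>x y. cm True \<phi> (\<lambda>z. f (hat 0 \<phi> (a # b # x) # z)) y) w
        = ksgn (fst a * fst b) (spl True (\<lambda>x y. cm True \<phi> (\<lambda>z. f (hat 0 \<phi> (b # a # x) # z)) y) w)"
        unfolding spl_ksgn[symmetric] cm_ksgn[symmetric]
        by (rule spl_cong, rule cm_cong[where H = UNIV and H' = UNIV])
           (auto intro: graded_sym_hat0[OF assms(1) ad])
      have "spl True (\<lambda>x y. ksgn (fst b * wdeg x) (cm True \<phi> (\<lambda>z. f (?h a x # z)) (b # y))) w
        = spl True (\<lambda>x y. spl True (\<lambda>y1 y2. ksgn (fst b * wdeg x) (cm True \<phi> (\<lambda>z. f (?h a x # ?h b y1 # z)) y2)) y) w"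
        by (simp add: spl_ksgn)
      also have "\<dots> = spl True (\<lambda>x y. spl True (\<lambda>y1 y2. ksgn (wdeg x * wdeg y1)
         (ksgn (fst b * wdeg y1) (cm True \<phi> (\<lambda>z. f (?h a y1 # ?h b x # z)) y2))) y) w"
        by (rule spl_exchange)
      also have "\<dots> = spl True (\<lambda>x y. spl True (\<lambda>y1 y2. ksgn (fst a * fst b) (ksgn (fst a * wdeg x)
          (cm True \<phi> (\<lambda>z. f (?h b x # ?h a y1 # z)) y2))) y) w"
        by (intro spl_cong, subst graded_symD0[OF sy])
           (auto simp: ksgn_ksgn cm_ksgn algebra_simps intro!: ksgn_cong)
      also have "\<dots> = ksgn (fst a * fst b) (spl True (\<lambda>x y. ksgn (fst a * wdeg x) (cm True \<phi> (\<lambda>z. f (?h b x # z)) (a # y))) w)"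
        by (simp add: spl_ksgn)
      finally have 2: "spl True (\<lambda>x y. ksgn (fst b * wdeg x) (cm True \<phi> (\<lambda>z. f (?h a x # z)) (b # y))) w
        = \<dots>" .
      show ?thesis
        unfolding Nil append_Nil cm.simps(2)[of True \<phi> f] spl.simps if_True 1 2 ksgn_plus ..
    next
      case (Cons c u')
      let ?b = "length u' + length w"
      \<comment> \<open>The parts of a splitting are shorter, and only for those the symmetry is known.\<close>
      let ?g = "\<lambda>x y. if length y \<le> Suc (Suc ?b) then cm True \<phi> (\<lambda>z. f (hat 0 \<phi> (c # x) # z)) y else 0"
      have "graded_sym (spl True ?g)"
      proof (rule graded_sym_spl)
        show "graded_sym (\<lambda>x. ?g x y)" for y
          by (rule graded_symI) (auto simp: cm_ksgn[symmetric]
            intro!: cm_cong[where H = UNIV and H' = UNIV] graded_sym_hat1[OF assms(1) ad])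
        show "graded_sym (\<lambda>y. ?g x y)" for x
        proof (rule graded_symI)
          fix u2 a b w2
          show "?g x (u2 @ a # b # w2) = ksgn (fst a * fst b) (?g x (u2 @ b # a # w2))"
          proof (cases "length u2 + length w2 \<le> ?b")
            case True
            have "cm True \<phi> (\<lambda>z. f (hat 0 \<phi> (c # x) # z)) (u2 @ a # b # w2) =
              ksgn (fst a * fst b) (cm True \<phi> (\<lambda>z. f (hat 0 \<phi> (c # x) # z)) (u2 @ b # a # w2))"
              by (rule IH) (use True Cons addv_Cons[OF ad] graded_sym_Cons[OF sy] in auto)
            with True show ?thesis by simp
          qed simp
        qed
      qed
      moreover have "spl True ?g (u' @ a # b # w) = cm True \<phi> f (u @ a # b # w)" for a b
        unfolding Cons append_Cons cm.simps by (rule spl_cong) simp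
      ultimately show ?thesis using graded_symD[of "spl True ?g" u' a b w] by simp
    qed
  qed
  then show ?thesis by (rule graded_symI)
qed

section \<open>Shuffles\<close>

text \<open>The value of \<open>f\<close> on the shuffle product of two words. In terms of the suspended degrees the sign of
  a shuffle is just a Koszul sign.\<close>

fun sh :: "(int \<times> 'v) list \<Rightarrow> (int \<times> 'v) list \<Rightarrow> ((int \<times> 'v) list \<Rightarrow> 'y::ab_group_add) \<Rightarrow> 'y" where
  "sh [] v f = f v"
| "sh (a # u) [] f = f (a # u)"
| "sh (a # u) (b # v) f = sh u (b # v) (\<lambda>z. f (a # z)) +
     ksgn (fst b * wdeg (a # u)) (sh (a # u) v (\<lambda>z. f (b # z)))"

definition shuffle_null :: "((int \<times> 'v) list \<Rightarrow> 'y::ab_group_add) \<Rightarrow> bool" where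
  "shuffle_null f \<longleftrightarrow> (\<forall>u v. u \<noteq> [] \<longrightarrow> v \<noteq> [] \<longrightarrow> sh u v f = 0)"

lemma sh_Nil2 [simp]: "sh u [] f = f u" by (cases u) simp_all

lemma sh_cong:
  assumes "\<And>z. length z = length u + length v \<Longrightarrow> wdeg z = wdeg u + wdeg v \<Longrightarrow>
    set z \<subseteq> set u \<union> set v \<Longrightarrow> f z = f' z"
  shows "sh u v f = sh u v f'"
  using assms
proof (induct u v f arbitrary: f' rule: sh.induct)
  case (3 a u b v f)
  have 1: "sh u (b # v) (\<lambda>z. f (a # z)) = sh u (b # v) (\<lambda>z. f' (a # z))"
    by (rule 3(1)) (rule 3(3), auto)
  have 2: "sh (a # u) v (\<lambda>z. f (b # z)) = sh (a # u) v (\<lambda>z. f' (b # z))"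
    by (rule 3(2)) (rule 3(3), auto)
  show ?case by (simp only: sh.simps 1 2)
qed simp_all

lemma sh_add: "sh u v (\<lambda>z. f z + h z) = sh u v f + sh u v h"
  by (induct u v f arbitrary: h rule: sh.induct) (simp_all add: ksgn_plus)

lemma sh_post: "addi L \<Longrightarrow> L (sh u v f) = sh u v (\<lambda>z. L (f z))"
  by (induct u v f rule: sh.induct) (simp_all add: addi_add[of L] addi_ksgn[of L])

lemma sh_ksgn: "sh u v (\<lambda>z. ksgn c (f z)) = ksgn c (sh u v f)"
  by (simp add: sh_post[OF addi_ksgn_fun])

lemma sh_0: "sh u v (\<lambda>z. 0) = 0"
  using sh_add[of u v "\<lambda>_. 0" "\<lambda>_. 0"] by simp

lemma spl_spl_comm:
  "spl s (\<lambda>x y. spl s' (\<lambda>x' y'. F x y x' y') v) w = spl s' (\<lambda>x' y'. spl s (\<lambda>x y. F x y x' y') w) v"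
  by (cases s; induct w arbitrary: F) (simp_all add: spl_add flip: spl_ksgn)

text \<open>Deconcatenation is multiplicative for the shuffle product: the letters in a prefix of a shuffle
  are a shuffle of prefixes of the two words.\<close>

lemma sh_spl:
  "sh u v (spl False g) = spl False (\<lambda>u1 u2. spl False (\<lambda>v1 v2.
     ksgn (wdeg u2 * wdeg v1) (sh u1 v1 (\<lambda>x. sh u2 v2 (\<lambda>y. g x y)))) v) u"
proof (induct "length u + length v" arbitrary: u v g rule: less_induct)
  case less
  show ?case
  proof (cases u)
    case Nil
    then show ?thesis by simp
  next
    case u: (Cons a u')
    show ?thesis
    proof (cases v)
      case Nil
      then show ?thesis by simp
    next
      case v: (Cons b v')
      let ?A = "fst a + wdeg u'"
      let ?G = "\<lambda>g u1 u2 v1 v2. ksgn (wdeg u2 * wdeg v1) (sh u1 v1 (\<lambda>x. sh u2 v2 (\<lambda>y. g x y)))"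
      let ?ga = "\<lambda>x. g (a # x)" and ?gb = "\<lambda>x. g (b # x)"
      have 1: "sh u' v (\<lambda>z. spl False ?ga z) = spl False (\<lambda>u1 u2. spl False (?G ?ga u1 u2) v) u'"
        by (rule less) (simp add: u)
      have 2: "sh u v' (\<lambda>z. spl False ?gb z) = spl False (\<lambda>u1 u2. spl False (?G ?gb u1 u2) v') u"
        by (rule less) (simp add: v)
      have L: "sh u v (spl False g) = sh u' v (\<lambda>z. spl False ?ga z) + sh u' v (\<lambda>z. g [] (a # z))
         + ksgn (fst b * ?A) (sh u v' (\<lambda>z. spl False ?gb z)) + ksgn (fst b * ?A) (sh u v' (\<lambda>z. g [] (b # z)))"
        by (simp add: u v sh_add ksgn_plus)
      have 3: "spl False (\<lambda>u1 u2. spl False (\<lambda>v1 v2. ?G g (a # u1) u2 (b # v1) v2) v') u'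
        = spl False (\<lambda>u1 u2. spl False (\<lambda>v1 v2. ?G ?ga u1 u2 (b # v1) v2) v') u'
        + ksgn (fst b * ?A) (spl False (\<lambda>u1 u2. spl False (\<lambda>v1 v2. ?G ?gb (a # u1) u2 v1 v2) v') u')"
        unfolding spl_ksgn[symmetric] spl_add[symmetric]
      proof (intro spl_cong)
        fix u1 u2 v1 v2 :: "(int \<times> 'b) list" assume "wdeg u1 + wdeg u2 = wdeg u'"
        then have "wdeg u' = wdeg u1 + wdeg u2" by simp
        then show "?G g (a # u1) u2 (b # v1) v2 = ?G ?ga u1 u2 (b # v1) v2 + ksgn (fst b * ?A) (?G ?gb (a # u1) u2 v1 v2)"
          by (auto simp: ksgn_plus ksgn_ksgn intro!: ksgn_cong)
      qed
      have 4: "spl False (\<lambda>v1 v2. ?G g [] u (b # v1) v2) v'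
         = ksgn (fst b * ?A) (spl False (\<lambda>v1 v2. ?G ?gb [] u v1 v2) v')"
        unfolding spl_ksgn[symmetric]
        by (intro spl_cong) (auto simp: u ksgn_ksgn intro!: ksgn_cong)
      have R: "spl False (\<lambda>u1 u2. spl False (?G g u1 u2) v) u =
           spl False (\<lambda>u1 u2. spl False (\<lambda>v1 v2. ?G g (a # u1) u2 (b # v1) v2) v') u'
         + spl False (\<lambda>u1 u2. sh u2 v (\<lambda>y. g (a # u1) y)) u'
         + spl False (\<lambda>v1 v2. ?G g [] u (b # v1) v2) v'
         + sh u v (\<lambda>y. g [] y)"
        by (simp add: u v spl_add algebra_simps)
      show ?thesis
        unfolding L R 1 2 3 4 by (simp add: u v spl_add ksgn_plus algebra_simps)
    qed
  qed
qed

lemma sh_nonempty_part: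
  assumes "shuffle_null t" and F: "\<And>d y. addi (\<lambda>v. F (d, v) y)"
  shows "sh u1 v1 (\<lambda>x. sh u2 v2 (\<lambda>y. if x = [] then 0 else F (hat e t x) y)) =
    (if u1 = [] then if v1 = [] then 0 else sh u2 v2 (F (hat e t v1))
     else if v1 = [] then sh u2 v2 (F (hat e t u1)) else 0)"
proof (cases "u1 = [] \<or> v1 = []")
  case True
  then show ?thesis by (auto simp: sh_0)
next
  case False
  let ?L = "\<lambda>v. sh u2 v2 (\<lambda>y. F (wdeg u1 + wdeg v1 + e, v) y)"
  have L: "addi ?L" by (rule addiI) (simp add: addi_add[OF F] sh_add)
  have "sh u1 v1 (\<lambda>x. sh u2 v2 (\<lambda>y. if x = [] then 0 else F (hat e t x) y)) = sh u1 v1 (\<lambda>x. ?L (t x))"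
  proof (rule sh_cong)
    fix z :: "(int \<times> 'a) list"
    assume z: "length z = length u1 + length v1" "wdeg z = wdeg u1 + wdeg v1"
    then have "z \<noteq> []" using False by auto
    then show "sh u2 v2 (\<lambda>y. if z = [] then 0 else F (hat e t z) y) = ?L (t z)"
      using z by (simp add: hat_def)
  qed
  also have "\<dots> = ?L (sh u1 v1 t)" by (rule sh_post[OF L, symmetric])
  also have "\<dots> = 0" using assms(1) False addi_0[OF L] by (simp add: shuffle_null_def)
  finally show ?thesis using False by simp
qed

text \<open>A map that vanishes on shuffles contracts only letters of one of the two words.\<close>

lemma sh_first_block:
  assumes "shuffle_null t" and F: "\<And>d y. addi (\<lambda>v. F (d, v) y)"
  shows "sh (a # u) (b # v) (spl False (\<lambda>x y. if x = [] then 0 else F (hat e t x) y)) =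
    spl False (\<lambda>x y. sh y (b # v) (F (hat e t (a # x)))) u +
    spl False (\<lambda>x y. ksgn (wdeg (a # u) * wdeg (b # x)) (sh (a # u) y (F (hat e t (b # x))))) v"
proof -
  have "sh (a # u) (b # v) (spl False (\<lambda>x y. if x = [] then 0 else F (hat e t x) y)) =
    spl False (\<lambda>u1 u2. spl False (\<lambda>v1 v2. ksgn (wdeg u2 * wdeg v1)
     (if u1 = [] then if v1 = [] then 0 else sh u2 v2 (F (hat e t v1))
     else if v1 = [] then sh u2 v2 (F (hat e t u1)) else 0)) (b # v)) (a # u)"
    unfolding sh_spl sh_nonempty_part[OF assms] ..
  then show ?thesis by (simp add: spl_0)
qed

text \<open>A coderivation with corestriction zero on shuffles is a derivation of the shuffle product, since
  contractions that involve letters of both words cancel.\<close>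

lemma sh_ins:
  assumes "shuffle_null t" "addv f"
  shows "sh u v (ins False e t f) =
    ins False e t (\<lambda>z. sh z v f) u + ksgn (e * wdeg u) (ins False e t (\<lambda>z. sh u z f) v)"
  using assms(2)
proof (induct "length u + length v" arbitrary: u v f rule: less_induct)
  case less
  note IH = less(1) and ad = less(2)
  show ?case
  proof (cases u)
    case Nil
    then show ?thesis by simp
  next
    case u: (Cons a u')
    show ?thesis
    proof (cases v)
      case Nil
      then show ?thesis by simp
    next
      case v: (Cons b v')
      let ?A = "fst a + wdeg u'" and ?h = "\<lambda>a x. hat e t (a # x)"
      let ?fa = "\<lambda>z. f (a # z)" and ?fb = "\<lambda>z. f (b # z)"
      let ?D = "spl False (\<lambda>x y. if x = [] then 0 else f (hat e t x # y))"
      let ?X = "spl False (\<lambda>x y. sh y v (\<lambda>z. f (?h a x # z))) u'"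
      let ?Y = "spl False (\<lambda>x y. ksgn (?A * wdeg (b # x)) (sh u y (\<lambda>z. f (?h b x # z)))) v'"
      have "sh u v (ins False e t f) = sh u v ?D + ksgn (e * fst a) (sh u' v (ins False e t ?fa))
         + ksgn (fst b * ?A) (ksgn (e * fst b) (sh u v' (ins False e t ?fb)))"
        by (simp add: u v sh_add sh_ksgn ksgn_plus)
      also have "sh u v ?D = ?X + ?Y"
        unfolding u v sh_first_block[OF assms(1), of "\<lambda>h y. f (h # y)", OF addv_addi0[OF ad]] by simp
      also have "sh u' v (ins False e t ?fa) =
         ins False e t (\<lambda>z. sh z v ?fa) u' + ksgn (e * wdeg u') (ins False e t (\<lambda>z. sh u' z ?fa) v)"
        by (rule IH) (simp_all add: u addv_Cons[OF ad])
      also have "sh u v' (ins False e t ?fb) =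
         ins False e t (\<lambda>z. sh z v' ?fb) u + ksgn (e * wdeg u) (ins False e t (\<lambda>z. sh u z ?fb) v')"
        by (rule IH) (simp_all add: v addv_Cons[OF ad])
      finally have L: "sh u v (ins False e t f) = ?X + ?Y
         + ksgn (e * fst a) (ins False e t (\<lambda>z. sh z v ?fa) u' + ksgn (e * wdeg u') (ins False e t (\<lambda>z. sh u' z ?fa) v))
         + ksgn (fst b * ?A) (ksgn (e * fst b)
             (ins False e t (\<lambda>z. sh z v' ?fb) u + ksgn (e * wdeg u) (ins False e t (\<lambda>z. sh u z ?fb) v')))" .
      have w1: "ins False e t (\<lambda>z. ksgn (fst b * (fst a + wdeg z)) (sh (a # z) v' ?fb)) u'
         = ksgn (fst b * (?A + e)) (ins False e t (\<lambda>z. sh (a # z) v' ?fb) u')"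
        unfolding ins_ksgn[symmetric]
        by (rule ins_cong[where H = UNIV]) (auto simp: algebra_simps)
      have w2: "spl False (\<lambda>x y. ksgn (fst b * (fst (?h a x) + wdeg y)) (sh (?h a x # y) v' ?fb)) u'
         = ksgn (fst b * (?A + e)) (spl False (\<lambda>x y. sh (?h a x # y) v' ?fb) u')"
        unfolding spl_ksgn[symmetric]
      proof (rule spl_cong)
        fix x y :: "(int \<times> 'a) list" assume "wdeg x + wdeg y = wdeg u'"
        then have "?A + e = fst (?h a x) + wdeg y" by simp
        then show "ksgn (fst b * (fst (?h a x) + wdeg y)) (sh (?h a x # y) v' ?fb)
          = ksgn (fst b * (?A + e)) (sh (?h a x # y) v' ?fb)" by (simp only:)
      qed
      have "ins False e t (\<lambda>z. sh z v f) u = ?X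
          + spl False (\<lambda>x y. ksgn (fst b * (fst (?h a x) + wdeg y)) (sh (?h a x # y) v' ?fb)) u'
          + ksgn (e * fst a) (ins False e t (\<lambda>z. sh z v ?fa) u')
          + ksgn (e * fst a) (ins False e t (\<lambda>z. ksgn (fst b * (fst a + wdeg z)) (sh (a # z) v' ?fb)) u')"
        by (simp add: u v spl_add ins_add ksgn_plus)
      also have "\<dots> = ?X + ksgn (e * fst a) (ins False e t (\<lambda>z. sh z v ?fa) u')
          + ksgn (fst b * (?A + e)) (ins False e t (\<lambda>z. sh z v' ?fb) u)"
        unfolding w1 w2 by (simp add: u ksgn_plus ksgn_ksgn algebra_simps)
      finally have R1: "ins False e t (\<lambda>z. sh z v f) u = \<dots>" .
      have "ins False e t (\<lambda>z. sh u z f) v =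
          spl False (\<lambda>x y. sh u' (?h b x # y) ?fa) v'
          + spl False (\<lambda>x y. ksgn (fst (?h b x) * ?A) (sh u y (\<lambda>z. f (?h b x # z)))) v'
          + ksgn (e * fst b) (ins False e t (\<lambda>z. sh u' (b # z) ?fa) v')
          + ksgn (e * fst b) (ksgn (fst b * ?A) (ins False e t (\<lambda>z. sh u z ?fb) v'))"
        by (simp add: u v spl_add ins_add ins_ksgn ksgn_plus)
      moreover have "ksgn (e * ?A) (spl False (\<lambda>x y. ksgn (fst (?h b x) * ?A) (sh u y (\<lambda>z. f (?h b x # z)))) v') = ?Y"
        unfolding spl_ksgn[symmetric] by (rule spl_cong) (auto simp: ksgn_ksgn intro!: ksgn_cong)
      ultimately have R2: "ksgn (e * ?A) (ins False e t (\<lambda>z. sh u z f) v) =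
          ksgn (e * ?A) (ins False e t (\<lambda>z. sh u' z ?fa) v) + ?Y
          + ksgn (e * ?A) (ksgn (e * fst b) (ksgn (fst b * ?A) (ins False e t (\<lambda>z. sh u z ?fb) v')))"
        by (simp add: v ksgn_plus)
      have u_A: "wdeg u = ?A" by (simp add: u)
      show ?thesis
        unfolding L u_A R1 R2 by (simp add: ksgn_plus ksgn_ksgn algebra_simps)
    qed
  qed
qed

text \<open>For the same reason, a coalgebra map with corestriction zero on shuffles is multiplicative.\<close>

lemma sh_cm:
  fixes \<phi> :: "(int \<times> 'a) list \<Rightarrow> 'b::ab_group_add"
  assumes "shuffle_null \<phi>" "addv f"
  shows "sh u v (cm False \<phi> f) = cm False \<phi> (\<lambda>z. cm False \<phi> (\<lambda>z'. sh z z' f) v) u"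
  using assms(2)
proof (induct "length u + length v" arbitrary: u v f rule: less_induct)
  case less
  note IH = less(1) and ad = less(2)
  show ?case
  proof (cases u)
    case Nil
    then show ?thesis by simp
  next
    case u: (Cons a u')
    show ?thesis
    proof (cases v)
      case Nil
      then show ?thesis by simp
    next
      case v: (Cons b v')
      let ?A = "fst a + wdeg u'" and ?h = "\<lambda>a x. hat 0 \<phi> (a # x)"
      let ?c = "cm False \<phi>"
      let ?B = "\<lambda>x y. if x = [] then 0 else ?c (\<lambda>z. f (hat 0 \<phi> x # z)) y"
      have sp: "?c f (c # z) = spl False ?B (c # z)" for c z by simp
      have "sh u v (?c f) = sh u v (spl False ?B)"
      proof (rule sh_cong)
        fix z :: "(int \<times> 'a) list" assume "length z = length u + length v"
        then obtain c z' where z: "z = c # z'" by (cases z) (auto simp: u)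
        show "?c f z = spl False ?B z" unfolding z by (rule sp)
      qed
      also have "\<dots> = spl False (\<lambda>x y. sh y v (?c (\<lambda>z. f (?h a x # z)))) u'
         + spl False (\<lambda>x y. ksgn (?A * wdeg (b # x)) (sh u y (?c (\<lambda>z. f (?h b x # z))))) v'"
        unfolding u v sh_first_block[OF assms(1), of "\<lambda>h. ?c (\<lambda>z. f (h # z))", OF addi_slot_cm[OF ad]] by simp
      also have "spl False (\<lambda>x y. sh y v (?c (\<lambda>z. f (?h a x # z)))) u'
         = spl False (\<lambda>x y. ?c (\<lambda>z. ?c (\<lambda>z'. sh z z' (\<lambda>z. f (?h a x # z))) v) y) u'"
        by (rule spl_cong, rule IH) (simp_all add: u addv_Cons[OF ad])
      also have "spl False (\<lambda>x y. ksgn (?A * wdeg (b # x)) (sh u y (?c (\<lambda>z. f (?h b x # z))))) v'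
         = spl False (\<lambda>x y. ksgn (?A * wdeg (b # x)) (?c (\<lambda>z. ?c (\<lambda>z'. sh z z' (\<lambda>z. f (?h b x # z))) y) u)) v'"
        by (rule spl_cong, rule arg_cong[where f = "ksgn _"], rule IH) (simp_all add: v addv_Cons[OF ad])
      finally have L: "sh u v (?c f) =
           spl False (\<lambda>x y. ?c (\<lambda>z. ?c (\<lambda>z'. sh z z' (\<lambda>z. f (?h a x # z))) v) y) u'
         + spl False (\<lambda>x y. ksgn (?A * wdeg (b # x)) (?c (\<lambda>z. ?c (\<lambda>z'. sh z z' (\<lambda>z. f (?h b x # z))) y) u)) v'" .
      let ?H = "\<lambda>x' y' w. ?c (\<lambda>z'. sh w z' (\<lambda>z. f (?h b x' # z))) y'"
      have 1: "?c (\<lambda>z'. sh (k # z) z' f) v = ?c (\<lambda>z'. sh z z' (\<lambda>z. f (k # z))) v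
          + spl False (\<lambda>x' y'. ksgn (wdeg (b # x') * (fst k + wdeg z)) (?H x' y' (k # z))) v'" for k z
      proof -
        have "?c (\<lambda>z'. sh (k # z) z' f) v = spl False (\<lambda>x' y'. ?c (\<lambda>z'. sh (k # z) (?h b x' # z') f) y') v'"
          by (simp add: v)
        also have "\<dots> = spl False (\<lambda>x' y'. ?c (\<lambda>z'. sh z (?h b x' # z') (\<lambda>z. f (k # z))) y'
            + ksgn (wdeg (b # x') * (fst k + wdeg z)) (?H x' y' (k # z))) v'"
          by (simp add: cm_add_fun cm_ksgn_fun)
        finally show ?thesis by (simp add: v spl_add)
      qed
      have "?c (\<lambda>z. ?c (\<lambda>z'. sh z z' f) v) u = spl False (\<lambda>x y. ?c (\<lambda>z. ?c (\<lambda>z'. sh (?h a x # z) z' f) v) y) u'"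
        by (simp add: u)
      also have "\<dots> = spl False (\<lambda>x y. ?c (\<lambda>z. ?c (\<lambda>z'. sh z z' (\<lambda>z. f (?h a x # z))) v) y) u'
         + spl False (\<lambda>x y. ?c (\<lambda>z. spl False (\<lambda>x' y'. ksgn (wdeg (b # x') * (fst (?h a x) + wdeg z))
             (?H x' y' (?h a x # z))) v') y) u'"
        unfolding 1 cm_add spl_add ..
      also have "spl False (\<lambda>x y. ?c (\<lambda>z. spl False (\<lambda>x' y'. ksgn (wdeg (b # x') * (fst (?h a x) + wdeg z))
             (?H x' y' (?h a x # z))) v') y) u'
         = spl False (\<lambda>x y. ?c (\<lambda>z. spl False (\<lambda>x' y'. ksgn (?A * wdeg (b # x'))
             (?H x' y' (?h a x # z))) v') y) u'"
      proof (rule spl_cong, rule cm_cong[where H = UNIV and H' = UNIV])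
        fix x y :: "(int \<times> 'a) list" and z :: "(int \<times> 'b) list" assume "wdeg x + wdeg y = wdeg u'" "wdeg z = wdeg y"
        then have "fst (?h a x) + wdeg z = ?A" by simp
        then show "spl False (\<lambda>x' y'. ksgn (wdeg (b # x') * (fst (?h a x) + wdeg z)) (?H x' y' (?h a x # z))) v'
          = spl False (\<lambda>x' y'. ksgn (?A * wdeg (b # x')) (?H x' y' (?h a x # z))) v'"
          by (simp only: mult.commute)
      qed auto
      also have "\<dots> = spl False (\<lambda>x' y'. spl False (\<lambda>x y. ?c (\<lambda>z. ksgn (?A * wdeg (b # x'))
             (?H x' y' (?h a x # z))) y) u') v'"
        unfolding cm_spl_comm by (rule spl_spl_comm)
      also have "\<dots> = spl False (\<lambda>x' y'. ksgn (?A * wdeg (b # x')) (?c (?H x' y') u)) v'"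
        by (simp add: u cm_ksgn_fun spl_ksgn)
      finally show ?thesis unfolding L by simp
    qed
  qed
qed

lemma shuffle_null_ins:
  assumes "shuffle_null t" "addv f" "shuffle_null f"
  shows "shuffle_null (ins False e t f)"
  unfolding shuffle_null_def
proof (intro allI impI)
  fix u v :: "(int \<times> 'a) list" assume "u \<noteq> []" "v \<noteq> []"
  then have "ins False e t (\<lambda>z. sh z v f) u = ins False e t (\<lambda>z. 0) u"
    "ins False e t (\<lambda>z. sh u z f) v = ins False e t (\<lambda>z. 0) v"
    using assms(3) by (auto intro!: ins_cong[where H = UNIV] simp: shuffle_null_def)
  then show "sh u v (ins False e t f) = 0" by (simp add: sh_ins[OF assms(1,2)] ins_0)
qed

lemma shuffle_null_cm:
  assumes "shuffle_null \<phi>" "addv f" "shuffle_null f"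
  shows "shuffle_null (cm False \<phi> f)"
  unfolding shuffle_null_def
proof (intro allI impI)
  fix u v :: "(int \<times> 'a) list" assume u: "u \<noteq> []" and v: "v \<noteq> []"
  have "cm False \<phi> (\<lambda>z'. sh z z' f) v = 0" if "z \<noteq> []" for z
  proof -
    have "cm False \<phi> (\<lambda>z'. sh z z' f) v = cm False \<phi> (\<lambda>z'. 0) v"
      by (rule cm_cong[where H = UNIV and H' = UNIV]) (use that v assms(3) in \<open>auto simp: shuffle_null_def\<close>)
    then show ?thesis by (simp add: cm_0)
  qed
  then have "cm False \<phi> (\<lambda>z. cm False \<phi> (\<lambda>z'. sh z z' f) v) u = cm False \<phi> (\<lambda>z. 0) u"
    by (intro cm_cong[where H = UNIV and H' = UNIV]) (use u in auto)
  then show "sh u v (cm False \<phi> f) = 0" by (simp add: sh_cm[OF assms(1,2)] cm_0)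
qed

section \<open>Homogeneous components\<close>

lemma linear_iff:
  "Vector_Spaces.linear s1 s2 f \<longleftrightarrow> vector_space s1 \<and> vector_space s2 \<and>
     (\<forall>x y. f (x + y) = f x + f y) \<and> (\<forall>c x. f (s1 c x) = s2 c (f x))"
  unfolding Vector_Spaces.linear_def module_hom_def module_hom_axioms_def
    vector_space_def module_def by argo

definition component :: "('k::field, 'v::ab_group_add) complex_data \<Rightarrow> int \<Rightarrow> 'v \<Rightarrow> 'v" where
  "component U d x = (THE c. finite {d. c d \<noteq> 0} \<and> (\<forall>d. c d \<in> grade U d) \<and> x = (\<Sum>d | c d \<noteq> 0. c d)) d"

locale complex =
  fixes U :: "('k::field, 'v::ab_group_add) complex_data"
  assumes cc: "chain_complex U"
begin

sublocale vs: vector_space "smul U" using cc by (simp add: chain_complex_def)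

lemma grade_subspace: "vs.subspace (grade U d)" using cc by (simp add: chain_complex_def)
lemma grade_0 [simp]: "0 \<in> grade U d" using grade_subspace by (rule vs.subspace_0)
lemma grade_add: "x \<in> grade U d \<Longrightarrow> y \<in> grade U d \<Longrightarrow> x + y \<in> grade U d"
  using grade_subspace by (rule vs.subspace_add)
lemma grade_diff: "x \<in> grade U d \<Longrightarrow> y \<in> grade U d \<Longrightarrow> x - y \<in> grade U d"
  using grade_subspace by (rule vs.subspace_diff)
lemma grade_neg: "x \<in> grade U d \<Longrightarrow> - x \<in> grade U d"
  using grade_subspace by (rule vs.subspace_neg)
lemma grade_scale: "x \<in> grade U d \<Longrightarrow> smul U c x \<in> grade U d"
  using grade_subspace by (rule vs.subspace_scale)
lemma grade_ksgn: "x \<in> grade U d \<Longrightarrow> ksgn e x \<in> grade U d"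
  by (simp add: ksgn_def grade_neg)

lemma bd_add: "bd U (x + y) = bd U x + bd U y"
  and bd_scale: "bd U (smul U c x) = smul U c (bd U x)"
  using cc by (simp_all add: chain_complex_def linear_iff)
lemma bd_addi: "addi (bd U)" by (rule addiI) (rule bd_add)
lemma bd_0 [simp]: "bd U 0 = 0" by (rule addi_0[OF bd_addi])
lemma bd_minus: "bd U (- x) = - bd U x" by (rule addi_minus[OF bd_addi])
lemma bd_diff: "bd U (x - y) = bd U x - bd U y" using bd_add[of x "- y"] by (simp add: bd_minus)
lemma bd_ksgn: "bd U (ksgn e x) = ksgn e (bd U x)" by (rule addi_ksgn[OF bd_addi])
lemma bd_bd [simp]: "bd U (bd U x) = 0" using cc by (simp add: chain_complex_def)
lemma bd_grade: "x \<in> grade U d \<Longrightarrow> bd U x \<in> grade U (d - 1)"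
  using cc by (simp add: chain_complex_def)

lemma decomp_ex1: "\<exists>!c. finite {d. c d \<noteq> 0} \<and> (\<forall>d. c d \<in> grade U d) \<and> x = (\<Sum>d | c d \<noteq> 0. c d)"
  using cc by (simp add: chain_complex_def)

lemma component_props:
  "finite {d. component U d x \<noteq> 0}" "component U d x \<in> grade U d" "x = (\<Sum>d | component U d x \<noteq> 0. component U d x)"
  using theI'[OF decomp_ex1[of x]] unfolding component_def by blast+

lemma component_unique:
  assumes "finite A" "\<And>d. c d \<in> grade U d" "\<And>d. d \<notin> A \<Longrightarrow> c d = 0" "x = (\<Sum>d\<in>A. c d)"
  shows "component U d x = c d"
proof -
  have f: "finite {d. c d \<noteq> 0}" by (rule finite_subset[OF _ assms(1)]) (use assms(3) in blast)
  have "(\<Sum>d\<in>A. c d) = (\<Sum>d | c d \<noteq> 0. c d)"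
    by (rule sum.mono_neutral_right[OF assms(1)]) (use assms(3) in auto)
  then have "finite {d. c d \<noteq> 0} \<and> (\<forall>d. c d \<in> grade U d) \<and> x = (\<Sum>d | c d \<noteq> 0. c d)"
    using f assms(2,4) by simp
  then have "(THE c. finite {d. c d \<noteq> 0} \<and> (\<forall>d. c d \<in> grade U d) \<and> x = (\<Sum>d | c d \<noteq> 0. c d)) = c"
    by (rule the1_equality[OF decomp_ex1])
  then show ?thesis by (simp add: component_def)
qed

lemma component_grade: "component U d x \<in> grade U d" by (rule component_props)

lemma component_same: "x \<in> grade U d \<Longrightarrow> component U d x = x"
  using component_unique[of "{d}" "\<lambda>e. if e = d then x else 0" x d] by simp

lemma component_other: "x \<in> grade U d \<Longrightarrow> e \<noteq> d \<Longrightarrow> component U e x = 0"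
  using component_unique[of "{d}" "\<lambda>e. if e = d then x else 0" x e] by simp

lemma component_component [simp]: "component U d (component U d x) = component U d x" by (rule component_same[OF component_grade])

lemma component_add: "component U d (x + y) = component U d x + component U d y"
proof (rule component_unique)
  let ?A = "{d. component U d x \<noteq> 0} \<union> {d. component U d y \<noteq> 0}"
  show f: "finite ?A" by (simp add: component_props)
  show "component U d x + component U d y \<in> grade U d" for d by (simp add: grade_add component_grade)
  have "x = (\<Sum>d\<in>?A. component U d x)"
    by (subst component_props(3)) (rule sum.mono_neutral_left[OF f], auto)
  moreover have "y = (\<Sum>d\<in>?A. component U d y)"
    by (subst component_props(3)) (rule sum.mono_neutral_left[OF f], auto)
  ultimately show "x + y = (\<Sum>d\<in>?A. component U d x + component U d y)" by (simp add: sum.distrib)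
qed auto

lemma component_scale: "component U d (smul U c x) = smul U c (component U d x)"
proof (rule component_unique)
  show "finite {d. component U d x \<noteq> 0}" by (rule component_props)
  show "smul U c x = (\<Sum>d | component U d x \<noteq> 0. smul U c (component U d x))"
    by (subst component_props(3)[of x]) (simp add: vs.scale_sum_right)
qed (auto simp: grade_scale component_grade)

lemma component_addi: "addi (component U d)" by (rule addiI) (rule component_add)
lemma component_0 [simp]: "component U d 0 = 0" by (rule addi_0[OF component_addi])
end

section \<open>Multilinear maps on words\<close>

text \<open>Linear functions of a letter of degree \<open>d\<close>. They only see the component of degree \<open>d\<close>, so
  that a letter \<open>(d, x)\<close> makes sense for every vector \<open>x\<close>.\<close>

definition lind :: "('k::field, 'v::ab_group_add) complex_data \<Rightarrow> ('k \<Rightarrow> 'y \<Rightarrow> 'y::ab_group_add)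
    \<Rightarrow> int \<Rightarrow> ('v \<Rightarrow> 'y) \<Rightarrow> bool" where
  "lind U sc d L \<longleftrightarrow> (\<forall>x y. L (x + y) = L x + L y) \<and> (\<forall>c x. L (smul U c x) = sc c (L x)) \<and>
     (\<forall>x. L (component U d x) = L x)"

definition mlin :: "('k::field, 'v::ab_group_add) complex_data \<Rightarrow> ('k \<Rightarrow> 'y \<Rightarrow> 'y::ab_group_add)
    \<Rightarrow> ((int \<times> 'v) list \<Rightarrow> 'y) \<Rightarrow> bool" where
  "mlin U sc f \<longleftrightarrow> (\<forall>u d w. lind U sc d (\<lambda>x. f (u @ (d, x) # w)))"

lemma lindD:
  assumes "lind U sc d L"
  shows "L (x + y) = L x + L y" "L (smul U c x) = sc c (L x)" "L (component U d x) = L x"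
  using assms by (simp_all add: lind_def)

lemma lind_addi: "lind U sc d L \<Longrightarrow> addi L" by (simp add: lind_def addi_def)

lemma lcl_lind:
  assumes "vector_space sc"
  shows "lcl (lind U sc d)"
proof -
  interpret vector_space sc by fact
  show ?thesis
    by (auto simp: lcl_def lind_def ksgn_def scale_right_distrib)
qed

lemma lind_compose:
  assumes "lind U (smul X) d L" "lind X sc e M"
  shows "lind U sc d (\<lambda>x. M (L x))"
  using assms by (simp add: lind_def)

lemma mlinD: "mlin U sc f \<Longrightarrow> lind U sc d (\<lambda>x. f (u @ (d, x) # w))" by (simp add: mlin_def)
lemma mlinD0: "mlin U sc f \<Longrightarrow> lind U sc d (\<lambda>x. f ((d, x) # w))" using mlinD[of U sc f d "[]"] by simp
lemma mlinI: "(\<And>u d w. lind U sc d (\<lambda>x. f (u @ (d, x) # w))) \<Longrightarrow> mlin U sc f" by (simp add: mlin_def)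
lemma mlin_addv: "mlin U sc f \<Longrightarrow> addv f"
  unfolding addv_def by (intro allI) (rule lind_addi[OF mlinD])
lemma mlin_Cons: "mlin U sc f \<Longrightarrow> mlin U sc (\<lambda>z. f (a # z))"
  by (rule mlinI) (use mlinD[of U sc f _ "a # _"] in simp)

lemma mlin_ins:
  fixes t :: "(int \<times> 'v::ab_group_add) list \<Rightarrow> 'v"
  assumes "vector_space sc" "mlin U (smul U) t" "mlin U sc f"
  shows "mlin U sc (ins s e t f)"
proof (rule mlinI, rule ins_slot[OF lcl_lind[OF assms(1)]])
  fix d and p x1 x2 y :: "(int \<times> 'v) list"
  show "lind U sc d (\<lambda>v. f (x1 @ (d, v) # x2))" by (rule mlinD[OF assms(3)])
  show "lind U sc d (\<lambda>v. f (p @ hat e t (x1 @ (d, v) # x2) # y))"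
    unfolding hat_def wdeg_append wdeg_Cons fst_conv
    by (rule lind_compose[OF mlinD[OF assms(2)] mlinD[OF assms(3)]])
qed

lemma mlin_cm:
  fixes \<phi> :: "(int \<times> 'v::ab_group_add) list \<Rightarrow> 'w::ab_group_add"
  assumes "vector_space sc" "mlin U (smul X) \<phi>" "mlin X sc f"
  shows "mlin U sc (cm s \<phi> f)"
proof (rule mlinI, rule cm_slot[OF lcl_lind[OF assms(1)]])
  fix d p and x1 x2 :: "(int \<times> 'v) list" and y
  show "lind U sc d (\<lambda>v. f (p @ hat 0 \<phi> (x1 @ (d, v) # x2) # y))"
    unfolding hat_def wdeg_append wdeg_Cons fst_conv
    by (rule lind_compose[OF mlinD[OF assms(2)] mlinD[OF assms(3)]])
qed

lemma mlin_add:
  assumes "vector_space sc" "mlin U sc f" "mlin U sc g"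
  shows "mlin U sc (\<lambda>w. f w + g w)"
  by (rule mlinI) (rule lcl_add[OF lcl_lind[OF assms(1)], OF mlinD[OF assms(2)] mlinD[OF assms(3)]])

lemma mlin_post:
  assumes "mlin U sc f" "addi L" "\<And>c x. L (sc c x) = sc' c (L x)"
  shows "mlin U sc' (\<lambda>w. L (f w))"
  by (rule mlinI) (use assms(3) addi_add[OF assms(2)] mlinD[OF assms(1)] in \<open>simp add: lind_def\<close>)

section \<open>Admissible maps\<close>

text \<open>The mode names the kind of structure: associative, commutative (vanishing on shuffles), or Lie
  (graded symmetric). It selects the coproduct and the maps that may be components.\<close>

datatype mode = Assoc | Comm | Lie

abbreviation sy :: "mode \<Rightarrow> bool" where "sy md \<equiv> md = Lie"

definition adm :: "mode \<Rightarrow> ('k::field, 'v::ab_group_add) complex_data \<Rightarrow> ('k, 'y::ab_group_add) complex_data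
   \<Rightarrow> int \<Rightarrow> ((int \<times> 'v) list \<Rightarrow> 'y) \<Rightarrow> bool" where
  "adm md U Y e f \<longleftrightarrow> mlin U (smul Y) f \<and> (\<forall>w. w \<noteq> [] \<longrightarrow> f w \<in> grade Y (wdeg w + e)) \<and>
     (md = Lie \<longrightarrow> graded_sym f) \<and> (md = Comm \<longrightarrow> shuffle_null f)"

lemma adm_mlin: "adm md U Y e f \<Longrightarrow> mlin U (smul Y) f" by (simp add: adm_def)
lemma adm_addv: "adm md U Y e f \<Longrightarrow> addv f" by (rule mlin_addv[OF adm_mlin])
lemma adm_graded_sym: "adm md U Y e f \<Longrightarrow> md = Lie \<Longrightarrow> graded_sym f" by (simp add: adm_def)
lemma adm_shuffle_null: "adm md U Y e f \<Longrightarrow> md = Comm \<Longrightarrow> shuffle_null f" by (simp add: adm_def)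
lemma adm_grade: "adm md U Y e f \<Longrightarrow> w \<noteq> [] \<Longrightarrow> f w \<in> grade Y (wdeg w + e)" by (simp add: adm_def)

lemma spl_in:
  assumes "0 \<in> S" "\<And>x y. x \<in> S \<Longrightarrow> y \<in> S \<Longrightarrow> x + y \<in> S" "\<And>e x. x \<in> S \<Longrightarrow> ksgn e x \<in> S"
    and "\<And>x y. length x + length y = length w \<Longrightarrow> wdeg x + wdeg y = wdeg w \<Longrightarrow> set x \<subseteq> set w \<Longrightarrow>
      set y \<subseteq> set w \<Longrightarrow> g x y \<in> S"
  shows "spl s g w \<in> S"
proof -
  \<comment> \<open>Outside the splittings of \<open>w\<close> the function may be replaced by zero.\<close>
  let ?g = "\<lambda>x y. if g x y \<in> S then g x y else 0"
  have "spl s g w = spl s ?g w" by (rule spl_cong) (simp add: assms(4))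
  moreover have "spl s h w \<in> S" if "\<And>x y. h x y \<in> S" for h
    using that
  proof (induct w arbitrary: h)
    case (Cons a w)
    have "spl s (\<lambda>x y. h (a # x) y) w \<in> S" by (rule Cons(1)) (rule Cons(2))
    moreover have "spl s (\<lambda>x y. ksgn (fst a * wdeg x) (h x (a # y))) w \<in> S"
      by (rule Cons(1)) (rule assms(3)[OF Cons(2)])
    ultimately show ?case using Cons(2)[of "[]" "a # w"] assms(2) by (cases s) simp_all
  qed simp
  ultimately show ?thesis using assms(1) by simp
qed

lemma ins_in:
  assumes S: "0 \<in> S" "\<And>x y. x \<in> S \<Longrightarrow> y \<in> S \<Longrightarrow> x + y \<in> S" "\<And>e x. x \<in> S \<Longrightarrow> ksgn e x \<in> S"
    and H: "set w \<subseteq> H" "\<And>x. x \<noteq> [] \<Longrightarrow> set x \<subseteq> H \<Longrightarrow> hat e t x \<in> H"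
    and f: "\<And>z. z \<noteq> [] \<Longrightarrow> set z \<subseteq> H \<Longrightarrow> wdeg z = wdeg w + e \<Longrightarrow> f z \<in> S"
  shows "ins s e t f w \<in> S"
  using H(1) f
proof (induct w arbitrary: f)
  case (Cons a w)
  have "spl s (\<lambda>x y. f (hat e t (a # x) # y)) w \<in> S"
  proof (rule spl_in[OF S])
    fix x y assume *: "wdeg x + wdeg y = wdeg w" "set x \<subseteq> set w" "set y \<subseteq> set w"
    have "hat e t (a # x) \<in> H" by (rule H(2)) (use * Cons(2) in auto)
    then show "f (hat e t (a # x) # y) \<in> S" by (intro Cons(3)) (use * Cons(2) in auto)
  qed
  moreover have "ins s e t (\<lambda>z. f (a # z)) w \<in> S"
    by (rule Cons(1), use Cons(2) in simp, rule Cons(3)) (use Cons(2) in auto)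
  ultimately show ?case using S by simp
qed (use S in simp)

lemma cm_in:
  assumes S: "0 \<in> S" "\<And>x y. x \<in> S \<Longrightarrow> y \<in> S \<Longrightarrow> x + y \<in> S" "\<And>e x. x \<in> S \<Longrightarrow> ksgn e x \<in> S"
    and H: "set w \<subseteq> H" "\<And>x. x \<noteq> [] \<Longrightarrow> set x \<subseteq> H \<Longrightarrow> hat 0 \<phi> x \<in> H'"
    and f: "\<And>z. (w \<noteq> [] \<Longrightarrow> z \<noteq> []) \<Longrightarrow> set z \<subseteq> H' \<Longrightarrow> wdeg z = wdeg w \<Longrightarrow> f z \<in> S"
  shows "cm s \<phi> f w \<in> S"
  using H(1) f
proof (induct "length w" arbitrary: w f rule: less_induct)
  case less
  show ?case
  proof (cases w)
    case Nil
    then show ?thesis using less(3)[of "[]"] by simp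
  next
    case (Cons a v)
    have "spl s (\<lambda>x y. cm s \<phi> (\<lambda>z. f (hat 0 \<phi> (a # x) # z)) y) v \<in> S"
    proof (rule spl_in[OF S])
      fix x y assume *: "length x + length y = length v" "wdeg x + wdeg y = wdeg v"
        "set x \<subseteq> set v" "set y \<subseteq> set v"
      have h: "hat 0 \<phi> (a # x) \<in> H'" by (rule H(2)) (use * less(2) Cons in auto)
      show "cm s \<phi> (\<lambda>z. f (hat 0 \<phi> (a # x) # z)) y \<in> S"
      proof (rule less(1))
        show "length y < length w" using * Cons by simp
        show "set y \<subseteq> H" using * less(2) Cons by auto
        fix z assume "set z \<subseteq> H'" "wdeg z = wdeg y"
        then show "f (hat 0 \<phi> (a # x) # z) \<in> S" by (intro less(3)) (use h * Cons in auto)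
      qed
    qed
    then show ?thesis by (simp add: Cons)
  qed
qed

lemma adm_ins:
  assumes "complex Y" "adm md U U e t" "adm md U Y e' f"
  shows "adm md U Y (e + e') (ins (sy md) e t f)"
proof -
  interpret Y: complex Y by fact
  have "ins (sy md) e t f w \<in> grade Y (wdeg w + (e + e'))" for w
    by (rule ins_in[where H = UNIV])
       (auto simp: Y.grade_add Y.grade_ksgn dest: adm_grade[OF assms(3)] simp: algebra_simps)
  moreover have "mlin U (smul Y) (ins (sy md) e t f)"
    by (rule mlin_ins[OF Y.vs.vector_space_axioms adm_mlin[OF assms(2)] adm_mlin[OF assms(3)]])
  moreover have "graded_sym (ins (sy md) e t f)" if "md = Lie"
    using graded_sym_ins[OF adm_graded_sym[OF assms(2) that] adm_addv[OF assms(3)] adm_graded_sym[OF assms(3) that]] that by simp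
  moreover have "shuffle_null (ins (sy md) e t f)" if "md = Comm"
    using shuffle_null_ins[OF adm_shuffle_null[OF assms(2) that] adm_addv[OF assms(3)] adm_shuffle_null[OF assms(3) that]] that by simp
  ultimately show ?thesis by (simp add: adm_def)
qed

lemma adm_cm:
  assumes "complex Y" "adm md U X 0 \<phi>" "adm md X Y e f"
  shows "adm md U Y e (cm (sy md) \<phi> f)"
proof -
  interpret Y: complex Y by fact
  have "cm (sy md) \<phi> f w \<in> grade Y (wdeg w + e)" if "w \<noteq> []" for w
    by (rule cm_in[where H = UNIV and H' = UNIV])
       (use that in \<open>auto simp: Y.grade_add Y.grade_ksgn dest: adm_grade[OF assms(3)]\<close>)
  moreover have "mlin U (smul Y) (cm (sy md) \<phi> f)"
    by (rule mlin_cm[OF Y.vs.vector_space_axioms adm_mlin[OF assms(2)] adm_mlin[OF assms(3)]])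
  moreover have "graded_sym (cm (sy md) \<phi> f)" if "md = Lie"
    using graded_sym_cm[OF adm_graded_sym[OF assms(2) that] adm_addv[OF assms(3)] adm_graded_sym[OF assms(3) that]] that by simp
  moreover have "shuffle_null (cm (sy md) \<phi> f)" if "md = Comm"
    using shuffle_null_cm[OF adm_shuffle_null[OF assms(2) that] adm_addv[OF assms(3)] adm_shuffle_null[OF assms(3) that]] that by simp
  ultimately show ?thesis by (simp add: adm_def)
qed

lemma adm_add:
  assumes "complex Y" "adm md U Y e f" "adm md U Y e g"
  shows "adm md U Y e (\<lambda>w. f w + g w)"
proof -
  interpret Y: complex Y by fact
  show ?thesis
    unfolding adm_def
  proof (intro conjI impI allI)
    show "mlin U (smul Y) (\<lambda>w. f w + g w)"
      by (rule mlin_add[OF Y.vs.vector_space_axioms]) (use assms in \<open>auto simp: adm_def\<close>)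
    show "f w + g w \<in> grade Y (wdeg w + e)" if "w \<noteq> []" for w
      using that assms by (simp add: adm_def Y.grade_add)
    assume "md = Lie"
    then have s: "graded_sym f" "graded_sym g" using assms by (auto simp: adm_def)
    show "graded_sym (\<lambda>w. f w + g w)"
      by (rule graded_symI, subst graded_symD[OF s(1)], subst graded_symD[OF s(2)]) (simp add: ksgn_plus)
  next
    assume "md = Comm"
    then show "shuffle_null (\<lambda>w. f w + g w)" using assms by (simp add: adm_def shuffle_null_def sh_add)
  qed
qed

lemma adm_post:
  assumes "adm md U Y e f" "addi L" "\<And>c x. L (smul Y c x) = smul Z c (L x)"
    "\<And>d x. x \<in> grade Y d \<Longrightarrow> L x \<in> grade Z (d + k)" "e' = e + k"
  shows "adm md U Z e' (\<lambda>w. L (f w))"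
  unfolding adm_def
proof (intro conjI impI allI)
  show "mlin U (smul Z) (\<lambda>w. L (f w))" by (rule mlin_post[where L = L and sc = "smul Y", OF adm_mlin[OF assms(1)] assms(2,3)])
  show "L (f w) \<in> grade Z (wdeg w + e')" if "w \<noteq> []" for w
    unfolding assms(5) add.assoc[symmetric] by (rule assms(4)[OF adm_grade[OF assms(1) that]])
  assume "md = Lie"
  then have s: "graded_sym f" by (rule adm_graded_sym[OF assms(1)])
  show "graded_sym (\<lambda>w. L (f w))"
    by (rule graded_symI, subst graded_symD[OF s]) (rule addi_ksgn[OF assms(2)])
next
  assume "md = Comm"
  then have "shuffle_null f" by (rule adm_shuffle_null[OF assms(1)])
  then show "shuffle_null (\<lambda>w. L (f w))"
    unfolding shuffle_null_def sh_post[OF assms(2), symmetric] by (simp add: addi_0[OF assms(2)])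
qed

lemma adm_scale:
  assumes "complex Y" "adm md U Y e f"
  shows "adm md U Y e (\<lambda>w. smul Y c (f w))"
proof -
  interpret Y: complex Y by fact
  show ?thesis
    by (rule adm_post[OF assms(2), where k = 0 and L = "smul Y c"])
       (simp_all add: addi_def Y.vs.scale_right_distrib Y.grade_scale mult.commute)
qed

lemma adm_minus:
  assumes "complex Y" "adm md U Y e f"
  shows "adm md U Y e (\<lambda>w. - f w)"
proof -
  interpret Y: complex Y by fact
  show ?thesis
    by (rule adm_post[OF assms(2), where k = 0 and L = uminus])
       (simp_all add: addi_def Y.grade_neg)
qed

lemma adm_ksgn:
  assumes "complex Y" "adm md U Y e f"
  shows "adm md U Y e (\<lambda>w. ksgn c (f w))"
  using adm_minus[OF assms] assms(2) by (cases "even c") (simp_all add: ksgn_def)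

lemma adm_diff:
  assumes "complex Y" "adm md U Y e f" "adm md U Y e g"
  shows "adm md U Y e (\<lambda>w. f w - g w)"
  using adm_add[OF assms(1,2) adm_minus[OF assms(1,3)]] by simp

text \<open>All conditions relate words of the same length only.\<close>

lemma adm_restrict:
  assumes "complex Y" "adm md U Y e f"
  shows "adm md U Y e (\<lambda>w. if P (length w) then f w else 0)"
proof -
  interpret Y: complex Y by fact
  show ?thesis
    unfolding adm_def
  proof (intro conjI impI allI)
    show "mlin U (smul Y) (\<lambda>w. if P (length w) then f w else 0)"
    proof (rule mlinI)
      fix u d w
      show "lind U (smul Y) d (\<lambda>x. if P (length (u @ (d, x) # w)) then f (u @ (d, x) # w) else 0)"
        using mlinD[OF adm_mlin[OF assms(2)], of d u w] lcl_0[OF lcl_lind[OF Y.vs.vector_space_axioms, of U d]]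
        by (cases "P (Suc (length u + length w))") simp_all
    qed
    show "(if P (length w) then f w else 0) \<in> grade Y (wdeg w + e)" if "w \<noteq> []" for w
      using adm_grade[OF assms(2) that] by simp
    assume "md = Lie"
    then have s: "graded_sym f" by (rule adm_graded_sym[OF assms(2)])
    show "graded_sym (\<lambda>w. if P (length w) then f w else 0)"
      by (rule graded_symI, subst graded_symD[OF s]) simp
  next
    assume "md = Comm"
    then have s: "shuffle_null f" by (rule adm_shuffle_null[OF assms(2)])
    have "sh u v (\<lambda>w. if P (length w) then f w else 0) = (if P (length u + length v) then sh u v f else 0)" for u v
    proof -
      have "sh u v (\<lambda>w. if P (length w) then f w else 0) =
        sh u v (\<lambda>w. if P (length u + length v) then f w else 0)"
        by (rule sh_cong) simp
      then show ?thesis by (simp add: sh_0)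
    qed
    then show "shuffle_null (\<lambda>w. if P (length w) then f w else 0)" using s by (simp add: shuffle_null_def)
  qed
qed


section \<open>Letter maps\<close>

text \<open>Chain maps, homotopies and differentials become corestrictions concentrated in arity one. The
  coderivation and the coalgebra map with such a corestriction act letter by letter.\<close>

definition let1 :: "(int \<Rightarrow> 'v \<Rightarrow> 'w::zero) \<Rightarrow> (int \<times> 'v) list \<Rightarrow> 'w" where
  "let1 h w = (case w of [a] \<Rightarrow> h (fst a) (snd a) | _ \<Rightarrow> 0)"

lemma let1_simps [simp]:
  "let1 h [] = 0" "let1 h [a] = h (fst a) (snd a)" "let1 h (a # b # w) = 0"
  by (simp_all add: let1_def)

lemma let1_long: "length w \<noteq> 1 \<Longrightarrow> let1 h w = 0"
  by (cases w rule: remdups_adj.cases) simp_all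

definition letl :: "('k::field, 'v::ab_group_add) complex_data \<Rightarrow> ('k, 'w::ab_group_add) complex_data
   \<Rightarrow> int \<Rightarrow> (int \<Rightarrow> 'v \<Rightarrow> 'w) \<Rightarrow> bool" where
  "letl U X e h \<longleftrightarrow> (\<forall>d. lind U (smul X) d (h d) \<and> (\<forall>x. h d x \<in> grade X (d + e)))"

lemma adm_let1:
  assumes "complex X" "letl U X e h"
  shows "adm md U X e (let1 h)"
proof -
  interpret X: complex X by fact
  show ?thesis
    unfolding adm_def
  proof (intro conjI impI allI)
    show "mlin U (smul X) (let1 h)"
    proof (rule mlinI)
      fix u d w
      show "lind U (smul X) d (\<lambda>x. let1 h (u @ (d, x) # w))"
      proof (cases "u = [] \<and> w = []")
        case True
        then show ?thesis using assms(2) by (simp add: letl_def)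
      next
        case False
        then have "let1 h (u @ (d, x) # w) = 0" for x by (intro let1_long) auto
        then show ?thesis using lcl_0[OF lcl_lind[OF X.vs.vector_space_axioms]] by simp
      qed
    qed
    show "let1 h w \<in> grade X (wdeg w + e)" if "w \<noteq> []" for w
      using assms(2) by (cases w rule: remdups_adj.cases) (simp_all add: letl_def)
    show "graded_sym (let1 h)" by (rule graded_symI) (simp add: let1_long)
    have "sh u v (let1 h) = 0" if "u \<noteq> []" "v \<noteq> []" for u v
    proof -
      have "sh u v (let1 h) = sh u v (\<lambda>_. 0)"
        by (rule sh_cong, rule let1_long) (use that in \<open>cases u; cases v; simp\<close>)
      then show ?thesis by (simp add: sh_0)
    qed
    then show "shuffle_null (let1 h)" by (simp add: shuffle_null_def)
  qed
qed

text \<open>Composition of \<open>f\<close> with \<open>\<Sum> 1 \<otimes> \<dots> \<otimes> h \<otimes> \<dots> \<otimes> 1\<close>, for letter maps \<open>h\<close> of degree \<open>e\<close>.\<close>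

primrec der :: "int \<Rightarrow> (int \<Rightarrow> 'v \<Rightarrow> 'v) \<Rightarrow> ((int \<times> 'v) list \<Rightarrow> 'y::ab_group_add) \<Rightarrow> (int \<times> 'v) list \<Rightarrow> 'y"
  where
  "der e h f [] = 0"
| "der e h f (a # w) = f ((fst a + e, h (fst a) (snd a)) # w) + ksgn (e * fst a) (der e h (\<lambda>z. f (a # z)) w)"

definition lmap :: "(int \<Rightarrow> 'v \<Rightarrow> 'w) \<Rightarrow> (int \<times> 'v) list \<Rightarrow> (int \<times> 'w) list" where
  "lmap g w = map (\<lambda>a. (fst a, g (fst a) (snd a))) w"

lemma lmap_simps [simp]: "lmap g [] = []" "lmap g (a # w) = (fst a, g (fst a) (snd a)) # lmap g w"
  "length (lmap g w) = length w" "wdeg (lmap g w) = wdeg w"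
  by (simp_all add: lmap_def wdeg_def o_def)

lemma ins_let1:
  assumes "addv f"
  shows "ins s e (let1 h) f w = der e h f w"
  using assms
proof (induct w arbitrary: f)
  case (Cons a w)
  have "spl s (\<lambda>x y. f (hat e (let1 h) (a # x) # y)) w =
    spl s (\<lambda>x y. if x = [] then f ((fst a + e, h (fst a) (snd a)) # y) else 0) w"
  proof (rule spl_cong)
    fix x y :: "(int \<times> 'a) list"
    show "f (hat e (let1 h) (a # x) # y) = (if x = [] then f ((fst a + e, h (fst a) (snd a)) # y) else 0)"
      using addv_zero[OF Cons(2), of "[]"] by (cases x) (simp_all add: hat_def)
  qed
  then show ?case by (simp add: spl_left_nil Cons addv_Cons)
qed simp

lemma cm_let1:
  assumes "addv f"
  shows "cm s (let1 g) f w = f (lmap g w)"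
  using assms
proof (induct w arbitrary: f)
  case (Cons a w)
  have "spl s (\<lambda>x y. cm s (let1 g) (\<lambda>z. f (hat 0 (let1 g) (a # x) # z)) y) w =
    spl s (\<lambda>x y. if x = [] then cm s (let1 g) (\<lambda>z. f ((fst a, g (fst a) (snd a)) # z)) y else 0) w"
  proof (rule spl_cong)
    fix x y :: "(int \<times> 'c) list"
    show "cm s (let1 g) (\<lambda>z. f (hat 0 (let1 g) (a # x) # z)) y =
      (if x = [] then cm s (let1 g) (\<lambda>z. f ((fst a, g (fst a) (snd a)) # z)) y else 0)"
      using addv_zero[OF Cons(2), of "[]"] by (cases x) (simp_all add: hat_def cm_0)
  qed
  then show ?case by (simp add: spl_left_nil Cons addv_Cons)
qed simp

text \<open>The maps \<open>der\<close> and \<open>lmap\<close> are a coderivation and a coalgebra map with corestriction concentrated on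
  letters; hence they preserve all symmetry types.\<close>

lemma adm_der:
  assumes "complex U" "complex Y" "letl U U e h" "adm md U Y e' f"
  shows "adm md U Y (e + e') (der e h f)"
  using adm_ins[OF assms(2) adm_let1[OF assms(1,3)] assms(4)]
  by (simp add: ins_let1[OF adm_addv[OF assms(4)], abs_def])

lemma adm_lmap:
  assumes "complex X" "complex Y" "letl U X 0 g" "adm md X Y e f"
  shows "adm md U Y e (\<lambda>w. f (lmap g w))"
  using adm_cm[OF assms(2) adm_let1[OF assms(1,3)] assms(4)]
  by (simp add: cm_let1[OF adm_addv[OF assms(4)], abs_def])

lemma der_cong_length:
  "(\<And>z. length z = length w \<Longrightarrow> f z = f' z) \<Longrightarrow> der e h f w = der e h f' w"
proof (induct w arbitrary: f f')
  case (Cons a w)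
  have "der e h (\<lambda>z. f (a # z)) w = der e h (\<lambda>z. f' (a # z)) w" by (rule Cons(1)) (simp add: Cons(2))
  then show ?case using Cons(2) by simp
qed simp

lemma der_cong_letter:
  "(\<And>d x. h d x = h' d x) \<Longrightarrow> der e h f w = der e h' f w"
  by (induct w arbitrary: f) simp_all

lemma der_post: "addi L \<Longrightarrow> L (der e h f w) = der e h (\<lambda>z. L (f z)) w"
  by (induct w arbitrary: f) (simp_all add: addi_0[of L] addi_add[of L] addi_ksgn[of L])

lemma der_add: "der e h (\<lambda>z. f z + g z) w = der e h f w + der e h g w"
  by (induct w arbitrary: f g) (simp_all add: ksgn_plus)

lemma der_ksgn: "der e h (\<lambda>z. ksgn c (f z)) w = ksgn c (der e h f w)"
  by (simp add: der_post[OF addi_ksgn_fun])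

lemma der_minus: "der e h (\<lambda>z. - f z) w = - der e h f w"
  by (simp add: der_post[OF addi_uminus])

lemma der_diff: "der e h (\<lambda>z. f z - g z) w = der e h f w - der e h g w"
  using der_add[of e h f "\<lambda>z. - g z" w] by (simp add: der_minus)

lemma der_zero:
  assumes "addv f" "\<And>d x. h d x = 0"
  shows "der e h f w = 0"
  using assms(1)
proof (induct w arbitrary: f)
  case (Cons a w)
  then show ?case using addv_zero[of f "[]"] by (simp add: assms(2) addv_Cons)
qed simp

lemma der_lmap:
  assumes "\<And>d x. g (d + e) (h d x) = k d (g d x)"
  shows "der e h (\<lambda>z. f (lmap g z)) w = der e k f (lmap g w)"
proof (induct w arbitrary: f)
  case (Cons a w)
  show ?case using Cons[of "\<lambda>z. f ((fst a, g (fst a) (snd a)) # z)"] by (simp add: assms)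
qed simp

text \<open>Applications of \<open>h\<close> and \<open>k\<close> to different letters cancel in the graded commutator.\<close>

lemma der_commutator:
  assumes "addv f"
  shows "der e h (der e' k f) w - ksgn (e * e') (der e' k (der e h f) w) =
    der (e + e') (\<lambda>d x. k (d + e) (h d x) - ksgn (e * e') (h (d + e') (k d x))) f w"
  using assms
proof (induct w arbitrary: f)
  case (Cons a w)
  obtain d x where a: "a = (d, x)" by force
  let ?m = "k (d + e) (h d x) - ksgn (e * e') (h (d + e') (k d x))"
  have L: "addi (\<lambda>v. f ((d + (e + e'), v) # w))" using addv_addi0[OF Cons(2)] .
  have 1: "f ((d + (e + e'), ?m) # w) = f ((d + (e + e'), k (d + e) (h d x)) # w)
    - ksgn (e * e') (f ((d + (e + e'), h (d + e') (k d x)) # w))"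
    using addi_add[OF L, of "k (d + e) (h d x)" "- ksgn (e * e') (h (d + e') (k d x))"]
    by (simp add: addi_minus[OF L] addi_ksgn[OF L])
  have 2: "der e h (der e' k (\<lambda>z. f (a # z))) w - ksgn (e * e') (der e' k (der e h (\<lambda>z. f (a # z))) w)
    = der (e + e') (\<lambda>d x. k (d + e) (h d x) - ksgn (e * e') (h (d + e') (k d x))) (\<lambda>z. f (a # z)) w"
    by (rule Cons(1)) (rule addv_Cons[OF Cons(2)])
  have 3: "der e h (der e' k f) (a # w) =
      f ((d + (e + e'), k (d + e) (h d x)) # w) + ksgn (e' * (d + e)) (der e' k (\<lambda>z. f ((d + e, h d x) # z)) w)
      + ksgn (e * d) (der e h (\<lambda>z. f ((d + e', k d x) # z)) w)
      + ksgn ((e + e') * d) (der e h (der e' k (\<lambda>z. f (a # z))) w)" for e e' h k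
    by (simp add: a der_add der_ksgn ksgn_plus ksgn_ksgn algebra_simps)
  have 4: "der e' k (der e h f) (a # w) =
      f ((d + (e + e'), h (d + e') (k d x)) # w) + ksgn (e * (d + e')) (der e h (\<lambda>z. f ((d + e', k d x) # z)) w)
      + ksgn (e' * d) (der e' k (\<lambda>z. f ((d + e, h d x) # z)) w)
      + ksgn ((e + e') * d) (der e' k (der e h (\<lambda>z. f (a # z))) w)"
    using 3[of e' k e h] by (simp add: add.commute[of e' e])
  have 5: "ksgn (e * e') (ksgn (e * (d + e')) Z) = ksgn (e * d) Z" for Z :: 'b
    unfolding ksgn_ksgn by (rule ksgn_cong) auto
  have 6: "ksgn (e * e') (ksgn (e' * d) Z) = ksgn (e' * (d + e)) Z" for Z :: 'b
    unfolding ksgn_ksgn by (rule ksgn_cong) auto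
  have 7: "ksgn (e * e') (ksgn ((e + e') * d) Z) = ksgn ((e + e') * d) (ksgn (e * e') Z)" for Z :: 'b
    unfolding ksgn_ksgn by (rule ksgn_cong) auto
  have "der e h (der e' k f) (a # w) - ksgn (e * e') (der e' k (der e h f) (a # w)) =
    f ((d + (e + e'), ?m) # w) + ksgn ((e + e') * d)
     (der e h (der e' k (\<lambda>z. f (a # z))) w - ksgn (e * e') (der e' k (der e h (\<lambda>z. f (a # z))) w))"
    unfolding 3[where e = e and h = h and e' = e' and k = k] 4 1 ksgn_plus 5 6 7 ksgn_diff by simp
  then show ?case unfolding 2 by (simp add: a)
qed simp

section \<open>Leading terms\<close>

text \<open>In the equations of arity \<open>n\<close>, the components of arity \<open>n\<close> meet only the components of arity one.
  The lemmas of this section isolate these terms: if one of the two maps involved vanishes on all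
  shorter words, a single kind of term is left.\<close>

lemma ins_lead:
  assumes "\<And>z. z \<noteq> [] \<Longrightarrow> length z < length w \<Longrightarrow> g z = 0"
  shows "ins s e t g w = der e (\<lambda>d x. t [(d, x)]) g w"
  using assms
proof (induct w arbitrary: g)
  case (Cons a w)
  have "spl s (\<lambda>x y. g (hat e t (a # x) # y)) w =
    spl s (\<lambda>x y. if x = [] then g ((fst a + e, t [a]) # y) else 0) w"
    by (rule spl_cong) (auto simp: hat_def neq_Nil_conv intro!: Cons(2))
  then have "spl s (\<lambda>x y. g (hat e t (a # x) # y)) w = g ((fst a + e, t [a]) # w)"
    by (simp add: spl_left_nil)
  moreover have "ins s e t (\<lambda>z. g (a # z)) w = der e (\<lambda>d x. t [(d, x)]) (\<lambda>z. g (a # z)) w"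
    by (rule Cons(1)) (rule Cons(2), auto)
  ultimately show ?case by simp
qed simp

lemma ins_t0:
  assumes "addv f"
  shows "ins s e (\<lambda>_. 0) f w = 0"
  using assms
proof (induct w arbitrary: f)
  case (Cons a w)
  then show ?case using addv_zero[OF Cons(2), of "[]"] by (simp add: hat_def spl_0 addv_Cons)
qed simp

lemma ins_t0':
  assumes "addv f" "\<And>x. x \<noteq> [] \<Longrightarrow> length x \<le> length w \<Longrightarrow> t x = 0"
  shows "ins s e t f w = 0"
  using ins_cong[of w UNIV e t f f "\<lambda>_. 0" s] assms(2) ins_t0[OF assms(1)] by simp

lemma ins_tadd:
  assumes "addv f"
  shows "ins s e (\<lambda>x. t x + r x) f w = ins s e t f w + ins s e r f w"
  using assms
proof (induct w arbitrary: f)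
  case (Cons a w)
  then show ?case
    by (simp add: hat_def addi_add[OF addv_addi0[OF Cons(2)]] spl_add addv_Cons ksgn_plus)
qed simp

lemma ins_top:
  assumes "addv f" "w \<noteq> []" "\<And>x. x \<noteq> [] \<Longrightarrow> length x < length w \<Longrightarrow> t x = 0"
  shows "ins s e t f w = f [hat e t w]"
proof -
  obtain a v where w: "w = a # v" using assms(2) by (cases w) auto
  have "spl s (\<lambda>x y. f (hat e t (a # x) # y)) v = spl s (\<lambda>x y. if y = [] then f [hat e t (a # x)] else 0) v"
  proof (rule spl_cong)
    fix x y :: "(int \<times> 'a) list" assume "length x + length y = length v"
    then show "f (hat e t (a # x) # y) = (if y = [] then f [hat e t (a # x)] else 0)"
      using assms(3)[of "a # x"] addv_zero[OF assms(1), of "[]"] w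
      by (cases y) (auto simp: hat_def)
  qed
  moreover have "ins s e t (\<lambda>z. f (a # z)) v = 0"
    by (rule ins_t0'[OF addv_Cons[OF assms(1)]]) (simp add: assms(3) w)
  ultimately show ?thesis by (simp add: w spl_right_nil)
qed

lemma cm_lead:
  assumes "\<And>z. z \<noteq> [] \<Longrightarrow> length z < length w \<Longrightarrow> g z = 0"
  shows "cm s \<phi> g w = g (lmap (\<lambda>d x. \<phi> [(d, x)]) w)"
  using assms
proof (induct w arbitrary: g)
  case (Cons a w)
  have "spl s (\<lambda>x y. cm s \<phi> (\<lambda>z. g (hat 0 \<phi> (a # x) # z)) y) w =
    spl s (\<lambda>x y. if x = [] then cm s \<phi> (\<lambda>z. g ((fst a, \<phi> [a]) # z)) y else 0) w"
  proof (rule spl_cong)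
    fix x y :: "(int \<times> 'b) list" assume l: "length x + length y = length w"
    show "cm s \<phi> (\<lambda>z. g (hat 0 \<phi> (a # x) # z)) y =
      (if x = [] then cm s \<phi> (\<lambda>z. g ((fst a, \<phi> [a]) # z)) y else 0)"
    proof (cases "x = []")
      case False
      then have "length y < length w" using l by (cases x) auto
      then have "cm s \<phi> (\<lambda>z. g (hat 0 \<phi> (a # x) # z)) y = cm s \<phi> (\<lambda>z. 0) y"
        by (intro cm_cong[where H = UNIV and H' = UNIV] Cons(2)) auto
      then show ?thesis using False by (simp add: cm_0)
    qed (simp add: hat_def)
  qed
  moreover have "cm s \<phi> (\<lambda>z. g ((fst a, \<phi> [a]) # z)) w = g ((fst a, \<phi> [a]) # lmap (\<lambda>d x. \<phi> [(d, x)]) w)"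
    by (rule Cons(1)) (rule Cons(2), auto)
  ultimately show ?case by (simp add: spl_left_nil)
qed simp

lemma cm_perturb:
  assumes "addv f" "w \<noteq> []" "\<And>x. x \<noteq> [] \<Longrightarrow> length x < length w \<Longrightarrow> \<psi> x = 0"
  shows "cm s (\<lambda>x. \<phi> x + \<psi> x) f w = cm s \<phi> f w + f [hat 0 \<psi> w]"
proof -
  obtain a v where w: "w = a # v" using assms(2) by (cases w) auto
  have "spl s (\<lambda>x y. cm s (\<lambda>x. \<phi> x + \<psi> x) (\<lambda>z. f (hat 0 (\<lambda>x. \<phi> x + \<psi> x) (a # x) # z)) y) v
    = spl s (\<lambda>x y. cm s \<phi> (\<lambda>z. f (hat 0 \<phi> (a # x) # z)) y + (if y = [] then f [hat 0 \<psi> (a # x)] else 0)) v"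
  proof (rule spl_cong)
    fix x y :: "(int \<times> 'c) list" assume l: "length x + length y = length v"
    show "cm s (\<lambda>x. \<phi> x + \<psi> x) (\<lambda>z. f (hat 0 (\<lambda>x. \<phi> x + \<psi> x) (a # x) # z)) y
     = cm s \<phi> (\<lambda>z. f (hat 0 \<phi> (a # x) # z)) y + (if y = [] then f [hat 0 \<psi> (a # x)] else 0)"
    proof (cases "y = []")
      case True
      then show ?thesis
        using addi_add[OF addv_addi0[OF assms(1)]] by (simp add: hat_def)
    next
      case False
      then have "\<psi> (a # x) = 0" by (intro assms(3)) (use l w in \<open>(cases y; auto)+\<close>)
      then have "hat 0 (\<lambda>x. \<phi> x + \<psi> x) (a # x) = hat 0 \<phi> (a # x)" by (simp add: hat_def)
      moreover have "cm s (\<lambda>x. \<phi> x + \<psi> x) F y = cm s \<phi> F y" for F :: "(int \<times> 'a) list \<Rightarrow> 'b"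
        by (rule cm_cong[where H = UNIV and H' = UNIV]) (use l w assms(3) in auto)
      ultimately show ?thesis using False by simp
    qed
  qed
  then show ?thesis by (simp add: w spl_add spl_right_nil)
qed

lemma cmd_r0:
  assumes "addv f" "\<And>x. x \<noteq> [] \<Longrightarrow> length x \<le> length w \<Longrightarrow> r x = 0"
  shows "cmd s e \<phi> r f w = 0"
  using assms
proof (induct "length w" arbitrary: w f rule: less_induct)
  case less
  show ?case
  proof (cases w)
    case (Cons a v)
    have "spl s (\<lambda>x y. cm s \<phi> (\<lambda>z. f (hat e r (a # x) # z)) y +
       ksgn (e * wdeg (a # x)) (cmd s e \<phi> r (\<lambda>z. f (hat 0 \<phi> (a # x) # z)) y)) v = spl s (\<lambda>x y. 0) v"
    proof (rule spl_cong)
      fix x y :: "(int \<times> 'c) list" assume l: "length x + length y = length v"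
      have "r (a # x) = 0" by (rule less(3)) (use l Cons in auto)
      then have "cm s \<phi> (\<lambda>z. f (hat e r (a # x) # z)) y = 0"
        using addv_zero[OF less(2), of "[]"] by (simp add: hat_def cm_0)
      moreover have "cmd s e \<phi> r (\<lambda>z. f (hat 0 \<phi> (a # x) # z)) y = 0"
        by (rule less(1)) (use l Cons less(2,3) in \<open>auto simp: addv_Cons\<close>)
      ultimately show "cm s \<phi> (\<lambda>z. f (hat e r (a # x) # z)) y +
       ksgn (e * wdeg (a # x)) (cmd s e \<phi> r (\<lambda>z. f (hat 0 \<phi> (a # x) # z)) y) = 0" by simp
    qed
    then show ?thesis by (simp add: Cons spl_0)
  qed simp
qed

lemma cmd_top:
  assumes "addv f" "w \<noteq> []" "\<And>x. x \<noteq> [] \<Longrightarrow> length x < length w \<Longrightarrow> r x = 0"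
  shows "cmd s e \<phi> r f w = f [hat e r w]"
proof -
  obtain a v where w: "w = a # v" using assms(2) by (cases w) auto
  have "spl s (\<lambda>x y. cm s \<phi> (\<lambda>z. f (hat e r (a # x) # z)) y +
       ksgn (e * wdeg (a # x)) (cmd s e \<phi> r (\<lambda>z. f (hat 0 \<phi> (a # x) # z)) y)) v
    = spl s (\<lambda>x y. if y = [] then f [hat e r (a # x)] else 0) v"
  proof (rule spl_cong)
    fix x y :: "(int \<times> 'c) list" assume l: "length x + length y = length v"
    have 1: "cmd s e \<phi> r (\<lambda>z. f (hat 0 \<phi> (a # x) # z)) y = 0"
      by (rule cmd_r0[OF addv_Cons[OF assms(1)]], rule assms(3)) (use l w in auto)
    have 2: "cm s \<phi> (\<lambda>z. f (hat e r (a # x) # z)) y = (if y = [] then f [hat e r (a # x)] else 0)"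
    proof (cases "y = []")
      case False
      then have "r (a # x) = 0" by (intro assms(3)) (use l w in \<open>(cases y; auto)+\<close>)
      then show ?thesis using False addv_zero[OF assms(1), of "[]"] by (simp add: hat_def cm_0)
    qed simp
    show "cm s \<phi> (\<lambda>z. f (hat e r (a # x) # z)) y +
       ksgn (e * wdeg (a # x)) (cmd s e \<phi> r (\<lambda>z. f (hat 0 \<phi> (a # x) # z)) y) =
       (if y = [] then f [hat e r (a # x)] else 0)" unfolding 1 2 by simp
  qed
  then show ?thesis by (simp add: w spl_right_nil)
qed

lemma cmd_rdiff:
  assumes "addv f"
  shows "cmd s e \<phi> (\<lambda>x. r x - r' x) f w = cmd s e \<phi> r f w - cmd s e \<phi> r' f w"
  using assms
proof (induct "length w" arbitrary: w f rule: less_induct)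
  case less
  show ?case
  proof (cases w)
    case (Cons a v)
    have d: "f ((d, x - y) # z) = f ((d, x) # z) - f ((d, y) # z)" for d x y z
      using addi_add[OF addv_addi0[OF less(2)], of d x "- y" z] addi_minus[OF addv_addi0[OF less(2)], of d y z]
      by simp
    have "spl s (\<lambda>x y. cm s \<phi> (\<lambda>z. f (hat e (\<lambda>x. r x - r' x) (a # x) # z)) y +
       ksgn (e * wdeg (a # x)) (cmd s e \<phi> (\<lambda>x. r x - r' x) (\<lambda>z. f (hat 0 \<phi> (a # x) # z)) y)) v
     = spl s (\<lambda>x y. (cm s \<phi> (\<lambda>z. f (hat e r (a # x) # z)) y +
       ksgn (e * wdeg (a # x)) (cmd s e \<phi> r (\<lambda>z. f (hat 0 \<phi> (a # x) # z)) y))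
       - (cm s \<phi> (\<lambda>z. f (hat e r' (a # x) # z)) y +
       ksgn (e * wdeg (a # x)) (cmd s e \<phi> r' (\<lambda>z. f (hat 0 \<phi> (a # x) # z)) y))) v"
    proof (rule spl_cong)
      fix x y :: "(int \<times> 'c) list" assume l: "length x + length y = length v"
      have 1: "cmd s e \<phi> (\<lambda>x. r x - r' x) (\<lambda>z. f (hat 0 \<phi> (a # x) # z)) y
        = cmd s e \<phi> r (\<lambda>z. f (hat 0 \<phi> (a # x) # z)) y - cmd s e \<phi> r' (\<lambda>z. f (hat 0 \<phi> (a # x) # z)) y"
        by (rule less(1)) (use l Cons less(2) in \<open>auto simp: addv_Cons\<close>)
      show "cm s \<phi> (\<lambda>z. f (hat e (\<lambda>x. r x - r' x) (a # x) # z)) y +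
         ksgn (e * wdeg (a # x)) (cmd s e \<phi> (\<lambda>x. r x - r' x) (\<lambda>z. f (hat 0 \<phi> (a # x) # z)) y)
       = (cm s \<phi> (\<lambda>z. f (hat e r (a # x) # z)) y +
         ksgn (e * wdeg (a # x)) (cmd s e \<phi> r (\<lambda>z. f (hat 0 \<phi> (a # x) # z)) y))
       - (cm s \<phi> (\<lambda>z. f (hat e r' (a # x) # z)) y +
         ksgn (e * wdeg (a # x)) (cmd s e \<phi> r' (\<lambda>z. f (hat 0 \<phi> (a # x) # z)) y))"
        unfolding 1 by (simp add: hat_def d cm_diff ksgn_diff)
    qed
    then show ?thesis by (simp add: Cons spl_diff)
  qed simp
qed

section \<open>The differential of a multilinear map\<close>

definition dU :: "('k::field, 'v::ab_group_add) complex_data \<Rightarrow> int \<Rightarrow> 'v \<Rightarrow> 'v" where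
  "dU U d x = bd U (component U d x)"

text \<open>The differential of \<open>f\<close> as an element of degree \<open>e\<close> of the complex of multilinear maps.\<close>

definition dl :: "('k::field, 'v::ab_group_add) complex_data \<Rightarrow> ('k, 'y::ab_group_add) complex_data \<Rightarrow>
   int \<Rightarrow> ((int \<times> 'v) list \<Rightarrow> 'y) \<Rightarrow> (int \<times> 'v) list \<Rightarrow> 'y" where
  "dl U Y e f w = bd Y (f w) - ksgn e (der (- 1) (dU U) f w)"

definition chainl :: "('k::field, 'v::ab_group_add) complex_data \<Rightarrow> ('k, 'w::ab_group_add) complex_data
   \<Rightarrow> (int \<Rightarrow> 'v \<Rightarrow> 'w) \<Rightarrow> bool" where
  "chainl U X g \<longleftrightarrow> letl U X 0 g \<and> (\<forall>d x. g (d - 1) (dU U d x) = dU X d (g d x))"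

text \<open>The primitive has to be of the same symmetry type. The arity \<open>n\<close> is fixed, as cycles and boundaries
  are considered in one arity at a time.\<close>

definition exact :: "mode \<Rightarrow> ('k::field, 'v::ab_group_add) complex_data \<Rightarrow> ('k, 'y::ab_group_add) complex_data \<Rightarrow>
   int \<Rightarrow> nat \<Rightarrow> ((int \<times> 'v) list \<Rightarrow> 'y) \<Rightarrow> bool" where
  "exact md U Y e n f \<longleftrightarrow> (\<exists>b. adm md U Y (e + 1) b \<and> (\<forall>w. length w = n \<longrightarrow> dl U Y (e + 1) b w = f w))"

lemma letlD:
  assumes "letl U X e h"
  shows "h d (x + y) = h d x + h d y" "h d (smul U c x) = smul X c (h d x)" "h d (component U d x) = h d x"
    "h d x \<in> grade X (d + e)" "addi (h d)"
  using assms by (simp_all add: letl_def lind_def addi_def)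

lemma letl_0: "letl U X e h \<Longrightarrow> h d 0 = 0" by (rule addi_0[OF letlD(5)])

lemma letl_diff: "letl U X e h \<Longrightarrow> h d (x - y) = h d x - h d y"
  using letlD(1)[of U X e h d x "- y"] addi_minus[OF letlD(5), of U X e h d y] by simp

lemma letl_dU: "complex U \<Longrightarrow> letl U U (- 1) (dU U)"
proof -
  assume "complex U"
  then interpret complex U .
  show ?thesis
    using bd_grade[OF component_grade]
    by (simp add: letl_def lind_def dU_def component_add bd_add component_scale bd_scale)
qed

lemma exact_diff:
  assumes "complex Y" "exact md U Y e n f" "exact md U Y e n g"
  shows "exact md U Y e n (\<lambda>w. f w - g w)"
proof -
  interpret Y: complex Y by fact
  obtain b b' where b: "adm md U Y (e + 1) b" "\<And>w. length w = n \<Longrightarrow> dl U Y (e + 1) b w = f w"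
    and b': "adm md U Y (e + 1) b'" "\<And>w. length w = n \<Longrightarrow> dl U Y (e + 1) b' w = g w"
    using assms(2,3) by (auto simp: exact_def)
  have "dl U Y (e + 1) (\<lambda>w. b w - b' w) w = dl U Y (e + 1) b w - dl U Y (e + 1) b' w" for w
    by (simp add: dl_def Y.bd_diff der_diff ksgn_diff)
  then show ?thesis
    unfolding exact_def
    using adm_diff[OF assms(1) b(1) b'(1)] b(2) b'(2) by (intro exI[of _ "\<lambda>w. b w - b' w"]) simp
qed

lemma exact_scale:
  assumes "complex Y" "exact md U Y e n f"
  shows "exact md U Y e n (\<lambda>w. smul Y c (f w))"
proof -
  interpret Y: complex Y by fact
  obtain b where b: "adm md U Y (e + 1) b" "\<And>w. length w = n \<Longrightarrow> dl U Y (e + 1) b w = f w"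
    using assms(2) by (auto simp: exact_def)
  have a: "addi (smul Y c)" by (simp add: addi_def Y.vs.scale_right_distrib)
  have "dl U Y (e + 1) (\<lambda>w. smul Y c (b w)) w = smul Y c (dl U Y (e + 1) b w)" for w
    by (simp add: dl_def Y.bd_scale der_post[OF a, symmetric] addi_ksgn[OF a, symmetric]
        Y.vs.scale_right_diff_distrib)
  then show ?thesis
    unfolding exact_def
    using adm_scale[OF assms(1) b(1)] b(2) by (intro exI[of _ "\<lambda>w. smul Y c (b w)"]) simp
qed

lemma exact_cong: "exact md U Y e n f \<Longrightarrow> (\<And>w. length w = n \<Longrightarrow> f w = g w) \<Longrightarrow> exact md U Y e n g"
  unfolding exact_def by auto

lemma exact_0: "complex Y \<Longrightarrow> adm md U Y (e + 1) f \<Longrightarrow> exact md U Y e n (\<lambda>_. 0)"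
  using exact_diff[of Y md U e n "dl U Y (e + 1) f" "dl U Y (e + 1) f"] by (auto simp: exact_def)

lemma dl_lmap:
  assumes "chainl U X g"
  shows "dl U Y e (\<lambda>w. f (lmap g w)) w = dl X Y e f (lmap g w)"
  unfolding dl_def using assms by (subst der_lmap[of g "- 1" "dU U" "dU X"]) (auto simp: chainl_def)

lemma exact_lmap:
  assumes "complex X" "complex Y" "chainl U X g" "exact md X Y e n f"
  shows "exact md U Y e n (\<lambda>w. f (lmap g w))"
proof -
  obtain b where b: "adm md X Y (e + 1) b" "\<And>w. length w = n \<Longrightarrow> dl X Y (e + 1) b w = f w"
    using assms(4) by (auto simp: exact_def)
  show ?thesis
    unfolding exact_def
    using adm_lmap[OF assms(1,2) _ b(1), of U g] assms(3) b(2)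
    by (intro exI[of _ "\<lambda>w. b (lmap g w)"]) (simp add: dl_lmap[OF assms(3)] chainl_def)
qed

section \<open>Splitting off the homology\<close>

text \<open>A contraction to the homology: \<open>P\<close> projects to cycles that represent the homology classes, and \<open>h\<close>
  is a homotopy from \<open>P\<close> to the identity.\<close>

definition retr :: "('k::field, 'v::ab_group_add) complex_data \<Rightarrow> (int \<Rightarrow> 'v \<Rightarrow> 'v) \<Rightarrow> (int \<Rightarrow> 'v \<Rightarrow> 'v) \<Rightarrow> bool"
  where
  "retr U P h \<longleftrightarrow> letl U U 0 P \<and> letl U U 1 h \<and>
     (\<forall>d x. bd U (h d x) + h (d - 1) (dU U d x) = component U d x - P d x) \<and>
     (\<forall>d x. P d (P d x) = P d x) \<and> (\<forall>d x. bd U (P d x) = 0) \<and> (\<forall>d x. P d (dU U (d + 1) x) = 0)"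

lemma retr_chainl: "complex U \<Longrightarrow> retr U P h \<Longrightarrow> chainl U U P"
proof -
  assume "complex U" and r: "retr U P h"
  then interpret complex U by simp
  have letl_P: "letl U U 0 P" using r by (simp add: retr_def)
  have "P (d - 1) (dU U d x) = 0" for d x
    using r[unfolded retr_def] by (metis diff_add_cancel)
  moreover have "dU U d (P d x) = 0" for d x
    using r letlD(4)[OF letl_P, of d x] by (simp add: retr_def dU_def component_same)
  ultimately show ?thesis using letl_P by (simp add: chainl_def)
qed

context
  fixes U :: "('k::field_char_0, 'v::ab_group_add) complex_data"
    and Y :: "('k, 'y::ab_group_add) complex_data" and P h
  assumes U: "complex U" and Y: "complex Y" and r: "retr U P h"
begin

interpretation U: complex U by (rule U)
interpretation Y: complex Y by (rule Y)

definition co_proj :: "int \<Rightarrow> 'v \<Rightarrow> 'v" where "co_proj d x = component U d x - P d x"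

lemma letl_P: "letl U U 0 P" and letl_h: "letl U U 1 h" using r by (simp_all add: retr_def)
lemma P_grade: "P d x \<in> grade U d" using letlD(4)[OF letl_P, of d x] by simp
lemma PP: "P d (P d x) = P d x" using r by (simp add: retr_def)

lemma letl_co_proj: "letl U U 0 co_proj"
  unfolding letl_def lind_def co_proj_def
  using letlD[OF letl_P]
  by (auto simp: U.component_add U.component_scale U.vs.scale_right_diff_distrib U.component_grade intro!: U.grade_diff)

lemma co_proj_grade: "co_proj d x \<in> grade U d" using letlD(4)[OF letl_co_proj, of d x] by simp
lemma P_co_proj: "P d (co_proj d x) = 0" by (simp add: co_proj_def letl_diff[OF letl_P] letlD(3)[OF letl_P] PP)
lemma co_proj_P: "co_proj d (P d x) = 0" by (simp add: co_proj_def PP U.component_same P_grade)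
lemma co_proj_comm: "co_proj (d - 1) (dU U d x) = dU U d (co_proj d x)"
proof -
  have "P (d - 1) (dU U d x) = 0" "dU U d (P d x) = 0"
    using retr_chainl[OF U r] r P_grade[of d x] by (simp_all add: chainl_def dU_def retr_def U.component_same)
  moreover have "component U (d - 1) (dU U d x) = dU U d x"
    using letlD(4)[OF letl_dU[OF U], of d x] by (simp add: U.component_same)
  ultimately show ?thesis
    by (simp add: co_proj_def letl_diff[OF letl_dU[OF U]] letlD(3)[OF letl_dU[OF U]])
qed

lemma co_proj_homotopy: "h (d - 1) (dU U d x) + dU U (d + 1) (h d x) = co_proj d x"
  using r letlD(4)[OF letl_h, of d x] by (simp add: retr_def co_proj_def dU_def U.component_same add.commute)

lemma cycle_der:
  assumes "\<And>z. length z = n \<Longrightarrow> dl U Y e c z = 0" "length z = n"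
  shows "der e' k (der (- 1) (dU U) c) z = ksgn e (bd Y (der e' k c z))"
proof -
  have "der (- 1) (dU U) c z = ksgn e (bd Y (c z))" if "length z = n" for z
    using assms(1)[OF that] by (simp add: dl_def ksgn_ksgn ksgn_even)
  then have "der e' k (der (- 1) (dU U) c) z = der e' k (\<lambda>z. ksgn e (bd Y (c z))) z"
    using assms(2) by (intro der_cong_length) simp
  then show ?thesis by (simp add: der_ksgn der_post[OF Y.bd_addi])
qed

text \<open>As \<open>1 - P = \<partial>h + h\<partial>\<close>, the derivation extending \<open>1 - P\<close> is the commutator of the differential with the
  derivation extending \<open>h\<close>, which therefore gives a primitive on cycles.\<close>

lemma exact_der_co_proj:
  assumes "adm md U Y e c" "\<And>z. length z = n \<Longrightarrow> dl U Y e c z = 0"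
  shows "exact md U Y e n (der 0 co_proj c)"
proof -
  let ?b = "\<lambda>w. ksgn e (der 1 h c w)"
  have ad: "adm md U Y (e + 1) ?b"
    using adm_ksgn[OF Y adm_der[OF U Y letl_h assms(1)]] by (simp add: add.commute)
  have "dl U Y (e + 1) ?b w = der 0 co_proj c w" if w: "length w = n" for w
  proof -
    have "der (- 1) (dU U) (der 1 h c) w + der 1 h (der (- 1) (dU U) c) w = der 0 co_proj c w"
      using der_commutator[OF adm_addv[OF assms(1)], of "- 1" "dU U" 1 h w]
        der_cong_letter[of "\<lambda>d x. h (d - 1) (dU U d x) + dU U (d + 1) (h d x)" co_proj 0 c w, OF co_proj_homotopy]
      by (simp add: ksgn_odd)
    moreover have "der 1 h (der (- 1) (dU U) c) w = ksgn e (bd Y (der 1 h c w))"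
      by (rule cycle_der[OF assms(2) w])
    ultimately have "der (- 1) (dU U) (der 1 h c) w = der 0 co_proj c w - ksgn e (bd Y (der 1 h c w))"
      by (simp add: eq_diff_eq)
    then show ?thesis
      by (simp add: dl_def der_ksgn ksgn_diff ksgn_ksgn Y.bd_ksgn ksgn_even) (simp add: ksgn_def)
  qed
  with ad show ?thesis by (auto simp: exact_def)
qed

lemma cycle_der_co_proj:
  assumes "adm md U Y e c" "\<And>z. length z = n \<Longrightarrow> dl U Y e c z = 0" "length w = n"
  shows "dl U Y e (der 0 co_proj c) w = 0"
proof -
  have "der (- 1) (dU U) (der 0 co_proj c) w - der 0 co_proj (der (- 1) (dU U) c) w = 0"
    using der_commutator[OF adm_addv[OF assms(1)], of "- 1" "dU U" 0 co_proj w]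
      der_zero[OF adm_addv[OF assms(1)], of "\<lambda>d x. co_proj (d - 1) (dU U d x) - dU U d (co_proj d x)" "- 1" w]
    by (simp add: co_proj_comm)
  moreover have "der 0 co_proj (der (- 1) (dU U) c) w = ksgn e (bd Y (der 0 co_proj c w))"
    by (rule cycle_der[OF assms(2,3)])
  ultimately show ?thesis by (simp add: dl_def ksgn_ksgn ksgn_even)
qed

text \<open>The product of the factors \<open>1 - D / k\<close> for \<open>k = 1, \<dots>, m\<close>, applied to \<open>c\<close>, where \<open>D\<close> is the derivation
  extending \<open>1 - P\<close>. It removes the eigenvalues \<open>1, \<dots>, m\<close> of \<open>D\<close> and is homotopic to the identity.\<close>

primrec cut_eigen :: "nat \<Rightarrow> ((int \<times> 'v) list \<Rightarrow> 'y) \<Rightarrow> (int \<times> 'v) list \<Rightarrow> 'y" where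
  "cut_eigen 0 c = c"
| "cut_eigen (Suc m) c = (\<lambda>w. cut_eigen m c w - smul Y (1 / of_nat (Suc m)) (der 0 co_proj (cut_eigen m c) w))"

lemma cut_eigen:
  assumes "adm md U Y e c" "\<And>z. length z = n \<Longrightarrow> dl U Y e c z = 0"
  shows "adm md U Y e (cut_eigen m c) \<and> (\<forall>z. length z = n \<longrightarrow> dl U Y e (cut_eigen m c) z = 0) \<and>
    exact md U Y e n (\<lambda>w. c w - cut_eigen m c w)"
proof (induct m)
  case 0
  have "exact md U Y e n (\<lambda>w. 0)"
    by (rule exact_0[OF Y]) (use adm_ksgn[OF Y adm_der[OF U Y letl_h assms(1)]] in \<open>simp add: add.commute\<close>)
  then show ?case using assms by simp
next
  case (Suc m)
  let ?s = "1 / of_nat (Suc m) :: 'k"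
  have ad: "adm md U Y e (cut_eigen m c)" and cy: "\<And>z. length z = n \<Longrightarrow> dl U Y e (cut_eigen m c) z = 0"
    and ex: "exact md U Y e n (\<lambda>w. c w - cut_eigen m c w)" using Suc by auto
  have 1: "adm md U Y e (der 0 co_proj (cut_eigen m c))" using adm_der[OF U Y letl_co_proj ad] by simp
  have a: "addi (smul Y ?s)" by (simp add: addi_def Y.vs.scale_right_distrib)
  have "dl U Y e (cut_eigen (Suc m) c) z = dl U Y e (cut_eigen m c) z - smul Y ?s (dl U Y e (der 0 co_proj (cut_eigen m c)) z)" for z
    by (simp add: dl_def Y.bd_diff Y.bd_scale der_diff der_post[OF a, symmetric] addi_ksgn[OF a, symmetric]
        Y.vs.scale_right_diff_distrib ksgn_diff del: of_nat_Suc)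
  then have 2: "dl U Y e (cut_eigen (Suc m) c) z = 0" if "length z = n" for z
    using that by (simp add: cy cycle_der_co_proj[OF ad cy that])
  have 3: "exact md U Y e n (\<lambda>w. (c w - cut_eigen m c w) - smul Y (- ?s) (der 0 co_proj (cut_eigen m c) w))"
    by (rule exact_diff[OF Y ex exact_scale[OF Y exact_der_co_proj[OF ad cy]]])
  show ?case
    using adm_diff[OF Y ad adm_scale[OF Y 1, of ?s]] 2 3 by (simp add: algebra_simps del: of_nat_Suc)
qed

text \<open>Every letter is the sum of one that is fixed by \<open>P\<close> and one that is annihilated by \<open>P\<close>. A word of such
  letters is an eigenvector, with the number \<open>rk\<close> of letters of the second kind as eigenvalue.\<close>

definition pure :: "int \<times> 'v \<Rightarrow> bool" where
  "pure a \<longleftrightarrow> P (fst a) (snd a) = snd a \<or> (P (fst a) (snd a) = 0 \<and> component U (fst a) (snd a) = snd a)"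

definition rk :: "(int \<times> 'v) list \<Rightarrow> nat" where
  "rk w = length (filter (\<lambda>a. P (fst a) (snd a) \<noteq> snd a) w)"

lemma der_co_proj_pure:
  assumes "mlin U (smul Y) f" "\<forall>a\<in>set w. pure a"
  shows "der 0 co_proj f w = smul Y (of_nat (rk w)) (f w)"
  using assms
proof (induct w arbitrary: f)
  case Nil
  then show ?case by (simp add: rk_def)
next
  case (Cons a w)
  have IH: "der 0 co_proj (\<lambda>z. f (a # z)) w = smul Y (of_nat (rk w)) (f (a # w))"
    by (rule Cons(1)) (rule mlin_Cons[OF Cons(2)], use Cons(3) in simp)
  obtain d x where a: "a = (d, x)" by force
  show ?case
  proof (cases "P d x = x")
    case True
    then have "co_proj d x = 0" using co_proj_P[of d x] by simp
    then show ?thesis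
      using True IH addv_zero[OF mlin_addv[OF Cons(2)], of "[]"] by (simp add: a rk_def)
  next
    case False
    then have "co_proj d x = x" using Cons(3) by (auto simp: a pure_def co_proj_def)
    then show ?thesis
      using False IH by (simp add: a rk_def Y.vs.scale_left_distrib)
  qed
qed

lemma cut_eigen_pure:
  assumes "adm md U Y e c" "\<And>z. length z = n \<Longrightarrow> dl U Y e c z = 0" "\<forall>a\<in>set w. pure a"
  shows "cut_eigen m c w = smul Y (\<Prod>k<m. 1 - of_nat (rk w) / of_nat (Suc k)) (c w)"
proof (induct m)
  case (Suc m)
  have ml: "mlin U (smul Y) (cut_eigen m c)" by (rule adm_mlin[OF conjunct1[OF cut_eigen[OF assms(1,2)]]])
  show ?case
    using Suc
    by (simp add: der_co_proj_pure[OF ml assms(3)] Y.vs.scale_left_diff_distrib algebra_simps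
        flip: Y.vs.scale_left_diff_distrib del: of_nat_Suc)
qed simp

lemma pure_split_zero:
  assumes "mlin U (smul Y) g" "\<And>w. length w = n \<Longrightarrow> \<forall>a\<in>set w. pure a \<Longrightarrow> g w = 0" "length w = n"
  shows "g w = 0"
proof -
  have "g (u @ w) = 0" if "\<forall>a\<in>set u. pure a" "length (u @ w) = n" for u w
    using that
  proof (induct w arbitrary: u)
    case Nil
    then show ?case using assms(2) by simp
  next
    case (Cons a w)
    obtain d x where a: "a = (d, x)" by force
    have L: "lind U (smul Y) d (\<lambda>x. g (u @ (d, x) # w))" by (rule mlinD[OF assms(1)])
    have "g (u @ a # w) = g (u @ (d, P d x + co_proj d x) # w)"
      using lindD(3)[OF L, of x] by (simp add: a co_proj_def)
    also have "\<dots> = g (u @ (d, P d x) # w) + g (u @ (d, co_proj d x) # w)" by (rule lindD(1)[OF L])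
    also have "g (u @ (d, P d x) # w) = 0"
      using Cons(1)[of "u @ [(d, P d x)]"] Cons(2,3) by (simp add: pure_def PP)
    also have "g (u @ (d, co_proj d x) # w) = 0"
      using Cons(1)[of "u @ [(d, co_proj d x)]"] Cons(2,3)
      by (simp add: pure_def P_co_proj U.component_same co_proj_grade)
    finally show ?case by simp
  qed
  from this[of "[]" w] assms(3) show ?thesis by simp
qed

text \<open>The derivation extending \<open>1 - P\<close> is diagonalizable with eigenvalues \<open>0, \<dots>, n\<close>, and the
  projection to its kernel is composition with \<open>P\<close> in all arguments. Dividing by the nonzero
  eigenvalues is where the characteristic enters; the resulting homotopy is symmetric, so
  that it does not leave the class of maps considered.\<close>

lemma exact_idem:
  assumes "adm md U Y e c" "\<And>z. length z = n \<Longrightarrow> dl U Y e c z = 0"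
  shows "exact md U Y e n (\<lambda>w. c w - c (lmap P w))"
proof -
  have ad: "adm md U Y e (cut_eigen n c)" by (rule conjunct1[OF cut_eigen[OF assms]])
  have 1: "adm md U Y e (\<lambda>w. c (lmap P w))" by (rule adm_lmap[OF U Y letl_P assms(1)])
  have "cut_eigen n c w - c (lmap P w) = 0" if "length w = n" for w
  proof (rule pure_split_zero[where n = n, OF _ _ that])
    show "mlin U (smul Y) (\<lambda>w. cut_eigen n c w - c (lmap P w))" by (rule adm_mlin[OF adm_diff[OF Y ad 1]])
    fix w assume w: "length w = n" "\<forall>a\<in>set w. pure a"
    show "cut_eigen n c w - c (lmap P w) = 0"
    proof (cases "rk w")
      case 0
      then have "lmap P w = w"
        unfolding lmap_def rk_def by (intro map_idI) (auto simp: filter_empty_conv)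
      then show ?thesis using 0 by (simp add: cut_eigen_pure[OF assms w(2)])
    next
      case (Suc k)
      have "rk w \<le> n" using w(1) by (simp add: rk_def le_trans[OF length_filter_le])
      then have "(\<Prod>k<n. 1 - of_nat (rk w) / of_nat (Suc k)) = (0 :: 'k)"
        using Suc by (intro prod_zero) (auto intro!: bexI[of _ k] simp del: of_nat_Suc)
      moreover have "c (lmap P w) = 0"
      proof -
        have "filter (\<lambda>a. P (fst a) (snd a) \<noteq> snd a) w \<noteq> []" using Suc by (auto simp: rk_def)
        then obtain a where a: "a \<in> set w" "P (fst a) (snd a) \<noteq> snd a" by (auto simp: filter_empty_conv)
        then have "P (fst a) (snd a) = 0" using w(2) by (auto simp: pure_def)
        moreover obtain u z where "w = u @ a # z" using a(1) by (meson split_list)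
        ultimately show ?thesis
          using addv_zero[OF adm_addv[OF assms(1)], of "lmap P u" "fst a" "lmap P z"] by (simp add: lmap_def)
      qed
      ultimately show ?thesis by (simp add: cut_eigen_pure[OF assms w(2)])
    qed
  qed
  moreover have "exact md U Y e n (\<lambda>w. c w - cut_eigen n c w)"
    by (rule conjunct2[OF conjunct2[OF cut_eigen[OF assms]]])
  ultimately show ?thesis by (auto intro: exact_cong)
qed

end


text \<open>Complements of the boundaries in the cycles and of the cycles in the whole space give the
  representatives of the homology and, on the latter complement, an inverse of the differential.\<close>

lemma retr_exists:
  assumes "complex U"
  shows "\<exists>P h. retr U P h"
proof -
  interpret complex U by fact
  interpret vp: vector_space_pair "smul U" "smul U" by unfold_locales
  define Z where "Z d = {x \<in> grade U d. bd U x = 0}" for d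
  define B where "B d = bd U ` grade U (d + 1)" for d
  have bd_lin: "Vector_Spaces.linear (smul U) (smul U) (bd U)"
    using cc by (simp add: chain_complex_def)
  have id_lin: "Vector_Spaces.linear (smul U) (smul U) (\<lambda>x. x)"
    by (simp add: linear_iff vs.vector_space_axioms)
  have subZ: "vs.subspace (Z d)" for d
    by (rule vs.subspaceI) (auto simp: Z_def grade_add grade_scale bd_add bd_scale)
  have subB: "vs.subspace (B d)" for d
    unfolding B_def
    by (rule module_hom.subspace_image[OF Vector_Spaces.linear.axioms(3)[OF bd_lin] grade_subspace])
  have BZ: "B d \<subseteq> Z d" for d using bd_grade[of _ "d + 1"] by (auto simp: B_def Z_def)
  have "\<exists>p. range p \<subseteq> S \<and> Vector_Spaces.linear (smul U) (smul U) p \<and> (\<forall>x\<in>S. p x = x)"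
    if "vs.subspace S" for S
    using vp.linear_exists_left_inverse_on[OF id_lin that] by auto
  then obtain pr where pr: "\<And>S. vs.subspace S \<Longrightarrow>
     range (pr S) \<subseteq> S \<and> Vector_Spaces.linear (smul U) (smul U) (pr S) \<and> (\<forall>x\<in>S. pr S x = x)"
    by metis
  define pz where "pz d = pr (Z d)" for d
  define pb where "pb d = pr (B d)" for d
  have pz: "pz d x \<in> Z d" "x \<in> Z d \<Longrightarrow> pz d x = x" "pz d (x + y) = pz d x + pz d y"
      "pz d (smul U c x) = smul U c (pz d x)" for d x y c
    using pr[OF subZ[of d]] by (auto simp: pz_def linear_iff)
  have pb: "pb d x \<in> B d" "x \<in> B d \<Longrightarrow> pb d x = x" "pb d (x + y) = pb d x + pb d y"
      "pb d (smul U c x) = smul U c (pb d x)" for d x y c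
    using pr[OF subB[of d]] by (auto simp: pb_def linear_iff)
  have pza: "addi (pz d)" and pba: "addi (pb d)" for d by (simp_all add: addi_def pz pb)
  have pzd: "pz d (x - y) = pz d x - pz d y" and pbd: "pb d (x - y) = pb d x - pb d y" for d x y
    using pz(3)[of d x "- y"] pb(3)[of d x "- y"] addi_minus[OF pza, of d y] addi_minus[OF pba, of d y]
    by simp_all
  have "\<exists>s. range s \<subseteq> grade U (d + 1) \<and> Vector_Spaces.linear (smul U) (smul U) s \<and> (\<forall>x\<in>B d. bd U (s x) = x)" for d
    using vp.linear_exists_right_inverse_on[OF bd_lin grade_subspace, of "d + 1"] by (simp add: B_def)
  then obtain s where s: "\<And>d. range (s d) \<subseteq> grade U (d + 1) \<and>
     Vector_Spaces.linear (smul U) (smul U) (s d) \<and> (\<forall>x\<in>B d. bd U (s d x) = x)"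
    by metis
  have s: "s d x \<in> grade U (d + 1)" "x \<in> B d \<Longrightarrow> bd U (s d x) = x"
    "s d (x + y) = s d x + s d y" "s d (smul U c x) = smul U c (s d x)" for d x y c
    using s[of d] by (auto simp: linear_iff)
  \<comment> \<open>The inverse of the differential with values in the chosen complement of the cycles.\<close>
  define s' where "s' d x = s d x - pz (d + 1) (s d x)" for d x
  have Zg: "x \<in> Z d \<Longrightarrow> x \<in> grade U d" "x \<in> Z d \<Longrightarrow> bd U x = 0" for x d by (auto simp: Z_def)
  have s': "s' d x \<in> grade U (d + 1)" "x \<in> B d \<Longrightarrow> bd U (s' d x) = x" "pz (d + 1) (s' d x) = 0"
    "s' d (x + y) = s' d x + s' d y" "s' d (smul U c x) = smul U c (s' d x)" for d x y c
    using Zg[OF pz(1)]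
    by (auto simp: s'_def s pz pzd bd_diff vs.scale_right_diff_distrib intro!: grade_diff)
  define P where "P d x = pz d (component U d x) - pb d (pz d (component U d x))" for d x
  define h where "h d x = s' d (pb d (pz d (component U d x)))" for d x
  have Bg: "x \<in> B d \<Longrightarrow> x \<in> grade U d" "x \<in> B d \<Longrightarrow> bd U x = 0" "x \<in> B d \<Longrightarrow> x \<in> Z d" for x d
    using BZ[of d] Zg by auto
  have P_grade: "P d x \<in> grade U d" for d x
    unfolding P_def by (intro grade_diff Zg(1)[OF pz(1)] Bg(1)[OF pb(1)])
  have bd_P: "bd U (P d x) = 0" for d x
    unfolding P_def by (simp add: bd_diff Zg(2)[OF pz(1)] Bg(2)[OF pb(1)])
  have PZ: "P d x \<in> Z d" for d x using P_grade bd_P by (simp add: Z_def)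
  have pb_P: "pb d (P d x) = 0" for d x
    unfolding P_def by (simp add: pbd pb(2)[OF pb(1)])
  have "letl U U 0 P"
    unfolding letl_def lind_def using P_grade
    by (simp add: P_def component_add component_scale pz pb vs.scale_right_diff_distrib)
  moreover have "letl U U 1 h"
    unfolding letl_def lind_def
    by (simp add: h_def component_add component_scale pz pb s')
  moreover have "bd U (h d x) + h (d - 1) (dU U d x) = component U d x - P d x" for d x
  proof -
    let ?c = "component U d x"
    have b: "bd U ?c \<in> B (d - 1)" using component_grade[of d x] by (simp add: B_def)
    have 1: "bd U (h d x) = pb d (pz d ?c)" unfolding h_def by (rule s'(2)[OF pb(1)])
    have "component U (d - 1) (bd U ?c) = bd U ?c" by (rule component_same[OF bd_grade[OF component_grade]])
    then have 2: "h (d - 1) (dU U d x) = s' (d - 1) (bd U ?c)"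
      unfolding h_def dU_def by (simp add: pz(2)[OF Bg(3)[OF b]] pb(2)[OF b])
    let ?y = "s' (d - 1) (bd U ?c) - (?c - pz d ?c)"
    have g: "s' (d - 1) (bd U ?c) \<in> grade U d" "pz d (s' (d - 1) (bd U ?c)) = 0"
      using s'(1)[of "d - 1" "bd U ?c"] s'(3)[of "d - 1" "bd U ?c"] by simp_all
    have "?y \<in> Z d"
      unfolding Z_def
      using g(1) component_grade[of d x] Zg[OF pz(1), of d ?c] s'(2)[OF b]
      by (simp add: grade_diff bd_diff)
    moreover have "pz d ?y = 0" by (simp add: pzd g pz(2)[OF pz(1)])
    ultimately have "?y = 0" using pz(2) by metis
    then show ?thesis by (simp add: 1 2 P_def)
  qed
  moreover have "P d (P d x) = P d x" for d x
    unfolding P_def[of d "P d x"] by (simp add: component_same[OF P_grade] pz(2)[OF PZ] pb_P)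
  moreover have "P d (dU U (d + 1) x) = 0" for d x
  proof -
    have b: "dU U (d + 1) x \<in> B d" using component_grade[of "d + 1" x] by (simp add: B_def dU_def)
    show ?thesis
      unfolding P_def by (simp add: component_same[OF Bg(1)[OF b]] pz(2)[OF Bg(3)[OF b]] pb(2)[OF b])
  qed
  ultimately have "retr U P h" using bd_P by (simp add: retr_def)
  then show ?thesis by blast
qed

text \<open>Injectivity and surjectivity on homology, expressed by cycles and boundaries.\<close>

definition quism :: "('k::field, 'v::ab_group_add) complex_data \<Rightarrow> ('k, 'w::ab_group_add) complex_data
    \<Rightarrow> (int \<Rightarrow> 'v \<Rightarrow> 'w) \<Rightarrow> bool" where
  "quism U X F \<longleftrightarrow> chainl U X F \<and>
    (\<forall>d. \<forall>z\<in>grade U d. bd U z = 0 \<longrightarrow> (\<exists>y\<in>grade X (d + 1). F d z = bd X y) \<longrightarrow>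
       (\<exists>y\<in>grade U (d + 1). z = bd U y)) \<and>
    (\<forall>d. \<forall>y\<in>grade X d. bd X y = 0 \<longrightarrow>
       (\<exists>z\<in>grade U d. bd U z = 0 \<and> (\<exists>x\<in>grade X (d + 1). y - F d z = bd X x)))"

text \<open>The image of \<open>P\<close> is the homology of \<open>U\<close> and that of \<open>P'\<close> is the homology of \<open>X\<close>; the inverse of the
  induced isomorphism, preceded by \<open>P'\<close>, is a chain map. The two equations say that \<open>G F\<close> and
  \<open>F G\<close> agree with the identity after projection, which for \<open>exact_idem\<close> is as good as being homotopic
  to the identity.\<close>

lemma quism_inverse:
  assumes "complex U" "complex X" "quism U X F" "retr U P h" "retr X P' h'"
  shows "\<exists>G. chainl X U G \<and> (\<forall>d x. G d (F d (P d x)) = P d x) \<and> (\<forall>d y. P' d (F d (G d y)) = P' d y)"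
proof -
  interpret U: complex U by fact
  interpret X: complex X by fact
  interpret vp: vector_space_pair "smul U" "smul X" by unfold_locales
  have F: "letl U X 0 F" and cF: "chainl U X F" using assms(3) by (simp_all add: quism_def chainl_def)
  have P: "letl U U 0 P" and P': "letl X X 0 P'" using assms(4,5) by (simp_all add: retr_def)
  note Pg = letlD(4)[OF P, simplified] and P'g = letlD(4)[OF P', simplified] and Fg = letlD(4)[OF F, simplified]
  have bdP: "bd U (P d x) = 0" "P d (P d x) = P d x" for d x using assms(4) by (simp_all add: retr_def)
  have bdP': "bd X (P' d x) = 0" "P' d (P' d x) = P' d x" for d x using assms(5) by (simp_all add: retr_def)
  have PB: "P d (bd U y) = 0" if "y \<in> grade U (d + 1)" for d y
    using assms(4) that U.component_same[OF that] unfolding retr_def by (metis dU_def)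
  have P'B: "P' d (bd X y) = 0" if "y \<in> grade X (d + 1)" for d y
    using assms(5) that X.component_same[OF that] unfolding retr_def by (metis dU_def)
  have hom: "\<exists>y\<in>grade U (d + 1). z - P d z = bd U y" if "z \<in> grade U d" "bd U z = 0" for d z
  proof -
    have h: "letl U U 1 h" using assms(4) by (simp add: retr_def)
    have "bd U (h d z) + h (d - 1) (dU U d z) = component U d z - P d z" using assms(4) by (simp add: retr_def)
    then have "z - P d z = bd U (h d z)" using that by (simp add: dU_def U.component_same letl_0[OF h])
    then show ?thesis using letlD(4)[OF h] by blast
  qed
  have hom': "\<exists>y\<in>grade X (d + 1). z - P' d z = bd X y" if "z \<in> grade X d" "bd X z = 0" for d z
  proof -
    have h: "letl X X 1 h'" using assms(5) by (simp add: retr_def)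
    have "bd X (h' d z) + h' (d - 1) (dU X d z) = component X d z - P' d z" using assms(5) by (simp add: retr_def)
    then have "z - P' d z = bd X (h' d z)" using that by (simp add: dU_def X.component_same letl_0[OF h])
    then show ?thesis using letlD(4)[OF h] by blast
  qed
  have F_bd: "bd X (F d x) = F (d - 1) (bd U x)" if "x \<in> grade U d" for d x
    using cF that Fg[of d x] unfolding chainl_def dU_def by (metis U.component_same X.component_same)
  have F_bd1: "F d (bd U x) = bd X (F (d + 1) x)" if "x \<in> grade U (d + 1)" for d x
    using F_bd[OF that] by simp
  have "\<exists>L. L ` UNIV \<subseteq> range (P d) \<and> Vector_Spaces.linear (smul X) (smul U) L \<and>
    (\<forall>v\<in>range (P d). L (P' d (F d v)) = v)" for d
  proof (rule vp.linear_exists_left_inverse_on)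
    show "Vector_Spaces.linear (smul U) (smul X) (\<lambda>x. P' d (F d x))"
      using letlD[OF P'] letlD[OF F] by (simp add: linear_iff U.vs.vector_space_axioms X.vs.vector_space_axioms)
    have lin: "Vector_Spaces.linear (smul U) (smul U) (P d)"
      using letlD[OF P] by (simp add: linear_iff U.vs.vector_space_axioms)
    show "U.vs.subspace (range (P d))"
      by (rule module_hom.subspace_image[OF Vector_Spaces.linear.axioms(3)[OF lin] U.vs.subspace_UNIV])
    show "inj_on (\<lambda>x. P' d (F d x)) (range (P d))"
    proof (rule inj_onI)
      fix u v assume u: "u \<in> range (P d)" "v \<in> range (P d)" and e: "P' d (F d u) = P' d (F d v)"
      let ?z = "u - v"
      have Pz: "P d ?z = ?z" using u by (auto simp: letl_diff[OF P] bdP)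
      have z: "?z \<in> grade U d" "bd U ?z = 0"
        using Pg[of d ?z] bdP(1)[of d ?z] unfolding Pz by auto
      have "P' d (F d ?z) = 0" using e by (simp add: letl_diff[OF F] letl_diff[OF P'])
      moreover have "bd X (F d ?z) = 0" using F_bd[OF z(1)] z(2) by (simp add: letl_0[OF F])
      ultimately have "\<exists>y\<in>grade X (d + 1). F d ?z = bd X y" using hom'[OF Fg] by fastforce
      then obtain y where "y \<in> grade U (d + 1)" "?z = bd U y"
        using assms(3) z unfolding quism_def by blast
      then show "u = v" using PB Pz by fastforce
    qed
  qed
  then obtain L where L: "\<And>d. range (L d) \<subseteq> range (P d)" "\<And>d. Vector_Spaces.linear (smul X) (smul U) (L d)"
    "\<And>d v. v \<in> range (P d) \<Longrightarrow> L d (P' d (F d v)) = v" by metis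
  have Ll: "L d (x + y) = L d x + L d y" "L d (smul X c x) = smul U c (L d x)" for d x y c
    using L(2)[of d] by (simp_all add: linear_iff)
  have LP: "P d (L d y) = L d y" for d y using L(1)[of d] bdP(2) by (metis image_iff range_subsetD)
  define G where "G d y = L d (P' d y)" for d y
  have "letl X U 0 G"
    unfolding letl_def lind_def G_def
    using letlD[OF P'] Ll LP Pg by (metis add.right_neutral)
  moreover have "G (d - 1) (dU X d y) = dU U d (G d y)" for d y
  proof -
    have "P' (d - 1) (dU X d y) = 0" using P'B[of "component X d y" "d - 1"] X.component_grade[of d y] by (simp add: dU_def)
    moreover have "L (d - 1) 0 = 0" by (rule addi_0) (simp add: addi_def Ll)
    moreover have "dU U d (G d y) = 0"
      unfolding dU_def G_def using LP[of d "P' d y"] Pg[of d "L d (P' d y)"] bdP(1)[of d "L d (P' d y)"]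
      by (simp add: U.component_same)
    ultimately show ?thesis by (simp add: G_def)
  qed
  moreover have "G d (F d (P d x)) = P d x" for d x unfolding G_def by (rule L(3)) simp
  moreover have "P' d (F d (G d y)) = P' d y" for d y
  proof -
    obtain z x where z: "z \<in> grade U d" "bd U z = 0" and x: "x \<in> grade X (d + 1)" "P' d y - F d z = bd X x"
      using assms(3) P'g[of d y] bdP'(1)[of d y] unfolding quism_def by blast
    obtain x' where x': "x' \<in> grade U (d + 1)" "z - P d z = bd U x'" using hom[OF z] by blast
    have "P' d (F d z) = P' d (F d (P d z))"
    proof -
      have "F d z - F d (P d z) = bd X (F (d + 1) x')"
        using F_bd1[OF x'(1)] letl_diff[OF F, of d z "P d z"] by (simp add: x'(2))
      then have "P' d (F d z - F d (P d z)) = 0" using P'B[OF Fg] by simp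
      then show ?thesis by (simp add: letl_diff[OF P'])
    qed
    moreover have "P' d (P' d y) = P' d (F d z)"
    proof -
      have "P' d (P' d y - F d z) = 0" using P'B[OF x(1)] by (simp add: x(2))
      then show ?thesis by (simp add: letl_diff[OF P'])
    qed
    ultimately have e: "P' d y = P' d (F d (P d z))" by (simp add: bdP')
    then have "G d y = P d z" using L(3)[of "P d z" d] by (simp add: G_def)
    then show ?thesis using e by simp
  qed
  ultimately show ?thesis by (auto simp: chainl_def)
qed

section \<open>The extension step\<close>

lemma lmap_lmap: "lmap f (lmap g w) = lmap (\<lambda>d x. f d (g d x)) w"
  by (simp add: lmap_def)

lemma chainl_compose:
  assumes "chainl U X f" "chainl X Y g"
  shows "chainl U Y (\<lambda>d x. g d (f d x))"
  using assms unfolding chainl_def letl_def lind_def by auto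

lemma dl_diff:
  assumes "complex Y"
  shows "dl U Y e (\<lambda>w. f w - g w) w = dl U Y e f w - dl U Y e g w"
proof -
  interpret Y: complex Y by fact
  show ?thesis by (simp add: dl_def Y.bd_diff der_diff ksgn_diff)
qed

lemma dl_add:
  assumes "complex Y"
  shows "dl U Y e (\<lambda>w. f w + g w) w = dl U Y e f w + dl U Y e g w"
proof -
  interpret Y: complex Y by fact
  show ?thesis by (simp add: dl_def Y.bd_add der_add ksgn_plus)
qed

text \<open>A chain map that agrees with the identity before or after the projection \<open>P\<close> acts on cycles as
  the identity up to boundaries, because both are comparable to composition with \<open>P\<close>.\<close>

lemma exact_homotopic_source:
  fixes U :: "('k::field_char_0, 'v::ab_group_add) complex_data"
  assumes "complex U" "complex Y" "retr U P h" "chainl U U g" "\<And>d x. g d (P d x) = P d x"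
    and "adm md U Y e c" "\<And>z. length z = n \<Longrightarrow> dl U Y e c z = 0"
  shows "exact md U Y e n (\<lambda>w. c w - c (lmap g w))"
proof -
  have 1: "exact md U Y e n (\<lambda>w. c w - c (lmap P w))" by (rule exact_idem[OF assms(1-3,6,7)])
  have ad: "adm md U Y e (\<lambda>w. c (lmap g w))"
    by (rule adm_lmap[OF assms(1,2) _ assms(6)]) (use assms(4) in \<open>simp add: chainl_def\<close>)
  have "exact md U Y e n (\<lambda>w. c (lmap g w) - c (lmap g (lmap P w)))"
    by (rule exact_idem[OF assms(1-3) ad]) (simp add: dl_lmap[OF assms(4)] assms(7))
  then have 2: "exact md U Y e n (\<lambda>w. c (lmap g w) - c (lmap P w))"
    by (simp add: lmap_lmap assms(5))
  show ?thesis by (rule exact_cong[OF exact_diff[OF assms(2) 1 2]]) simp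
qed

lemma exact_homotopic_target:
  fixes X :: "('k::field_char_0, 'v::ab_group_add) complex_data"
  assumes "complex X" "complex Y" "retr X P h" "chainl X X g" "\<And>d x. P d (g d x) = P d x"
    and "adm md X Y e c" "\<And>z. length z = n \<Longrightarrow> dl X Y e c z = 0"
  shows "exact md X Y e n (\<lambda>w. c w - c (lmap g w))"
proof -
  have 1: "exact md X Y e n (\<lambda>w. c w - c (lmap P w))" by (rule exact_idem[OF assms(1-3,6,7)])
  have "exact md X Y e n (\<lambda>w. c (lmap g w) - c (lmap P (lmap g w)))"
    by (rule exact_lmap[OF assms(1,2,4) 1])
  then have 2: "exact md X Y e n (\<lambda>w. c (lmap g w) - c (lmap P w))"
    by (simp add: lmap_lmap assms(5))
  show ?thesis by (rule exact_cong[OF exact_diff[OF assms(2) 1 2]]) simp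
qed

text \<open>The complex of pairs \<open>(R, E)\<close> is the mapping cone of composition with \<open>F\<close>, which is a
  homotopy equivalence; so every cycle is a boundary.\<close>

lemma cone_acyclic:
  fixes U :: "('k::field_char_0, 'v::ab_group_add) complex_data"
    and X :: "('k, 'w::ab_group_add) complex_data"
  assumes U: "complex U" and X: "complex X" and F: "quism U X F"
    and R: "adm md X X (- 2) R" and E: "adm md U X (- 1) E"
    and dR: "\<And>w. length w = n \<Longrightarrow> dl X X (- 2) R w = 0"
    and dE: "\<And>w. length w = n \<Longrightarrow> dl U X (- 1) E w = - R (lmap F w)"
  shows "\<exists>r \<psi>. adm md X X (- 1) r \<and> adm md U X 0 \<psi> \<and>
    (\<forall>w. length w = n \<longrightarrow> dl X X (- 1) r w = - R w) \<and>
    (\<forall>w. length w = n \<longrightarrow> dl U X 0 \<psi> w = E w - r (lmap F w))"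
proof -
  obtain P h P' h' where r: "retr U P h" and r': "retr X P' h'"
    using retr_exists[OF U] retr_exists[OF X] by blast
  have cF: "chainl U X F" using F by (simp add: quism_def)
  obtain G where cG: "chainl X U G" and GF: "\<And>d x. G d (F d (P d x)) = P d x"
    and FG: "\<And>d y. P' d (F d (G d y)) = P' d y"
    using quism_inverse[OF U X F r r'] by blast
  have lF: "letl U X 0 F" and lG: "letl X U 0 G" using cF cG by (simp_all add: chainl_def)
  have "exact md X X (- 2) n (\<lambda>w. R w - R (lmap (\<lambda>d x. F d (G d x)) w))"
    by (rule exact_homotopic_target[where P = P' and g = "\<lambda>d x. F d (G d x)", OF X X r' chainl_compose[OF cG cF] FG R dR])
  then obtain H where H: "adm md X X (- 1) H"
    "\<And>w. length w = n \<Longrightarrow> dl X X (- 1) H w = R w - R (lmap F (lmap G w))"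
    by (auto simp: exact_def lmap_lmap)
  \<comment> \<open>The standard formula for contracting the cone of a homotopy equivalence: the first guess
      satisfies the equation for \<open>R\<close>, and the remaining error \<open>E - \<rho> F\<close> is a cycle that is pulled
      back along \<open>G\<close> to correct it.\<close>
  let ?rho = "\<lambda>w. E (lmap G w) - H w"
  have r0: "adm md X X (- 1) ?rho" by (rule adm_diff[OF X adm_lmap[OF U X lG E] H(1)])
  have dr0: "dl X X (- 1) ?rho w = - R w" if "length w = n" for w
    using that by (simp add: dl_diff[OF X] dl_lmap[OF cG] dE H(2))
  let ?c = "\<lambda>w. E w - ?rho (lmap F w)"
  have c: "adm md U X (- 1) ?c" by (rule adm_diff[OF X E adm_lmap[OF X X lF r0]])
  have dc: "dl U X (- 1) ?c w = 0" if "length w = n" for w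
    unfolding dl_diff[OF X, of U "- 1" E] dl_lmap[OF cF, of X "- 1" ?rho] using that by (simp add: dE dr0)
  have "exact md U X (- 1) n (\<lambda>w. ?c w - ?c (lmap (\<lambda>d x. G d (F d x)) w))"
    by (rule exact_homotopic_source[where P = P and g = "\<lambda>d x. G d (F d x)", OF U X r chainl_compose[OF cF cG] GF c dc])
  then obtain \<psi> where \<psi>: "adm md U X 0 \<psi>"
    "\<And>w. length w = n \<Longrightarrow> dl U X 0 \<psi> w = ?c w - ?c (lmap G (lmap F w))"
    by (auto simp: exact_def lmap_lmap)
  let ?r = "\<lambda>w. ?rho w + ?c (lmap G w)"
  have "adm md X X (- 1) ?r" by (rule adm_add[OF X r0 adm_lmap[OF U X lG c]])
  moreover have "dl X X (- 1) ?r w = - R w" if "length w = n" for w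
  proof -
    have "dl X X (- 1) ?r w = dl X X (- 1) ?rho w + dl X X (- 1) (\<lambda>w. ?c (lmap G w)) w"
      by (rule dl_add[OF X])
    also have "dl X X (- 1) (\<lambda>w. ?c (lmap G w)) w = dl U X (- 1) ?c (lmap G w)"
      by (rule dl_lmap[OF cG, where f = ?c])
    finally show ?thesis using dr0[OF that] dc[of "lmap G w"] that by simp
  qed
  moreover have "dl U X 0 \<psi> w = E w - ?r (lmap F w)" if "length w = n" for w
    using \<psi>(2)[OF that] by (simp add: algebra_simps)
  ultimately show ?thesis using \<psi>(1) by blast
qed

text \<open>A structure \<open>q\<close> and a morphism \<open>\<phi>\<close> from the structure \<open>p\<close>, with the equations required up to arity
  \<open>N\<close> only. The unary part of \<open>q\<close> is the given differential.\<close>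

definition stage :: "mode \<Rightarrow> ('k::field, 'v::ab_group_add) complex_data \<Rightarrow> ('k, 'w::ab_group_add) complex_data
   \<Rightarrow> ((int \<times> 'v) list \<Rightarrow> 'v) \<Rightarrow> nat \<Rightarrow> ((int \<times> 'w) list \<Rightarrow> 'w) \<Rightarrow> ((int \<times> 'v) list \<Rightarrow> 'w) \<Rightarrow> bool" where
  "stage md U X p N q \<phi> \<longleftrightarrow> adm md X X (- 1) q \<and> adm md U X 0 \<phi> \<and> (\<forall>d x. q [(d, x)] = dU X d x) \<and>
     (\<forall>w. w \<noteq> [] \<and> length w \<le> N \<longrightarrow> ins (sy md) (- 1) q q w = 0) \<and>
     (\<forall>w. w \<noteq> [] \<and> length w \<le> N \<longrightarrow> ins (sy md) (- 1) p \<phi> w = cm (sy md) \<phi> q w)"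

text \<open>The failures \<open>R\<close> and \<open>E\<close> of the equations in arity \<open>N + 1\<close> form a cycle of the mapping cone: evaluating
  \<open>D\<^sup>2 D = D D\<^sup>2\<close> and \<open>D (\<Phi> D - D \<Phi>) + (\<Phi> D - D \<Phi>) D = \<Phi> D\<^sup>2 - D\<^sup>2 \<Phi>\<close> on words of length \<open>N + 1\<close>, only the
  unary components can meet \<open>R\<close> and \<open>E\<close>, which vanish on shorter words.\<close>

lemma extension_step:
  fixes U :: "('k::field_char_0, 'v::ab_group_add) complex_data"
    and X :: "('k, 'w::ab_group_add) complex_data"
  assumes U: "complex U" and X: "complex X"
    and p: "adm md U U (- 1) p" "\<And>d x. p [(d, x)] = dU U d x" "\<And>w. w \<noteq> [] \<Longrightarrow> ins (sy md) (- 1) p p w = 0"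
    and st: "stage md U X p N q \<phi>" and N: "1 \<le> N" and qi: "quism U X (\<lambda>d x. \<phi> [(d, x)])"
  shows "\<exists>q' \<phi>'. stage md U X p (Suc N) q' \<phi>' \<and> 
    (\<forall>w. length w \<le> N \<longrightarrow> q' w = q w) \<and> (\<forall>w. length w \<le> N \<longrightarrow> \<phi>' w = \<phi> w)"
proof -
  interpret X: complex X by fact
  let ?s = "sy md" and ?n = "Suc N" and ?F = "\<lambda>d x. \<phi> [(d, x)]"
  have q: "adm md X X (- 1) q" "\<And>d x. q [(d, x)] = dU X d x" and \<phi>: "adm md U X 0 \<phi>"
    using st by (simp_all add: stage_def)
  note qa = adm_addv[OF q(1)] and \<phi>a = adm_addv[OF \<phi>]
  define R where "R = ins ?s (- 1) q q"
  define E where "E w = ins ?s (- 1) p \<phi> w - cm ?s \<phi> q w" for w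
  have R0: "R w = 0" if "w \<noteq> []" "length w < ?n" for w using st that by (simp add: stage_def R_def)
  have E0: "E w = 0" if "w \<noteq> []" "length w < ?n" for w using st that by (simp add: stage_def E_def)
  have R: "adm md X X (- 2) R" unfolding R_def using adm_ins[OF X q(1) q(1)] by simp
  have "adm md U X (- 1) (ins ?s (- 1) p \<phi>)" using adm_ins[OF X p(1) \<phi>] by simp
  then have E: "adm md U X (- 1) E" unfolding E_def by (rule adm_diff[OF X _ adm_cm[OF X \<phi> q(1)]])
  have q_top: "q [(d, x)] = bd X x" if "x \<in> grade X d" for d x using that by (simp add: q(2) dU_def X.component_same)
  have dR: "dl X X (- 2) R w = 0" if w: "length w = ?n" for w
  proof -
    have ne: "w \<noteq> []" using w by auto
    have "der (- 1) (dU X) R w = ins ?s (- 1) q R w"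
      using ins_lead[of w R ?s "- 1" q] R0 w by (simp add: q(2))
    also have "\<dots> = ins ?s (- 2) R q w" unfolding R_def using ins_ins[of "- 1" q ?s q w] qa by simp
    also have "\<dots> = q [hat (- 2) R w]" using ins_top[OF qa ne, of R ?s "- 2"] R0 w by simp
    also have "\<dots> = bd X (R w)" unfolding hat_def by (rule q_top) (use adm_grade[OF R ne] in simp)
    finally show ?thesis by (simp add: dl_def ksgn_even)
  qed
  have dE: "dl U X (- 1) E w = - R (lmap ?F w)" if w: "length w = ?n" for w
  proof -
    have ne: "w \<noteq> []" using w by auto
    have "bd X (E w) = q [hat (- 1) E w]"
      unfolding hat_def by (rule q_top[symmetric]) (use adm_grade[OF E ne] in simp)
    also have "\<dots> = cmd ?s (- 1) \<phi> E q w" using cmd_top[OF qa ne, of E ?s "- 1" \<phi>] E0 w by simp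
    also have "\<dots> = ins ?s (- 1) p (cm ?s \<phi> q) w - cm ?s \<phi> R w"
      unfolding E_def R_def cmd_rdiff[OF qa] ins_cm[OF qa] cm_ins[OF qa] ..
    finally have 1: "bd X (E w) = \<dots>" .
    have "der (- 1) (dU U) E w = ins ?s (- 1) p E w"
      using ins_lead[of w E ?s "- 1" p] E0 w by (simp add: p(2))
    also have "\<dots> = ins ?s (- 1) p (ins ?s (- 1) p \<phi>) w - ins ?s (- 1) p (cm ?s \<phi> q) w"
      unfolding E_def ins_diff ..
    also have "ins ?s (- 1) p (ins ?s (- 1) p \<phi>) w = ins ?s (- 2) (ins ?s (- 1) p p) \<phi> w"
      using ins_ins[of "- 1" \<phi> ?s p w] \<phi>a by simp
    also have "\<dots> = 0" by (rule ins_t0'[OF \<phi>a]) (rule p(3))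
    finally have 2: "der (- 1) (dU U) E w = - ins ?s (- 1) p (cm ?s \<phi> q) w" by simp
    have "cm ?s \<phi> R w = R (lmap ?F w)" by (rule cm_lead) (use R0 w in auto)
    then show ?thesis unfolding dl_def 1 2 by (simp add: ksgn_odd)
  qed
  obtain r \<psi> where r: "adm md X X (- 1) r" "\<And>w. length w = ?n \<Longrightarrow> dl X X (- 1) r w = - R w"
    and \<psi>: "adm md U X 0 \<psi>" "\<And>w. length w = ?n \<Longrightarrow> dl U X 0 \<psi> w = E w - r (lmap ?F w)"
    using cone_acyclic[OF U X qi R E dR dE] by blast
  define r' where "r' w = (if length w = ?n then r w else 0)" for w
  define \<psi>' where "\<psi>' w = (if length w = ?n then \<psi> w else 0)" for w
  let ?q = "\<lambda>w. q w + r' w" and ?\<phi> = "\<lambda>w. \<phi> w + \<psi>' w"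
  have q': "adm md X X (- 1) ?q" unfolding r'_def by (rule adm_add[OF X q(1) adm_restrict[OF X r(1)]])
  have \<phi>': "adm md U X 0 ?\<phi>" unfolding \<psi>'_def by (rule adm_add[OF X \<phi> adm_restrict[OF X \<psi>(1)]])
  have same: "?q w = q w" "?\<phi> v = \<phi> v" if "length w \<le> N" "length v \<le> N" for w v
    using that by (simp_all add: r'_def \<psi>'_def)
  have q1: "?q [(d, x)] = dU X d x" for d x using same(1)[of "[(d, x)]" "[]"] N q(2) by simp
  have \<phi>1: "?\<phi> [(d, x)] = \<phi> [(d, x)]" for d x using same(2)[of "[]" "[(d, x)]"] N by simp
  have A: "ins ?s (- 1) ?q ?q w = 0" if w: "w \<noteq> []" "length w \<le> Suc N" for w
  proof (cases "length w = Suc N")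
    case False
    then have "ins ?s (- 1) ?q ?q w = ins ?s (- 1) q q w"
      using w by (intro ins_cong[where H = UNIV] same(1)[where v = "[]"]) auto
    then show ?thesis using st w False by (simp add: stage_def)
  next
    case True
    have "ins ?s (- 1) ?q r' w = der (- 1) (dU X) r' w"
      using ins_lead[of w r' ?s "- 1" ?q] True by (simp add: q1) (simp add: r'_def)
    also have "\<dots> = der (- 1) (dU X) r w" by (rule der_cong_length) (simp add: r'_def True)
    finally have 1: "ins ?s (- 1) ?q r' w = \<dots>" .
    have "ins ?s (- 1) r' q w = q [hat (- 1) r' w]" by (rule ins_top[OF qa w(1)]) (simp add: r'_def True)
    also have "\<dots> = bd X (r w)"
      unfolding hat_def using adm_grade[OF r(1) w(1)] by (simp add: r'_def True q_top)
    finally have 2: "ins ?s (- 1) r' q w = \<dots>" .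
    have "ins ?s (- 1) ?q ?q w = R w + bd X (r w) + der (- 1) (dU X) r w"
      unfolding ins_add ins_tadd[OF qa] 1 2 R_def ..
    also have "\<dots> = 0" using r(2)[OF True] by (simp add: dl_def ksgn_odd add.assoc)
    finally show ?thesis .
  qed
  have B: "ins ?s (- 1) p ?\<phi> w = cm ?s ?\<phi> ?q w" if w: "w \<noteq> []" "length w \<le> Suc N" for w
  proof (cases "length w = Suc N")
    case False
    then have "ins ?s (- 1) p ?\<phi> w = ins ?s (- 1) p \<phi> w"
      using w by (intro ins_cong[where H = UNIV] same(2)[where w = "[]"]) auto
    moreover have "cm ?s ?\<phi> ?q w = cm ?s \<phi> q w"
      using w False by (intro cm_cong[where H = UNIV and H' = UNIV] same[where w = "[]"] same(1)[where v = "[]"]) auto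
    ultimately show ?thesis using st w False by (simp add: stage_def)
  next
    case True
    have "ins ?s (- 1) p \<psi>' w = der (- 1) (dU U) \<psi>' w"
      using ins_lead[of w \<psi>' ?s "- 1" p] True by (simp add: p(2)) (simp add: \<psi>'_def)
    also have "\<dots> = der (- 1) (dU U) \<psi> w" by (rule der_cong_length) (simp add: \<psi>'_def True)
    finally have 1: "ins ?s (- 1) p \<psi>' w = \<dots>" .
    have "cm ?s ?\<phi> r' w = r' (lmap (\<lambda>d x. ?\<phi> [(d, x)]) w)" by (rule cm_lead) (simp add: r'_def True)
    then have 2: "cm ?s ?\<phi> r' w = r (lmap ?F w)" unfolding \<phi>1 by (simp add: r'_def True)
    have "cm ?s ?\<phi> q w = cm ?s \<phi> q w + q [hat 0 \<psi>' w]"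
      by (rule cm_perturb[OF qa w(1)]) (simp add: \<psi>'_def True)
    also have "q [hat 0 \<psi>' w] = bd X (\<psi> w)"
      unfolding hat_def using adm_grade[OF \<psi>(1) w(1)] by (simp add: \<psi>'_def True q_top)
    finally have 3: "cm ?s ?\<phi> q w = cm ?s \<phi> q w + bd X (\<psi> w)" .
    show ?thesis
      unfolding ins_add cm_add 1 2 3 using \<psi>(2)[OF True] by (simp add: dl_def E_def algebra_simps)
  qed
  have "stage md U X p (Suc N) ?q ?\<phi>" unfolding stage_def using q' \<phi>' q1 A B by blast
  then show ?thesis
    using same(1)[where v = "[]"] same(2)[where w = "[]"] by (intro exI[of _ ?q] exI[of _ ?\<phi>]) auto
qed

section \<open>The extension theorem for maps on words\<close>

lemma adm_by_length:
  fixes f :: "(int \<times> 'u::ab_group_add) list \<Rightarrow> 'y::ab_group_add"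
  assumes "complex Y" "\<And>n. \<exists>g. adm md U Y e g \<and> (\<forall>w. length w = n \<longrightarrow> f w = g w)"
  shows "adm md U Y e f"
  unfolding adm_def
proof (intro conjI impI allI)
  show "mlin U (smul Y) f"
  proof (rule mlinI)
    fix u w :: "(int \<times> 'u) list" and d
    obtain g where g: "adm md U Y e g" "\<And>z. length z = length u + length w + 1 \<Longrightarrow> f z = g z"
      using assms(2)[of "length u + length w + 1"] by auto
    then have "(\<lambda>x. f (u @ (d, x) # w)) = (\<lambda>x. g (u @ (d, x) # w))" by auto
    then show "lind U (smul Y) d (\<lambda>x. f (u @ (d, x) # w))" using mlinD[OF adm_mlin[OF g(1)]] by simp
  qed
  show "f w \<in> grade Y (wdeg w + e)" if "w \<noteq> []" for w
    using assms(2)[of "length w"] adm_grade[OF _ that] by auto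
  show "graded_sym f" if md: "md = Lie"
  proof (rule graded_symI)
    fix u w :: "(int \<times> 'u) list" and a b
    obtain g where g: "adm md U Y e g" "\<And>z. length z = length u + length w + 2 \<Longrightarrow> f z = g z"
      using assms(2)[of "length u + length w + 2"] by auto
    then show "f (u @ a # b # w) = ksgn (fst a * fst b) (f (u @ b # a # w))"
      using graded_symD[OF adm_graded_sym[OF g(1) md], of u a b w] by simp
  qed
  show "shuffle_null f" if md: "md = Comm"
    unfolding shuffle_null_def
  proof (intro allI impI)
    fix u v :: "(int \<times> 'u) list" assume uv: "u \<noteq> []" "v \<noteq> []"
    obtain g where g: "adm md U Y e g" "\<And>z. length z = length u + length v \<Longrightarrow> f z = g z"
      using assms(2)[of "length u + length v"] by auto
    have "sh u v f = sh u v g" by (rule sh_cong) (rule g(2))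
    then show "sh u v f = 0" using adm_shuffle_null[OF g(1) md] uv by (simp add: shuffle_null_def)
  qed
qed

text \<open>The step is iterated by dependent choice. The components of each arity are eventually constant, so
  the limit is read off arity by arity.\<close>

theorem extension_words:
  fixes U :: "('k::field_char_0, 'v::ab_group_add) complex_data"
    and X :: "('k, 'w::ab_group_add) complex_data"
  assumes U: "complex U" and X: "complex X"
    and p: "adm md U U (- 1) p" "\<And>d x. p [(d, x)] = dU U d x" "\<And>w. w \<noteq> [] \<Longrightarrow> ins (sy md) (- 1) p p w = 0"
    and st: "stage md U X p N q \<phi>" and N: "1 \<le> N" and qi: "quism U X (\<lambda>d x. \<phi> [(d, x)])"
  shows "\<exists>q' \<phi>'. (\<forall>M. stage md U X p M q' \<phi>') \<and> 
    (\<forall>w. length w \<le> N \<longrightarrow> q' w = q w) \<and> (\<forall>w. length w \<le> N \<longrightarrow> \<phi>' w = \<phi> w)"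
proof -
  define Pr where "Pr k s \<longleftrightarrow> stage md U X p (N + k) (fst s) (snd s) \<and>
    (\<forall>d x. snd s [(d, x)] = \<phi> [(d, x)])" for k s
  define Qr where "Qr k s s' \<longleftrightarrow> (\<forall>w. length w \<le> N + k \<longrightarrow> fst s' w = fst s w) \<and>
      (\<forall>w. length w \<le> N + k \<longrightarrow> snd s' w = snd s w)"
    for k and s s' :: "((int \<times> 'w) list \<Rightarrow> 'w) \<times> ((int \<times> 'v) list \<Rightarrow> 'w)"
  have "\<exists>y. Pr (Suc k) y \<and> Qr k s y" if s: "Pr k s" for k s
  proof -
    have qi': "quism U X (\<lambda>d x. snd s [(d, x)])" using s qi by (simp add: Pr_def)
    obtain q' \<phi>' where "stage md U X p (Suc (N + k)) q' \<phi>'"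
      and "\<And>w. length w \<le> N + k \<Longrightarrow> q' w = fst s w" "\<And>w. length w \<le> N + k \<Longrightarrow> \<phi>' w = snd s w"
      using extension_step[OF U X p _ _ qi', of "N + k" "fst s"] s N by (auto simp: Pr_def)
    then show ?thesis
      using s N by (intro exI[of _ "(q', \<phi>')"]) (auto simp: Pr_def Qr_def)
  qed
  then obtain nx where nx: "\<And>k s. Pr k s \<Longrightarrow> Pr (Suc k) (nx k s) \<and> Qr k s (nx k s)" by metis
  define f where "f = rec_nat (q, \<phi>) nx"
  have f0: "f 0 = (q, \<phi>)" and fS: "f (Suc k) = nx k (f k)" for k by (simp_all add: f_def)
  have fP: "Pr k (f k)" for k
    using st nx by (induct k) (simp_all add: fS, simp add: Pr_def f0)
  have fQ: "Qr k (f k) (f (Suc k))" for k using nx[OF fP] by (simp add: fS)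
  have mono: "fst (f (k + j)) w = fst (f k) w" "snd (f (k + j)) v = snd (f k) v"
    if "length w \<le> N + k" "length v \<le> N + k" for k j w v
    using that fQ by (induct j) (simp_all add: Qr_def)
  define q' where "q' w = fst (f (length w)) w" for w
  define \<phi>' where "\<phi>' w = snd (f (length w)) w" for w
  have q'k: "q' w = fst (f k) w" if "length w \<le> N + k" for w k
    using mono(1)[of w k "[]" "length w - k"] mono(1)[of w "length w" "[]" "k - length w"] that
    by (cases "k \<le> length w") (simp_all add: q'_def)
  have \<phi>'k: "\<phi>' w = snd (f k) w" if "length w \<le> N + k" for w k
    using mono(2)[of "[]" k w "length w - k"] mono(2)[of "[]" "length w" w "k - length w"] that
    by (cases "k \<le> length w") (simp_all add: \<phi>'_def)
  have "stage md U X p M q' \<phi>'" for M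
    unfolding stage_def
  proof (intro conjI allI impI)
    show "adm md X X (- 1) q'"
    proof (rule adm_by_length[OF X])
      fix n
      show "\<exists>g. adm md X X (- 1) g \<and> (\<forall>w. length w = n \<longrightarrow> q' w = g w)"
        by (rule exI[of _ "fst (f n)"]) (use fP[of n] in \<open>auto simp: Pr_def stage_def intro!: q'k\<close>)
    qed
    show "adm md U X 0 \<phi>'"
    proof (rule adm_by_length[OF X])
      fix n
      show "\<exists>g. adm md U X 0 g \<and> (\<forall>w. length w = n \<longrightarrow> \<phi>' w = g w)"
        by (rule exI[of _ "snd (f n)"]) (use fP[of n] in \<open>auto simp: Pr_def stage_def intro!: \<phi>'k\<close>)
    qed
    show "q' [(d, x)] = dU X d x" for d x using fP[of 1] q'k[of "[(d, x)]" 1] by (simp add: Pr_def stage_def)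
  next
    fix w :: "(int \<times> 'w) list" assume w: "w \<noteq> [] \<and> length w \<le> M"
    have "ins (sy md) (- 1) q' q' w = ins (sy md) (- 1) (fst (f M)) (fst (f M)) w"
      by (rule ins_cong[where H = UNIV]) (use w in \<open>auto intro!: q'k\<close>)
    then show "ins (sy md) (- 1) q' q' w = 0" using fP[of M] w by (simp add: Pr_def stage_def)
  next
    fix w :: "(int \<times> 'v) list" assume w: "w \<noteq> [] \<and> length w \<le> M"
    have "ins (sy md) (- 1) p \<phi>' w = ins (sy md) (- 1) p (snd (f M)) w"
      by (rule ins_cong[where H = UNIV]) (use w in \<open>auto intro!: \<phi>'k\<close>)
    moreover have "cm (sy md) \<phi>' q' w = cm (sy md) (snd (f M)) (fst (f M)) w"
      by (rule cm_cong[where H = UNIV and H' = UNIV]) (use w in \<open>auto intro!: \<phi>'k q'k\<close>)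
    ultimately show "ins (sy md) (- 1) p \<phi>' w = cm (sy md) \<phi>' q' w"
      using fP[of M] w by (simp add: Pr_def stage_def)
  qed
  moreover have "q' w = q w \<and> \<phi>' v = \<phi> v" if "length w \<le> N" "length v \<le> N" for w v
    using q'k[of w 0] \<phi>'k[of v 0] that by (simp add: f0)
  from this[where v = "[]"] this[where w = "[]"]
  have "\<forall>w. length w \<le> N \<longrightarrow> q' w = q w" "\<forall>w. length w \<le> N \<longrightarrow> \<phi>' w = \<phi> w" by auto
  ultimately show ?thesis by (intro exI[of _ q'] exI[of _ \<phi>']) blast
qed

section \<open>Suspension\<close>

lemma susp_simps [simp]: "smul (susp V) = smul V" "grade (susp V) d = grade V (d - 1)"
  "bd (susp V) x = - bd V x"
  by (simp_all add: susp_def)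

lemma complex_susp:
  assumes "chain_complex V"
  shows "complex (susp V)"
proof
  interpret complex V by unfold_locales (rule assms)
  have "\<exists>!c. finite {d. c d \<noteq> 0} \<and> (\<forall>d. c d \<in> grade V (d - 1)) \<and> v = (\<Sum>d | c d \<noteq> 0. c d)" for v
  proof -
    have shift: "(\<Sum>d | c d \<noteq> 0. c d) = (\<Sum>d | c (d + k) \<noteq> 0. c (d + k))"
      "finite {d. c d \<noteq> 0} \<longleftrightarrow> finite {d. c (d + k) \<noteq> 0}" for c :: "int \<Rightarrow> 'b" and k
    proof -
      have b: "bij_betw (\<lambda>d. d + k) {d. c (d + k) \<noteq> 0} {d. c d \<noteq> 0}"
        by (rule bij_betw_byWitness[where f' = "\<lambda>d. d - k"]) auto
      show "(\<Sum>d | c d \<noteq> 0. c d) = (\<Sum>d | c (d + k) \<noteq> 0. c (d + k))"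
        by (rule sum.reindex_bij_betw[OF b, symmetric])
      show "finite {d. c d \<noteq> 0} \<longleftrightarrow> finite {d. c (d + k) \<noteq> 0}"
        using bij_betw_finite[OF b] by simp
    qed
    obtain c where c: "finite {d. c d \<noteq> 0}" "\<And>d. c d \<in> grade V d" "v = (\<Sum>d | c d \<noteq> 0. c d)"
      and u: "\<And>c'. finite {d. c' d \<noteq> 0} \<and> (\<forall>d. c' d \<in> grade V d) \<and> v = (\<Sum>d | c' d \<noteq> 0. c' d) \<Longrightarrow> c' = c"
      using decomp_ex1[of v] by blast
    show ?thesis
    proof (rule ex1I[of _ "\<lambda>d. c (d + - 1)"])
      show "finite {d. c (d + - 1) \<noteq> 0} \<and> (\<forall>d. c (d + - 1) \<in> grade V (d - 1)) \<and>
        v = (\<Sum>d | c (d + - 1) \<noteq> 0. c (d + - 1))"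
        using c shift[of c "- 1"] by simp
      fix c' assume c': "finite {d. c' d \<noteq> 0} \<and> (\<forall>d. c' d \<in> grade V (d - 1)) \<and> v = (\<Sum>d | c' d \<noteq> 0. c' d)"
      have "(\<lambda>d. c' (d + 1)) = c"
      proof (rule u, intro conjI allI)
        show "c' (d + 1) \<in> grade V d" for d using c' by (metis add_diff_cancel)
      qed (use c' shift[of c' 1] in auto)
      from fun_cong[OF this, of "_ - 1"] show "c' = (\<lambda>d. c (d + - 1))" by auto
    qed
  qed
  moreover have "Vector_Spaces.linear (smul V) (smul V) (\<lambda>x. - bd V x)"
    using bd_add bd_scale by (simp add: linear_iff vs.vector_space_axioms)
  moreover have "\<forall>d. \<forall>x\<in>grade V (d - 1). - bd V x \<in> grade V (d - 2)"
    using bd_grade[of _ "_ - 1"] grade_neg by fastforce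
  ultimately show "chain_complex (susp V)"
    using grade_subspace vs.vector_space_axioms
    unfolding chain_complex_def by (simp add: susp_def bd_minus)
qed

lemma chain_complex_complex: "chain_complex V \<Longrightarrow> complex V" by unfold_locales

lemma quism_susp:
  assumes V: "chain_complex V" and W: "chain_complex W" and q: "quasi_iso V W f"
  shows "quism (susp V) (susp W) (\<lambda>d x. f (component (susp V) d x))"
proof -
  interpret V: complex V by unfold_locales (rule V)
  interpret W: complex W by unfold_locales (rule W)
  interpret sV: complex "susp V" by (rule complex_susp[OF V])
  interpret sW: complex "susp W" by (rule complex_susp[OF W])
  have f: "f (x + y) = f x + f y" "f (smul V c x) = smul W c (f x)" "bd W (f x) = f (bd V x)"
    "x \<in> grade V d \<Longrightarrow> f x \<in> grade W d" for x y c d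
    using q by (auto simp: quasi_iso_def chain_map_def linear_iff)
  have fa: "addi f" by (simp add: addi_def f)
  have fd: "f (x - y) = f x - f y" for x y
    using f(1)[of x "- y"] addi_minus[OF fa, of y] by simp
  have zV: "0 \<in> bd V ` grade V d" and zW: "0 \<in> bd W ` grade W d" for d
    using imageI[OF V.grade_0[of d], of "bd V"] imageI[OF W.grade_0[of d], of "bd W"] by simp_all
  have hV: "(x, x) \<in> homologous V d" if "x \<in> cycles V d" for x d
    using that zV by (simp add: homologous_def)
  have symW: "(y, x) \<in> homologous W d" if xy: "(x, y) \<in> homologous W d" for x y d
  proof -
    obtain b where b: "b \<in> grade W (d + 1)" "x - y = bd W b" using xy by (auto simp: homologous_def)
    have "y - x = - (x - y)" by simp
    then have "y - x = bd W (- b)" unfolding b(2) by (simp add: W.bd_minus)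
    with W.grade_neg[OF b(1)] show ?thesis using xy by (auto simp: homologous_def)
  qed
  have trW: "(x, z) \<in> homologous W d" if xy: "(x, y) \<in> homologous W d" and yz: "(y, z) \<in> homologous W d" for x y z d
  proof -
    obtain b b' where b: "b \<in> grade W (d + 1)" "x - y = bd W b" "b' \<in> grade W (d + 1)" "y - z = bd W b'"
      using xy yz by (auto simp: homologous_def)
    have "x - z = (x - y) + (y - z)" by simp
    then have "x - z = bd W (b + b')" unfolding b W.bd_add .
    then show ?thesis using xy yz W.grade_add[OF b(1,3)] by (auto simp: homologous_def)
  qed
  have fhom: "(f x, f y) \<in> homologous W d" if xy: "(x, y) \<in> homologous V d" for x y d
  proof -
    obtain b where b: "b \<in> grade V (d + 1)" "x - y = bd V b" using xy by (auto simp: homologous_def)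
    have "f x - f y = bd W (f b)" unfolding fd[symmetric] b(2) f(3) ..
    then have "f x - f y \<in> bd W ` grade W (d + 1)" using f(4)[OF b(1)] by auto
    moreover have "f x \<in> cycles W d" if "x \<in> cycles V d" for x
      using that addi_0[OF fa] by (simp add: cycles_def f)
    ultimately show ?thesis using xy by (auto simp: homologous_def)
  qed
  let ?H = "\<lambda>d c. homologous W d `` (f ` c)"
  have HV: "?H d (homologous V d `` {x}) = homologous W d `` {f x}" if "x \<in> cycles V d" for d x
  proof
    show "?H d (homologous V d `` {x}) \<subseteq> homologous W d `` {f x}" using fhom trW by blast
    show "homologous W d `` {f x} \<subseteq> ?H d (homologous V d `` {x})" using hV[OF that] by blast
  qed
  have bij: "bij_betw (?H d) (homology V d) (homology W d)" for d using q by (simp add: quasi_iso_def)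
  have inj: "\<exists>y\<in>grade V (d + 1). z = bd V y"
    if z: "z \<in> grade V d" "bd V z = 0" and y: "y \<in> grade W (d + 1)" "f z = bd W y" for d z y
  proof -
    have cz: "z \<in> cycles V d" "0 \<in> cycles V d" using z by (auto simp: cycles_def)
    have "(f z, f 0) \<in> homologous W d"
      using y z f(4)[OF z(1)] by (auto simp: homologous_def cycles_def addi_0[OF fa])
    then have "homologous W d `` {f z} = homologous W d `` {f 0}" using symW trW by blast
    then have "?H d (homologous V d `` {z}) = ?H d (homologous V d `` {0})" using HV cz by simp
    then have "homologous V d `` {z} = homologous V d `` {0}"
      using bij[of d] cz by (auto simp: bij_betw_def homology_def quotient_def inj_on_def)
    then have "(0, z) \<in> homologous V d" using hV[OF cz(1)] by blast
    then obtain b where "b \<in> grade V (d + 1)" "- z = bd V b" by (auto simp: homologous_def)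
    then show ?thesis using V.grade_neg[of b] V.bd_minus[of b] by (metis minus_minus)
  qed
  have surj: "\<exists>z\<in>grade V d. bd V z = 0 \<and> (\<exists>x\<in>grade W (d + 1). y - f z = bd W x)"
    if y: "y \<in> grade W d" "bd W y = 0" for d y
  proof -
    have "homologous W d `` {y} \<in> homology W d" using y by (auto simp: homology_def quotient_def cycles_def)
    then obtain c where c: "c \<in> homology V d" "?H d c = homologous W d `` {y}"
      using bij_betw_imp_surj_on[OF bij[of d]] by (metis (no_types, lifting) imageE)
    then obtain z where z: "z \<in> cycles V d" "c = homologous V d `` {z}" by (auto simp: homology_def quotient_def)
    have "homologous W d `` {f z} = homologous W d `` {y}" using c HV z by simp
    moreover have "(y, y) \<in> homologous W d" using y zW by (simp add: homologous_def cycles_def)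
    ultimately have "(y, f z) \<in> homologous W d" using symW by blast
    then show ?thesis using z by (auto simp: homologous_def cycles_def)
  qed
  show ?thesis
    unfolding quism_def
  proof (intro conjI allI ballI impI)
    have g: "f (component (susp V) d x) \<in> grade W (d - 1)" for d x
      by (rule f(4)) (use sV.component_grade[of d x] in simp)
    show "chainl (susp V) (susp W) (\<lambda>d x. f (component (susp V) d x))"
    proof -
      have "letl (susp V) (susp W) 0 (\<lambda>d x. f (component (susp V) d x))"
        using g sV.component_scale by (simp add: letl_def lind_def sV.component_add f)
      moreover have "f (component (susp V) (d - 1) (dU (susp V) d x)) = dU (susp W) d (f (component (susp V) d x))" for d x
      proof -
        have "component (susp V) (d - 1) (dU (susp V) d x) = dU (susp V) d x"
          by (rule sV.component_same) (use sV.bd_grade[OF sV.component_grade, of d x] in \<open>simp add: dU_def\<close>)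
        moreover have "component (susp W) d (f (component (susp V) d x)) = f (component (susp V) d x)"
          by (rule sW.component_same) (use g in simp)
        ultimately show ?thesis by (simp add: dU_def f addi_minus[OF fa])
      qed
      ultimately show ?thesis by (simp add: chainl_def)
    qed
  next
    fix d z assume z: "z \<in> grade (susp V) d" "bd (susp V) z = 0"
      and "\<exists>y\<in>grade (susp W) (d + 1). f (component (susp V) d z) = bd (susp W) y"
    then obtain y where y: "y \<in> grade W d" "f z = - bd W y" by (auto simp: sV.component_same)
    have z': "z \<in> grade V (d - 1)" "bd V z = 0" using z by simp_all
    have "\<exists>y\<in>grade V (d - 1 + 1). z = bd V y"
      by (rule inj[OF z', of "- y"]) (use y in \<open>auto simp: W.grade_neg W.bd_minus\<close>)
    then obtain x where "x \<in> grade V d" "z = bd V x" by auto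
    then show "\<exists>y\<in>grade (susp V) (d + 1). z = bd (susp V) y"
      by (intro bexI[of _ "- x"]) (auto simp: V.grade_neg V.bd_minus)
  next
    fix d y assume y: "y \<in> grade (susp W) d" "bd (susp W) y = 0"
    then have y': "y \<in> grade W (d - 1)" "bd W y = 0" by simp_all
    from surj[OF this] obtain z x where zx: "z \<in> grade V (d - 1)" "bd V z = 0"
      "x \<in> grade W d" "y - f z = bd W x" by auto
    have "component (susp V) d z = z" by (rule sV.component_same) (use zx in simp)
    then show "\<exists>z\<in>grade (susp V) d. bd (susp V) z = 0 \<and>
       (\<exists>x\<in>grade (susp W) (d + 1). y - f (component (susp V) d z) = bd (susp W) x)"
      using zx by (intro bexI[of _ z] conjI bexI[of _ "- x"]) (auto simp: W.grade_neg W.bd_minus)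
  qed
qed

section \<open>Multilinear maps on vectors and on words\<close>

text \<open>A letter \<open>(d, x)\<close> stands for the component of \<open>x\<close> of degree \<open>d\<close>. Every list of degrees and vectors is
  thus a word, and every word gives a list of homogeneous arguments.\<close>

definition args :: "('k::field, 'v::ab_group_add) complex_data \<Rightarrow> (int \<times> 'v) list \<Rightarrow> 'v list" where
  "args U w = map (\<lambda>a. component U (fst a) (snd a)) w"

lemma args_simps [simp]: "args U [] = []" "args U (a # w) = component U (fst a) (snd a) # args U w"
  "args U (u @ w) = args U u @ args U w" "length (args U w) = length w"
  by (simp_all add: args_def)

lemma homogeneous_args: "complex U \<Longrightarrow> homogeneous U (map fst w) (args U w)"
  unfolding homogeneous_def args_def list.rel_map
  by (rule list.rel_refl) (simp add: complex.component_grade)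

lemma args_zip:
  assumes "complex U" "homogeneous U ds xs"
  shows "args U (zip ds xs) = xs \<and> map fst (zip ds xs) = ds"
  using assms(2) unfolding homogeneous_def
  by (induct rule: list_all2_induct) (simp_all add: complex.component_same[OF assms(1)])

lemma multi_hom_additive:
  assumes "multi_hom U X n e f" "length us + length vs + 1 = n"
  shows "f (us @ (x + y) # vs) = f (us @ x # vs) + f (us @ y # vs)"
    "f (us @ smul U c x # vs) = smul X c (f (us @ x # vs))"
  using assms by (auto simp: multi_hom_def linear_iff)

lemma multi_hom_addi:
  assumes "multi_hom U X n e f" "length us + length vs + 1 = n"
  shows "addi (\<lambda>x. f (us @ x # vs))"
  using multi_hom_additive(1)[OF assms] by (simp add: addi_def)

lemma multi_hom_grade:
  assumes "multi_hom U X n e f" "complex U" "length w = n"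
  shows "f (args U w) \<in> grade X (wdeg w + e)"
  using assms homogeneous_args[OF assms(2), of w] by (simp add: multi_hom_def wdeg_def)

text \<open>Words carry the suspended degrees; \<open>sg\<close> is a sign that depends on the degrees only.\<close>

definition tagged :: "('k::field, 'v::ab_group_add) complex_data \<Rightarrow> (int list \<Rightarrow> int) \<Rightarrow> (nat \<Rightarrow> 'v list \<Rightarrow> 'y::ab_group_add)
   \<Rightarrow> (int \<times> 'v) list \<Rightarrow> 'y" where
  "tagged U sg f w = ksgn (sg (map fst w)) (f (length w) (args U w))"

lemma adm_tagged:
  fixes U :: "('k::field, 'v::ab_group_add) complex_data"
  assumes "complex U" "complex X" "\<And>n. n \<ge> 1 \<Longrightarrow> multi_hom U X n e (f n)"
    and "md = Lie \<Longrightarrow> graded_sym (tagged U sg f)" "md = Comm \<Longrightarrow> shuffle_null (tagged U sg f)"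
  shows "adm md U X e (tagged U sg f)"
proof -
  interpret U: complex U by fact
  interpret X: complex X by fact
  have "mlin U (smul X) (tagged U sg f)"
  proof (rule mlinI)
    fix u w :: "(int \<times> 'v) list" and d
    let ?n = "length u + length w + 1"
    have m: "multi_hom U X ?n e (f ?n)" by (rule assms(3)) simp
    have "lind U (smul X) d (\<lambda>x. f ?n (args U u @ component U d x # args U w))"
      using multi_hom_additive[OF m, of "args U u" "args U w"]
      by (simp add: lind_def U.component_add U.component_scale)
    then show "lind U (smul X) d (\<lambda>x. tagged U sg f (u @ (d, x) # w))"
      using lcl_ksgn[OF lcl_lind[OF X.vs.vector_space_axioms], of U d
        "\<lambda>x. f ?n (args U u @ component U d x # args U w)" "sg (map fst u @ d # map fst w)"]
      by (simp add: tagged_def)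
  qed
  moreover have "tagged U sg f w \<in> grade X (wdeg w + e)" if "w \<noteq> []" for w
    unfolding tagged_def
    by (rule X.grade_ksgn, rule multi_hom_grade[OF assms(3) assms(1)]) (use that in \<open>cases w; auto\<close>)+
  ultimately show ?thesis using assms(4,5) by (simp add: adm_def)
qed

text \<open>Conversely, a multilinear map on words of homogeneous letters extends to all vectors, by
  decomposing every argument into its components.\<close>

primrec ext :: "('k::field, 'v::ab_group_add) complex_data \<Rightarrow> ((int \<times> 'v) list \<Rightarrow> 'y::ab_group_add) \<Rightarrow> 'v list \<Rightarrow> 'y"
  where
  "ext U f [] = f []"
| "ext U f (x # xs) = (\<Sum>d | component U d x \<noteq> 0. ext U (\<lambda>z. f ((d, x) # z)) xs)"

lemma ext_zero: "ext U (\<lambda>_. 0) xs = 0" by (induct xs) simp_all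

lemma ext_ksgn: "ext U (\<lambda>w. ksgn e (f w)) xs = ksgn e (ext U f xs)"
  by (induct xs arbitrary: f) (simp_all add: ksgn_sum)

lemma ext_args:
  assumes U: "complex U" and f: "mlin U sc f"
  shows "ext U f (args U w) = f w"
  using f
proof (induct w arbitrary: f)
  case (Cons a w)
  interpret complex U by (rule U)
  obtain d x where a: "a = (d, x)" by force
  let ?y = "component U d x"
  have e: "{d'. component U d' ?y \<noteq> 0} = (if ?y = 0 then {} else {d})"
    using component_other[OF component_grade[of d x]] by auto
  have 1: "f ((d, ?y) # z) = f ((d, x) # z)" for z using lindD(3)[OF mlinD0[OF Cons(2)]] .
  have "ext U (\<lambda>z. f ((d, ?y) # z)) (args U w) = f ((d, x) # w)"
    unfolding 1 by (rule Cons(1)) (rule mlin_Cons[OF Cons(2)])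
  moreover have "f ((d, x) # w) = 0" if "?y = 0"
    using 1[of w] that addv_zero[OF mlin_addv[OF Cons(2)], of "[]"] by simp
  ultimately show ?case unfolding a by (cases "?y = 0") (simp_all add: e)
qed simp

lemma ext_lin:
  assumes U: "complex U" and sc: "vector_space sc" and f: "mlin U sc f"
  shows "Vector_Spaces.linear (smul U) sc (\<lambda>x. ext U f (us @ x # vs))"
proof -
  interpret complex U by (rule U)
  interpret sc: vector_space sc by (rule sc)
  have l: "lind U sc d (\<lambda>v. ext U (\<lambda>z. F v z) vs)" if "\<And>z. lind U sc d (\<lambda>v. F v z)" for F d vs
    using that
  proof (induct vs arbitrary: F)
    case (Cons y vs)
    have "lind U sc d (\<lambda>v. \<Sum>e\<in>A. ext U (\<lambda>z. F v ((e, y) # z)) vs)" if "finite A" for A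
      using that
    proof (induct A)
      case empty
      show ?case using lcl_0[OF lcl_lind[OF sc]] by simp
    next
      case (insert e A)
      have "lind U sc d (\<lambda>v. ext U (\<lambda>z. F v ((e, y) # z)) vs)"
        by (rule Cons(1)[of "\<lambda>v z. F v ((e, y) # z)"]) (rule Cons(2))
      from lcl_add[OF lcl_lind[OF sc], OF this insert(3)] show ?case using insert(1,2) by simp
    qed
    from this[OF component_props(1)] show ?case by simp
  qed simp
  have "(\<forall>x y. ext U f (us @ (x + y) # vs) = ext U f (us @ x # vs) + ext U f (us @ y # vs)) \<and>
    (\<forall>c x. ext U f (us @ smul U c x # vs) = sc c (ext U f (us @ x # vs)))"
    using f
  proof (induct us arbitrary: f)
    case Nil
    let ?g = "\<lambda>d x. ext U (\<lambda>z. f ((d, x) # z)) vs"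
    have g: "lind U sc d (?g d)" for d by (rule l[of d "\<lambda>v z. f ((d, v) # z)"]) (rule mlinD0[OF Nil])
    have g0: "?g d x = 0" if "component U d x = 0" for d x
      using lindD(3)[OF g[of d], of x] addi_0[OF lind_addi[OF g[of d]]] that by simp
    have big: "(\<Sum>d | component U d x \<noteq> 0. ?g d x) = (\<Sum>d\<in>A. ?g d x)"
      if "finite A" "{d. component U d x \<noteq> 0} \<subseteq> A" for A x
      by (rule sum.mono_neutral_left[OF that]) (auto intro: g0)
    show ?case
    proof (intro conjI allI)
      fix x y
      let ?A = "{d. component U d x \<noteq> 0} \<union> {d. component U d y \<noteq> 0}"
      have A: "finite ?A" by (simp add: component_props)
      have s: "{d. component U d (x + y) \<noteq> 0} \<subseteq> ?A" by (auto simp: component_add)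
      show "ext U f ([] @ (x + y) # vs) = ext U f ([] @ x # vs) + ext U f ([] @ y # vs)"
        using big[OF A s] big[OF A, of x] big[OF A, of y] by (simp add: lindD(1)[OF g] sum.distrib)
    next
      fix c x
      have "{d. component U d (smul U c x) \<noteq> 0} \<subseteq> {d. component U d x \<noteq> 0}" by (auto simp: component_scale)
      from big[OF component_props(1) this]
      show "ext U f ([] @ smul U c x # vs) = sc c (ext U f ([] @ x # vs))"
        by (simp add: lindD(2)[OF g] sc.scale_sum_right)
    qed
  next
    case (Cons a us)
    have "(\<forall>x y. ext U (\<lambda>z. f ((d, a) # z)) (us @ (x + y) # vs) =
       ext U (\<lambda>z. f ((d, a) # z)) (us @ x # vs) + ext U (\<lambda>z. f ((d, a) # z)) (us @ y # vs)) \<and>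
      (\<forall>c x. ext U (\<lambda>z. f ((d, a) # z)) (us @ smul U c x # vs) = sc c (ext U (\<lambda>z. f ((d, a) # z)) (us @ x # vs)))" for d
      by (rule Cons(1)) (rule mlin_Cons[OF Cons(2)])
    then show ?case by (simp add: sum.distrib sc.scale_sum_right)
  qed
  then show ?thesis by (simp add: linear_iff vs.vector_space_axioms sc)
qed

lemma multi_hom_ext:
  fixes U :: "('k::field, 'v::ab_group_add) complex_data"
  assumes U: "complex U" and X: "complex X" and f: "adm md U X e f" and n: "n \<ge> 1"
  shows "multi_hom U X n e (ext U f)"
proof -
  interpret X: complex X by (rule X)
  show ?thesis
    unfolding multi_hom_def
  proof (intro conjI allI impI)
    fix us vs :: "'v list" assume "length us + length vs + 1 = n"
    show "Vector_Spaces.linear (smul U) (smul X) (\<lambda>x. ext U f (us @ x # vs))"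
      by (rule ext_lin[OF U X.vs.vector_space_axioms adm_mlin[OF f]])
  next
    fix ds xs assume *: "length xs = n \<and> homogeneous U ds xs"
    then have z: "args U (zip ds xs) = xs" "map fst (zip ds xs) = ds" and ne: "zip ds xs \<noteq> []"
      using args_zip[OF U, of ds xs] n by auto
    have "ext U f xs = f (zip ds xs)" using ext_args[OF U adm_mlin[OF f], of "zip ds xs"] z by simp
    then show "ext U f xs \<in> grade X (sum_list ds + e)"
      using adm_grade[OF f ne] z(2) by (simp add: wdeg_def)
  qed
qed

lemma ext_sym:
  assumes U: "complex U" and f: "mlin U sc f" "graded_sym f" and x: "x \<in> grade U c" "y \<in> grade U d"
  shows "ext U f (us @ x # y # vs) = ksgn (c * d) (ext U f (us @ y # x # vs))"
  using f
proof (induct us arbitrary: f)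
  case Nil
  interpret complex U by (rule U)
  have one: "(\<Sum>d' | component U d' x \<noteq> 0. G d') = G d" if "x \<in> grade U d" "x = 0 \<Longrightarrow> G d = 0" for G :: "int \<Rightarrow> 'c" and x d
  proof -
    have "{d'. component U d' x \<noteq> 0} = (if x = 0 then {} else {d})"
      using component_other[OF that(1)] component_same[OF that(1)] by auto
    then show ?thesis using that(2) by simp
  qed
  have ad: "addv f" by (rule mlin_addv[OF Nil(1)])
  have z: "ext U (\<lambda>z. f ((c, x) # (d, y) # z)) vs = 0" if "x = 0 \<or> y = 0" for c x d y
    using that addv_zero[OF ad, of "[]"] addv_zero[OF ad, of "[(c, x)]"] by (auto simp: ext_zero)
  have two: "ext U f (x # y # vs) = ext U (\<lambda>z. f ((c, x) # (d, y) # z)) vs"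
    if "x \<in> grade U c" "y \<in> grade U d" for x y c d
  proof -
    have "(\<Sum>d' | component U d' y \<noteq> 0. ext U (\<lambda>z. f ((c', x) # (d', y) # z)) vs) = ext U (\<lambda>z. f ((c', x) # (d, y) # z)) vs" for c'
      by (rule one[OF that(2)]) (simp add: z)
    then show ?thesis by (simp) (rule one[OF that(1)], simp add: z)
  qed
  have "f ((c, x) # (d, y) # z) = ksgn (c * d) (f ((d, y) # (c, x) # z))" for z
    using graded_symD0[OF Nil(2), of "(c, x)" "(d, y)" z] by simp
  then show ?case using two[OF x] two[OF x(2,1)] by (simp add: ext_ksgn)
next
  case (Cons a us)
  have "ext U (\<lambda>z. f ((e, a) # z)) (us @ x # y # vs) = ksgn (c * d) (ext U (\<lambda>z. f ((e, a) # z)) (us @ y # x # vs))" for e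
    by (rule Cons(1)) (rule mlin_Cons[OF Cons(2)], rule graded_sym_Cons[OF Cons(3)])
  then show ?case by (simp add: ksgn_sum)
qed

lemma sum_list_shift: "sum_list (map (\<lambda>d. d + k) ds) = sum_list ds + k * int (length ds)"
  by (induct ds) (simp_all add: algebra_simps)

lemma homogeneous_length: "homogeneous U ds xs \<Longrightarrow> length ds = length xs"
  by (auto simp: homogeneous_def dest: list_all2_lengthD)

lemma multi_hom_susp:
  assumes f: "multi_hom V W n e f" and e': "e' = e - int n + 1"
  shows "multi_hom (susp V) (susp W) n e' f"
  unfolding multi_hom_def
proof (intro conjI allI impI)
  show "Vector_Spaces.linear (smul (susp V)) (smul (susp W)) (\<lambda>x. f (us @ x # vs))"
    if "length us + length vs + 1 = n" for us vs
    using f that by (simp add: multi_hom_def)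
next
  fix ds xs assume *: "length xs = n \<and> homogeneous (susp V) ds xs"
  then have "homogeneous V (map (\<lambda>d. d + - 1) ds) xs" by (simp add: homogeneous_def list.rel_map)
  then have "f xs \<in> grade W (sum_list (map (\<lambda>d. d + - 1) ds) + e)"
    using f * unfolding multi_hom_def by blast
  moreover have "sum_list (map (\<lambda>d. d + - 1) ds) = sum_list ds - int n"
    using sum_list_shift[of "- 1" ds] homogeneous_length[of "susp V" ds xs] * by simp
  ultimately have "f xs \<in> grade W (sum_list ds - int n + e)" by (simp only:)
  then show "f xs \<in> grade (susp W) (sum_list ds + e')" by (simp add: e' algebra_simps)
qed

lemma multi_hom_unsusp:
  assumes f: "multi_hom (susp V) (susp W) n e' f" and e': "e' = e - int n + 1"
  shows "multi_hom V W n e f"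
  unfolding multi_hom_def
proof (intro conjI allI impI)
  show "Vector_Spaces.linear (smul V) (smul W) (\<lambda>x. f (us @ x # vs))"
    if "length us + length vs + 1 = n" for us vs
    using f that by (simp add: multi_hom_def)
next
  fix ds xs assume *: "length xs = n \<and> homogeneous V ds xs"
  then have "homogeneous (susp V) (map (\<lambda>d. d + 1) ds) xs" by (simp add: homogeneous_def list.rel_map)
  then have "f xs \<in> grade (susp W) (sum_list (map (\<lambda>d. d + 1) ds) + e')"
    using f * unfolding multi_hom_def by blast
  moreover have "sum_list (map (\<lambda>d. d + 1) ds) = sum_list ds + int n"
    using sum_list_shift[of 1 ds] homogeneous_length[of V ds xs] * by simp
  ultimately have "f xs \<in> grade (susp W) (sum_list ds + int n + e')" by (simp only:)
  then show "f xs \<in> grade W (sum_list ds + e)" by (simp add: e' algebra_simps)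
qed

section \<open>Contractions and partitions as explicit sums\<close>

lemma spl_sum: "spl False g w = (\<Sum>k=0..length w. g (take k w) (drop k w))"
proof (induct w arbitrary: g)
  case (Cons a w)
  have "(\<Sum>k=0..length (a # w). g (take k (a # w)) (drop k (a # w))) =
    g [] (a # w) + (\<Sum>k=0..length w. g (a # take k w) (drop k w))"
    by (simp add: sum.atLeast0_atMost_Suc_shift del: sum.cl_ivl_Suc)
  then show ?case by (simp add: Cons add.commute)
qed simp

lemma ins_sum: "ins False e t f w = (\<Sum>s<length w. ksgn (e * wdeg (take s w))
    (\<Sum>j=1..length w - s. f (take s w @ hat e t (take j (drop s w)) # drop (s + j) w)))"
proof (induct w arbitrary: f)
  case (Cons a w)
  have 1: "(\<Sum>j=Suc 0..Suc (length w). f (hat e t (take j (a # w)) # drop j (a # w)))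
    = spl False (\<lambda>x y. f (hat e t (a # x) # y)) w"
    unfolding spl_sum sum.shift_bounds_cl_Suc_ivl by simp
  have 2: "(\<Sum>s<length w. ksgn (e * wdeg (take (Suc s) (a # w)))
      (\<Sum>j=1..length (a # w) - Suc s. f (take (Suc s) (a # w) @ hat e t (take j (drop (Suc s) (a # w))) # drop (Suc s + j) (a # w))))
    = ksgn (e * fst a) (ins False e t (\<lambda>z. f (a # z)) w)"
    by (simp add: Cons ksgn_sum ksgn_ksgn distrib_left)
  show ?case
    unfolding ins.simps 2[symmetric] list.size(4) add_Suc_right add_0_right
    by (subst sum.lessThan_Suc_shift) (simp add: 1 del: sum.cl_ivl_Suc)
qed simp

lemma ins_sum_swap: "ins False e t f w = (\<Sum>j=1..length w. \<Sum>s=0..length w - j.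
    ksgn (e * wdeg (take s w)) (f (take s w @ hat e t (take j (drop s w)) # drop (s + j) w)))"
proof -
  let ?N = "length w"
  let ?g = "\<lambda>s j. ksgn (e * wdeg (take s w)) (f (take s w @ hat e t (take j (drop s w)) # drop (s + j) w))"
  have "ins False e t f w = (\<Sum>s<?N. sum (?g s) {1..?N - s})" by (simp add: ins_sum ksgn_sum)
  also have "\<dots> = (\<Sum>s\<in>{..<?N}. sum (?g s) {j \<in> {1..?N}. s + j \<le> ?N})"
    by (rule sum.cong) (auto intro!: sum.cong)
  also have "\<dots> = (\<Sum>j\<in>{1..?N}. \<Sum>s | s \<in> {..<?N} \<and> s + j \<le> ?N. ?g s j)"
    by (rule sum.swap_restrict) simp_all
  also have "\<dots> = (\<Sum>j=1..?N. \<Sum>s=0..?N - j. ?g s j)"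
    by (rule sum.cong) (auto intro!: sum.cong)
  finally show ?thesis .
qed

definition compositions :: "nat \<Rightarrow> nat list set" where
  "compositions N = {rs. sum_list rs = N \<and> (\<forall>r\<in>set rs. 1 \<le> r)}"

lemma compositions_length: "rs \<in> compositions N \<Longrightarrow> length rs \<le> N"
proof -
  have "(\<forall>r\<in>set rs. Suc 0 \<le> r) \<Longrightarrow> length rs \<le> sum_list rs" by (induct rs) auto
  then show "rs \<in> compositions N \<Longrightarrow> length rs \<le> N" by (auto simp: compositions_def)
qed

lemma finite_compositions: "finite (compositions N)"
proof (rule finite_subset)
  show "compositions N \<subseteq> {rs. set rs \<subseteq> {..N} \<and> length rs \<le> N}"
    using compositions_length[of _ N] member_le_sum_list by (auto simp: compositions_def)
  show "finite {rs. set rs \<subseteq> {..N} \<and> length rs \<le> N}" by (rule finite_lists_length_le) simp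
qed

lemma compositions_0: "compositions 0 = {[]}"
  using compositions_length[of _ 0] by (auto simp: compositions_def)

lemma compositions_Suc: "bij_betw (\<lambda>(k, rs). Suc k # rs) (Sigma {0..n} (\<lambda>k. compositions (n - k))) (compositions (Suc n))"
  unfolding bij_betw_def
proof
  show "inj_on (\<lambda>(k, rs). Suc k # rs) (Sigma {0..n} (\<lambda>k. compositions (n - k)))" by (auto simp: inj_on_def)
  have "rs \<in> (\<lambda>(k, rs). Suc k # rs) ` Sigma {0..n} (\<lambda>k. compositions (n - k))" if m: "rs \<in> compositions (Suc n)" for rs
  proof -
    obtain r rs' where rs: "rs = r # rs'" using m by (cases rs) (auto simp: compositions_def)
    then obtain k where k: "r = Suc k" using m by (cases r) (auto simp: compositions_def)
    then have "(k, rs') \<in> Sigma {0..n} (\<lambda>k. compositions (n - k))" using m rs by (auto simp: compositions_def)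
    then show ?thesis using rs k by force
  qed
  then show "(\<lambda>(k, rs). Suc k # rs) ` Sigma {0..n} (\<lambda>k. compositions (n - k)) = compositions (Suc n)"
    by (auto simp: compositions_def)
qed

lemma cm_sum: "cm False \<phi> f w = (\<Sum>rs\<in>compositions (length w). f (map (hat 0 \<phi>) (blocks rs w)))"
proof (induct "length w" arbitrary: w f rule: less_induct)
  case less
  show ?case
  proof (cases w)
    case Nil
    then show ?thesis by (simp add: compositions_0)
  next
    case (Cons a v)
    let ?n = "length v"
    have "cm False \<phi> f w = (\<Sum>k=0..?n. \<Sum>rs\<in>compositions (?n - k). f (hat 0 \<phi> (a # take k v) # map (hat 0 \<phi>) (blocks rs (drop k v))))"
      unfolding Cons cm.simps spl_sum
    proof (rule sum.cong[OF refl])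
      fix k
      show "cm False \<phi> (\<lambda>z. f (hat 0 \<phi> (a # take k v) # z)) (drop k v) =
        (\<Sum>rs\<in>compositions (?n - k). f (hat 0 \<phi> (a # take k v) # map (hat 0 \<phi>) (blocks rs (drop k v))))"
        using less[of "drop k v"] Cons by simp
    qed
    also have "\<dots> = (\<Sum>(k, rs)\<in>Sigma {0..?n} (\<lambda>k. compositions (?n - k)).
       f (map (hat 0 \<phi>) (blocks (Suc k # rs) w)))"
      by (subst sum.Sigma) (auto simp: finite_compositions Cons)
    also have "\<dots> = (\<Sum>rs\<in>compositions (Suc ?n). f (map (hat 0 \<phi>) (blocks rs w)))"
      by (subst sum.reindex_bij_betw[OF compositions_Suc[of ?n], symmetric]) (simp add: case_prod_unfold)
    finally show ?thesis by (simp add: Cons)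
  qed
qed

section \<open>Suspension signs\<close>

text \<open>The exponent \<open>\<Sum> (n - i) d\<^sub>i\<close> of the Koszul sign of desuspending all letters of a word, whose
  suspended degrees are \<open>d\<^sub>1, \<dots>, d\<^sub>n\<close>.\<close>

primrec susp_sign :: "int list \<Rightarrow> int" where
  "susp_sign [] = 0"
| "susp_sign (d # ds) = int (length ds) * d + susp_sign ds"

lemma susp_sign_append: "susp_sign (a @ b) = susp_sign a + susp_sign b + int (length b) * sum_list a"
  by (induct a) (simp_all add: algebra_simps)

lemma sum_list_fst: "sum_list (map fst w) = wdeg w" by (simp add: wdeg_def)

text \<open>Conjugation with the suspension turns all operations into maps of degree \<open>-1\<close>; the explicit signs
  of the algebra equations are what is left when the Koszul signs are moved back to the original
  degrees. The comparison is a computation of parities.\<close>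

lemma ins_tagged:
  assumes V: "complex (susp V)" and nn: "\<And>j. 1 \<le> j \<Longrightarrow> multi_hom V V j (int j - 2) (nn j)"
    and ff: "\<And>us vs. addi (\<lambda>x. ff (length us + length vs + 1) (us @ x # vs))"
    and ds: "ds = map (\<lambda>a. fst a - 1) w" and xs: "xs = args (susp V) w"
  shows "ins False (- 1) (\<lambda>w. - tagged (susp V) susp_sign nn w) (tagged (susp V) susp_sign ff) w =
    ksgn (susp_sign (map fst w)) (\<Sum>j=1..length w. \<Sum>s=0..length w - j.
      ksgn (int (length w + 1 - j + s * (j + 1)))
        (insert_op (ff (length w + 1 - j)) s (nn j) j (int j - 2) ds xs))"
  unfolding ins_sum_swap ksgn_sum
proof (intro sum.cong refl)
  interpret complex "susp V" by (rule V)
  let ?U = "susp V" and ?N = "length w"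
  let ?q = "\<lambda>w. - tagged ?U susp_sign nn w"
  fix j s assume "j \<in> {1..?N}" "s \<in> {0..?N - j}"
  then have j: "1 \<le> j" "j \<le> ?N" and s: "s + j \<le> ?N" by auto
  define u where "u = take s w"
  define v where "v = take j (drop s w)"
  define z where "z = drop (s + j) w"
  have w: "w = u @ v @ z"
    unfolding u_def v_def z_def by (metis add.commute append_take_drop_id drop_drop)
  have l: "length u = s" "length v = j" using s by (simp_all add: u_def v_def)
  have i: "?N + 1 - j = length u + length z + 1" using w l by simp
  have vg: "nn j (args ?U v) \<in> grade ?U (wdeg v - 1)"
    using multi_hom_grade[OF multi_hom_susp[OF nn[OF j(1)] refl] V, of v] l j by simp
  have c: "component ?U (wdeg v - 1) (?q v) = - ksgn (susp_sign (map fst v)) (nn j (args ?U v))"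
    unfolding tagged_def l(2) by (intro component_same grade_neg grade_ksgn vg)
  have a: "addi (\<lambda>x. ff (length u + length z + 1) (args ?U u @ x # args ?U z))"
    using ff[of "args ?U u" "args ?U z"] by simp
  let ?y = "ff (length u + length z + 1) (args ?U u @ nn j (args ?U v) # args ?U z)"
  let ?k = "susp_sign (map fst u @ (wdeg v - 1) # map fst z)"
  have L: "tagged ?U susp_sign ff (u @ hat (- 1) ?q v # z) = ksgn (?k + susp_sign (map fst v) + 1) ?y"
    using addi_minus[OF a, of "ksgn (susp_sign (map fst v)) (nn j (args ?U v))"]
      addi_ksgn[OF a, of "susp_sign (map fst v)" "nn j (args ?U v)"]
    unfolding tagged_def args_simps hat_def fst_conv snd_conv
    by (simp add: c[unfolded tagged_def] ksgn_ksgn ksgn_minus) (simp add: ksgn_def)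
  have xs': "take s xs = args ?U u" "take j (drop s xs) = args ?U v" "drop (s + j) xs = args ?U z"
    unfolding xs w args_simps using l by simp_all
  have sd: "sum_list (take s ds) = wdeg u - int s"
    using sum_list_shift[of "- 1" "map fst u"] l
    unfolding ds w by (simp add: o_def sum_list_fst)
  have R: "insert_op (ff (?N + 1 - j)) s (nn j) j (int j - 2) ds xs = ksgn ((int j - 2) * (wdeg u - int s)) ?y"
    unfolding insert_op_def xs' sd i ..
  have k1: "susp_sign (map fst w) = susp_sign (map fst u) + susp_sign (map fst v) + susp_sign (map fst z) + int (length z) * wdeg v
      + (int j + int (length z)) * wdeg u"
    unfolding w by (simp add: susp_sign_append sum_list_fst l algebra_simps)
  have k2: "?k = susp_sign (map fst u) + susp_sign (map fst z) + int (length z) * (wdeg v - 1) + (int (length z) + 1) * wdeg u"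
    by (simp add: susp_sign_append sum_list_fst algebra_simps)
  show "ksgn (- 1 * wdeg (take s w)) (tagged ?U susp_sign ff (take s w @ hat (- 1) ?q (take j (drop s w)) # drop (s + j) w)) =
    ksgn (susp_sign (map fst w)) (ksgn (int (?N + 1 - j + s * (j + 1)))
      (insert_op (ff (?N + 1 - j)) s (nn j) j (int j - 2) ds xs))"
    unfolding u_def[symmetric] v_def[symmetric] z_def[symmetric] L R ksgn_ksgn
    unfolding k1 k2 i l
    by (rule ksgn_cong[OF _ refl]) (simp; argo)
qed

lemma addi_list_signs:
  assumes "\<And>us vs x. length us + length vs + 1 = n \<Longrightarrow> addi (\<lambda>x. g (us @ x # vs))"
    and "length us + length l = n"
  shows "g (us @ map (\<lambda>b. ksgn (\<sigma> b) (y b)) l) = ksgn (\<Sum>b\<leftarrow>l. \<sigma> b) (g (us @ map y l))"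
  using assms(2)
proof (induct l arbitrary: us)
  case (Cons b l)
  have a: "addi (\<lambda>x. g (us @ x # map (\<lambda>b. ksgn (\<sigma> b) (y b)) l))"
    by (rule assms(1)) (use Cons(2) in simp)
  have "g (us @ map (\<lambda>b. ksgn (\<sigma> b) (y b)) (b # l)) = ksgn (\<sigma> b) (g (us @ y b # map (\<lambda>b. ksgn (\<sigma> b) (y b)) l))"
    using addi_ksgn[OF a] by simp
  also have "\<dots> = ksgn (\<sigma> b + (\<Sum>b\<leftarrow>l. \<sigma> b)) (g (us @ map y (b # l)))"
    using Cons(1)[of "us @ [y b]"] Cons(2) by (simp add: ksgn_ksgn)
  finally show ?case by simp
qed simp

lemma blocks_lengths: "sum_list rs = length w \<Longrightarrow> map length (blocks rs w) = rs"
  by (induct rs arbitrary: w) auto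

lemma blocks_length [simp]: "length (blocks rs w) = length rs"
  by (induct rs arbitrary: w) auto

lemma blocks_args: "blocks rs (args U w) = map (args U) (blocks rs w)"
  by (induct rs arbitrary: w) (simp_all add: args_def take_map drop_map)

lemma blocks_nonempty:
  "sum_list rs = length w \<Longrightarrow> \<forall>r\<in>set rs. 1 \<le> r \<Longrightarrow> b \<in> set (blocks rs w) \<Longrightarrow> b \<noteq> []"
proof (induct rs arbitrary: w)
  case (Cons r rs)
  have "b \<in> set (blocks rs (drop r w)) \<Longrightarrow> b \<noteq> []" by (rule Cons(1)) (use Cons(2,3) in auto)
  then show ?case using Cons(2-4) by auto
qed simp

lemma map2_lengths: "map2 f (map length bs) bs' = map2 (\<lambda>b b'. f (length b) b') bs bs'"
  by (simp add: zip_map1 case_prod_unfold)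

text \<open>The exponents of the two signs are compared by splitting off the first block.\<close>

lemma tensor_sign:
  assumes "sum_list rs = length w" "ds = map (\<lambda>a. fst a - 1) w"
  shows "even (susp_sign (map wdeg (blocks rs w)) + (\<Sum>b\<leftarrow>blocks rs w. susp_sign (map fst b))) =
    even (susp_sign (map fst w) + int (\<Sum>b<length rs. \<Sum>a<b. rs ! a * (rs ! b + 1)) +
      (\<Sum>b<length rs. (int (rs ! b) - 1) * sum_list (take (sum_list (take b rs)) ds)))"
  using assms
proof (induct rs arbitrary: w ds)
  case (Cons r rs)
  let ?v = "take r w" and ?w = "drop r w" and ?ds = "drop r ds"
  have len: "length ?v = r" "sum_list rs = length ?w" using Cons(2) by simp_all
  have sd: "sum_list (take r ds) = wdeg ?v - int r"
    using sum_list_shift[of "- 1" "map fst ?v"] len(1)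
    by (simp add: Cons(3) o_def sum_list_fst take_map)
  have nth_sum: "(\<Sum>b<length rs. int (rs ! b)) = int (length ?w)"
    using arg_cong[OF len(2), of int] unfolding sum_list_sum_nth atLeast0LessThan of_nat_sum .
  have M: "int (\<Sum>b<length (r # rs). \<Sum>a<b. (r # rs) ! a * ((r # rs) ! b + 1)) =
      int (\<Sum>b<length rs. \<Sum>a<b. rs ! a * (rs ! b + 1)) + int r * (int (length ?w) + int (length rs))"
  proof -
    have "(\<Sum>b<length (r # rs). \<Sum>a<b. (r # rs) ! a * ((r # rs) ! b + 1)) =
      (\<Sum>b<length rs. r * (rs ! b + 1) + (\<Sum>a<b. rs ! a * (rs ! b + 1)))"
      unfolding list.size(4) add_Suc_right add_0_right
      by (subst sum.lessThan_Suc_shift) (simp add: sum.lessThan_Suc_shift del: sum.lessThan_Suc)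
    also have "int \<dots> = (\<Sum>b<length rs. int r * (int (rs ! b) + 1)) + int (\<Sum>b<length rs. \<Sum>a<b. rs ! a * (rs ! b + 1))"
      by (simp add: sum.distrib distrib_left mult.commute)
    also have "(\<Sum>b<length rs. int r * (int (rs ! b) + 1)) = int r * (int (length ?w) + int (length rs))"
      by (simp add: sum_distrib_left[symmetric] sum.distrib nth_sum)
    finally show ?thesis by simp
  qed
  have T: "(\<Sum>b<length (r # rs). (int ((r # rs) ! b) - 1) * sum_list (take (sum_list (take b (r # rs))) ds)) =
    (\<Sum>b<length rs. (int (rs ! b) - 1) * sum_list (take (sum_list (take b rs)) ?ds))
     + (wdeg ?v - int r) * (int (length ?w) - int (length rs))"
  proof -
    have "(\<Sum>b<length (r # rs). (int ((r # rs) ! b) - 1) * sum_list (take (sum_list (take b (r # rs))) ds)) =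
      (\<Sum>b<length rs. (int (rs ! b) - 1) * (sum_list (take r ds) + sum_list (take (sum_list (take b rs)) ?ds)))"
      unfolding list.size(4) add_Suc_right add_0_right
      by (subst sum.lessThan_Suc_shift) (simp add: take_add)
    also have "\<dots> = (\<Sum>b<length rs. (int (rs ! b) - 1)) * sum_list (take r ds)
        + (\<Sum>b<length rs. (int (rs ! b) - 1) * sum_list (take (sum_list (take b rs)) ?ds))"
      by (simp add: distrib_left sum.distrib sum_distrib_right)
    also have "(\<Sum>b<length rs. (int (rs ! b) - 1)) = int (length ?w) - int (length rs)"
      by (simp add: sum_subtractf nth_sum)
    finally show ?thesis by (simp add: sd mult.commute add.commute)
  qed
  have k: "susp_sign (map fst w) = susp_sign (map fst ?v) + susp_sign (map fst ?w) + int (length ?w) * wdeg ?v"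
    using susp_sign_append[of "map fst ?v" "map fst ?w"] by (simp add: sum_list_fst flip: map_append)
  have IH: "even (susp_sign (map wdeg (blocks rs ?w)) + (\<Sum>b\<leftarrow>blocks rs ?w. susp_sign (map fst b))) =
    even (susp_sign (map fst ?w) + int (\<Sum>b<length rs. \<Sum>a<b. rs ! a * (rs ! b + 1)) +
      (\<Sum>b<length rs. (int (rs ! b) - 1) * sum_list (take (sum_list (take b rs)) ?ds)))"
    by (rule Cons(1)) (simp_all add: len(2) Cons(3) drop_map)
  have B: "susp_sign (map wdeg (blocks (r # rs) w)) + (\<Sum>b\<leftarrow>blocks (r # rs) w. susp_sign (map fst b)) =
    int (length rs) * wdeg ?v + susp_sign (map fst ?v) +
    (susp_sign (map wdeg (blocks rs ?w)) + (\<Sum>b\<leftarrow>blocks rs ?w. susp_sign (map fst b)))" by simp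
  have par: "even (l * x + c + A) = even (c + kw + m * x + (M + r * (m + l)) + (T + (x - r) * (m - l)))"
    if "even A = even (kw + M + T)" for l x c A kw m M T r :: int
    using that by (simp; argo)
  show ?case unfolding B k M T by (rule par[OF IH])
qed simp

lemma cm_tagged:
  assumes V: "complex (susp V)" and W: "complex (susp W)"
    and ff: "\<And>i. 1 \<le> i \<Longrightarrow> multi_hom V W i (int i - 1) (ff i)"
    and nn: "\<And>us vs. addi (\<lambda>x. nn (length us + length vs + 1) (us @ x # vs))"
    and ds: "ds = map (\<lambda>a. fst a - 1) w" and xs: "xs = args (susp V) w"
  shows "cm False (tagged (susp V) susp_sign ff) (\<lambda>w. - tagged (susp W) susp_sign nn w) w =
    - ksgn (susp_sign (map fst w)) (\<Sum>rs\<in>compositions (length w).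
      ksgn (int (\<Sum>b<length rs. \<Sum>a<b. rs ! a * (rs ! b + 1))) (tensor_op (nn (length rs)) ff rs ds xs))"
  unfolding cm_minus cm_sum ksgn_sum sum_negf[symmetric]
proof (intro sum.cong refl arg_cong[where f = uminus])
  interpret W: complex "susp W" by (rule W)
  let ?U = "susp V" and ?X = "susp W"
  fix rs assume "rs \<in> compositions (length w)"
  then have rs: "sum_list rs = length w" "\<forall>r\<in>set rs. 1 \<le> r" by (simp_all add: compositions_def)
  let ?bl = "blocks rs w"
  let ?y = "\<lambda>b. ff (length b) (args ?U b)"
  have "component ?X (wdeg b) (tagged ?U susp_sign ff b) = ksgn (susp_sign (map fst b)) (?y b)" if "b \<in> set ?bl" for b
  proof -
    have "1 \<le> length b" using blocks_nonempty[OF rs that] by (cases b) auto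
    then have "?y b \<in> grade ?X (wdeg b)"
      using multi_hom_grade[OF multi_hom_susp[OF ff refl] V, of "length b" b] by simp
    then show ?thesis unfolding tagged_def by (intro W.component_same W.grade_ksgn)
  qed
  then have 1: "args ?X (map (hat 0 (tagged ?U susp_sign ff)) ?bl) = map (\<lambda>b. ksgn (susp_sign (map fst b)) (?y b)) ?bl"
    unfolding args_def map_map by (intro map_cong) (simp_all add: hat_def)
  have a: "addi (\<lambda>x. nn (length rs) (us @ x # vs))" if l: "length us + length vs + 1 = length rs" for us vs
    using nn[of us vs] unfolding l .
  have 2: "nn (length rs) (map (\<lambda>b. ksgn (susp_sign (map fst b)) (?y b)) ?bl) =
    ksgn (\<Sum>b\<leftarrow>?bl. susp_sign (map fst b)) (nn (length rs) (map ?y ?bl))"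
    using addi_list_signs[of "length rs" "nn (length rs)" "[]" ?bl "\<lambda>b. susp_sign (map fst b)" ?y, OF a] by simp
  have 3: "map2 ff rs (blocks rs xs) = map ?y ?bl"
  proof -
    have "map2 ff rs (blocks rs xs) = map2 ff (map length ?bl) (map (args ?U) ?bl)"
      unfolding xs blocks_args blocks_lengths[OF rs(1)] ..
    also have "\<dots> = map ?y ?bl" unfolding map2_lengths by (simp add: zip_map2 zip_same_conv_map case_prod_unfold)
    finally show ?thesis .
  qed
  have 4: "map fst (map (hat 0 (tagged ?U susp_sign ff)) ?bl) = map wdeg ?bl" by simp
  show "tagged ?X susp_sign nn (map (hat 0 (tagged ?U susp_sign ff)) ?bl) =
    ksgn (susp_sign (map fst w)) (ksgn (int (\<Sum>b<length rs. \<Sum>a<b. rs ! a * (rs ! b + 1)))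
      (tensor_op (nn (length rs)) ff rs ds xs))"
    unfolding tagged_def[of ?X] 1 4 length_map blocks_length 2 tensor_op_def 3 ksgn_ksgn
    by (rule ksgn_cong[OF _ refl]) (use tensor_sign[OF rs(1) ds] in \<open>simp add: add.assoc\<close>)
qed

section \<open>Shuffles as permutations\<close>

text \<open>A \<open>(p, n - p)\<close>-shuffle takes the value \<open>0\<close> at \<open>0\<close> or at \<open>p\<close>. In the first case it is \<open>lift0\<close> of a smaller
  shuffle, in the second case it is so after the cycle \<open>cyc p\<close> that brings \<open>p\<close> to the front. This
  matches the recursion for shuffles of words, where the first letter comes from one of the two
  words.\<close>

definition lift0 :: "(nat \<Rightarrow> nat) \<Rightarrow> nat \<Rightarrow> nat" where
  "lift0 \<tau> i = (case i of 0 \<Rightarrow> 0 | Suc j \<Rightarrow> Suc (\<tau> j))"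

definition cyc :: "nat \<Rightarrow> nat \<Rightarrow> nat" where
  "cyc p i = (if i = p then 0 else if i < p then Suc i else i)"

text \<open>The map \<open>skip p\<close> enumerates the numbers other than \<open>p\<close>, and \<open>front p\<close> is the inverse of \<open>cyc p\<close>.\<close>

definition skip :: "nat \<Rightarrow> nat \<Rightarrow> nat" where
  "skip p j = (if j < p then j else Suc j)"

definition front :: "nat \<Rightarrow> nat \<Rightarrow> nat" where
  "front p i = (case i of 0 \<Rightarrow> p | Suc j \<Rightarrow> skip p j)"

lemma lift0_simps [simp]: "lift0 \<tau> 0 = 0" "lift0 \<tau> (Suc j) = Suc (\<tau> j)"
  by (simp_all add: lift0_def)

lemma cyc_front: "cyc p (front p i) = i" "front p (cyc p i) = i"
  by (cases i; simp add: cyc_def front_def skip_def split: nat.split; fail) (cases i; auto simp: cyc_def front_def skip_def)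

lemma lift0_compose: "lift0 f (lift0 g i) = lift0 (\<lambda>j. f (g j)) i"
  by (cases i) simp_all

lemma lift0_id: "lift0 (\<lambda>j. j) i = i" by (cases i) simp_all

lemma permutes_lift0:
  assumes "\<tau> permutes {..<m}"
  shows "lift0 \<tau> permutes {..<Suc m}" "inv (lift0 \<tau>) = lift0 (inv \<tau>)" "evenperm (lift0 \<tau>) = evenperm \<tau>"
proof -
  have b: "lift0 \<tau> (lift0 (inv \<tau>) i) = i" "lift0 (inv \<tau>) (lift0 \<tau> i) = i" for i
    using permutes_inverses[OF assms] by (simp_all add: lift0_compose lift0_id)
  have nf: "lift0 \<tau> i = i" if "i \<notin> {..<Suc m}" for i
    using permutes_not_in[OF assms] that by (cases i) auto
  have bij: "bij (lift0 \<tau>)" by (rule bij_betw_byWitness[where f' = "lift0 (inv \<tau>)"]) (auto simp: b)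
  show p: "lift0 \<tau> permutes {..<Suc m}"
    unfolding permutes_def using nf bij by (auto simp: bij_iff)
  show "inv (lift0 \<tau>) = lift0 (inv \<tau>)"
    by (rule inv_equality) (simp_all add: b)
  have "lift0 \<tau> = map_permutation {..<m} Suc \<tau>"
  proof
    fix i
    show "lift0 \<tau> i = map_permutation {..<m} Suc \<tau> i"
    proof (cases i)
      case 0
      then show ?thesis by (auto simp: map_permutation_def restrict_id_def)
    next
      case (Suc j)
      then show ?thesis
        using permutes_not_in[OF assms, of j]
        by (auto simp: map_permutation_def restrict_id_def inv_into_f_f)
    qed
  qed
  then show "evenperm (lift0 \<tau>) = evenperm \<tau>"
    using evenperm_map_permutation[of Suc "{..<m}" \<tau>] assms by simp
qed

lemma cyc_Suc: "cyc (Suc p) = cyc p \<circ> transpose p (Suc p)"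
  by (auto simp: fun_eq_iff cyc_def transpose_def)

lemma permutes_cyc: "cyc p permutes {..p}" "evenperm (cyc p) = even p"
proof (induct p)
  case 0
  have "cyc 0 = id" by (auto simp: cyc_def)
  then show "cyc 0 permutes {..0}" "evenperm (cyc 0) = even (0::nat)" by simp_all
next
  case (Suc p)
  have 1: "cyc p permutes {..Suc p}" by (rule permutes_subset[OF Suc(1)]) auto
  have 2: "transpose p (Suc p) permutes {..Suc p}" by (rule permutes_swap_id) auto
  show "cyc (Suc p) permutes {..Suc p}" unfolding cyc_Suc by (rule permutes_compose[OF 2 1])
  show "evenperm (cyc (Suc p)) = even (Suc p)"
    unfolding cyc_Suc
    by (subst evenperm_comp) (use 1 2 Suc(2) in \<open>auto intro: permutes_imp_permutation simp: evenperm_swap\<close>)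
qed

lemma inv_cyc: "inv (cyc p) = front p"
  by (rule inv_equality) (simp_all add: cyc_front)

lemma shuffle_permsD:
  assumes "\<sigma> \<in> shuffle_perms p n"
  shows "\<sigma> permutes {..<n}" "\<And>i j. i < j \<Longrightarrow> j < p \<Longrightarrow> \<sigma> i < \<sigma> j"
    "\<And>i j. p \<le> i \<Longrightarrow> i < j \<Longrightarrow> j < n \<Longrightarrow> \<sigma> i < \<sigma> j"
proof -
  have s: "\<sigma> permutes {..<n}" "strict_mono_on {..<p} \<sigma>" "strict_mono_on {p..<n} \<sigma>"
    using assms by (auto simp: shuffle_perms_def)
  show "\<sigma> permutes {..<n}" by (rule s(1))
  show "\<sigma> i < \<sigma> j" if "i < j" "j < p" for i j by (rule strict_mono_onD[OF s(2)]) (use that in auto)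
  show "\<sigma> i < \<sigma> j" if "p \<le> i" "i < j" "j < n" for i j by (rule strict_mono_onD[OF s(3)]) (use that in auto)
qed

lemma shuffle_permsI:
  assumes "\<sigma> permutes {..<n}" "\<And>i j. i < j \<Longrightarrow> j < p \<Longrightarrow> \<sigma> i < \<sigma> j"
    "\<And>i j. p \<le> i \<Longrightarrow> i < j \<Longrightarrow> j < n \<Longrightarrow> \<sigma> i < \<sigma> j"
  shows "\<sigma> \<in> shuffle_perms p n"
  using assms unfolding shuffle_perms_def by (auto intro!: strict_mono_onI)

lemma finite_shuffle_perms: "finite (shuffle_perms p n)"
  by (rule finite_subset[OF _ finite_permutations[of "{..<n}"]]) (auto simp: shuffle_perms_def)

lemma mono_permutes_id:
  fixes n :: nat
  assumes "\<sigma> permutes {..<n}" "\<And>i j. i < j \<Longrightarrow> j < n \<Longrightarrow> \<sigma> i < \<sigma> j"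
  shows "\<sigma> = id"
proof -
  have le: "i \<le> \<sigma> i" if "i < n" for i
    using that
  proof (induct i)
    case (Suc i)
    then have "i \<le> \<sigma> i" "\<sigma> i < \<sigma> (Suc i)" using assms(2)[of i "Suc i"] by auto
    then show ?case by simp
  qed simp
  have "\<sigma> i = i" if "i < n" for i
  proof (rule ccontr)
    assume "\<sigma> i \<noteq> i"
    have "(\<Sum>i<n. \<sigma> i) = (\<Sum>i<n. i)"
      using sum.permute[OF assms(1), of "\<lambda>i. i"] by (simp add: o_def)
    moreover have "(\<Sum>i<n. i) < (\<Sum>i<n. \<sigma> i)"
      by (rule sum_strict_mono_ex1) (use le that \<open>\<sigma> i \<noteq> i\<close> in \<open>auto intro!: bexI[of _ i] simp: le_neq_implies_less\<close>)
    ultimately show False by simp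
  qed
  then show ?thesis using permutes_not_in[OF assms(1)] by (auto simp: fun_eq_iff)
qed

lemma shuffle_perms_trivial: "shuffle_perms 0 n = {id}" "shuffle_perms n n = {id}"
  using mono_permutes_id[of _ n] by (auto simp: shuffle_perms_def permutes_id strict_mono_on_def)

lemma shuffle_perms_first:
  assumes "\<sigma> \<in> shuffle_perms (Suc p) (Suc n)" "p < n"
  shows "\<sigma> 0 = 0 \<or> \<sigma> (Suc p) = 0"
proof -
  note D = shuffle_permsD[OF assms(1)]
  obtain i where i: "\<sigma> i = 0" "i < Suc n"
    using permutes_inverses(1)[OF D(1), of 0] permutes_in_image[OF D(1), of "inv \<sigma> 0"] by auto
  show ?thesis
    using D(2)[of 0 i] D(3)[of "Suc p" i] i assms(2) by (cases "i < Suc p"; cases "i = 0"; cases "i = Suc p") auto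
qed

lemma shuffle_perms_lift0: "\<tau> \<in> shuffle_perms p n \<Longrightarrow> lift0 \<tau> \<in> shuffle_perms (Suc p) (Suc n)"
  using shuffle_permsD[of \<tau> p n] permutes_lift0(1)[of \<tau> n]
  by (intro shuffle_permsI) (auto simp: lift0_def split: nat.splits)

lemma permutes_lower:
  assumes "\<sigma> permutes {..<Suc n}" "\<sigma> 0 = 0"
  shows "\<exists>\<tau>. \<tau> permutes {..<n} \<and> \<sigma> = lift0 \<tau>"
proof -
  define \<tau> where "\<tau> j = \<sigma> (Suc j) - 1" for j
  have nz: "\<sigma> (Suc j) \<noteq> 0" for j using permutes_inj[OF assms(1)] assms(2) by (metis injD nat.distinct(1))
  have S: "\<sigma> (Suc j) = Suc (\<tau> j)" for j using nz[of j] by (simp add: \<tau>_def)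
  have e: "\<sigma> = lift0 \<tau>" by (auto simp: fun_eq_iff lift0_def S assms(2) split: nat.split)
  have "\<tau> permutes {..<n}"
  proof (rule bij_imp_permutes)
    have "inj \<tau>" using permutes_inj[OF assms(1)] S by (metis (no_types, lifting) injD injI nat.inject)
    moreover have "\<tau> ` {..<n} \<subseteq> {..<n}"
      using permutes_in_image[OF assms(1)] S by (metis Suc_less_eq image_subsetI lessThan_iff)
    ultimately show "bij_betw \<tau> {..<n} {..<n}"
      by (intro bij_betw_imageI inj_on_subset[OF \<open>inj \<tau>\<close>] endo_inj_surj) (auto intro: inj_on_subset)
    show "\<tau> j = j" if "j \<notin> {..<n}" for j
      using permutes_not_in[OF assms(1), of "Suc j"] that S[of j] by simp
  qed
  with e show ?thesis by blast
qed

lemma shuffle_perms_fix0: "{\<sigma> \<in> shuffle_perms (Suc p) (Suc n). \<sigma> 0 = 0} = lift0 ` shuffle_perms p n"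
proof
  show "{\<sigma> \<in> shuffle_perms (Suc p) (Suc n). \<sigma> 0 = 0} \<subseteq> lift0 ` shuffle_perms p n"
  proof
    fix \<sigma> assume "\<sigma> \<in> {\<sigma> \<in> shuffle_perms (Suc p) (Suc n). \<sigma> 0 = 0}"
    then have s: "\<sigma> \<in> shuffle_perms (Suc p) (Suc n)" "\<sigma> 0 = 0" by auto
    obtain \<tau> where t: "\<tau> permutes {..<n}" "\<sigma> = lift0 \<tau>" using permutes_lower[OF shuffle_permsD(1)[OF s(1)] s(2)] by blast
    have "\<tau> \<in> shuffle_perms p n"
      using shuffle_permsD(2)[OF s(1), of "Suc _" "Suc _"] shuffle_permsD(3)[OF s(1), of "Suc _" "Suc _"] t
      by (intro shuffle_permsI) auto
    then show "\<sigma> \<in> lift0 ` shuffle_perms p n" using t by blast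
  qed
  show "lift0 ` shuffle_perms p n \<subseteq> {\<sigma> \<in> shuffle_perms (Suc p) (Suc n). \<sigma> 0 = 0}" using shuffle_perms_lift0 by auto
qed

lemma lift0_cyc: "lift0 \<tau> (cyc p p) = 0" "lift0 \<tau> (cyc p (skip p j)) = Suc (\<tau> j)"
  by (auto simp: cyc_def skip_def)

lemma skip_cases: obtains "i = p" | j where "i = skip p j"
proof (cases "i < p")
  case True
  then show ?thesis using that(2)[of i] by (simp add: skip_def)
next
  case False
  then show ?thesis using that(1) that(2)[of "i - 1"] by (cases "i = p") (auto simp: skip_def)
qed

lemma shuffle_perms_cyc:
  assumes "p \<le> n"
  shows "{\<sigma> \<in> shuffle_perms p (Suc n). \<sigma> p = 0} = (\<lambda>\<tau>. lift0 \<tau> \<circ> cyc p) ` shuffle_perms p n"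
proof
  have cp: "cyc p permutes {..<Suc n}" by (rule permutes_subset[OF permutes_cyc(1)]) (use assms in auto)
  show "{\<sigma> \<in> shuffle_perms p (Suc n). \<sigma> p = 0} \<subseteq> (\<lambda>\<tau>. lift0 \<tau> \<circ> cyc p) ` shuffle_perms p n"
  proof
    fix \<sigma> assume "\<sigma> \<in> {\<sigma> \<in> shuffle_perms p (Suc n). \<sigma> p = 0}"
    then have s: "\<sigma> \<in> shuffle_perms p (Suc n)" "\<sigma> p = 0" by auto
    note D = shuffle_permsD[OF s(1)]
    have "\<sigma> \<circ> front p permutes {..<Suc n}"
      unfolding inv_cyc[symmetric] by (rule permutes_compose[OF permutes_inv[OF cp] D(1)])
    moreover have "(\<sigma> \<circ> front p) 0 = 0" using s(2) by (simp add: front_def)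
    ultimately obtain \<tau> where t: "\<tau> permutes {..<n}" "\<sigma> \<circ> front p = lift0 \<tau>" using permutes_lower by blast
    have st: "\<sigma> (skip p j) = Suc (\<tau> j)" for j using fun_cong[OF t(2), of "Suc j"] by (simp add: front_def)
    have "\<sigma> = lift0 \<tau> \<circ> cyc p" unfolding t(2)[symmetric] by (auto simp: fun_eq_iff cyc_front)
    moreover have "\<tau> \<in> shuffle_perms p n"
    proof (rule shuffle_permsI[OF t(1)])
      show "\<tau> i < \<tau> j" if "i < j" "j < p" for i j
        using D(2)[of "skip p i" "skip p j"] that st[of i] st[of j] by (simp add: skip_def)
      show "\<tau> i < \<tau> j" if "p \<le> i" "i < j" "j < n" for i j
        using D(3)[of "skip p i" "skip p j"] that st[of i] st[of j] by (simp add: skip_def)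
    qed
    ultimately show "\<sigma> \<in> (\<lambda>\<tau>. lift0 \<tau> \<circ> cyc p) ` shuffle_perms p n" by blast
  qed
  show "(\<lambda>\<tau>. lift0 \<tau> \<circ> cyc p) ` shuffle_perms p n \<subseteq> {\<sigma> \<in> shuffle_perms p (Suc n). \<sigma> p = 0}"
  proof
    fix \<sigma> assume "\<sigma> \<in> (\<lambda>\<tau>. lift0 \<tau> \<circ> cyc p) ` shuffle_perms p n"
    then obtain \<tau> where t: "\<tau> \<in> shuffle_perms p n" and s: "\<sigma> = lift0 \<tau> \<circ> cyc p" by blast
    note D = shuffle_permsD[OF t]
    have "\<sigma> \<in> shuffle_perms p (Suc n)"
    proof (rule shuffle_permsI)
      show "\<sigma> permutes {..<Suc n}" unfolding s by (rule permutes_compose[OF cp permutes_lift0(1)[OF D(1)]])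
      show "\<sigma> i < \<sigma> j" if "i < j" "j < p" for i j
        using D(2)[of i j] that by (simp add: s cyc_def)
      show "\<sigma> i < \<sigma> j" if "p \<le> i" "i < j" "j < Suc n" for i j
        using D(3)[of "i - 1" "j - 1"] that by (cases i; cases j) (auto simp: s cyc_def)
    qed
    then show "\<sigma> \<in> {\<sigma> \<in> shuffle_perms p (Suc n). \<sigma> p = 0}" using lift0_cyc(1) by (simp add: s)
  qed
qed

lemma permute_lift0:
  assumes "\<tau> permutes {..<length w}"
  shows "permute_list (inv (lift0 \<tau>)) (a # w) = a # permute_list (inv \<tau>) w"
proof -
  have "permute_list (lift0 g) (a # w) = a # permute_list g w" for g
    unfolding permute_list_def length_Cons upt_conv_Cons[OF zero_less_Suc] map_Suc_upt[symmetric]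
    by (simp add: o_def)
  then show ?thesis using permutes_lift0(2)[OF assms] by simp
qed

lemma nth_skip: "k < length (u @ v) \<Longrightarrow> (u @ b # v) ! skip (length u) k = (u @ v) ! k"
  by (auto simp: skip_def nth_append Suc_diff_le)

lemma permute_lift0_cyc:
  assumes "\<tau> permutes {..<length (u @ v)}"
  shows "permute_list (inv (lift0 \<tau> \<circ> cyc (length u))) (u @ b # v) = b # permute_list (inv \<tau>) (u @ v)"
proof -
  have bij: "bij (lift0 \<tau>)" "bij (cyc (length u))"
    using permutes_lift0(1)[OF assms] permutes_cyc(1) by (blast intro: permutes_bij)+
  have "inv (lift0 \<tau> \<circ> cyc (length u)) = front (length u) \<circ> lift0 (inv \<tau>)"
    by (subst o_inv_distrib) (use bij permutes_lift0(2)[OF assms] inv_cyc in \<open>auto simp: \<close>)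
  moreover have "permute_list (front (length u) \<circ> lift0 g) (u @ b # v) = b # permute_list g (u @ v)"
    if "\<And>i. i < length (u @ v) \<Longrightarrow> g i < length (u @ v)" for g
  proof -
    have "permute_list (front (length u) \<circ> lift0 g) (u @ b # v) =
      b # map (\<lambda>i. (u @ b # v) ! skip (length u) (g i)) [0..<length (u @ v)]"
      unfolding permute_list_def length_append list.size add_Suc_right add_0_right
        upt_conv_Cons[OF zero_less_Suc] map_Suc_upt[symmetric]
      by (simp add: o_def front_def)
    also have "map (\<lambda>i. (u @ b # v) ! skip (length u) (g i)) [0..<length (u @ v)] = permute_list g (u @ v)"
      unfolding permute_list_def by (rule map_cong[OF refl], rule nth_skip, rule that) simp
    finally show ?thesis .
  qed
  ultimately show ?thesis
    using permutes_in_image[OF permutes_inv[OF assms]] by auto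
qed

lemma perm_koszul_lift0: "perm_koszul (lift0 \<tau>) (d # ds) = perm_koszul \<tau> ds"
proof -
  have "{(a, b). a < b \<and> b < length (d # ds) \<and> lift0 \<tau> b < lift0 \<tau> a} =
    map_prod Suc Suc ` {(a, b). a < b \<and> b < length ds \<and> \<tau> b < \<tau> a}" (is "?A = ?B")
  proof
    show "?A \<subseteq> ?B"
    proof
      fix x assume "x \<in> ?A"
      then obtain a b where x: "x = (a, b)" "a < b" "b < length (d # ds)" "lift0 \<tau> b < lift0 \<tau> a" by blast
      then obtain a' b' where "a = Suc a'" "b = Suc b'" by (cases a; cases b) auto
      with x show "x \<in> ?B" by (force simp: map_prod_def)
    qed
  qed auto
  moreover have "inj_on (map_prod Suc Suc) X" for X by (auto simp: inj_on_def)
  ultimately show ?thesis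
    unfolding perm_koszul_def by (simp add: sum.reindex case_prod_unfold)
qed

lemma perm_koszul_lift0_cyc:
  "perm_koszul (lift0 \<tau> \<circ> cyc (length u)) (u @ e # v) = perm_koszul \<tau> (u @ v) + e * sum_list u"
proof -
  let ?p = "length u" and ?\<sigma> = "lift0 \<tau> \<circ> cyc (length u)"
  let ?I = "{(a, b). a < b \<and> b < length (u @ v) \<and> \<tau> b < \<tau> a}"
  let ?A = "(\<lambda>a. (a, ?p)) ` {..<?p}" and ?B = "map_prod (skip ?p) (skip ?p) ` ?I"
  have nz: "?\<sigma> a \<noteq> 0" if "a < ?p" for a using that by (simp add: cyc_def)
  have len: "skip ?p j < length (u @ e # v) \<longleftrightarrow> j < length (u @ v)" for j by (auto simp: skip_def)
  have ms: "skip ?p i < skip ?p j \<longleftrightarrow> i < j" for i j by (auto simp: skip_def)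
  have ss: "?\<sigma> (skip ?p j) = Suc (\<tau> j)" "?\<sigma> ?p = 0" for j using lift0_cyc by simp_all
  have val: "(\<Sum>(a, b)\<in>?I. (u @ e # v) ! skip ?p a * (u @ e # v) ! skip ?p b) = (\<Sum>(a, b)\<in>?I. (u @ v) ! a * (u @ v) ! b)"
  proof (rule sum.cong[OF refl])
    fix x assume "x \<in> ?I"
    then obtain a b where "x = (a, b)" "a < length (u @ v)" "b < length (u @ v)" by auto
    then show "(case x of (a, b) \<Rightarrow> (u @ e # v) ! skip ?p a * (u @ e # v) ! skip ?p b) = (case x of (a, b) \<Rightarrow> (u @ v) ! a * (u @ v) ! b)"
      using nth_skip[of a u v e] nth_skip[of b u v e] by simp
  qed
  have inj: "inj_on (map_prod (skip ?p) (skip ?p)) X" for X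
    by (auto simp: inj_on_def skip_def split: if_splits)
  have "{(a, b). a < b \<and> b < length (u @ e # v) \<and> ?\<sigma> b < ?\<sigma> a} = ?A \<union> ?B" (is "?J = _")
  proof
    show "?J \<subseteq> ?A \<union> ?B"
    proof
      fix x assume "x \<in> ?J"
      then obtain a b where x: "x = (a, b)" "a < b" "b < length (u @ e # v)" "?\<sigma> b < ?\<sigma> a" by blast
      show "x \<in> ?A \<union> ?B"
      proof (cases rule: skip_cases[of b ?p])
        case 1
        then show ?thesis using x by auto
      next
        case (2 j)
        obtain i where i: "a = skip ?p i"
          using x(4) ss(2) by (cases rule: skip_cases[of a ?p]) auto
        have "(i, j) \<in> ?I" using x unfolding 2 i ms len ss by simp
        then show ?thesis unfolding x(1) 2 i by force
      qed
    qed
    show "?A \<union> ?B \<subseteq> ?J"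
    proof (intro Un_least subsetI)
      show "x \<in> ?J" if "x \<in> ?A" for x using that nz ss(2) by fastforce
      fix x assume "x \<in> ?B"
      then obtain i j where "x = (skip ?p i, skip ?p j)" "i < j" "j < length (u @ v)" "\<tau> j < \<tau> i" by auto
      then show "x \<in> ?J" using ms len ss by simp
    qed
  qed
  moreover have "?A \<inter> ?B = {}" by (auto simp: skip_def split: if_splits)
  moreover have fin: "finite ?A" "finite ?B"
  proof -
    have "finite ?I" by (rule finite_subset[of _ "{..<length (u @ v)} \<times> {..<length (u @ v)}"]) auto
    then show "finite ?A" "finite ?B" by simp_all
  qed
  moreover have "(\<Sum>a<?p. (u @ e # v) ! a * e) = e * sum_list u"
    by (simp add: nth_append sum_list_sum_nth sum_distrib_left atLeast0LessThan mult.commute)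
  ultimately have "perm_koszul ?\<sigma> (u @ e # v) = e * sum_list u
    + (\<Sum>(a, b)\<in>map_prod (skip ?p) (skip ?p) ` ?I. (u @ e # v) ! a * (u @ e # v) ! b)"
    unfolding perm_koszul_def by (simp add: sum.union_disjoint sum.reindex inj_on_def)
  also have "(\<Sum>(a, b)\<in>map_prod (skip ?p) (skip ?p) ` ?I. (u @ e # v) ! a * (u @ e # v) ! b)
    = (\<Sum>(a, b)\<in>?I. (u @ e # v) ! skip ?p a * (u @ e # v) ! skip ?p b)"
    by (subst sum.reindex[OF inj]) (simp add: case_prod_unfold)
  finally show ?thesis unfolding val by (simp add: perm_koszul_def)
qed

text \<open>The sum over shuffles with the sign of the permutation and the Koszul sign in the unsuspended
  degrees.\<close>

definition shsum :: "(int \<times> 'v) list \<Rightarrow> (int \<times> 'v) list \<Rightarrow> ((int \<times> 'v) list \<Rightarrow> 'y::ab_group_add) \<Rightarrow> 'y" where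
  "shsum u v f = (\<Sum>\<sigma>\<in>shuffle_perms (length u) (length (u @ v)). ksgn ((if evenperm \<sigma> then 0 else 1) +
     perm_koszul \<sigma> (map (\<lambda>a. fst a - 1) (u @ v))) (f (permute_list (inv \<sigma>) (u @ v))))"

lemma shsum_trivial: "shsum [] v f = f v" "shsum u [] f = f u"
proof -
  have "perm_koszul id ds = 0" for ds
  proof -
    have e: "{(a, b). a < b \<and> b < length ds \<and> b < a} = {}" by auto
    show ?thesis unfolding perm_koszul_def id_apply e by simp
  qed
  then show "shsum [] v f = f v" "shsum u [] f = f u"
    by (simp_all add: shsum_def shuffle_perms_trivial evenperm_id inv_id)
qed

lemma shsum_Cons:
  "shsum (a # u) (b # v) f = shsum u (b # v) (\<lambda>z. f (a # z)) +
    ksgn (int (length (a # u)) + (fst b - 1) * (wdeg (a # u) - int (length (a # u))))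
      (shsum (a # u) v (\<lambda>z. f (b # z)))"
proof -
  let ?g = "\<lambda>a. fst a - 1"
  let ?T = "\<lambda>w f \<sigma>. ksgn ((if evenperm \<sigma> then 0 else 1) + perm_koszul \<sigma> (map ?g w)) (f (permute_list (inv \<sigma>) w))"
  let ?w = "a # u @ b # v" and ?p = "length (a # u)" and ?n = "length (u @ b # v)"
  let ?S = "shuffle_perms ?p (Suc ?n)"
  have inj0: "inj_on lift0 X" for X
    by (rule inj_onI) (metis lift0_simps(2) ext nat.inject)
  have "inj_on (\<lambda>\<tau>. lift0 \<tau> \<circ> cyc ?p) X" for X
  proof (rule inj_onI)
    fix \<tau> \<tau>' assume "lift0 \<tau> \<circ> cyc ?p = lift0 \<tau>' \<circ> cyc ?p"
    then have "Suc (\<tau> j) = Suc (\<tau>' j)" for j using lift0_cyc(2) by (metis comp_apply)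
    then show "\<tau> = \<tau>'" by auto
  qed
  note injp = this
  have split: "?S = {\<sigma> \<in> ?S. \<sigma> 0 = 0} \<union> {\<sigma> \<in> ?S. \<sigma> ?p = 0}"
  proof -
    have "\<sigma> 0 = 0 \<or> \<sigma> ?p = 0" if "\<sigma> \<in> ?S" for \<sigma>
      using shuffle_perms_first[of \<sigma> "length u" ?n] that by simp
    then show ?thesis by blast
  qed
  have disj: "{\<sigma> \<in> ?S. \<sigma> 0 = 0} \<inter> {\<sigma> \<in> ?S. \<sigma> ?p = 0} = {}"
  proof -
    have "\<sigma> 0 \<noteq> \<sigma> ?p" if "\<sigma> \<in> ?S" for \<sigma> using permutes_inj[OF shuffle_permsD(1)[OF that]] by (metis injD length_Cons nat.distinct(1))
    note ne = this
    show ?thesis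
    proof (rule equals0I)
      fix \<sigma> assume "\<sigma> \<in> {\<sigma> \<in> ?S. \<sigma> 0 = 0} \<inter> {\<sigma> \<in> ?S. \<sigma> ?p = 0}"
      then have "\<sigma> \<in> ?S" "\<sigma> 0 = \<sigma> ?p" by simp_all
      then show False using ne by blast
    qed
  qed
  have "shsum (a # u) (b # v) f = sum (?T ?w f) ?S" by (simp add: shsum_def)
  also have "\<dots> = sum (?T ?w f) {\<sigma> \<in> ?S. \<sigma> 0 = 0} + sum (?T ?w f) {\<sigma> \<in> ?S. \<sigma> ?p = 0}"
    by (subst split, rule sum.union_disjoint[OF _ _ disj]) (simp_all add: finite_shuffle_perms)
  also have "sum (?T ?w f) {\<sigma> \<in> ?S. \<sigma> 0 = 0} = shsum u (b # v) (\<lambda>z. f (a # z))"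
  proof -
    have "sum (?T ?w f) {\<sigma> \<in> ?S. \<sigma> 0 = 0} = (\<Sum>\<tau>\<in>shuffle_perms (length u) ?n. ?T ?w f (lift0 \<tau>))"
      using shuffle_perms_fix0[of "length u" ?n] by (simp add: sum.reindex[OF inj0])
    also have "\<dots> = shsum u (b # v) (\<lambda>z. f (a # z))"
      unfolding shsum_def
    proof (rule sum.cong[OF refl])
      fix \<tau> assume "\<tau> \<in> shuffle_perms (length u) ?n"
      then have t: "\<tau> permutes {..<length (u @ b # v)}" by (rule shuffle_permsD)
      show "?T ?w f (lift0 \<tau>) = ?T (u @ b # v) (\<lambda>z. f (a # z)) \<tau>"
        unfolding list.map(2) perm_koszul_lift0 permute_lift0[OF t] permutes_lift0(3)[OF t] ..
    qed
    finally show ?thesis .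
  qed
  also have "sum (?T ?w f) {\<sigma> \<in> ?S. \<sigma> ?p = 0} =
    ksgn (int ?p + (fst b - 1) * (wdeg (a # u) - int ?p)) (shsum (a # u) v (\<lambda>z. f (b # z)))"
  proof -
    have pn: "?p \<le> ?n" by simp
    have "sum (?T ?w f) {\<sigma> \<in> ?S. \<sigma> ?p = 0} = (\<Sum>\<tau>\<in>shuffle_perms ?p ?n. ?T ?w f (lift0 \<tau> \<circ> cyc ?p))"
      unfolding shuffle_perms_cyc[OF pn] sum.reindex[OF injp] by (rule sum.cong) simp_all
    also have "\<dots> = ksgn (int ?p + (fst b - 1) * (wdeg (a # u) - int ?p)) (shsum (a # u) v (\<lambda>z. f (b # z)))"
      unfolding shsum_def ksgn_sum
    proof (rule sum.cong)
      show "shuffle_perms ?p ?n = shuffle_perms ?p (length ((a # u) @ v))" by simp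
      fix \<tau> assume "\<tau> \<in> shuffle_perms ?p (length ((a # u) @ v))"
      then have t: "\<tau> permutes {..<length ((a # u) @ v)}" by (rule shuffle_permsD)
      have w: "?w = (a # u) @ b # v" by simp
      have ev: "evenperm (lift0 \<tau> \<circ> cyc ?p) = (evenperm \<tau> = even ?p)"
        using permutes_imp_permutation[OF _ permutes_lift0(1)[OF t]] permutes_imp_permutation[OF _ permutes_cyc(1)[of ?p]]
        by (simp add: evenperm_comp permutes_lift0(3)[OF t] permutes_cyc(2))
      have sl: "sum_list (map ?g (a # u)) = wdeg (a # u) - int ?p"
        using sum_list_shift[of "- 1" "map fst (a # u)"] by (simp add: o_def sum_list_fst)
      have pk: "perm_koszul (lift0 \<tau> \<circ> cyc ?p) (map ?g ?w) =
        perm_koszul \<tau> (map ?g ((a # u) @ v)) + (fst b - 1) * (wdeg (a # u) - int ?p)"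
        using perm_koszul_lift0_cyc[of \<tau> "map ?g (a # u)" "?g b" "map ?g v"]
        unfolding w map_append list.map(2) sl[unfolded list.map(2)] length_map length_Cons by simp
      have pl: "permute_list (inv (lift0 \<tau> \<circ> cyc ?p)) ?w = b # permute_list (inv \<tau>) ((a # u) @ v)"
        unfolding w by (rule permute_lift0_cyc[OF t])
      have par: "even ((if A = even p then 0 else 1) + (P + X)) = even (p + X + ((if A then 0 else 1) + P))"
        for A and p P X :: int by auto
      have "?T ?w f (lift0 \<tau> \<circ> cyc ?p) = ksgn ((if evenperm \<tau> = even (int ?p) then 0 else 1) +
          (perm_koszul \<tau> (map ?g ((a # u) @ v)) + (fst b - 1) * (wdeg (a # u) - int ?p)))
          (f (b # permute_list (inv \<tau>) ((a # u) @ v)))"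
        unfolding pk pl ev even_of_nat ..
      also have "\<dots> = ksgn (int ?p + (fst b - 1) * (wdeg (a # u) - int ?p) +
          ((if evenperm \<tau> then 0 else 1) + perm_koszul \<tau> (map ?g ((a # u) @ v))))
          (f (b # permute_list (inv \<tau>) ((a # u) @ v)))"
        by (rule ksgn_cong[OF par refl])
      finally show "?T ?w f (lift0 \<tau> \<circ> cyc ?p) = ksgn (int ?p + (fst b - 1) * (wdeg (a # u) - int ?p))
        (?T ((a # u) @ v) (\<lambda>z. f (b # z)) \<tau>)"
        unfolding ksgn_ksgn .
    qed
    finally show ?thesis .
  qed
  finally show ?thesis .
qed

text \<open>Moving a letter to the front past \<open>p\<close> letters changes the suspension sign by exactly the difference
  between the Koszul sign in suspended degrees and the signed Koszul sign in the original degrees.\<close>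

lemma sh_susp_sign: "sh u v (\<lambda>z. ksgn (susp_sign (map fst z)) (f z)) = ksgn (susp_sign (map fst (u @ v))) (shsum u v f)"
proof (induct "length u + length v" arbitrary: u v f rule: less_induct)
  case less
  show ?case
  proof (cases u)
    case Nil
    then show ?thesis by (simp add: shsum_trivial)
  next
    case u: (Cons a u')
    show ?thesis
    proof (cases v)
      case Nil
      then show ?thesis by (simp add: shsum_trivial)
    next
      case v: (Cons b v')
      let ?N = "int (length u' + length v)"
      have 1: "sh u' v (\<lambda>z. ksgn (susp_sign (map fst (a # z))) (f (a # z))) =
        ksgn (susp_sign (map fst (u @ v))) (shsum u' v (\<lambda>z. f (a # z)))"
      proof -
        have "sh u' v (\<lambda>z. ksgn (susp_sign (map fst (a # z))) (f (a # z))) =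
          sh u' v (\<lambda>z. ksgn (?N * fst a) (ksgn (susp_sign (map fst z)) (f (a # z))))"
          by (rule sh_cong) (simp add: ksgn_ksgn)
        also have "\<dots> = ksgn (?N * fst a) (ksgn (susp_sign (map fst (u' @ v))) (shsum u' v (\<lambda>z. f (a # z))))"
          unfolding sh_ksgn by (rule arg_cong[where f = "ksgn _"], rule less) (simp add: u)
        finally show ?thesis by (simp add: u ksgn_ksgn)
      qed
      have 2: "sh u v' (\<lambda>z. ksgn (susp_sign (map fst (b # z))) (f (b # z))) =
        ksgn (int (length u + length v') * fst b + susp_sign (map fst (u @ v'))) (shsum u v' (\<lambda>z. f (b # z)))"
      proof -
        have "sh u v' (\<lambda>z. ksgn (susp_sign (map fst (b # z))) (f (b # z))) =
          sh u v' (\<lambda>z. ksgn (int (length u + length v') * fst b) (ksgn (susp_sign (map fst z)) (f (b # z))))"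
          by (rule sh_cong) (simp add: ksgn_ksgn)
        also have "\<dots> = ksgn (int (length u + length v') * fst b) (ksgn (susp_sign (map fst (u @ v'))) (shsum u v' (\<lambda>z. f (b # z))))"
          unfolding sh_ksgn by (rule arg_cong[where f = "ksgn _"], rule less) (simp add: v)
        finally show ?thesis by (simp add: ksgn_ksgn)
      qed
      have k: "susp_sign (map fst (u @ v)) = susp_sign (map fst u) + int (length v') * fst b + susp_sign (map fst v') + (int (length v') + 1) * wdeg u"
        unfolding map_append susp_sign_append by (simp add: v sum_list_fst algebra_simps)
      have k': "susp_sign (map fst (u @ v')) = susp_sign (map fst u) + susp_sign (map fst v') + int (length v') * wdeg u"
        unfolding map_append susp_sign_append by (simp add: sum_list_fst algebra_simps)
      have "sh u v (\<lambda>z. ksgn (susp_sign (map fst z)) (f z)) =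
        sh u' v (\<lambda>z. ksgn (susp_sign (map fst (a # z))) (f (a # z))) +
        ksgn (fst b * wdeg u) (sh u v' (\<lambda>z. ksgn (susp_sign (map fst (b # z))) (f (b # z))))"
        unfolding u v sh.simps ..
      also have "\<dots> = ksgn (susp_sign (map fst (u @ v))) (shsum u' v (\<lambda>z. f (a # z)) +
        ksgn (int (length u) + (fst b - 1) * (wdeg u - int (length u))) (shsum u v' (\<lambda>z. f (b # z))))"
        unfolding 1 2 ksgn_plus ksgn_ksgn k k'
        by (intro arg_cong2[where f = "(+)"] refl ksgn_cong) (simp; argo)
      finally show ?thesis unfolding u v shsum_Cons .
    qed
  qed
qed

lemma vanishes_on_shuffles_sh:
  assumes V: "chain_complex V" and W: "chain_complex W"
  shows "vanishes_on_shuffles V W n f \<longleftrightarrow>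
    (\<forall>u v. u \<noteq> [] \<and> v \<noteq> [] \<and> length (u @ v) = n \<longrightarrow>
      sh u v (\<lambda>w. ksgn (susp_sign (map fst w)) (f (args (susp V) w))) = 0)"
proof -
  interpret W: complex W by (rule chain_complex_complex[OF W])
  have sV: "complex (susp V)" by (rule complex_susp[OF V])
  have sm: "smul W (of_int (sign \<sigma>)) x = ksgn (if evenperm \<sigma> then 0 else 1) x" for \<sigma> x
    by (simp add: sign_def ksgn_def)
  have eq: "(\<Sum>\<sigma>\<in>shuffle_perms (length u) n. smul W (of_int (sign \<sigma>))
       (ksgn (perm_koszul \<sigma> (map (\<lambda>a. fst a - 1) (u @ v))) (f (permute_list (inv \<sigma>) (args (susp V) (u @ v)))))) =
     shsum u v (\<lambda>w. f (args (susp V) w))" if n: "length (u @ v) = n" for u v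
    unfolding shsum_def n
  proof (rule sum.cong[OF refl])
    fix \<sigma> assume "\<sigma> \<in> shuffle_perms (length u) n"
    then have "inv \<sigma> permutes {..<length (u @ v)}" unfolding n by (rule permutes_inv[OF shuffle_permsD(1)])
    then have "permute_list (inv \<sigma>) (args (susp V) (u @ v)) = args (susp V) (permute_list (inv \<sigma>) (u @ v))"
      unfolding args_def by (rule permute_list_map)
    then show "smul W (of_int (sign \<sigma>))
       (ksgn (perm_koszul \<sigma> (map (\<lambda>a. fst a - 1) (u @ v))) (f (permute_list (inv \<sigma>) (args (susp V) (u @ v))))) =
      ksgn ((if evenperm \<sigma> then 0 else 1) + perm_koszul \<sigma> (map (\<lambda>a. fst a - 1) (u @ v)))
        (f (args (susp V) (permute_list (inv \<sigma>) (u @ v))))"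
      unfolding sm ksgn_ksgn by simp
  qed
  have kz: "ksgn e x = 0 \<longleftrightarrow> x = 0" for e and x :: 'c by (simp add: ksgn_def)
  show ?thesis
  proof
    assume van: "vanishes_on_shuffles V W n f"
    show "\<forall>u v. u \<noteq> [] \<and> v \<noteq> [] \<and> length (u @ v) = n \<longrightarrow>
      sh u v (\<lambda>w. ksgn (susp_sign (map fst w)) (f (args (susp V) w))) = 0"
    proof (intro allI impI)
      fix u v :: "(int \<times> 'b) list" assume *: "u \<noteq> [] \<and> v \<noteq> [] \<and> length (u @ v) = n"
      have "homogeneous V (map (\<lambda>a. fst a - 1) (u @ v)) (args (susp V) (u @ v))"
        unfolding homogeneous_def args_def list.rel_map
        by (rule list.rel_refl) (use complex.component_grade[OF sV] in simp)
      then have "shsum u v (\<lambda>w. f (args (susp V) w)) = 0"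
        unfolding eq[OF conjunct2[OF conjunct2[OF *]], symmetric]
        using van * unfolding vanishes_on_shuffles_def by (auto simp: length_greater_0_conv[symmetric] simp del: length_greater_0_conv)
      then show "sh u v (\<lambda>w. ksgn (susp_sign (map fst w)) (f (args (susp V) w))) = 0" unfolding sh_susp_sign kz .
    qed
  next
    assume van: "\<forall>u v. u \<noteq> [] \<and> v \<noteq> [] \<and> length (u @ v) = n \<longrightarrow>
      sh u v (\<lambda>w. ksgn (susp_sign (map fst w)) (f (args (susp V) w))) = 0"
    show "vanishes_on_shuffles V W n f"
      unfolding vanishes_on_shuffles_def
    proof (intro allI impI)
      fix p ds xs assume *: "1 \<le> p \<and> p < n \<and> length xs = n \<and> homogeneous V ds xs"
      let ?w = "zip (map (\<lambda>d. d + 1) ds) xs"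
      have h: "homogeneous (susp V) (map (\<lambda>d. d + 1) ds) xs" using * by (simp add: homogeneous_def list.rel_map)
      have w: "args (susp V) ?w = xs" "map fst ?w = map (\<lambda>d. d + 1) ds" using args_zip[OF sV h] by auto
      have ds: "map (\<lambda>a. fst a - 1) ?w = ds"
        using arg_cong[OF w(2), of "map (\<lambda>d. d - 1)"] by (simp add: o_def)
      have l: "length ?w = n" using arg_cong[OF w(1), of length] * by simp
      let ?u = "take p ?w" and ?v = "drop p ?w"
      have uv: "?u \<noteq> [] \<and> ?v \<noteq> [] \<and> length (?u @ ?v) = n" "length ?u = p"
        using * l by (auto simp del: length_zip)
      have "shsum ?u ?v (\<lambda>w. f (args (susp V) w)) = 0" using van uv unfolding sh_susp_sign kz by blast
      then show "(\<Sum>\<sigma>\<in>shuffle_perms p n. smul W (of_int (sign \<sigma>))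
        (ksgn (perm_koszul \<sigma> ds) (f (permute_list (inv \<sigma>) xs)))) = 0"
        using eq[of ?u ?v] uv unfolding append_take_drop_id ds w by simp
    qed
  qed
qed

section \<open>Associative and commutative algebras\<close>

text \<open>In the bar construction the differential is the operation of arity one.\<close>

definition opsA :: "enat \<Rightarrow> ('k::field, 'w::ab_group_add) complex_data \<Rightarrow> (nat \<Rightarrow> 'w list \<Rightarrow> 'w) \<Rightarrow> nat \<Rightarrow> 'w list \<Rightarrow> 'w"
  where "opsA K W n i xs = (if i = 1 then bd W (hd xs) else if 2 \<le> i \<and> enat i \<le> K then n i xs else 0)"

definition mapsA :: "enat \<Rightarrow> (nat \<Rightarrow> 'v list \<Rightarrow> 'w::zero) \<Rightarrow> nat \<Rightarrow> 'v list \<Rightarrow> 'w"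
  where "mapsA K F i xs = (if enat i \<le> K then F i xs else 0)"

lemma multi_hom_zero:
  assumes "complex V" "complex W"
  shows "multi_hom V W n e (\<lambda>_. 0)"
proof -
  interpret V: complex V by fact
  interpret W: complex W by fact
  show ?thesis by (simp add: multi_hom_def linear_iff V.vs.vector_space_axioms W.vs.vector_space_axioms)
qed

lemma multi_hom_opsA:
  assumes W: "complex W" and n: "\<And>i. 2 \<le> i \<Longrightarrow> enat i \<le> K \<Longrightarrow> multi_hom W W i (int i - 2) (n i)" and j: "1 \<le> j"
  shows "multi_hom W W j (int j - 2) (opsA K W n j)"
proof -
  interpret W: complex W by (rule W)
  consider "j = 1" | "2 \<le> j" "enat j \<le> K" | "2 \<le> j" "\<not> enat j \<le> K" using j by linarith
  then show ?thesis
  proof cases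
    case 1
    have "opsA K W n j = (\<lambda>xs. bd W (hd xs))" using 1 by (auto simp: opsA_def)
    moreover have "multi_hom W W 1 (- 1) (\<lambda>xs. bd W (hd xs))"
      unfolding multi_hom_def
      by (auto simp: linear_iff W.vs.vector_space_axioms W.bd_add W.bd_scale homogeneous_def
          length_Suc_conv list_all2_Cons2 W.bd_grade)
    ultimately show ?thesis using 1 by simp
  next
    case 2
    then have "opsA K W n j = n j" by (auto simp: opsA_def)
    then show ?thesis using n 2 by simp
  next
    case 3
    then have "opsA K W n j = (\<lambda>_. 0)" by (auto simp: opsA_def)
    then show ?thesis using multi_hom_zero[OF W W] by simp
  qed
qed

lemma multi_hom_mapsA:
  assumes V: "complex V" and W: "complex W"
    and F: "\<And>i. 1 \<le> i \<Longrightarrow> enat i \<le> K \<Longrightarrow> multi_hom V W i (int i - 1) (F i)" and j: "1 \<le> j"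
  shows "multi_hom V W j (int j - 1) (mapsA K F j)"
proof (cases "enat j \<le> K")
  case True
  then have "mapsA K F j = F j" by (auto simp: mapsA_def)
  then show ?thesis using F[OF j True] by simp
next
  case False
  then have "mapsA K F j = (\<lambda>_. 0)" by (auto simp: mapsA_def)
  then show ?thesis using multi_hom_zero[OF V W] by simp
qed

text \<open>The part of \<open>hom_diff\<close> in which the differential is applied first.\<close>

definition dterms :: "('k, 'v::ab_group_add) complex_data \<Rightarrow> ('v list \<Rightarrow> 'w::ab_group_add) \<Rightarrow> int list \<Rightarrow> 'v list \<Rightarrow> 'w" where
  "dterms V f ds xs = (\<Sum>s<length xs. ksgn (sum_list (take s ds)) (f (xs[s := bd V (xs ! s)])))"

lemma insert_sum_split:
  assumes N: "length xs = N" "1 \<le> N"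
  shows "(\<Sum>j=1..N. \<Sum>s=0..N - j. ksgn (int (N + 1 - j + s * (j + 1)))
      (insert_op (ff (N + 1 - j)) s (opsA K V m j) j (int j - 2) ds xs)) =
    ksgn (int N) (dterms V (ff N) ds xs) +
    (\<Sum>(i, j) | i + j = N + 1 \<and> 1 \<le> i \<and> 2 \<le> j. \<Sum>s=0..N - j. ksgn (int (i + s * (j + 1)))
      (insert_op (ff i) s (opsA K V m j) j (int j - 2) ds xs))"
proof -
  let ?g = "\<lambda>i j. \<Sum>s=0..N - j. ksgn (int (i + s * (j + 1))) (insert_op (ff i) s (opsA K V m j) j (int j - 2) ds xs)"
  have re: "(\<Sum>j=2..N. h (N + 1 - j) j) = (\<Sum>(i, j) | i + j = N + 1 \<and> 1 \<le> i \<and> 2 \<le> j. h i j)"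
    for h :: "nat \<Rightarrow> nat \<Rightarrow> 'b"
    by (rule sum.reindex_bij_witness[of _ snd "\<lambda>j. (N + 1 - j, j)"]) auto
  have "(\<Sum>j=1..N. ?g (N + 1 - j) j) = ?g N 1 + (\<Sum>j=2..N. ?g (N + 1 - j) j)"
    using N(2) by (simp add: sum.atLeast_Suc_atMost numeral_2_eq_2)
  also have "(\<Sum>j=2..N. ?g (N + 1 - j) j) = (\<Sum>(i, j) | i + j = N + 1 \<and> 1 \<le> i \<and> 2 \<le> j. ?g i j)"
    by (rule re)
  also have "?g N 1 = ksgn (int N) (dterms V (ff N) ds xs)"
  proof -
    have "{0..N - 1} = {..<N}" using N(2) by auto
    then have "?g N 1 = (\<Sum>s<N. ksgn (int (N + s * 2)) (insert_op (ff N) s (opsA K V m 1) 1 (- 1) ds xs))"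
      by (simp add: mult.commute)
    also have "\<dots> = (\<Sum>s<N. ksgn (int N) (ksgn (sum_list (take s ds)) (ff N (xs[s := bd V (xs ! s)]))))"
    proof (rule sum.cong[OF refl])
      fix s assume "s \<in> {..<N}"
      then have s: "s < length xs" using N(1) by simp
      have "hd (take 1 (drop s xs)) = xs ! s"
        using s by (cases "drop s xs") (auto simp: hd_drop_conv_nth[symmetric])
      then have "take s xs @ opsA K V m 1 (take 1 (drop s xs)) # drop (s + 1) xs = xs[s := bd V (xs ! s)]"
        using s by (simp add: opsA_def upd_conv_take_nth_drop)
      then have "insert_op (ff N) s (opsA K V m 1) 1 (- 1) ds xs = ksgn (- sum_list (take s ds)) (ff N (xs[s := bd V (xs ! s)]))"
        by (simp add: insert_op_def)
      then show "ksgn (int (N + s * 2)) (insert_op (ff N) s (opsA K V m 1) 1 (- 1) ds xs) =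
        ksgn (int N) (ksgn (sum_list (take s ds)) (ff N (xs[s := bd V (xs ! s)])))"
        unfolding ksgn_ksgn by (simp add: ksgn_ksgn) (rule ksgn_cong, auto)
    qed
    finally show ?thesis by (simp add: dterms_def N(1) ksgn_sum)
  qed
  finally show ?thesis .
qed

lemma tensor_sum_split:
  assumes N: "length xs = N" "1 \<le> N"
  shows "(\<Sum>rs\<in>compositions N. ksgn (int (\<Sum>b<length rs. \<Sum>a<b. rs ! a * (rs ! b + 1)))
      (tensor_op (opsA K W n (length rs)) ff rs ds xs)) =
    bd W (ff N xs) +
    (\<Sum>k=2..N. \<Sum>rs | length rs = k \<and> sum_list rs = N \<and> (\<forall>r\<in>set rs. 1 \<le> r).
      ksgn (int (\<Sum>b<k. \<Sum>a<b. rs ! a * (rs ! b + 1))) (tensor_op (opsA K W n k) ff rs ds xs))"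
proof -
  let ?g = "\<lambda>rs. ksgn (int (\<Sum>b<length rs. \<Sum>a<b. rs ! a * (rs ! b + 1)))
      (tensor_op (opsA K W n (length rs)) ff rs ds xs)"
  let ?C = "\<lambda>k. {rs. length rs = k \<and> sum_list rs = N \<and> (\<forall>r\<in>set rs. 1 \<le> r)}"
  have C: "{rs \<in> compositions N. length rs = k} = ?C k" for k by (auto simp: compositions_def)
  have ln: "length rs \<in> {1..N}" if "rs \<in> compositions N" for rs
    using compositions_length[OF that] that N(2) by (cases rs) (auto simp: compositions_def)
  have "sum ?g (compositions N) = (\<Sum>k=1..N. sum ?g {rs \<in> compositions N. length rs = k})"
    by (rule sum.group[symmetric]) (use finite_compositions ln in auto)
  also have "\<dots> = sum ?g (?C 1) + (\<Sum>k=2..N. sum ?g (?C k))"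
    unfolding C using N(2) by (simp add: sum.atLeast_Suc_atMost numeral_2_eq_2)
  also have "?C 1 = {[N]}" using N(2) by (auto simp: length_Suc_conv)
  also have "sum ?g {[N]} = bd W (ff N xs)"
    using N by (simp add: tensor_op_def opsA_def)
  also have "(\<Sum>k=2..N. sum ?g (?C k)) = (\<Sum>k=2..N. \<Sum>rs\<in>?C k.
      ksgn (int (\<Sum>b<k. \<Sum>a<b. rs ! a * (rs ! b + 1))) (tensor_op (opsA K W n k) ff rs ds xs))"
    by (intro sum.cong refl) auto
  finally show ?thesis .
qed

text \<open>The minus sign makes the unary part equal to the differential \<open>- \<partial>\<close> of the suspension.\<close>

definition bar_ops :: "enat \<Rightarrow> ('k::field, 'w::ab_group_add) complex_data \<Rightarrow> (nat \<Rightarrow> 'w list \<Rightarrow> 'w) \<Rightarrow> (int \<times> 'w) list \<Rightarrow> 'w" where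
  "bar_ops K W n w = - tagged (susp W) susp_sign (opsA K W n) w"

definition bar_maps :: "enat \<Rightarrow> ('k::field, 'v::ab_group_add) complex_data \<Rightarrow> (nat \<Rightarrow> 'v list \<Rightarrow> 'w::ab_group_add) \<Rightarrow> (int \<times> 'v) list \<Rightarrow> 'w" where
  "bar_maps K V F = tagged (susp V) susp_sign (mapsA K F)"

lemma ksgn_eq_0: "ksgn e x = 0 \<longleftrightarrow> x = 0" by (simp add: ksgn_def)

text \<open>Words of length \<open>N\<close> and homogeneous lists of length \<open>N\<close> carry the same data.\<close>

lemma all_words_iff:
  assumes "complex (susp V)"
  shows "(\<forall>ds xs. length xs = N \<and> homogeneous V ds xs \<longrightarrow> Q ds xs) \<longleftrightarrow>
    (\<forall>w. length w = N \<longrightarrow> Q (map (\<lambda>a. fst a - 1) w) (args (susp V) w))"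
proof (intro iffI allI impI)
  fix w :: "(int \<times> 'b) list" assume Q: "\<forall>ds xs. length xs = N \<and> homogeneous V ds xs \<longrightarrow> Q ds xs" and w: "length w = N"
  have "homogeneous V (map (\<lambda>a. fst a - 1) w) (args (susp V) w)"
    unfolding homogeneous_def args_def list.rel_map
    by (rule list.rel_refl) (use complex.component_grade[OF assms] in simp)
  then show "Q (map (\<lambda>a. fst a - 1) w) (args (susp V) w)" using Q w by simp
next
  fix ds xs assume Q: "\<forall>w. length w = N \<longrightarrow> Q (map (\<lambda>a. fst a - 1) w) (args (susp V) w)"
    and x: "length xs = N \<and> homogeneous V ds xs"
  let ?w = "zip (map (\<lambda>d. d + 1) ds) xs"
  have "homogeneous (susp V) (map (\<lambda>d. d + 1) ds) xs" using x by (simp add: homogeneous_def list.rel_map)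
  then have w: "args (susp V) ?w = xs" "map fst ?w = map (\<lambda>d. d + 1) ds" using args_zip[OF assms] by auto
  have "map (\<lambda>a. fst a - 1) ?w = ds" using arg_cong[OF w(2), of "map (\<lambda>d. d - 1)"] by (simp add: o_def)
  moreover have "length ?w = N" using arg_cong[OF w(1), of length] x by simp
  ultimately show "Q ds xs" using Q w(1) by metis
qed

text \<open>The terms of \<open>\<delta>(n\<^sub>N)\<close> are those terms of the square of the coderivation in which one of the two
  operations is unary.\<close>

lemma A_equation_words:
  assumes W: "chain_complex W" and n: "\<And>i. 2 \<le> i \<Longrightarrow> enat i \<le> K \<Longrightarrow> multi_hom W W i (int i - 2) (n i)"
    and N: "2 \<le> N" "enat N \<le> K" and w: "length w = N"
    and ds: "ds = map (\<lambda>a. fst a - 1) w" and xs: "xs = args (susp W) w"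
  shows "hom_diff W W (int N - 2) (n N) ds xs =
      (\<Sum>(i, j) | i + j = N + 1 \<and> 2 \<le> i \<and> 2 \<le> j. \<Sum>s = 0..N - j.
         ksgn (int (i + s * (j + 1))) (insert_op (n i) s (n j) j (int j - 2) ds xs)) \<longleftrightarrow>
    ins False (- 1) (bar_ops K W n) (bar_ops K W n) w = 0"
proof -
  let ?nn = "opsA K W n"
  have cW: "complex W" by (rule chain_complex_complex[OF W])
  have sW: "complex (susp W)" by (rule complex_susp[OF W])
  have m: "multi_hom W W j (int j - 2) (?nn j)" if "1 \<le> j" for j by (rule multi_hom_opsA[OF cW n that])
  have a: "addi (\<lambda>x. ?nn (length us + length vs + 1) (us @ x # vs))" for us vs
    by (rule multi_hom_addi[OF m]) auto
  have l: "length xs = N" "1 \<le> N" using w N by (simp_all add: xs)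
  let ?I = "\<lambda>i j. \<Sum>s = 0..N - j. ksgn (int (i + s * (j + 1))) (insert_op (?nn i) s (?nn j) j (int j - 2) ds xs)"
  let ?P = "{(i, j). i + j = N + 1 \<and> 2 \<le> i \<and> 2 \<le> j}"
  have le: "enat i \<le> K" if "i \<le> N" for i using that N(2) by (meson enat_ord_simps(1) order_trans)
  have op: "?nn i = n i" if "2 \<le> i" "i \<le> N" for i using that le by (auto simp: opsA_def)
  have t: "ins False (- 1) (\<lambda>w. - tagged (susp W) susp_sign ?nn w) (tagged (susp W) susp_sign ?nn) w =
    ksgn (susp_sign (map fst w)) (\<Sum>j=1..N. \<Sum>s=0..N - j. ksgn (int (N + 1 - j + s * (j + 1)))
        (insert_op (?nn (N + 1 - j)) s (?nn j) j (int j - 2) ds xs))"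
    using ins_tagged[where ff = ?nn and nn = ?nn, OF sW _ _ ds xs] m a w by blast
  have "ins False (- 1) (bar_ops K W n) (bar_ops K W n) w =
    - ins False (- 1) (\<lambda>w. - tagged (susp W) susp_sign ?nn w) (tagged (susp W) susp_sign ?nn) w"
    unfolding bar_ops_def[abs_def] by (rule ins_minus)
  also have "\<dots> = - ksgn (susp_sign (map fst w)) (ksgn (int N) (dterms W (?nn N) ds xs) +
     (\<Sum>(i, j) | i + j = N + 1 \<and> 1 \<le> i \<and> 2 \<le> j. ?I i j))"
    unfolding t insert_sum_split[OF l, of ?nn K W n] ..
  also have "(\<Sum>(i, j) | i + j = N + 1 \<and> 1 \<le> i \<and> 2 \<le> j. ?I i j) = ?I 1 N + (\<Sum>(i, j)\<in>?P. ?I i j)"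
  proof -
    have "{(i, j). i + j = N + 1 \<and> 1 \<le> i \<and> 2 \<le> j} = insert (1, N) ?P" using N by auto
    moreover have "finite ?P" by (rule finite_subset[of _ "{..N} \<times> {..N}"]) auto
    ultimately show ?thesis by simp
  qed
  also have "?I 1 N = - bd W (n N xs)"
    using l(1) N by (simp add: insert_op_def opsA_def ksgn_odd ksgn_even)
  also have "(\<Sum>(i, j)\<in>?P. ?I i j) = (\<Sum>(i, j)\<in>?P. \<Sum>s = 0..N - j.
      ksgn (int (i + s * (j + 1))) (insert_op (n i) s (n j) j (int j - 2) ds xs))" (is "_ = ?R")
    by (intro sum.cong refl) (auto simp: op intro!: sum.cong)
  finally have "ins False (- 1) (bar_ops K W n) (bar_ops K W n) w =
     - ksgn (susp_sign (map fst w)) (ksgn (int N) (dterms W (n N) ds xs) + (- bd W (n N xs) + ?R))"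
    unfolding op[OF N(1) order_refl] .
  moreover have "hom_diff W W (int N - 2) (n N) ds xs = bd W (n N xs) - ksgn (int N) (dterms W (n N) ds xs)"
    unfolding hom_diff_def dterms_def by (rule arg_cong2[where f = "(-)"], rule refl, rule ksgn_cong) auto
  moreover have "(B - A = R) \<longleftrightarrow> (- ksgn e (A + (- B + R)) = 0)" for e and A B R :: 'b
    by (auto simp: ksgn_eq_0 algebra_simps)
  ultimately show ?thesis by (simp only:)
qed

lemma A_equation_letter:
  assumes W: "chain_complex W" and w: "length w = 1"
  shows "ins False (- 1) (bar_ops K W n) (bar_ops K W n) w = 0"
proof -
  interpret W: complex W by (rule chain_complex_complex[OF W])
  interpret sW: complex "susp W" by (rule complex_susp[OF W])
  obtain d x where w: "w = [(d, x)]" using w by (cases w) auto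
  have q: "bar_ops K W n [(d, x)] = - bd W (component (susp W) d x)" for d x
    by (simp add: bar_ops_def tagged_def opsA_def)
  have "- bd W (component (susp W) d x) \<in> grade (susp W) (d - 1)"
    using sW.bd_grade[OF sW.component_grade, of d x] by simp
  then show ?thesis
    unfolding w by (simp add: hat_def q sW.component_same W.bd_minus)
qed

text \<open>The terms with a unary operation or with a single block make up \<open>\<delta>(F\<^sub>N)\<close>.\<close>

lemma A_morphism_equation_words:
  assumes V: "chain_complex V" and W: "chain_complex W"
    and m: "\<And>i. 2 \<le> i \<Longrightarrow> multi_hom V V i (int i - 2) (m i)"
    and n: "\<And>i. 2 \<le> i \<Longrightarrow> enat i \<le> K \<Longrightarrow> multi_hom W W i (int i - 2) (n i)"
    and F: "\<And>i. 1 \<le> i \<Longrightarrow> enat i \<le> K \<Longrightarrow> multi_hom V W i (int i - 1) (F i)"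
    and N: "1 \<le> N" "enat N \<le> K" and w: "length w = N"
    and ds: "ds = map (\<lambda>a. fst a - 1) w" and xs: "xs = args (susp V) w"
  shows "hom_diff V W (int N - 1) (F N) ds xs =
        - (\<Sum>k = 2..N. \<Sum>rs | length rs = k \<and> sum_list rs = N \<and> (\<forall>r\<in>set rs. 1 \<le> r).
             ksgn (int (\<Sum>b<k. \<Sum>a<b. rs ! a * (rs ! b + 1))) (tensor_op (n k) F rs ds xs))
        - (\<Sum>(i, j) | i + j = N + 1 \<and> 1 \<le> i \<and> 2 \<le> j. \<Sum>s = 0..N - j.
             ksgn (int (i + s * (j + 1))) (insert_op (F i) s (m j) j (int j - 2) ds xs)) \<longleftrightarrow>
    ins False (- 1) (bar_ops \<infinity> V m) (bar_maps K V F) w = cm False (bar_maps K V F) (bar_ops K W n) w"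
proof -
  let ?mm = "opsA \<infinity> V m" and ?nn = "opsA K W n" and ?FF = "mapsA K F"
  have cV: "complex V" and cW: "complex W" and sV: "complex (susp V)" and sW: "complex (susp W)"
    using chain_complex_complex complex_susp V W by blast+
  have mm: "multi_hom V V j (int j - 2) (?mm j)" if "1 \<le> j" for j by (rule multi_hom_opsA[OF cV m that])
  have nn: "multi_hom W W j (int j - 2) (?nn j)" if "1 \<le> j" for j by (rule multi_hom_opsA[OF cW n that])
  have FF: "multi_hom V W j (int j - 1) (?FF j)" if "1 \<le> j" for j by (rule multi_hom_mapsA[OF cV cW F that])
  have na: "addi (\<lambda>x. ?nn (length us + length vs + 1) (us @ x # vs))" for us vs
    by (rule multi_hom_addi[OF nn]) auto
  have Fa: "addi (\<lambda>x. ?FF (length us + length vs + 1) (us @ x # vs))" for us vs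
    by (rule multi_hom_addi[OF FF]) auto
  have l: "length xs = N" using w by (simp add: xs)
  have le: "enat i \<le> K" if "i \<le> N" for i using that N(2) by (meson enat_ord_simps(1) order_trans)
  have opF: "?FF i = F i" if "i \<le> N" for i using that le by (auto simp: mapsA_def)
  have opn: "?nn i = n i" if "2 \<le> i" "i \<le> N" for i using that le by (auto simp: opsA_def)
  have opm: "?mm i = m i" if "2 \<le> i" for i using that by (auto simp: opsA_def)
  let ?k = "susp_sign (map fst w)"
  let ?S1 = "\<Sum>k = 2..N. \<Sum>rs | length rs = k \<and> sum_list rs = N \<and> (\<forall>r\<in>set rs. 1 \<le> r).
             ksgn (int (\<Sum>b<k. \<Sum>a<b. rs ! a * (rs ! b + 1))) (tensor_op (n k) F rs ds xs)"
  let ?S2 = "\<Sum>(i, j) | i + j = N + 1 \<and> 1 \<le> i \<and> 2 \<le> j. \<Sum>s = 0..N - j.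
             ksgn (int (i + s * (j + 1))) (insert_op (F i) s (m j) j (int j - 2) ds xs)"
  have S2: "(\<Sum>(i, j) | i + j = N + 1 \<and> 1 \<le> i \<and> 2 \<le> j. \<Sum>s = 0..N - j.
       ksgn (int (i + s * (j + 1))) (insert_op (?FF i) s (?mm j) j (int j - 2) ds xs)) = ?S2"
    by (intro sum.cong refl) (auto simp: opF opm intro!: sum.cong)
  have S1: "(\<Sum>k = 2..N. \<Sum>rs | length rs = k \<and> sum_list rs = N \<and> (\<forall>r\<in>set rs. 1 \<le> r).
       ksgn (int (\<Sum>b<k. \<Sum>a<b. rs ! a * (rs ! b + 1))) (tensor_op (?nn k) ?FF rs ds xs)) = ?S1"
  proof (intro sum.cong refl, goal_cases)
    case (1 k rs)
    have r: "r \<le> N" if "r \<in> set rs" for r using 1 that member_le_sum_list by auto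
    have "map2 ?FF rs ys = map2 F rs ys" for ys
      by (rule map_cong[OF refl]) (use r opF in \<open>auto dest: set_zip_leftD\<close>)
    moreover have "?nn k = n k" using 1 opn by simp
    ultimately show ?case unfolding tensor_op_def by (simp only:)
  qed
  have I: "ins False (- 1) (bar_ops \<infinity> V m) (bar_maps K V F) w =
     ksgn ?k (ksgn (int N) (dterms V (F N) ds xs) + ?S2)"
  proof -
    have t: "ins False (- 1) (\<lambda>w. - tagged (susp V) susp_sign ?mm w) (tagged (susp V) susp_sign ?FF) w =
      ksgn ?k (\<Sum>j=1..N. \<Sum>s=0..N - j. ksgn (int (N + 1 - j + s * (j + 1)))
        (insert_op (?FF (N + 1 - j)) s (?mm j) j (int j - 2) ds xs))"
      using ins_tagged[where ff = ?FF and nn = ?mm, OF sV _ _ ds xs] mm Fa w by blast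
    show ?thesis
      unfolding bar_ops_def[abs_def] bar_maps_def t
        insert_sum_split[OF l N(1), of ?FF \<infinity> V m] S2 opF[OF order_refl] ..
  qed
  have C: "cm False (bar_maps K V F) (bar_ops K W n) w = - ksgn ?k (bd W (F N xs) + ?S1)"
  proof -
    have t: "cm False (tagged (susp V) susp_sign ?FF) (\<lambda>w. - tagged (susp W) susp_sign ?nn w) w =
      - ksgn ?k (\<Sum>rs\<in>compositions N. ksgn (int (\<Sum>b<length rs. \<Sum>a<b. rs ! a * (rs ! b + 1)))
        (tensor_op (?nn (length rs)) ?FF rs ds xs))"
      using cm_tagged[where ff = ?FF and nn = ?nn, OF sV sW _ _ ds xs] FF na w by blast
    show ?thesis
      unfolding bar_ops_def[abs_def] bar_maps_def t
        tensor_sum_split[OF l N(1), of K W n ?FF] S1 opF[OF order_refl] ..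
  qed
  have H: "hom_diff V W (int N - 1) (F N) ds xs = bd W (F N xs) + ksgn (int N) (dterms V (F N) ds xs)"
    unfolding hom_diff_def dterms_def by (simp add: ksgn_def)
  have "ksgn ?k A = - ksgn ?k B \<longleftrightarrow> A + B = 0" for A B :: 'c
    by (auto simp: ksgn_def eq_neg_iff_add_eq_0 add.commute neg_eq_iff_add_eq_0)
  then show ?thesis unfolding I C H by (auto simp: algebra_simps eq_neg_iff_add_eq_0)
qed

lemma adm_sign:
  assumes "complex X" "adm md U X e f"
  shows "adm Assoc U X e (\<lambda>w. ksgn (sg (map fst w)) (f w))"
proof -
  interpret X: complex X by fact
  have "lind U (smul X) d (\<lambda>x. ksgn (sg (map fst (u @ (d, x) # w))) (f (u @ (d, x) # w)))" for u d w
    using lcl_ksgn[OF lcl_lind[OF X.vs.vector_space_axioms], OF mlinD[OF adm_mlin[OF assms(2)]], of d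
      "sg (map fst u @ d # map fst w)" u w] by simp
  then show ?thesis
    using adm_grade[OF assms(2)] by (auto simp: adm_def mlin_def intro: X.grade_ksgn)
qed

text \<open>Both cases without permutations: \<open>md\<close> is \<open>Assoc\<close> or \<open>Comm\<close>. The components of the extension above arity
  \<open>k\<close> are taken from the words, after removing the suspension sign.\<close>

theorem A_extension:
  fixes V :: "('k::field_char_0, 'v::ab_group_add) complex_data"
    and W :: "('k, 'w::ab_group_add) complex_data"
  assumes md: "md \<noteq> Lie" and k: "1 \<le> k"
    and Va: "A_algebra \<infinity> V m" and Wa: "A_algebra (enat k) W n" and Fm: "A_morphism (enat k) V W m n F"
    and qi: "quasi_iso V W (\<lambda>x. F 1 [x])"
    and cm: "\<And>i. md = Comm \<Longrightarrow> 2 \<le> i \<Longrightarrow> vanishes_on_shuffles V V i (m i)"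
      "\<And>i. md = Comm \<Longrightarrow> 2 \<le> i \<Longrightarrow> i \<le> k \<Longrightarrow> vanishes_on_shuffles W W i (n i)"
      "\<And>i. md = Comm \<Longrightarrow> 1 \<le> i \<Longrightarrow> i \<le> k \<Longrightarrow> vanishes_on_shuffles V W i (F i)"
  shows "\<exists>n' F'. (\<forall>i. 2 \<le> i \<and> i \<le> k \<longrightarrow> n' i = n i) \<and> (\<forall>i. 1 \<le> i \<and> i \<le> k \<longrightarrow> F' i = F i) \<and>
     A_algebra \<infinity> W n' \<and> A_morphism \<infinity> V W m n' F' \<and>
     (md = Comm \<longrightarrow> (\<forall>i\<ge>2. vanishes_on_shuffles W W i (n' i)) \<and> (\<forall>i\<ge>1. vanishes_on_shuffles V W i (F' i)))"
proof -
  let ?U = "susp V" and ?X = "susp W" and ?K = "enat k"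
  have V: "chain_complex V" and W: "chain_complex W" using Va Wa by (simp_all add: A_algebra_def)
  have cV: "complex V" and cW: "complex W" and sV: "complex ?U" and sW: "complex ?X"
    using chain_complex_complex complex_susp V W by blast+
  have m: "multi_hom V V i (int i - 2) (m i)" if "2 \<le> i" for i using Va that by (simp add: A_algebra_def)
  have n: "multi_hom W W i (int i - 2) (n i)" if "2 \<le> i" "enat i \<le> ?K" for i using Wa that by (simp add: A_algebra_def)
  have F: "multi_hom V W i (int i - 1) (F i)" if "1 \<le> i" "enat i \<le> ?K" for i using Fm that by (simp add: A_morphism_def)
  have sy: "sy md = False" using md by simp
  have shuffle_null_tagged: "shuffle_null (tagged (susp A) susp_sign g)"
    if A: "chain_complex A" and B: "chain_complex B" and v: "\<And>i. 2 \<le> i \<Longrightarrow> vanishes_on_shuffles A B i (g i)"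
    for A :: "('k, 'a::ab_group_add) complex_data" and B :: "('k, 'b::ab_group_add) complex_data" and g
    unfolding shuffle_null_def
  proof (intro allI impI)
    fix u v :: "(int \<times> 'a) list" assume uv: "u \<noteq> []" "v \<noteq> []"
    then have 2: "2 \<le> length (u @ v)" by (cases u; cases v) auto
    have "sh u v (tagged (susp A) susp_sign g) = sh u v (\<lambda>w. ksgn (susp_sign (map fst w)) (g (length (u @ v)) (args (susp A) w)))"
      by (rule sh_cong) (simp add: tagged_def)
    also have "\<dots> = 0" using v[OF 2] uv unfolding vanishes_on_shuffles_sh[OF A B] by blast
    finally show "sh u v (tagged (susp A) susp_sign g) = 0" .
  qed
  have shuffle_null_neg: "shuffle_null (\<lambda>w. - f w)" if "shuffle_null f" for f :: "(int \<times> 'a) list \<Rightarrow> 'b::ab_group_add"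
    using that by (simp add: shuffle_null_def sh_post[OF addi_uminus, symmetric])
  have vz: "vanishes_on_shuffles A B i (\<lambda>_. 0)" if "chain_complex A" "chain_complex B"
    for A :: "('k, 'a::ab_group_add) complex_data" and B :: "('k, 'b::ab_group_add) complex_data" and i
    unfolding vanishes_on_shuffles_sh[OF that] by (simp add: sh_0)
  have adm_ops: "adm md (susp A) (susp A) (- 1) (bar_ops K' A n'')"
    if A: "chain_complex A" and nn: "\<And>i. 2 \<le> i \<Longrightarrow> enat i \<le> K' \<Longrightarrow> multi_hom A A i (int i - 2) (n'' i)"
      and v: "\<And>i. md = Comm \<Longrightarrow> 2 \<le> i \<Longrightarrow> enat i \<le> K' \<Longrightarrow> vanishes_on_shuffles A A i (n'' i)"
    for A :: "('k, 'a::ab_group_add) complex_data" and K' n''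
    unfolding bar_ops_def[abs_def]
  proof (rule adm_minus[OF complex_susp[OF A]], rule adm_tagged[OF complex_susp[OF A] complex_susp[OF A]])
    show "multi_hom (susp A) (susp A) i (- 1) (opsA K' A n'' i)" if "1 \<le> i" for i
      by (rule multi_hom_susp[OF multi_hom_opsA[OF chain_complex_complex[OF A] nn that]]) simp_all
    show "shuffle_null (tagged (susp A) susp_sign (opsA K' A n''))" if c: "md = Comm"
    proof (rule shuffle_null_tagged[OF A A])
      fix i :: nat assume i: "2 \<le> i"
      show "vanishes_on_shuffles A A i (opsA K' A n'' i)"
      proof (cases "enat i \<le> K'")
        case True
        then have "opsA K' A n'' i = n'' i" using i by (auto simp: opsA_def)
        then show ?thesis using v[OF c i True] by simp
      next
        case False
        then have "opsA K' A n'' i = (\<lambda>_. 0)" using i by (auto simp: opsA_def)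
        then show ?thesis using vz[OF A A] by simp
      qed
    qed
  qed (use md in simp)
  let ?p = "bar_ops \<infinity> V m" and ?q = "bar_ops ?K W n" and ?\<phi> = "bar_maps ?K V F"
  have p: "adm md ?U ?U (- 1) ?p" by (rule adm_ops[OF V]) (use m cm(1) in auto)
  have q: "adm md ?X ?X (- 1) ?q" by (rule adm_ops[OF W]) (use n cm(2) in auto)
  have \<phi>: "adm md ?U ?X 0 ?\<phi>"
    unfolding bar_maps_def
  proof (rule adm_tagged[OF sV sW])
    show "multi_hom ?U ?X i 0 (mapsA ?K F i)" if "1 \<le> i" for i
      by (rule multi_hom_susp[OF multi_hom_mapsA[OF cV cW F that]]) simp_all
    show "shuffle_null (tagged ?U susp_sign (mapsA ?K F))" if c: "md = Comm"
    proof (rule shuffle_null_tagged[OF V W])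
      fix i :: nat assume i: "2 \<le> i"
      show "vanishes_on_shuffles V W i (mapsA ?K F i)"
      proof (cases "i \<le> k")
        case True
        then have "mapsA ?K F i = F i" by (auto simp: mapsA_def)
        then show ?thesis using cm(3)[OF c, of i] i True by simp
      next
        case False
        then have "mapsA ?K F i = (\<lambda>_. 0)" by (auto simp: mapsA_def)
        then show ?thesis using vz[OF V W] by simp
      qed
    qed
  qed (use md in simp)
  have one: "bar_ops K' A n'' [(d, x)] = dU (susp A) d x" for A :: "('k, 'a::ab_group_add) complex_data" and K' n'' d x
    by (simp add: bar_ops_def tagged_def opsA_def dU_def)
  have pp: "ins (sy md) (- 1) ?p ?p w = 0" if "w \<noteq> []" for w
  proof (cases "length w = 1")
    case True
    then show ?thesis unfolding sy by (rule A_equation_letter[OF V])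
  next
    case False
    then have 2: "2 \<le> length w" using that by (cases w) (auto simp: Suc_le_eq)
    let ?N = "length w"
    have "\<forall>ds xs. length xs = ?N \<and> homogeneous V ds xs \<longrightarrow>
        hom_diff V V (int ?N - 2) (m ?N) ds xs =
        (\<Sum>(i, j) | i + j = ?N + 1 \<and> 2 \<le> i \<and> 2 \<le> j. \<Sum>s = 0..?N - j.
           ksgn (int (i + s * (j + 1))) (insert_op (m i) s (m j) j (int j - 2) ds xs))"
      using Va 2 by (simp add: A_algebra_def)
    note eq = this[unfolded all_words_iff[OF sV], rule_format, OF refl]
    have le: "enat ?N \<le> \<infinity>" by simp
    show ?thesis
      unfolding sy by (rule iffD1[OF A_equation_words[OF V m 2 le refl refl refl] eq])
  qed
  have st: "stage md ?U ?X ?p k ?q ?\<phi>"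
    unfolding stage_def sy
  proof (intro conjI allI impI q \<phi> one)
    fix w :: "(int \<times> 'w) list" assume w: "w \<noteq> [] \<and> length w \<le> k"
    show "ins False (- 1) ?q ?q w = 0"
    proof (cases "length w = 1")
      case True
      then show ?thesis by (rule A_equation_letter[OF W])
    next
      case False
      then have 2: "2 \<le> length w" using w by (cases w) (auto simp: Suc_le_eq)
      let ?N = "length w"
      have "\<forall>ds xs. length xs = ?N \<and> homogeneous W ds xs \<longrightarrow>
        hom_diff W W (int ?N - 2) (n ?N) ds xs =
        (\<Sum>(i, j) | i + j = ?N + 1 \<and> 2 \<le> i \<and> 2 \<le> j. \<Sum>s = 0..?N - j.
           ksgn (int (i + s * (j + 1))) (insert_op (n i) s (n j) j (int j - 2) ds xs))"
        using Wa 2 w by (simp add: A_algebra_def)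
      note eq = this[unfolded all_words_iff[OF sW], rule_format, OF refl]
      have le: "enat ?N \<le> ?K" using w by simp
      show ?thesis by (rule iffD1[OF A_equation_words[OF W n 2 le refl refl refl] eq])
    qed
  next
    fix w :: "(int \<times> 'v) list" assume w: "w \<noteq> [] \<and> length w \<le> k"
    let ?N = "length w"
    have 1: "1 \<le> ?N" using w by (cases w) auto
    have "\<forall>ds xs. length xs = ?N \<and> homogeneous V ds xs \<longrightarrow> hom_diff V W (int ?N - 1) (F ?N) ds xs =
        - (\<Sum>k = 2..?N. \<Sum>rs | length rs = k \<and> sum_list rs = ?N \<and> (\<forall>r\<in>set rs. 1 \<le> r).
             ksgn (int (\<Sum>b<k. \<Sum>a<b. rs ! a * (rs ! b + 1))) (tensor_op (n k) F rs ds xs))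
        - (\<Sum>(i, j) | i + j = ?N + 1 \<and> 1 \<le> i \<and> 2 \<le> j. \<Sum>s = 0..?N - j.
             ksgn (int (i + s * (j + 1))) (insert_op (F i) s (m j) j (int j - 2) ds xs))"
      using Fm 1 w by (simp add: A_morphism_def)
    note eq = this[unfolded all_words_iff[OF sV], rule_format, OF refl]
    have le: "enat ?N \<le> ?K" using w by simp
    show "ins False (- 1) ?p ?\<phi> w = cm False ?\<phi> ?q w"
      by (rule iffD1[OF A_morphism_equation_words[OF V W m n F 1 le refl refl refl] eq])
  qed
  have "?\<phi> [(d, x)] = F 1 [component ?U d x]" for d x
    using k by (simp add: bar_maps_def tagged_def mapsA_def one_enat_def)
  then have "quism ?U ?X (\<lambda>d x. ?\<phi> [(d, x)])" using quism_susp[OF V W qi] by simp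
  from extension_words[OF sV sW p one pp st k this]
  obtain q' \<phi>' where st': "\<And>M. stage md ?U ?X ?p M q' \<phi>'"
    and same: "\<And>w. length w \<le> k \<Longrightarrow> q' w = ?q w" "\<And>w. length w \<le> k \<Longrightarrow> \<phi>' w = ?\<phi> w" by blast
  have q': "adm md ?X ?X (- 1) q'" and \<phi>': "adm md ?U ?X 0 \<phi>'" and q'1: "\<And>d x. q' [(d, x)] = dU ?X d x"
    using st'[of 0] by (simp_all add: stage_def)
  let ?eq = "\<lambda>w. ksgn (susp_sign (map fst w)) (- q' w)" and ?ef = "\<lambda>w. ksgn (susp_sign (map fst w)) (\<phi>' w)"
  have eq: "adm Assoc ?X ?X (- 1) ?eq" by (rule adm_sign[OF sW adm_minus[OF sW q']])
  have ef: "adm Assoc ?U ?X 0 ?ef" by (rule adm_sign[OF sW \<phi>'])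
  define n' where "n' i = (if i \<le> k then n i else ext ?X ?eq)" for i
  define F' where "F' i = (if i \<le> k then F i else ext ?U ?ef)" for i
  have n'm: "multi_hom W W i (int i - 2) (n' i)" if "2 \<le> i" for i
    using n[OF that] multi_hom_unsusp[OF multi_hom_ext[OF sW sW eq, of i], of "int i - 2"] that by (simp add: n'_def)
  have F'm: "multi_hom V W i (int i - 1) (F' i)" if "1 \<le> i" for i
    using F[OF that] multi_hom_unsusp[OF multi_hom_ext[OF sV sW ef, of i], of "int i - 1"] that by (simp add: F'_def)
  have bq: "bar_ops \<infinity> W n' w = q' w" if wn: "w \<noteq> []" for w
  proof -
    consider "length w = 1" | "2 \<le> length w" "length w \<le> k" | "2 \<le> length w" "\<not> length w \<le> k"
    proof -
      assume a: "length w = 1 \<Longrightarrow> thesis" "2 \<le> length w \<Longrightarrow> length w \<le> k \<Longrightarrow> thesis"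
        "2 \<le> length w \<Longrightarrow> \<not> length w \<le> k \<Longrightarrow> thesis"
      have "length w = 1 \<or> 2 \<le> length w" using wn by (cases w) (auto simp: Suc_le_eq)
      then show thesis using a by blast
    qed
    then show ?thesis
    proof cases
      case 1
      then obtain d x where "w = [(d, x)]" by (cases w) auto
      then show ?thesis using one q'1 by simp
    next
      case 2
      have "bar_ops \<infinity> W n' w = ?q w" using 2 by (simp add: bar_ops_def tagged_def opsA_def n'_def)
      then show ?thesis using same(1)[OF 2(2)] by simp
    next
      case 3
      have "bar_ops \<infinity> W n' w = - ksgn (susp_sign (map fst w)) (ext ?X ?eq (args ?X w))"
        using 3 by (simp add: bar_ops_def tagged_def opsA_def n'_def)
      also have "\<dots> = q' w"
        unfolding ext_args[OF sW adm_mlin[OF eq]] ksgn_ksgn by (simp add: ksgn_even)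
      finally show ?thesis .
    qed
  qed
  have bf: "bar_maps \<infinity> V F' w = \<phi>' w" if "w \<noteq> []" for w
  proof (cases "length w \<le> k")
    case True
    have "bar_maps \<infinity> V F' w = ?\<phi> w" using True by (simp add: bar_maps_def tagged_def mapsA_def F'_def)
    then show ?thesis using same(2)[OF True] by simp
  next
    case False
    have "bar_maps \<infinity> V F' w = ksgn (susp_sign (map fst w)) (ext ?U ?ef (args ?U w))"
      using False by (simp add: bar_maps_def tagged_def mapsA_def F'_def)
    also have "\<dots> = \<phi>' w"
      unfolding ext_args[OF sV adm_mlin[OF ef]] ksgn_ksgn by (simp add: ksgn_even)
    finally show ?thesis .
  qed
  have insq: "ins False (- 1) (bar_ops \<infinity> W n') (bar_ops \<infinity> W n') w = 0" if "w \<noteq> []" for w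
  proof -
    have "ins False (- 1) (bar_ops \<infinity> W n') (bar_ops \<infinity> W n') w = ins False (- 1) q' q' w"
      by (rule ins_cong[where H = UNIV]) (auto simp: bq)
    then show ?thesis using st'[of "length w"] that by (simp add: stage_def md)
  qed
  have cmf: "ins False (- 1) ?p (bar_maps \<infinity> V F') w = cm False (bar_maps \<infinity> V F') (bar_ops \<infinity> W n') w" if w: "w \<noteq> []" for w
  proof -
    have "ins False (- 1) ?p (bar_maps \<infinity> V F') w = ins False (- 1) ?p \<phi>' w"
      by (rule ins_cong[where H = UNIV]) (auto simp: bf)
    moreover have "cm False (bar_maps \<infinity> V F') (bar_ops \<infinity> W n') w = cm False \<phi>' q' w"
      by (rule cm_cong[where H = UNIV and H' = UNIV]) (use w in \<open>auto simp: bf bq\<close>)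
    ultimately show ?thesis using st'[of "length w"] w by (simp add: stage_def md)
  qed
  have "A_algebra \<infinity> W n'"
    unfolding A_algebra_def
  proof (intro conjI allI impI W)
    show "multi_hom W W i (int i - 2) (n' i)" if "2 \<le> i" for i by (rule n'm[OF that])
  next
    fix N :: nat and ds xs assume N: "2 \<le> N" and x: "length xs = N \<and> homogeneous W ds xs"
    let ?E = "\<lambda>ds xs. hom_diff W W (int N - 2) (n' N) ds xs =
        (\<Sum>(i, j) | i + j = N + 1 \<and> 2 \<le> i \<and> 2 \<le> j. \<Sum>s = 0..N - j.
           ksgn (int (i + s * (j + 1))) (insert_op (n' i) s (n' j) j (int j - 2) ds xs))"
    have "\<forall>w. length w = N \<longrightarrow> ?E (map (\<lambda>a. fst a - 1) w) (args ?X w)"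
    proof (intro allI impI)
      fix w :: "(int \<times> 'w) list" assume w: "length w = N"
      then have ne: "w \<noteq> []" using N by auto
      show "?E (map (\<lambda>a. fst a - 1) w) (args ?X w)"
        by (rule iffD2[OF A_equation_words[OF W n'm N _ w refl refl] insq[OF ne]]) simp_all
    qed
    then have "\<forall>ds xs. length xs = N \<and> homogeneous W ds xs \<longrightarrow> ?E ds xs"
      by (rule iffD2[OF all_words_iff[OF sW, of N ?E]])
    then show "?E ds xs" using x by blast
  qed
  moreover have "A_morphism \<infinity> V W m n' F'"
    unfolding A_morphism_def
  proof (intro conjI allI impI)
    show "multi_hom V W i (int i - 1) (F' i)" if "1 \<le> i" for i by (rule F'm[OF that])
  next
    fix N :: nat and ds xs assume N: "1 \<le> N" and x: "length xs = N \<and> homogeneous V ds xs"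
    let ?E = "\<lambda>ds xs. hom_diff V W (int N - 1) (F' N) ds xs =
        - (\<Sum>k = 2..N. \<Sum>rs | length rs = k \<and> sum_list rs = N \<and> (\<forall>r\<in>set rs. 1 \<le> r).
             ksgn (int (\<Sum>b<k. \<Sum>a<b. rs ! a * (rs ! b + 1))) (tensor_op (n' k) F' rs ds xs))
        - (\<Sum>(i, j) | i + j = N + 1 \<and> 1 \<le> i \<and> 2 \<le> j. \<Sum>s = 0..N - j.
             ksgn (int (i + s * (j + 1))) (insert_op (F' i) s (m j) j (int j - 2) ds xs))"
    have "\<forall>w. length w = N \<longrightarrow> ?E (map (\<lambda>a. fst a - 1) w) (args ?U w)"
    proof (intro allI impI)
      fix w :: "(int \<times> 'v) list" assume w: "length w = N"
      then have ne: "w \<noteq> []" using N by auto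
      show "?E (map (\<lambda>a. fst a - 1) w) (args ?U w)"
        by (rule iffD2[OF A_morphism_equation_words[OF V W m n'm F'm N _ w refl refl] cmf[OF ne]]) simp_all
    qed
    then have "\<forall>ds xs. length xs = N \<and> homogeneous V ds xs \<longrightarrow> ?E ds xs"
      by (rule iffD2[OF all_words_iff[OF sV, of N ?E]])
    then show "?E ds xs" using x by blast
  qed
  moreover have "vanishes_on_shuffles W W i (n' i)" if c: "md = Comm" and i: "2 \<le> i" for i
    unfolding vanishes_on_shuffles_sh[OF W W]
  proof (intro allI impI)
    fix u v :: "(int \<times> 'w) list" assume uv: "u \<noteq> [] \<and> v \<noteq> [] \<and> length (u @ v) = i"
    have "sh u v (\<lambda>w. ksgn (susp_sign (map fst w)) (n' i (args ?X w))) = sh u v (\<lambda>w. - q' w)"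
    proof (rule sh_cong)
      fix z :: "(int \<times> 'w) list" assume "length z = length u + length v"
      then have z: "length z = i" "z \<noteq> []" using uv i by auto
      then have "bar_ops \<infinity> W n' z = - ksgn (susp_sign (map fst z)) (n' i (args ?X z))"
        using i by (simp add: bar_ops_def tagged_def opsA_def)
      then show "ksgn (susp_sign (map fst z)) (n' i (args ?X z)) = - q' z" using bq[OF z(2)] by simp
    qed
    also have "\<dots> = 0" using shuffle_null_neg[OF adm_shuffle_null[OF q' c]] uv by (simp add: shuffle_null_def)
    finally show "sh u v (\<lambda>w. ksgn (susp_sign (map fst w)) (n' i (args ?X w))) = 0" .
  qed
  moreover have "vanishes_on_shuffles V W i (F' i)" if c: "md = Comm" and i: "1 \<le> i" for i
    unfolding vanishes_on_shuffles_sh[OF V W]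
  proof (intro allI impI)
    fix u v :: "(int \<times> 'v) list" assume uv: "u \<noteq> [] \<and> v \<noteq> [] \<and> length (u @ v) = i"
    have "sh u v (\<lambda>w. ksgn (susp_sign (map fst w)) (F' i (args ?U w))) = sh u v \<phi>'"
    proof (rule sh_cong)
      fix z :: "(int \<times> 'v) list" assume "length z = length u + length v"
      then have z: "length z = i" "z \<noteq> []" using uv i by auto
      then show "ksgn (susp_sign (map fst z)) (F' i (args ?U z)) = \<phi>' z"
        using bf[OF z(2)] by (simp add: bar_maps_def tagged_def mapsA_def)
    qed
    also have "\<dots> = 0" using adm_shuffle_null[OF \<phi>' c] uv by (simp add: shuffle_null_def)
    finally show "sh u v (\<lambda>w. ksgn (susp_sign (map fst w)) (F' i (args ?U w))) = 0" .
  qed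
  ultimately show ?thesis by (intro exI[of _ n'] exI[of _ F']) (simp add: n'_def F'_def)
qed

section \<open>Free vector spaces\<close>

interpretation fs: vector_space "fscale :: 'k::field \<Rightarrow> ('a \<Rightarrow>\<^sub>0 'k) \<Rightarrow> ('a \<Rightarrow>\<^sub>0 'k)"
  by (rule vector_space_fscale)

lemma linear_simps:
  assumes "Vector_Spaces.linear s1 s2 T"
  shows "T (x + y) = T x + T y" "T (s1 c x) = s2 c (T x)" "T 0 = 0" "T (- x) = - T x"
    "T (x - y) = T x - T y" "T (ksgn e x) = ksgn e (T x)"
proof -
  have a: "addi T" using assms by (simp add: linear_iff addi_def)
  show "T (x + y) = T x + T y" "T (s1 c x) = s2 c (T x)" using assms by (simp_all add: linear_iff)
  show "T 0 = 0" "T (- x) = - T x" "T (ksgn e x) = ksgn e (T x)"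
    using addi_0[OF a] addi_minus[OF a] addi_ksgn[OF a] by simp_all
  then show "T (x - y) = T x - T y" using addi_add[OF a, of x "- y"] addi_minus[OF a] by simp
qed

lemma linear_addi: "Vector_Spaces.linear s1 s2 T \<Longrightarrow> addi T" by (simp add: linear_iff addi_def)

lemma linear_compose2:
  "Vector_Spaces.linear s1 s2 T \<Longrightarrow> Vector_Spaces.linear s2 s3 T' \<Longrightarrow> Vector_Spaces.linear s1 s3 (\<lambda>x. T' (T x))"
  by (simp add: linear_iff)

lemma linear_difference:
  assumes "Vector_Spaces.linear s1 s2 T" "Vector_Spaces.linear s1 s2 T'"
  shows "Vector_Spaces.linear s1 s2 (\<lambda>x. T x - T' x)"
proof -
  interpret vector_space s2 using assms by (simp add: linear_iff)
  show ?thesis using assms by (simp add: linear_iff scale_right_diff_distrib)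
qed

lemma linear_span:
  assumes T: "Vector_Spaces.linear fscale sc T" and S: "module.subspace sc S"
    and A: "\<And>a. a \<in> A \<Longrightarrow> T a \<in> S" and p: "p \<in> fs.span A"
  shows "T p \<in> S"
proof -
  interpret vector_space sc using T by (simp add: linear_iff)
  have "fs.subspace {p. T p \<in> S}"
    using S by (auto simp: fs.subspace_def subspace_def linear_simps[OF T])
  from fs.span_induct[OF p this A] show ?thesis by simp
qed

lemma linear_span_eq:
  assumes "Vector_Spaces.linear fscale sc T" "Vector_Spaces.linear fscale sc T'"
    and "\<And>a. a \<in> A \<Longrightarrow> T a = T' a" and "p \<in> fs.span A"
  shows "T p = T' p"
proof -
  interpret vector_space sc using assms(1) by (simp add: linear_iff)
  have "T p - T' p \<in> {0}"
    by (rule linear_span[OF linear_difference[OF assms(1,2)] _ _ assms(4)]) (use assms(3) subspace_0 in auto)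
  then show ?thesis by simp
qed

lemma lin_ext_superset:
  assumes "finite A" "Poly_Mapping.keys p \<subseteq> A" "vector_space s"
  shows "lin_ext s f p = (\<Sum>a\<in>A. s (Poly_Mapping.lookup p a) (f a))"
proof -
  interpret vector_space s by fact
  show ?thesis
    unfolding lin_ext_def
    by (rule sum.mono_neutral_left) (use assms in \<open>auto simp: in_keys_iff\<close>)
qed

lemma lin_ext_fgen [simp]: "vector_space s \<Longrightarrow> lin_ext s f (fgen a) = f a"
  by (subst lin_ext_superset[of "{a}"]) (simp_all add: fgen_def module.scale_one vector_space_def module_def)

lemma linear_lin_ext:
  assumes "vector_space s"
  shows "Vector_Spaces.linear fscale s (lin_ext s f)"
proof -
  interpret vector_space s by fact
  have "lin_ext s f (x + y) = lin_ext s f x + lin_ext s f y" for x y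
  proof -
    let ?A = "Poly_Mapping.keys x \<union> Poly_Mapping.keys y"
    have "Poly_Mapping.keys (x + y) \<subseteq> ?A" by (rule Poly_Mapping.keys_add)
    then show ?thesis
      using lin_ext_superset[OF _ _ assms, of ?A "x + y" f] lin_ext_superset[OF _ _ assms, of ?A x f]
        lin_ext_superset[OF _ _ assms, of ?A y f]
      by (simp add: lookup_add scale_left_distrib sum.distrib)
  qed
  moreover have "lin_ext s f (fscale c x) = s c (lin_ext s f x)" for c x
  proof -
    have "Poly_Mapping.keys (fscale c x) \<subseteq> Poly_Mapping.keys x" by (auto simp: in_keys_iff)
    then show ?thesis
      using lin_ext_superset[OF _ _ assms, of "Poly_Mapping.keys x" "fscale c x" f]
      by (simp add: scale_sum_right lin_ext_def)
  qed
  ultimately show ?thesis by (simp add: linear_iff assms vector_space_fscale)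
qed

text \<open>A linear map with prescribed kernel turns congruences modulo relations into equations, to which the
  results on functions of words apply.\<close>

lemma exists_linear_kernel:
  fixes S :: "('a \<Rightarrow>\<^sub>0 'k::field) set"
  shows "\<exists>L :: ('a \<Rightarrow>\<^sub>0 'k) \<Rightarrow> ('a \<Rightarrow>\<^sub>0 'k). Vector_Spaces.linear fscale fscale L \<and> (\<forall>p. L p = 0 \<longleftrightarrow> p \<in> fs.span S)"
proof -
  interpret fp: vector_space_pair "fscale :: 'k \<Rightarrow> ('a \<Rightarrow>\<^sub>0 'k) \<Rightarrow> _" "fscale :: 'k \<Rightarrow> ('a \<Rightarrow>\<^sub>0 'k) \<Rightarrow> _"
    by unfold_locales
  obtain B where B: "B \<subseteq> S" "fs.independent B" "S \<subseteq> fs.span B"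
    by (rule fs.maximal_independent_subset)
  have sB: "fs.span B = fs.span S"
    using fs.span_mono[OF B(1)] fs.span_minimal[OF B(3) fs.subspace_span] by blast
  let ?C = "fs.extend_basis B"
  obtain g where g: "Vector_Spaces.linear fscale fscale g" "\<And>x. x \<in> ?C \<Longrightarrow> g x = (if x \<in> B then 0 else x)"
    using fp.linear_independent_extend[OF fs.independent_extend_basis[OF B(2)], of "\<lambda>x. if x \<in> B then 0 else x"]
    by blast
  have id: "Vector_Spaces.linear fscale fscale (\<lambda>p :: 'a \<Rightarrow>\<^sub>0 'k. p)" by (simp add: linear_iff vector_space_fscale)
  have d: "p - g p \<in> fs.span B" for p
  proof (rule linear_span[OF linear_difference[OF id g(1)] fs.subspace_span])
    show "x - g x \<in> fs.span B" if "x \<in> ?C" for x using g(2)[OF that] by (cases "x \<in> B") (simp_all add: fs.span_base fs.span_zero)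
    show "p \<in> fs.span ?C" using fs.span_extend_basis[OF B(2)] by simp
  qed
  have "g p \<in> {0}" if "p \<in> fs.span B" for p
    by (rule linear_span[OF g(1) fs.subspace_single_0 _ that])
      (use g(2) fs.extend_basis_superset[OF B(2)] in auto)
  then have "g p = 0 \<longleftrightarrow> p \<in> fs.span S" for p using d[of p] unfolding sB by auto
  then show ?thesis using g(1) by blast
qed

lemma lookup_ftensor: "Poly_Mapping.lookup (ftensor p q) (a, b) = Poly_Mapping.lookup p a * Poly_Mapping.lookup q b"
proof -
  have "Poly_Mapping.lookup (ftensor p q) (a, b) =
    (\<Sum>a'\<in>Poly_Mapping.keys p. if a' = a then \<Sum>b'\<in>Poly_Mapping.keys q.
       if b' = b then Poly_Mapping.lookup p a * Poly_Mapping.lookup q b else 0 else 0)"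
    unfolding ftensor_def lookup_sum
    by (intro sum.cong refl) (auto simp: lookup_single when_def intro!: sum.cong)
  also have "\<dots> = Poly_Mapping.lookup p a * Poly_Mapping.lookup q b"
    by (simp add: in_keys_iff)
  finally show ?thesis .
qed

lemma linear_ftensor:
  "Vector_Spaces.linear fscale fscale (\<lambda>p. ftensor p q)" "Vector_Spaces.linear fscale fscale (ftensor p)"
  by (auto simp: linear_iff vector_space_fscale lookup_ftensor lookup_add algebra_simps intro!: poly_mapping_eqI)

lemma ftensor_fgen: "ftensor (fgen a) (fgen b) = fgen (a, b)"
  by (simp add: ftensor_def fgen_def)

section \<open>The coproduct as a sum over splittings\<close>

lemma wdeg_nths:
  assumes "I \<subseteq> {..<length w}"
  shows "wdeg (nths w I) = (\<Sum>i\<in>I. fst (w ! i))"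
  using assms
proof (induct w arbitrary: I)
  case (Cons a w)
  let ?J = "{j. Suc j \<in> I}"
  have I: "I = (if 0 \<in> I then {0} else {}) \<union> Suc ` ?J"
  proof -
    have "x \<in> (if 0 \<in> I then {0} else {}) \<union> Suc ` ?J \<longleftrightarrow> x \<in> I" for x by (cases x) auto
    then show ?thesis by blast
  qed
  have J: "?J \<subseteq> {..<length w}" using Cons(2) by auto
  then have fin: "finite (Suc ` ?J)" using finite_subset by blast
  have "(\<Sum>i\<in>I. fst ((a # w) ! i)) = (if 0 \<in> I then fst a else 0) + (\<Sum>i\<in>Suc ` ?J. fst ((a # w) ! i))"
    by (subst I, subst sum.union_disjoint) (use fin in auto)
  also have "(\<Sum>i\<in>Suc ` ?J. fst ((a # w) ! i)) = (\<Sum>j\<in>?J. fst (w ! j))"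
    by (simp add: sum.reindex)
  finally show ?case using Cons(1)[OF J] by (simp add: nths_Cons)
qed simp

lemma spl_Pow:
  "spl True g w = (\<Sum>I\<in>Pow {..<length w}.
     ksgn (\<Sum>i\<in>I. \<Sum>j\<in>{..<i} - I. fst (w ! i) * fst (w ! j)) (g (nths w I) (nths w (- I))))"
proof (induct w arbitrary: g)
  case (Cons a w)
  let ?n = "length w" and ?P = "Pow {..<length w}"
  let ?T = "\<lambda>w g I. ksgn (\<Sum>i\<in>I. \<Sum>j\<in>{..<i} - I. fst (w ! i) * fst (w ! j)) (g (nths w I) (nths w (- I)))"
  have P: "Pow {..<Suc ?n} = (\<lambda>I. Suc ` I) ` ?P \<union> (\<lambda>I. insert 0 (Suc ` I)) ` ?P"
  proof -
    have "Pow (Suc ` {..<?n}) = (\<lambda>I. Suc ` I) ` ?P" by (rule image_Pow_surj[OF refl, symmetric])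
    then show ?thesis by (simp add: lessThan_Suc_eq_insert_0 Pow_insert image_image)
  qed
  have i: "inj_on (\<lambda>I. Suc ` I) ?P" "inj_on (\<lambda>I. insert 0 (Suc ` I)) ?P"
    by (auto simp: inj_on_def inj_image_eq_iff dest!: insert_ident[THEN iffD1, rotated 2])
  have "(\<Sum>I\<in>Pow {..<Suc ?n}. ?T (a # w) g I) =
      (\<Sum>I\<in>?P. ?T (a # w) g (Suc ` I)) + (\<Sum>I\<in>?P. ?T (a # w) g (insert 0 (Suc ` I)))"
    unfolding P by (subst sum.union_disjoint) (auto simp: sum.reindex[OF i(1)] sum.reindex[OF i(2)])
  also have "(\<Sum>I\<in>?P. ?T (a # w) g (insert 0 (Suc ` I))) = (\<Sum>I\<in>?P. ?T w (\<lambda>x y. g (a # x) y) I)"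
  proof (rule sum.cong[OF refl])
    fix I assume "I \<in> ?P"
    then have fin: "finite I" using finite_subset by blast
    have e: "{..<Suc i} - insert 0 (Suc ` I) = Suc ` ({..<i} - I)" for i
      by (auto simp: lessThan_Suc_eq_insert_0)
    have "{j. Suc j \<in> insert 0 (Suc ` I)} = I" "{j. Suc j \<in> - insert 0 (Suc ` I)} = - I" by auto
    then show "?T (a # w) g (insert 0 (Suc ` I)) = ?T w (\<lambda>x y. g (a # x) y) I"
      using fin by (simp add: nths_Cons e sum.reindex)
  qed
  also have "(\<Sum>I\<in>?P. ?T (a # w) g (Suc ` I)) = (\<Sum>I\<in>?P. ?T w (\<lambda>x y. ksgn (fst a * wdeg x) (g x (a # y))) I)"
  proof (rule sum.cong[OF refl])
    fix I assume I: "I \<in> ?P"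
    then have fin: "finite I" using finite_subset by blast
    have e: "{..<Suc i} - Suc ` I = insert 0 (Suc ` ({..<i} - I))" for i
      by (auto simp: lessThan_Suc_eq_insert_0)
    have "{j. Suc j \<in> Suc ` I} = I" "{j. Suc j \<in> - Suc ` I} = - I" by auto
    moreover have "wdeg (nths w I) = (\<Sum>i\<in>I. fst (w ! i))" by (rule wdeg_nths) (use I in auto)
    ultimately show "?T (a # w) g (Suc ` I) = ?T w (\<lambda>x y. ksgn (fst a * wdeg x) (g x (a # y))) I"
      using fin
      by (simp add: nths_Cons e sum.reindex sum.distrib ksgn_ksgn sum_distrib_left mult.commute add.commute)
  qed
  finally show ?case
    unfolding spl.simps if_True Cons by (simp only: length_Cons add.commute)
qed simp

text \<open>Composition with \<open>red\<close> passes from the full to the reduced coproduct.\<close>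

definition red :: "'a list \<Rightarrow> 'b list \<Rightarrow> ('a list \<times> 'b list \<Rightarrow>\<^sub>0 'k::field)" where
  "red x y = (if x = [] \<or> y = [] then 0 else fgen (x, y))"

lemma coprod_fgen: "coprod (fgen w :: (int \<times> 'v) list \<Rightarrow>\<^sub>0 'k::field) = spl True red w"
proof -
  let ?P = "Pow {..<length w}" and ?E = "{{}, {..<length w}}"
  let ?s = "\<lambda>I. \<Sum>i\<in>I. \<Sum>j\<in>{..<i} - I. fst (w ! i) * fst (w ! j)"
  have "coprod (fgen w :: _ \<Rightarrow>\<^sub>0 'k) = (\<Sum>I\<in>?P - ?E. ksgn (?s I) (fgen (nths w I, nths w (- I))))"
    unfolding coprod_def by (simp add: vector_space_fscale)
  also have "\<dots> = (\<Sum>I\<in>?P - ?E. ksgn (?s I) (red (nths w I) (nths w (- I))))"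
  proof (rule sum.cong[OF refl])
    fix I assume I: "I \<in> ?P - ?E"
    then obtain i j where "i \<in> I" "i < length w" "j \<notin> I" "j < length w" by auto
    then have "w ! i \<in> set (nths w I)" "w ! j \<in> set (nths w (- I))" by (auto simp: set_nths)
    then have "nths w I \<noteq> []" "nths w (- I) \<noteq> []" by auto
    then show "ksgn (?s I) (fgen (nths w I, nths w (- I))) = ksgn (?s I) (red (nths w I) (nths w (- I)))"
      by (simp add: red_def)
  qed
  also have "\<dots> = (\<Sum>I\<in>?P. ksgn (?s I) (red (nths w I) (nths w (- I))))"
  proof (rule sum.mono_neutral_left)
    have "set (nths w (- {..<length w})) = {}" unfolding set_nths by auto
    then have "nths w (- {..<length w}) = []" by (simp only: set_empty)
    then show "\<forall>I\<in>?P - (?P - ?E). ksgn (?s I) (red (nths w I) (nths w (- I))) = 0"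
      by (auto simp: red_def)
  qed auto
  finally show ?thesis unfolding spl_Pow .
qed

lemma linear_coprod: "Vector_Spaces.linear fscale fscale (coprod :: ((int \<times> 'v) list \<Rightarrow>\<^sub>0 'k::field) \<Rightarrow> _)"
  unfolding coprod_def by (rule linear_lin_ext[OF vector_space_fscale])

section \<open>Graded symmetric functions as functionals on the symmetric coalgebra\<close>

definition letters :: "('k, 'v) complex_data \<Rightarrow> (int \<times> 'v) set" where
  "letters U = {a. snd a \<in> grade U (fst a)}"

lemma words_iff: "w \<in> words U \<longleftrightarrow> w \<noteq> [] \<and> set w \<subseteq> letters U"
  by (auto simp: words_def letters_def)

definition normal_word :: "('k::field, 'v::ab_group_add) complex_data \<Rightarrow> (int \<times> 'v) list \<Rightarrow> (int \<times> 'v) list" where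
  "normal_word U w = map (\<lambda>a. (fst a, component U (fst a) (snd a))) w"

lemma normal_word_simps [simp]: "normal_word U [] = []" "normal_word U (a # w) = (fst a, component U (fst a) (snd a)) # normal_word U w"
  "normal_word U (u @ w) = normal_word U u @ normal_word U w" "normal_word U w = [] \<longleftrightarrow> w = []" "length (normal_word U w) = length w"
  by (simp_all add: normal_word_def)

lemma normal_word_letters: "complex U \<Longrightarrow> set (normal_word U w) \<subseteq> letters U"
  by (induct w) (simp_all add: letters_def complex.component_grade)

lemma normal_word_id: "complex U \<Longrightarrow> set w \<subseteq> letters U \<Longrightarrow> normal_word U w = w"
  by (induct w) (simp_all add: letters_def complex.component_same)

lemma normal_word_words: "complex U \<Longrightarrow> w \<noteq> [] \<Longrightarrow> normal_word U w \<in> words U"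
  by (simp add: words_iff normal_word_letters)

lemma mlin_normal_word: "mlin U sc f \<Longrightarrow> f (u @ normal_word U w) = f (u @ w)"
proof (induct w arbitrary: u)
  case (Cons a w)
  obtain d x where a: "a = (d, x)" by force
  have "f (u @ (d, component U d x) # normal_word U w) = f (u @ (d, x) # normal_word U w)"
    by (rule lindD(3)[OF mlinD[OF Cons(2)]])
  also have "\<dots> = f (u @ (d, x) # w)" using Cons(1)[OF Cons(2), of "u @ [(d, x)]"] by simp
  finally show ?case by (simp add: a)
qed simp

lemma sym_gens_intros:
  "u @ (d, x) # w \<in> words U \<Longrightarrow> y \<in> grade U d \<Longrightarrow>
    fgen (u @ (d, x + y) # w) - fgen (u @ (d, x) # w) - fgen (u @ (d, y) # w) \<in> sym_gens U"
  "u @ (d, x) # w \<in> words U \<Longrightarrow>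
    fgen (u @ (d, smul U c x) # w) - fscale c (fgen (u @ (d, x) # w)) \<in> sym_gens U"
  "u @ (d, x) # (e, y) # w \<in> words U \<Longrightarrow>
    fgen (u @ (d, x) # (e, y) # w) - ksgn (d * e) (fgen (u @ (e, y) # (d, x) # w)) \<in> sym_gens U"
  unfolding sym_gens_def by blast+

text \<open>The relations say precisely that the class of a word is linear in every letter and graded symmetric.\<close>

lemma kills_sym_rel:
  assumes U: "complex U" and T: "Vector_Spaces.linear fscale sc T"
    and f: "\<And>w. w \<in> words U \<Longrightarrow> T (fgen w) = f w" "mlin U sc f" "graded_sym f" and p: "p \<in> sym_rel U"
  shows "T p = 0"
proof -
  interpret U: complex U by (rule U)
  interpret sc: vector_space sc using T by (simp add: linear_iff)
  have "T p \<in> {0}"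
  proof (rule linear_span[OF T sc.subspace_single_0 _ p[unfolded sym_rel_def]])
    fix g assume "g \<in> sym_gens U"
    then consider (add) u w d x y where "g = fgen (u @ (d, x + y) # w) - fgen (u @ (d, x) # w) - fgen (u @ (d, y) # w)"
        "u @ (d, x) # w \<in> words U" "y \<in> grade U d"
      | (scale) u w d x c where "g = fgen (u @ (d, smul U c x) # w) - fscale c (fgen (u @ (d, x) # w))"
        "u @ (d, x) # w \<in> words U"
      | (swap) u w d x e y where "g = fgen (u @ (d, x) # (e, y) # w) - ksgn (d * e) (fgen (u @ (e, y) # (d, x) # w))"
        "u @ (d, x) # (e, y) # w \<in> words U"
      unfolding sym_gens_def by blast
    then have "T g = 0"
    proof cases
      case add
      then have "u @ (d, y) # w \<in> words U" "u @ (d, x + y) # w \<in> words U"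
        by (auto simp: words_def U.grade_add)
      then show ?thesis using add by (simp add: linear_simps[OF T] f(1) lindD(1)[OF mlinD[OF f(2)]])
    next
      case scale
      then have "u @ (d, smul U c x) # w \<in> words U" by (auto simp: words_def U.grade_scale)
      then show ?thesis using scale by (simp add: linear_simps[OF T] f(1) lindD(2)[OF mlinD[OF f(2)]])
    next
      case swap
      have 2: "u @ (e, y) # (d, x) # w \<in> words U" using swap by (auto simp: words_def)
      have "T g = f (u @ (d, x) # (e, y) # w) - ksgn (d * e) (f (u @ (e, y) # (d, x) # w))"
        unfolding swap(1) linear_simps[OF T] f(1)[OF swap(2)] f(1)[OF 2] ..
      then show ?thesis using graded_symD[OF f(3), of u "(d, x)" "(e, y)" w] by simp
    qed
    then show "T g \<in> {0}" by simp
  qed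
  then show ?thesis by simp
qed

text \<open>The projection to the quotient by the relations is realised as an endomorphism \<open>L\<close> of the free space.
  Then \<open>L\<close> of a word is itself a graded symmetric multilinear function of words.\<close>

lemma sym_quotient:
  fixes U :: "('k::field, 'v::ab_group_add) complex_data"
  assumes U: "complex U"
  obtains L :: "((int \<times> 'v) list \<Rightarrow>\<^sub>0 'k) \<Rightarrow> ((int \<times> 'v) list \<Rightarrow>\<^sub>0 'k)"
  where "Vector_Spaces.linear fscale fscale L" "\<And>p. L p = 0 \<longleftrightarrow> p \<in> sym_rel U"
    "mlin U fscale (\<lambda>w. L (fgen (normal_word U w)))" "graded_sym (\<lambda>w. L (fgen (normal_word U w)))"
    "\<And>w. set w \<subseteq> letters U \<Longrightarrow> L (fgen w) = L (fgen (normal_word U w))"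
proof -
  interpret U: complex U by (rule U)
  obtain L :: "((int \<times> 'v) list \<Rightarrow>\<^sub>0 'k) \<Rightarrow> ((int \<times> 'v) list \<Rightarrow>\<^sub>0 'k)"
    where L: "Vector_Spaces.linear fscale fscale L" "\<And>p. L p = 0 \<longleftrightarrow> p \<in> sym_rel U"
    using exists_linear_kernel[of "sym_gens U"] unfolding sym_rel_def by blast
  have z: "L g = 0" if "g \<in> sym_gens U" for g
    unfolding L(2) sym_rel_def by (rule fs.span_base[OF that])
  have m: "mlin U fscale (\<lambda>w. L (fgen (normal_word U w)))"
  proof (rule mlinI)
    fix u w :: "(int \<times> 'v) list" and d
    have wd: "normal_word U u @ (d, component U d x) # normal_word U w \<in> words U" for x
      using normal_word_words[OF U, of "u @ (d, x) # w"] by simp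
    show "lind U fscale d (\<lambda>x. L (fgen (normal_word U (u @ (d, x) # w))))"
      using z[OF sym_gens_intros(1)[OF wd U.component_grade], unfolded linear_simps[OF L(1)] diff_diff_eq right_minus_eq]
        z[OF sym_gens_intros(2)[OF wd], unfolded linear_simps[OF L(1)] right_minus_eq]
      by (simp add: lind_def U.component_add U.component_scale)
  qed
  have s: "graded_sym (\<lambda>w. L (fgen (normal_word U w)))"
  proof (rule graded_symI)
    fix u a b and w :: "(int \<times> 'v) list"
    have wd: "normal_word U u @ (fst a, component U (fst a) (snd a)) # (fst b, component U (fst b) (snd b)) # normal_word U w \<in> words U"
      using normal_word_words[OF U, of "u @ a # b # w"] by simp
    show "L (fgen (normal_word U (u @ a # b # w))) = ksgn (fst a * fst b) (L (fgen (normal_word U (u @ b # a # w))))"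
      using z[OF sym_gens_intros(3)[OF wd]] by (simp add: linear_simps[OF L(1)])
  qed
  show thesis by (rule that[OF L m s]) (simp_all add: normal_word_id[OF U])
qed

lemma graded_sym_to_front: "graded_sym f \<Longrightarrow> f (x @ a # y) = ksgn (fst a * wdeg x) (f (a # x @ y))"
proof (induct x arbitrary: f)
  case (Cons b x)
  have "f (b # x @ a # y) = ksgn (fst a * wdeg x) (f (b # a # x @ y))"
    by (rule Cons(1)[of "\<lambda>z. f (b # z)"]) (rule graded_sym_Cons[OF Cons(2)])
  also have "f (b # a # x @ y) = ksgn (fst b * fst a) (f (a # b # x @ y))" by (rule graded_symD0[OF Cons(2)])
  finally show ?case by (simp add: ksgn_ksgn distrib_left mult.commute add.commute)
qed simp

text \<open>Each of the \<open>2\<^sup>n\<close> splittings contributes the same, as its sign is that of putting the letters back in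
  their original order.\<close>

lemma spl_join:
  fixes f :: "(int \<times> 'v) list \<Rightarrow> ('a \<Rightarrow>\<^sub>0 'k::field)"
  shows "graded_sym f \<Longrightarrow> spl True (\<lambda>x y. f (x @ y)) w = fscale (2 ^ length w) (f w)"
proof (induct w arbitrary: f)
  case (Cons a w)
  have 1: "spl True (\<lambda>x y. f (a # x @ y)) w = fscale (2 ^ length w) (f (a # w))"
    by (rule Cons(1)[of "\<lambda>z. f (a # z)"]) (rule graded_sym_Cons[OF Cons(2)])
  have "spl True (\<lambda>x y. ksgn (fst a * wdeg x) (f (x @ a # y))) w = spl True (\<lambda>x y. f (a # x @ y)) w"
  proof (rule spl_cong)
    fix x y :: "(int \<times> 'v) list"
    show "ksgn (fst a * wdeg x) (f (x @ a # y)) = f (a # x @ y)"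
      unfolding graded_sym_to_front[OF Cons(2)] by (simp add: ksgn_ksgn ksgn_even)
  qed
  then show ?case using 1 by (simp add: fs.scale_left_distrib[symmetric])
qed (simp add: fs.scale_one)

lemma linear_proj1: "complex U \<Longrightarrow> Vector_Spaces.linear fscale (smul U) (proj1 U)"
  unfolding proj1_def by (rule linear_lin_ext) (simp add: complex_def chain_complex_def)

lemma proj1_fgen: "complex U \<Longrightarrow> proj1 U (fgen w) = let1 (\<lambda>d x. x) w"
proof -
  assume "complex U"
  then have v: "vector_space (smul U)" by (simp add: complex_def chain_complex_def)
  have "(if length w = 1 then snd (hd w) else 0) = let1 (\<lambda>d x. x) w"
    by (cases w rule: remdups_adj.cases) simp_all
  then show ?thesis unfolding proj1_def lin_ext_fgen[OF v] .
qed

lemma sym_free_induct_eq: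
  assumes "Vector_Spaces.linear fscale sc T" "Vector_Spaces.linear fscale sc T'"
    and "\<And>w. w \<in> words U \<Longrightarrow> T (fgen w) = T' (fgen w)" and "p \<in> sym_free U"
  shows "T p = T' p"
  by (rule linear_span_eq[OF assms(1,2) _ assms(4)[unfolded sym_free_def]]) (use assms(3) in auto)

text \<open>Multiplying the two parts of the reduced coproduct back together is multiplication by \<open>2\<^sup>n - 2\<close> on \<open>S\<^sup>n\<close>.
  In characteristic zero this is invertible for \<open>n \<ge> 2\<close>, so a primitive element has only a component
  in \<open>S\<^sup>1\<close>, and \<open>proj1\<close> detects it.\<close>

lemma primitive_sym_rel:
  fixes U :: "('k::field_char_0, 'v::ab_group_add) complex_data"
  assumes U: "complex U" and p: "p \<in> sym_free U" and c: "coprod p \<in> sym_rel2 U" and p1: "proj1 U p = 0"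
  shows "p \<in> sym_rel U"
proof -
  interpret U: complex U by (rule U)
  obtain L :: "((int \<times> 'v) list \<Rightarrow>\<^sub>0 'k) \<Rightarrow> ((int \<times> 'v) list \<Rightarrow>\<^sub>0 'k)"
    where L: "Vector_Spaces.linear fscale fscale L" "\<And>p. L p = 0 \<longleftrightarrow> p \<in> sym_rel U"
    and m: "mlin U fscale (\<lambda>w. L (fgen (normal_word U w)))" and s: "graded_sym (\<lambda>w. L (fgen (normal_word U w)))"
    and n: "\<And>w. set w \<subseteq> letters U \<Longrightarrow> L (fgen w) = L (fgen (normal_word U w))"
    using sym_quotient[OF U] by blast
  define f where "f w = L (fgen (normal_word U w))" for w
  have f: "mlin U fscale f" "graded_sym f" using m s by (simp_all add: f_def[abs_def])
  have Lf: "L (fgen w) = f w" if "set w \<subseteq> letters U" for w using n[OF that] by (simp add: f_def)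
  have vs: "vector_space (fscale :: 'k \<Rightarrow> ('a \<Rightarrow>\<^sub>0 'k) \<Rightarrow> _)" by (rule vector_space_fscale)
  define G :: "((int \<times> 'v) list \<times> (int \<times> 'v) list \<Rightarrow>\<^sub>0 'k) \<Rightarrow> ((int \<times> 'v) list \<Rightarrow>\<^sub>0 'k)"
    where "G = lin_ext fscale (\<lambda>(a, b). L (fgen (a @ b)))"
  have G: "Vector_Spaces.linear fscale fscale G" unfolding G_def by (rule linear_lin_ext[OF vector_space_fscale])
  have Gf: "G (fgen (a, b)) = L (fgen (a @ b))" for a b by (simp add: G_def vector_space_fscale)
  have G0: "G q \<in> {0}" if "q \<in> sym_rel2 U" for q
  proof (rule linear_span[OF G fs.subspace_single_0 _ that[unfolded sym_rel2_def]])
    fix h assume "h \<in> {ftensor r (fgen w) |r w. r \<in> sym_gens U \<and> w \<in> words U} \<union>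
      {ftensor (fgen w) r |r w. r \<in> sym_gens U \<and> w \<in> words U}"
    then obtain r w where r: "r \<in> sym_gens U" and w: "w \<in> words U"
      and h: "h = ftensor r (fgen w) \<or> h = ftensor (fgen w) r" by blast
    have r': "r \<in> sym_rel U" unfolding sym_rel_def by (rule fs.span_base[OF r])
    have "G (ftensor r (fgen w)) = 0"
    proof (rule kills_sym_rel[OF U linear_compose2[OF linear_ftensor(1) G] _ _ _ r'])
      show "G (ftensor (fgen u) (fgen w)) = f (u @ w)" if "u \<in> words U" for u
        using that w by (simp add: ftensor_fgen Gf Lf words_iff)
      show "mlin U fscale (\<lambda>u. f (u @ w))" by (rule mlinI, unfold append_assoc append_Cons, rule mlinD[OF f(1)])
      show "graded_sym (\<lambda>u. f (u @ w))" by (rule graded_symI, unfold append_assoc append_Cons, rule graded_symD[OF f(2)])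
    qed
    moreover have "G (ftensor (fgen w) r) = 0"
    proof (rule kills_sym_rel[OF U linear_compose2[OF linear_ftensor(2) G] _ _ _ r'])
      show "G (ftensor (fgen w) (fgen u)) = f (w @ u)" if "u \<in> words U" for u
        using that w by (simp add: ftensor_fgen Gf Lf words_iff)
      show "mlin U fscale (\<lambda>u. f (w @ u))" by (rule mlinI, unfold append_assoc[symmetric], rule mlinD[OF f(1)])
      show "graded_sym (\<lambda>u. f (w @ u))" by (rule graded_symI, unfold append_assoc[symmetric], rule graded_symD[OF f(2)])
    qed
    ultimately show "G h \<in> {0}" using h by auto
  qed
  have Gc: "G (coprod (fgen w)) = fscale (2 ^ length w - 2) (f w)" if w: "w \<in> words U" for w
  proof -
    have "G (coprod (fgen w)) = spl True (\<lambda>x y. G (red x y)) w"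
      unfolding coprod_fgen by (rule spl_post[OF linear_addi[OF G]])
    also have "\<dots> = spl True (\<lambda>x y. f (x @ y) - (if x = [] then f y else 0) - (if y = [] then f x else 0)) w"
    proof (rule spl_cong)
      fix x y assume *: "set x \<subseteq> set w" "set y \<subseteq> set w" "length x + length y = length w"
      then have "set (x @ y) \<subseteq> letters U" "x \<noteq> [] \<or> y \<noteq> []" using w by (auto simp: words_iff)
      then show "G (red x y) = f (x @ y) - (if x = [] then f y else 0) - (if y = [] then f x else 0)"
        using Lf[of "x @ y"] by (auto simp: red_def Gf linear_simps[OF G])
    qed
    also have "\<dots> = fscale (2 ^ length w) (f w) - f w - f w"
      unfolding spl_diff spl_join[OF f(2)] spl_left_nil spl_right_nil ..
    also have "\<dots> = fscale (2 ^ length w - 2) (f w)"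
    proof -
      have "(2::'k) = 1 + 1" by simp
      then show ?thesis
        by (simp only: fs.scale_left_diff_distrib fs.scale_left_distrib fs.scale_one) (simp add: algebra_simps)
    qed
    finally show ?thesis .
  qed
  \<comment> \<open>For \<open>n = 1\<close> this is the inverse of zero, which is zero; so \<open>E\<close> also removes the component in \<open>S\<^sup>1\<close>.\<close>
  define e :: "nat \<Rightarrow> 'k" where "e n = inverse (2 ^ n - 2)" for n
  define D :: "((int \<times> 'v) list \<Rightarrow>\<^sub>0 'k) \<Rightarrow> ((int \<times> 'v) list \<Rightarrow>\<^sub>0 'k)"
    where "D = lin_ext fscale (\<lambda>w. fscale (2 ^ length w - 2) (fgen w))"
  define E :: "((int \<times> 'v) list \<Rightarrow>\<^sub>0 'k) \<Rightarrow> ((int \<times> 'v) list \<Rightarrow>\<^sub>0 'k)"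
    where "E = lin_ext fscale (\<lambda>w. fscale (e (length w)) (fgen w))"
  have D: "Vector_Spaces.linear fscale fscale D" and E: "Vector_Spaces.linear fscale fscale E"
    unfolding D_def E_def by (rule linear_lin_ext[OF vector_space_fscale])+
  have Df: "D (fgen w) = fscale (2 ^ length w - 2) (fgen w)" and Ef: "E (fgen w) = fscale (e (length w)) (fgen w)" for w
    by (simp_all add: D_def E_def vector_space_fscale)
  have "L (D p) = G (coprod p)"
    by (rule sym_free_induct_eq[OF linear_compose2[OF D L(1)] linear_compose2[OF linear_coprod G] _ p])
      (simp add: Gc Df linear_simps[OF L(1)] Lf words_iff)
  also have "\<dots> = 0" using G0[OF c] by simp
  finally have Dp: "D p \<in> sym_rel U" using L(2) by blast
  have LE: "L (E (D p)) = 0"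
  proof (rule kills_sym_rel[OF U linear_compose2[OF E L(1)] _ _ _ Dp])
    show "L (E (fgen w)) = fscale (e (length w)) (f w)" if "w \<in> words U" for w
      using that by (simp add: Ef linear_simps[OF L(1)] Lf words_iff)
    show "mlin U fscale (\<lambda>w. fscale (e (length w)) (f w))"
      by (rule mlinI) (use lindD[OF mlinD[OF f(1)]] in \<open>simp add: lind_def fs.scale_right_distrib mult.commute\<close>)
    show "graded_sym (\<lambda>w. fscale (e (length w)) (f w))"
    proof (rule graded_symI)
      fix u a b and w :: "(int \<times> 'v) list"
      show "fscale (e (length (u @ a # b # w))) (f (u @ a # b # w)) =
        ksgn (fst a * fst b) (fscale (e (length (u @ b # a # w))) (f (u @ b # a # w)))"
        using graded_symD[OF f(2), of u a b w] by (simp add: ksgn_def)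
    qed
  qed
  \<comment> \<open>The classes of single letters depend linearly on the vector, across all degrees.\<close>
  define R where "R v = ext U f [v]" for v
  have R: "Vector_Spaces.linear (smul U) fscale R"
    using ext_lin[OF U vector_space_fscale f(1), of "[]" "[]"] by (simp add: R_def[abs_def])
  have LR: "Vector_Spaces.linear fscale fscale (\<lambda>p. L p - R (proj1 U p))"
    by (rule linear_difference[OF L(1) linear_compose2[OF linear_proj1[OF U] R]])
  have "L p - R (proj1 U p) = L (E (D p))"
  proof (rule sym_free_induct_eq[OF LR linear_compose2[OF D linear_compose2[OF E L(1)]] _ p])
    fix w assume w: "w \<in> words U"
    let ?n = "length w"
    have r: "L (E (D (fgen w))) = fscale ((2 ^ ?n - 2) * e ?n) (f w)"
      using w by (simp add: Df Ef linear_simps[OF E] linear_simps[OF L(1)] Lf words_iff)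
    have n: "?n \<noteq> 0" using w by (simp add: words_iff)
    show "L (fgen w) - R (proj1 U (fgen w)) = L (E (D (fgen w)))"
    proof (cases "?n = 1")
      case True
      then obtain d x where wx: "w = [(d, x)]" by (cases w) auto
      have "x \<in> grade U d" using w wx by (simp add: words_def)
      then have "R x = f w" using ext_args[OF U f(1), of w] by (simp add: R_def wx U.component_same)
      then show ?thesis unfolding r proj1_fgen[OF U] using w True wx by (simp add: Lf words_iff)
    next
      case False
      have "(of_nat (2 ^ ?n) :: 'k) \<noteq> of_nat (2 ^ 1)"
        unfolding of_nat_eq_iff using False by (subst power_inject_exp) simp_all
      then have "(2 ^ ?n - 2) * e ?n = 1" by (simp add: e_def)
      then show ?thesis
        unfolding r proj1_fgen[OF U] let1_long[OF False] linear_simps[OF R]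
        using w by (simp add: Lf words_iff fs.scale_one)
    qed
  qed
  then have "L p = 0" by (simp add: LE p1 linear_simps[OF R])
  then show ?thesis using L(2) by blast
qed

lemma ftensor_sym_rel2:
  assumes r: "r \<in> sym_rel U" and q: "q \<in> sym_free U"
  shows "ftensor r q \<in> sym_rel2 U" "ftensor q r \<in> sym_rel2 U"
proof -
  have S: "fs.subspace (sym_rel2 U)" unfolding sym_rel2_def by (rule fs.subspace_span)
  have 1: "ftensor g (fgen w) \<in> sym_rel2 U" "ftensor (fgen w) g \<in> sym_rel2 U"
    if "g \<in> sym_gens U" "w \<in> words U" for g w
    unfolding sym_rel2_def by (rule fs.span_base, use that in blast)+
  have 2: "ftensor r (fgen w) \<in> sym_rel2 U" "ftensor (fgen w) r \<in> sym_rel2 U" if "w \<in> words U" for w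
    by (rule linear_span[OF linear_ftensor(1) S 1(1)[OF _ that] r[unfolded sym_rel_def]], assumption)
      (rule linear_span[OF linear_ftensor(2) S 1(2)[OF _ that] r[unfolded sym_rel_def]])
  show "ftensor r q \<in> sym_rel2 U"
    by (rule linear_span[OF linear_ftensor(2) S _ q[unfolded sym_free_def]]) (use 2 in auto)
  show "ftensor q r \<in> sym_rel2 U"
    by (rule linear_span[OF linear_ftensor(1) S _ q[unfolded sym_free_def]]) (use 2 in auto)
qed

lemma sym_map_free:
  assumes T: "sym_map U X e T" and p: "p \<in> sym_free U"
  shows "T p \<in> sym_free X"
proof -
  have l: "Vector_Spaces.linear fscale fscale T" using T by (simp add: sym_map_def)
  have "T (fgen w) \<in> fs.span (fgen ` words X)" if "w \<in> words U" for w
  proof -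
    have "T (fgen w) \<in> fs.span (fgen ` {w' \<in> words X. wdeg w' = wdeg w + e})" using T that by (simp add: sym_map_def)
    moreover have "fs.span (fgen ` {w' \<in> words X. wdeg w' = wdeg w + e}) \<subseteq> fs.span (fgen ` words X)"
      by (rule fs.span_mono) auto
    ultimately show ?thesis by blast
  qed
  then show ?thesis
    unfolding sym_free_def by (intro linear_span[OF l fs.subspace_span _ p[unfolded sym_free_def]]) auto
qed

lemma fgen_sym_free: "w \<in> words U \<Longrightarrow> fgen w \<in> sym_free U"
  unfolding sym_free_def by (rule fs.span_base) auto

lemma coprod_short:
  assumes w: "w \<in> words U"
  shows "(coprod (fgen w) :: _ \<Rightarrow>\<^sub>0 'k::field) \<in>
    fs.span (fgen ` {(a, b). a \<in> words U \<and> b \<in> words U \<and> length a < length w \<and> length b < length w})"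
    (is "_ \<in> fs.span ?A")
  unfolding coprod_fgen
proof (rule spl_in)
  show "x + y \<in> fs.span ?A" if "x \<in> fs.span ?A" "y \<in> fs.span ?A" for x y using fs.span_add that .
  show "ksgn e x \<in> fs.span ?A" if "x \<in> fs.span ?A" for e x using fs.span_neg[OF that] that by (simp add: ksgn_def)
  fix x y assume *: "length x + length y = length w" "set x \<subseteq> set w" "set y \<subseteq> set w"
  show "red x y \<in> fs.span ?A"
  proof (cases "x = [] \<or> y = []")
    case True
    then show ?thesis by (auto simp: red_def fs.span_zero)
  next
    case False
    then have "length x \<noteq> 0" "length y \<noteq> 0" by simp_all
    then have "length x < length w" "length y < length w" using *(1) by linarith+
    moreover have "x \<in> words U" "y \<in> words U" using w * False by (auto simp: words_iff)
    ultimately show ?thesis using False by (auto simp: red_def intro!: fs.span_base)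
  qed
qed (rule fs.span_zero)

text \<open>The reduced coproduct of a word involves shorter words only, on which the two coderivations agree by
  induction. So the difference of their values on the word is primitive.\<close>

lemma coderivation_unique:
  fixes U :: "('k::field_char_0, 'v::ab_group_add) complex_data"
  assumes U: "complex U" and Q: "coderivation U Q" "coderivation U Q'"
    and eq: "\<And>w. w \<in> words U \<Longrightarrow> proj1 U (Q (fgen w)) = proj1 U (Q' (fgen w))" and w: "w \<in> words U"
  shows "Q (fgen w) - Q' (fgen w) \<in> sym_rel U"
  using w
proof (induct "length w" arbitrary: w rule: less_induct)
  case less
  have sm: "sym_map U U (- 1) Q" "sym_map U U (- 1) Q'" using Q by (simp_all add: coderivation_def)
  let ?H = "\<lambda>Q :: ((int \<times> 'v) list \<Rightarrow>\<^sub>0 'k) \<Rightarrow> ((int \<times> 'v) list \<Rightarrow>\<^sub>0 'k).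
    \<lambda>(a, b). ftensor (Q (fgen a)) (fgen b) + ksgn (wdeg a) (ftensor (fgen a) (Q (fgen b)))"
  let ?p = "Q (fgen w) - Q' (fgen w)" and ?c = "coprod (fgen w) :: _ \<Rightarrow>\<^sub>0 'k"
  have S: "fs.subspace (sym_rel2 U)" unfolding sym_rel2_def by (rule fs.subspace_span)
  have d: "coprod (Q (fgen w)) - lin_ext fscale (?H Q) ?c \<in> sym_rel2 U"
    "coprod (Q' (fgen w)) - lin_ext fscale (?H Q') ?c \<in> sym_rel2 U"
    using Q fgen_sym_free[OF less(2)] unfolding coderivation_def by blast+
  have "lin_ext fscale (?H Q) ?c - lin_ext fscale (?H Q') ?c \<in> sym_rel2 U"
  proof (rule linear_span[OF linear_difference[OF linear_lin_ext[OF vector_space_fscale] linear_lin_ext[OF vector_space_fscale]]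
        S _ coprod_short[OF less(2)]])
    fix h :: "(int \<times> 'v) list \<times> (int \<times> 'v) list \<Rightarrow>\<^sub>0 'k"
    assume "h \<in> fgen ` {(a, b). a \<in> words U \<and> b \<in> words U \<and> length a < length w \<and> length b < length w}"
    then obtain a b where h: "h = fgen (a, b)" and ab: "a \<in> words U" "b \<in> words U" "length a < length w" "length b < length w"
      by auto
    have "lin_ext fscale (?H Q) h - lin_ext fscale (?H Q') h =
      ftensor (Q (fgen a) - Q' (fgen a)) (fgen b) + ksgn (wdeg a) (ftensor (fgen a) (Q (fgen b) - Q' (fgen b)))"
      unfolding linear_simps[OF linear_ftensor(1)] linear_simps[OF linear_ftensor(2)]
      by (simp add: h vector_space_fscale ksgn_def)
    moreover have "ftensor (Q (fgen a) - Q' (fgen a)) (fgen b) \<in> sym_rel2 U"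
      by (rule ftensor_sym_rel2(1)[OF less(1)[OF ab(3,1)] fgen_sym_free[OF ab(2)]])
    moreover have "ftensor (fgen a) (Q (fgen b) - Q' (fgen b)) \<in> sym_rel2 U"
      by (rule ftensor_sym_rel2(2)[OF less(1)[OF ab(4,2)] fgen_sym_free[OF ab(1)]])
    ultimately show "lin_ext fscale (?H Q) h - lin_ext fscale (?H Q') h \<in> sym_rel2 U"
      using S by (simp add: ksgn_def fs.subspace_add fs.subspace_neg)
  qed
  from fs.subspace_add[OF S fs.subspace_diff[OF S d] this]
  have "coprod ?p \<in> sym_rel2 U" by (simp add: linear_simps[OF linear_coprod])
  moreover have "?p \<in> sym_free U"
    using sym_map_free[OF sm(1) fgen_sym_free[OF less(2)]] sym_map_free[OF sm(2) fgen_sym_free[OF less(2)]]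
    unfolding sym_free_def by (rule fs.span_diff)
  moreover have "proj1 U ?p = 0" using eq[OF less(2)] by (simp add: linear_simps[OF linear_proj1[OF U]])
  ultimately show ?case by (intro primitive_sym_rel[OF U])
qed

lemma coalgebra_map_unique:
  fixes U :: "('k::field_char_0, 'v::ab_group_add) complex_data"
    and X :: "('k, 'w::ab_group_add) complex_data"
  assumes X: "complex X" and Q: "coalgebra_map U X Q" "coalgebra_map U X Q'"
    and eq: "\<And>w. w \<in> words U \<Longrightarrow> proj1 X (Q (fgen w)) = proj1 X (Q' (fgen w))" and w: "w \<in> words U"
  shows "Q (fgen w) - Q' (fgen w) \<in> sym_rel X"
  using w
proof (induct "length w" arbitrary: w rule: less_induct)
  case less
  have sm: "sym_map U X 0 Q" "sym_map U X 0 Q'" using Q by (simp_all add: coalgebra_map_def)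
  let ?H = "\<lambda>Q :: ((int \<times> 'v) list \<Rightarrow>\<^sub>0 'k) \<Rightarrow> ((int \<times> 'w) list \<Rightarrow>\<^sub>0 'k).
    \<lambda>(a, b). ftensor (Q (fgen a)) (Q (fgen b))"
  let ?p = "Q (fgen w) - Q' (fgen w)" and ?c = "coprod (fgen w) :: _ \<Rightarrow>\<^sub>0 'k"
  have S: "fs.subspace (sym_rel2 X)" unfolding sym_rel2_def by (rule fs.subspace_span)
  have d: "coprod (Q (fgen w)) - lin_ext fscale (?H Q) ?c \<in> sym_rel2 X"
    "coprod (Q' (fgen w)) - lin_ext fscale (?H Q') ?c \<in> sym_rel2 X"
    using Q fgen_sym_free[OF less(2)] unfolding coalgebra_map_def by blast+
  have "lin_ext fscale (?H Q) ?c - lin_ext fscale (?H Q') ?c \<in> sym_rel2 X"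
  proof (rule linear_span[OF linear_difference[OF linear_lin_ext[OF vector_space_fscale] linear_lin_ext[OF vector_space_fscale]]
        S _ coprod_short[OF less(2)]])
    fix h :: "(int \<times> 'v) list \<times> (int \<times> 'v) list \<Rightarrow>\<^sub>0 'k"
    assume "h \<in> fgen ` {(a, b). a \<in> words U \<and> b \<in> words U \<and> length a < length w \<and> length b < length w}"
    then obtain a b where h: "h = fgen (a, b)" and ab: "a \<in> words U" "b \<in> words U" "length a < length w" "length b < length w"
      by auto
    have "lin_ext fscale (?H Q) h - lin_ext fscale (?H Q') h =
      ftensor (Q (fgen a) - Q' (fgen a)) (Q (fgen b)) + ftensor (Q' (fgen a)) (Q (fgen b) - Q' (fgen b))"
      unfolding linear_simps[OF linear_ftensor(1)] linear_simps[OF linear_ftensor(2)]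
      by (simp add: h vector_space_fscale)
    moreover have "ftensor (Q (fgen a) - Q' (fgen a)) (Q (fgen b)) \<in> sym_rel2 X"
      by (rule ftensor_sym_rel2(1)[OF less(1)[OF ab(3,1)] sym_map_free[OF sm(1) fgen_sym_free[OF ab(2)]]])
    moreover have "ftensor (Q' (fgen a)) (Q (fgen b) - Q' (fgen b)) \<in> sym_rel2 X"
      by (rule ftensor_sym_rel2(2)[OF less(1)[OF ab(4,2)] sym_map_free[OF sm(2) fgen_sym_free[OF ab(1)]]])
    ultimately show "lin_ext fscale (?H Q) h - lin_ext fscale (?H Q') h \<in> sym_rel2 X"
      using S by (simp add: fs.subspace_add)
  qed
  from fs.subspace_add[OF S fs.subspace_diff[OF S d] this]
  have "coprod ?p \<in> sym_rel2 X" by (simp add: linear_simps[OF linear_coprod])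
  moreover have "?p \<in> sym_free X"
    using sym_map_free[OF sm(1) fgen_sym_free[OF less(2)]] sym_map_free[OF sm(2) fgen_sym_free[OF less(2)]]
    unfolding sym_free_def by (rule fs.span_diff)
  moreover have "proj1 X ?p = 0" using eq[OF less(2)] by (simp add: linear_simps[OF linear_proj1[OF X]])
  ultimately show ?case by (intro primitive_sym_rel[OF X])
qed

section \<open>The coderivation and the coalgebra map with given components\<close>

lemma ins_let: "w \<noteq> [] \<Longrightarrow> ins s e t (let1 g) w = g (wdeg w + e) (t w)"
proof (cases w)
  case (Cons a v)
  have "ins s e t (\<lambda>z. let1 g (a # z)) v = ins s e t (\<lambda>z. 0) v"
    by (rule ins_cong[where H = UNIV]) (auto simp: neq_Nil_conv)
  moreover have "spl s (\<lambda>x y. let1 g (hat e t (a # x) # y)) v =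
      spl s (\<lambda>x y. if y = [] then g (wdeg (a # x) + e) (t (a # x)) else 0) v"
  proof (rule spl_cong)
    fix x y :: "(int \<times> 'a) list"
    show "let1 g (hat e t (a # x) # y) = (if y = [] then g (wdeg (a # x) + e) (t (a # x)) else 0)"
      by (cases y) (simp_all add: hat_def)
  qed
  ultimately show ?thesis by (simp add: Cons ins_0 spl_right_nil)
qed simp

lemma cm_let: "w \<noteq> [] \<Longrightarrow> cm s \<phi> (let1 g) w = g (wdeg w) (\<phi> w)"
proof (cases w)
  case (Cons a v)
  have "spl s (\<lambda>x y. cm s \<phi> (\<lambda>z. let1 g (hat 0 \<phi> (a # x) # z)) y) v =
      spl s (\<lambda>x y. if y = [] then g (wdeg (a # x)) (\<phi> (a # x)) else 0) v"
  proof (rule spl_cong)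
    fix x y :: "(int \<times> 'a) list"
    have "cm s \<phi> (\<lambda>z. let1 g (hat 0 \<phi> (a # x) # z)) y = cm s \<phi> (\<lambda>z. 0) y" if "y \<noteq> []"
      by (rule cm_cong[where H = UNIV and H' = UNIV]) (use that in \<open>auto simp: neq_Nil_conv\<close>)
    then show "cm s \<phi> (\<lambda>z. let1 g (hat 0 \<phi> (a # x) # z)) y = (if y = [] then g (wdeg (a # x)) (\<phi> (a # x)) else 0)"
      by (simp add: cm_0 hat_def)
  qed
  then show ?thesis by (simp add: Cons spl_right_nil)
qed simp

text \<open>The explicit coderivation and coalgebra map with given components. Their compatibility with the
  coproduct holds already on the free space, before passing to the quotient.\<close>

definition codr :: "((int \<times> 'v) list \<Rightarrow> 'v) \<Rightarrow> ((int \<times> 'v) list \<Rightarrow>\<^sub>0 'k::field) \<Rightarrow> ((int \<times> 'v) list \<Rightarrow>\<^sub>0 'k)" where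
  "codr t = lin_ext fscale (ins True (- 1) t fgen)"

definition coal :: "((int \<times> 'v) list \<Rightarrow> 'w) \<Rightarrow> ((int \<times> 'v) list \<Rightarrow>\<^sub>0 'k::field) \<Rightarrow> ((int \<times> 'w) list \<Rightarrow>\<^sub>0 'k)" where
  "coal \<phi> = lin_ext fscale (cm True \<phi> fgen)"

lemma codr: "Vector_Spaces.linear fscale fscale (codr t)" "codr t (fgen w) = ins True (- 1) t fgen w"
  by (simp_all add: codr_def linear_lin_ext vector_space_fscale)

lemma coal: "Vector_Spaces.linear fscale fscale (coal \<phi>)" "coal \<phi> (fgen w) = cm True \<phi> fgen w"
  by (simp_all add: coal_def linear_lin_ext vector_space_fscale)

lemma hat_letters: "adm md U X e t \<Longrightarrow> x \<noteq> [] \<Longrightarrow> hat e t x \<in> letters X"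
  by (simp add: letters_def hat_def adm_grade)

lemma codr_coderivation:
  fixes U :: "('k::field, 'v::ab_group_add) complex_data"
  assumes U: "complex U" and t: "adm Lie U U (- 1) t"
  shows "coderivation U (codr t)"
proof -
  let ?Q = "codr t :: ((int \<times> 'v) list \<Rightarrow>\<^sub>0 'k) \<Rightarrow> _"
  have vs: "vector_space (fscale :: 'k \<Rightarrow> ((int \<times> 'v) list \<Rightarrow>\<^sub>0 'k) \<Rightarrow> _)" by (rule vector_space_fscale)
  obtain L :: "((int \<times> 'v) list \<Rightarrow>\<^sub>0 'k) \<Rightarrow> ((int \<times> 'v) list \<Rightarrow>\<^sub>0 'k)"
    where L: "Vector_Spaces.linear fscale fscale L" "\<And>p. L p = 0 \<longleftrightarrow> p \<in> sym_rel U"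
    and f: "mlin U fscale (\<lambda>w. L (fgen (normal_word U w)))" "graded_sym (\<lambda>w. L (fgen (normal_word U w)))"
    and n: "\<And>w. set w \<subseteq> letters U \<Longrightarrow> L (fgen w) = L (fgen (normal_word U w))"
    using sym_quotient[OF U] by blast
  have rel: "L (?Q p) = 0" if p: "p \<in> sym_rel U" for p
  proof (rule kills_sym_rel[OF U linear_compose2[OF codr(1) L(1)] _ _ _ p])
    show "L (?Q (fgen w)) = ins True (- 1) t (\<lambda>w. L (fgen (normal_word U w))) w" if w: "w \<in> words U" for w
    proof -
      have "L (?Q (fgen w)) = ins True (- 1) t (\<lambda>z. L (fgen z)) w"
        unfolding codr(2) by (rule ins_post[OF linear_addi[OF L(1)]])
      also have "\<dots> = ins True (- 1) t (\<lambda>w. L (fgen (normal_word U w))) w"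
        by (rule ins_cong[where H = "letters U"]) (use w n hat_letters[OF t] in \<open>auto simp: words_iff\<close>)
      finally show ?thesis .
    qed
    show "mlin U fscale (ins True (- 1) t (\<lambda>w. L (fgen (normal_word U w))))"
      by (rule mlin_ins[OF vs adm_mlin[OF t] f(1)])
    show "graded_sym (ins True (- 1) t (\<lambda>w. L (fgen (normal_word U w))))"
      by (rule graded_sym_ins[OF adm_graded_sym[OF t refl] mlin_addv[OF f(1)] f(2)])
  qed
  have sm: "sym_map U U (- 1) ?Q"
    unfolding sym_map_def
  proof (intro conjI ballI codr(1))
    show "?Q ` sym_rel U \<subseteq> sym_rel U" using rel L(2) by blast
    fix w assume w: "w \<in> words U"
    let ?S = "fs.span (fgen ` {w' \<in> words U. wdeg w' = wdeg w + - 1}) :: ((int \<times> 'v) list \<Rightarrow>\<^sub>0 'k) set"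
    show "?Q (fgen w) \<in> ?S"
      unfolding codr(2)
    proof (rule ins_in[where H = "letters U"])
      show "ksgn e x \<in> ?S" if "x \<in> ?S" for e x using fs.span_neg[OF that] that by (simp add: ksgn_def)
      show "x + y \<in> ?S" if "x \<in> ?S" "y \<in> ?S" for x y by (rule fs.span_add[OF that])
      show "fgen z \<in> ?S" if "z \<noteq> []" "set z \<subseteq> letters U" "wdeg z = wdeg w + - 1" for z
        by (rule fs.span_base) (use that in \<open>auto simp: words_iff\<close>)
      show "set w \<subseteq> letters U" using w by (simp add: words_iff)
    qed (auto intro: fs.span_zero hat_letters[OF t])
  qed
  let ?H = "\<lambda>(a, b). ftensor (?Q (fgen a)) (fgen b) + ksgn (wdeg a) (ftensor (fgen a) (?Q (fgen b)))"
  have lH: "Vector_Spaces.linear fscale fscale (lin_ext fscale ?H)" by (rule linear_lin_ext[OF vector_space_fscale])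
  have "coprod (?Q p) = lin_ext fscale ?H (coprod p)" if p: "p \<in> sym_free U" for p
  proof (rule sym_free_induct_eq[OF linear_compose2[OF codr(1) linear_coprod] linear_compose2[OF linear_coprod lH] _ p])
    fix w :: "(int \<times> 'v) list"
    let ?i = "ins True (- 1) t"
    have "coprod (?Q (fgen w)) = ?i (spl True red) w"
      unfolding codr(2) coprod_fgen[symmetric, abs_def] by (rule ins_post[OF linear_addi[OF linear_coprod]])
    also have "\<dots> = spl True (\<lambda>x y. ?i (\<lambda>x'. red x' y) x + ksgn (- 1 * wdeg x) (?i (\<lambda>y'. red x y') y)) w"
      by (rule ins_spl)
    also have "\<dots> = spl True (\<lambda>x y. lin_ext fscale ?H (red x y)) w"
    proof (rule spl_cong)
      fix x y :: "(int \<times> 'v) list"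
      have 1: "?i (\<lambda>x'. red x' y) x = (if y = [] then 0 else ftensor (?i fgen x) (fgen y) :: _ \<Rightarrow>\<^sub>0 'k)" for x y :: "(int \<times> 'v) list"
      proof (cases "y = []")
        case True
        then show ?thesis by (simp add: red_def ins_0)
      next
        case False
        have "(ftensor (?i fgen x) (fgen y) :: _ \<Rightarrow>\<^sub>0 'k) = ?i (\<lambda>z. ftensor (fgen z) (fgen y)) x"
          by (rule ins_post[OF linear_addi[OF linear_ftensor(1)]])
        also have "\<dots> = ?i (\<lambda>x'. red x' y) x"
          by (rule ins_cong[where H = UNIV]) (use False in \<open>auto simp: red_def ftensor_fgen\<close>)
        finally show ?thesis using False by simp
      qed
      have 2: "?i (\<lambda>y'. red x y') y = (if x = [] then 0 else ftensor (fgen x) (?i fgen y) :: _ \<Rightarrow>\<^sub>0 'k)" for x y :: "(int \<times> 'v) list"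
      proof (cases "x = []")
        case True
        then show ?thesis by (simp add: red_def ins_0)
      next
        case False
        have "(ftensor (fgen x) (?i fgen y) :: _ \<Rightarrow>\<^sub>0 'k) = ?i (\<lambda>z. ftensor (fgen x) (fgen z)) y"
          by (rule ins_post[OF linear_addi[OF linear_ftensor(2)]])
        also have "\<dots> = ?i (\<lambda>y'. red x y') y"
          by (rule ins_cong[where H = UNIV]) (use False in \<open>auto simp: red_def ftensor_fgen\<close>)
        finally show ?thesis using False by simp
      qed
      show "?i (\<lambda>x'. red x' y) x + ksgn (- 1 * wdeg x) (?i (\<lambda>y'. red x y') y) = lin_ext fscale ?H (red x y)"
        unfolding 1 2 using linear_simps(3)[OF lH] linear_simps(3)[OF linear_ftensor(1)] linear_simps(3)[OF linear_ftensor(2)]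
        by (auto simp: red_def vector_space_fscale codr(2) ksgn_def)
    qed
    also have "\<dots> = lin_ext fscale ?H (coprod (fgen w))"
      unfolding coprod_fgen by (rule spl_post[OF linear_addi[OF lH], symmetric])
    finally show "coprod (?Q (fgen w)) = lin_ext fscale ?H (coprod (fgen w))" .
  qed
  then have "coprod (?Q p) - lin_ext fscale ?H (coprod p) \<in> sym_rel2 U" if "p \<in> sym_free U" for p
    using that unfolding sym_rel2_def by (simp add: fs.span_zero)
  then show ?thesis using sm by (simp add: coderivation_def)
qed

lemma coal_coalgebra_map:
  fixes U :: "('k::field, 'v::ab_group_add) complex_data" and X :: "('k, 'w::ab_group_add) complex_data"
  assumes U: "complex U" and X: "complex X" and t: "adm Lie U X 0 \<phi>"
  shows "coalgebra_map U X (coal \<phi>)"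
proof -
  let ?Q = "coal \<phi> :: ((int \<times> 'v) list \<Rightarrow>\<^sub>0 'k) \<Rightarrow> _"
  have vs: "vector_space (fscale :: 'k \<Rightarrow> ((int \<times> 'w) list \<Rightarrow>\<^sub>0 'k) \<Rightarrow> _)" by (rule vector_space_fscale)
  obtain L :: "((int \<times> 'w) list \<Rightarrow>\<^sub>0 'k) \<Rightarrow> ((int \<times> 'w) list \<Rightarrow>\<^sub>0 'k)"
    where L: "Vector_Spaces.linear fscale fscale L" "\<And>p. L p = 0 \<longleftrightarrow> p \<in> sym_rel X"
    and f: "mlin X fscale (\<lambda>w. L (fgen (normal_word X w)))" "graded_sym (\<lambda>w. L (fgen (normal_word X w)))"
    and n: "\<And>w. set w \<subseteq> letters X \<Longrightarrow> L (fgen w) = L (fgen (normal_word X w))"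
    using sym_quotient[OF X] by blast
  have rel: "L (?Q p) = 0" if p: "p \<in> sym_rel U" for p
  proof (rule kills_sym_rel[OF U linear_compose2[OF coal(1) L(1)] _ _ _ p])
    show "L (?Q (fgen w)) = cm True \<phi> (\<lambda>w. L (fgen (normal_word X w))) w" if w: "w \<in> words U" for w
    proof -
      have "L (?Q (fgen w)) = cm True \<phi> (\<lambda>z. L (fgen z)) w"
        unfolding coal(2) by (rule cm_post[OF linear_addi[OF L(1)]])
      also have "\<dots> = cm True \<phi> (\<lambda>w. L (fgen (normal_word X w))) w"
        by (rule cm_cong[where H = "letters U" and H' = "letters X"]) (use w n hat_letters[OF t] in \<open>auto simp: words_iff\<close>)
      finally show ?thesis .
    qed
    show "mlin U fscale (cm True \<phi> (\<lambda>w. L (fgen (normal_word X w))))"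
      by (rule mlin_cm[OF vs adm_mlin[OF t] f(1)])
    show "graded_sym (cm True \<phi> (\<lambda>w. L (fgen (normal_word X w))))"
      by (rule graded_sym_cm[OF adm_graded_sym[OF t refl] mlin_addv[OF f(1)] f(2)])
  qed
  have sm: "sym_map U X 0 ?Q"
    unfolding sym_map_def
  proof (intro conjI ballI coal(1))
    show "?Q ` sym_rel U \<subseteq> sym_rel X" using rel L(2) by blast
    fix w assume w: "w \<in> words U"
    let ?S = "fs.span (fgen ` {w' \<in> words X. wdeg w' = wdeg w + 0}) :: ((int \<times> 'w) list \<Rightarrow>\<^sub>0 'k) set"
    show "?Q (fgen w) \<in> ?S"
      unfolding coal(2)
    proof (rule cm_in[where H = "letters U" and H' = "letters X"])
      show "ksgn e x \<in> ?S" if "x \<in> ?S" for e x using fs.span_neg[OF that] that by (simp add: ksgn_def)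
      show "x + y \<in> ?S" if "x \<in> ?S" "y \<in> ?S" for x y by (rule fs.span_add[OF that])
      show "fgen z \<in> ?S" if "w \<noteq> [] \<Longrightarrow> z \<noteq> []" "set z \<subseteq> letters X" "wdeg z = wdeg w" for z
        by (rule fs.span_base) (use that w in \<open>auto simp: words_iff\<close>)
      show "set w \<subseteq> letters U" using w by (simp add: words_iff)
    qed (auto intro: fs.span_zero hat_letters[OF t])
  qed
  let ?H = "\<lambda>(a, b). ftensor (?Q (fgen a)) (?Q (fgen b))"
  have lH: "Vector_Spaces.linear fscale fscale (lin_ext fscale ?H)" by (rule linear_lin_ext[OF vector_space_fscale])
  have "coprod (?Q p) = lin_ext fscale ?H (coprod p)" if p: "p \<in> sym_free U" for p
  proof (rule sym_free_induct_eq[OF linear_compose2[OF coal(1) linear_coprod] linear_compose2[OF linear_coprod lH] _ p])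
    fix w :: "(int \<times> 'v) list"
    let ?i = "cm True \<phi>"
    have "coprod (?Q (fgen w)) = ?i (spl True red) w"
      unfolding coal(2) coprod_fgen[symmetric, abs_def] by (rule cm_post[OF linear_addi[OF linear_coprod]])
    also have "\<dots> = spl True (\<lambda>x y. ?i (\<lambda>x'. ?i (\<lambda>y'. red x' y') y) x) w"
      by (rule cm_spl)
    also have "\<dots> = spl True (\<lambda>x y. lin_ext fscale ?H (red x y)) w"
    proof (rule spl_cong)
      fix x y :: "(int \<times> 'v) list"
      show "?i (\<lambda>x'. ?i (\<lambda>y'. red x' y') y) x = lin_ext fscale ?H (red x y)"
      proof (cases "x = [] \<or> y = []")
        case True
        have "?i (\<lambda>x'. ?i (\<lambda>y'. red x' y') y) x = ?i (\<lambda>x'. 0) x"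
          by (rule cm_cong[where H = UNIV and H' = UNIV]) (use True in \<open>auto simp: red_def cm_0\<close>)
        then show ?thesis using True by (auto simp: red_def cm_0 linear_simps(3)[OF lH])
      next
        case False
        have "lin_ext fscale ?H (red x y) = (ftensor (?i fgen x) (?i fgen y) :: _ \<Rightarrow>\<^sub>0 'k)"
          using False by (simp add: red_def vector_space_fscale coal(2))
        also have "\<dots> = ?i (\<lambda>x'. ftensor (fgen x') (?i fgen y)) x"
          by (rule cm_post[OF linear_addi[OF linear_ftensor(1)]])
        also have "\<dots> = ?i (\<lambda>x'. ?i (\<lambda>y'. ftensor (fgen x') (fgen y')) y) x"
          unfolding cm_post[OF linear_addi[OF linear_ftensor(2)]] ..
        also have "\<dots> = ?i (\<lambda>x'. ?i (\<lambda>y'. red x' y') y) x"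
        proof (rule cm_cong[where H = UNIV and H' = UNIV])
          fix x' :: "(int \<times> 'w) list" assume "x \<noteq> [] \<Longrightarrow> x' \<noteq> []"
          then show "?i (\<lambda>y'. ftensor (fgen x') (fgen y')) y = ?i (\<lambda>y'. red x' y') y"
            by (intro cm_cong[where H = UNIV and H' = UNIV]) (use False in \<open>auto simp: red_def ftensor_fgen\<close>)
        qed auto
        finally show ?thesis ..
      qed
    qed
    also have "\<dots> = lin_ext fscale ?H (coprod (fgen w))"
      unfolding coprod_fgen by (rule spl_post[OF linear_addi[OF lH], symmetric])
    finally show "coprod (?Q (fgen w)) = lin_ext fscale ?H (coprod (fgen w))" .
  qed
  then have "coprod (?Q p) - lin_ext fscale ?H (coprod p) \<in> sym_rel2 X" if "p \<in> sym_free U" for p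
    using that unfolding sym_rel2_def by (simp add: fs.span_zero)
  then show ?thesis using sm by (simp add: coalgebra_map_def)
qed

lemma proj1_codr:
  assumes U: "complex U" and w: "w \<in> words U"
  shows "proj1 U (codr t (fgen w)) = t w"
proof -
  have "proj1 U (codr t (fgen w)) = ins True (- 1) t (let1 (\<lambda>d x. x)) w"
    unfolding codr(2) proj1_fgen[OF U, symmetric, abs_def] by (rule ins_post[OF linear_addi[OF linear_proj1[OF U]]])
  then show ?thesis using w by (simp add: ins_let words_iff)
qed

lemma proj1_coal:
  assumes X: "complex X" and w: "w \<noteq> []"
  shows "proj1 X (coal \<phi> (fgen w)) = \<phi> w"
proof -
  have "proj1 X (coal \<phi> (fgen w)) = cm True \<phi> (let1 (\<lambda>d x. x)) w"
    unfolding coal(2) proj1_fgen[OF X, symmetric, abs_def] by (rule cm_post[OF linear_addi[OF linear_proj1[OF X]]])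
  then show ?thesis using w by (simp add: cm_let)
qed

text \<open>The first component of a composition only depends on the class of the inner value and on the
  components of the outer map; this is why the inner map may be replaced by the explicit one.\<close>

lemma lin_ext_components:
  assumes U: "complex U" and X: "complex X" and t: "adm Lie U X e t"
    and T: "Vector_Spaces.linear fscale fscale T" and c: "\<And>w. w \<in> words U \<Longrightarrow> proj1 X (T (fgen w)) = t w"
    and p: "p \<in> sym_free U" and r: "p - p' \<in> sym_rel U"
  shows "proj1 X (T p) = lin_ext (smul X) t p'"
proof -
  interpret X: complex X by (rule X)
  have l: "Vector_Spaces.linear fscale (smul X) (lin_ext (smul X) t)"
    by (rule linear_lin_ext[OF X.vs.vector_space_axioms])
  have "proj1 X (T p) = lin_ext (smul X) t p"
    by (rule sym_free_induct_eq[OF linear_compose2[OF T linear_proj1[OF X]] l _ p])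
      (simp add: c X.vs.vector_space_axioms)
  moreover have "lin_ext (smul X) t (p - p') = 0"
    by (rule kills_sym_rel[OF U l _ adm_mlin[OF t] adm_graded_sym[OF t refl] r])
      (simp add: X.vs.vector_space_axioms)
  ultimately show ?thesis by (simp add: linear_simps[OF l])
qed

lemma proj1_codr_compose:
  fixes U :: "('k::field_char_0, 'v::ab_group_add) complex_data"
  assumes U: "complex U" and X: "complex X" and t: "adm Lie U U (- 1) t" and \<phi>: "adm Lie U X e \<phi>"
    and Q: "coderivation U Q" "\<And>w. w \<in> words U \<Longrightarrow> proj1 U (Q (fgen w)) = t w"
    and T: "Vector_Spaces.linear fscale fscale T" "\<And>w. w \<in> words U \<Longrightarrow> proj1 X (T (fgen w)) = \<phi> w"
    and w: "w \<in> words U"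
  shows "proj1 X (T (Q (fgen w))) = ins True (- 1) t \<phi> w"
proof -
  interpret X: complex X by (rule X)
  have "sym_map U U (- 1) Q" using Q(1) by (simp add: coderivation_def)
  then have "Q (fgen w) \<in> sym_free U" by (rule sym_map_free[OF _ fgen_sym_free[OF w]])
  moreover have "Q (fgen w) - codr t (fgen w) \<in> sym_rel U"
    by (rule coderivation_unique[OF U Q(1) codr_coderivation[OF U t] _ w]) (simp add: Q(2) proj1_codr[OF U])
  ultimately have "proj1 X (T (Q (fgen w))) = lin_ext (smul X) \<phi> (codr t (fgen w))"
    by (intro lin_ext_components[OF U X \<phi> T(1)] T(2))
  also have "\<dots> = ins True (- 1) t (\<lambda>z. lin_ext (smul X) \<phi> (fgen z :: _ \<Rightarrow>\<^sub>0 'k)) w"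
    unfolding codr(2)
    by (rule ins_post[OF linear_addi[OF linear_lin_ext[OF X.vs.vector_space_axioms]]])
  finally show ?thesis by (simp add: X.vs.vector_space_axioms)
qed

lemma proj1_coal_compose:
  fixes U :: "('k::field_char_0, 'v::ab_group_add) complex_data"
    and X :: "('k, 'w::ab_group_add) complex_data"
  assumes U: "complex U" and X: "complex X" and t: "adm Lie U X 0 \<phi>" and q: "adm Lie X X e q"
    and Q: "coalgebra_map U X \<Phi>" "\<And>w. w \<in> words U \<Longrightarrow> proj1 X (\<Phi> (fgen w)) = \<phi> w"
    and T: "Vector_Spaces.linear fscale fscale T" "\<And>w. w \<in> words X \<Longrightarrow> proj1 X (T (fgen w)) = q w"
    and w: "w \<in> words U"
  shows "proj1 X (T (\<Phi> (fgen w))) = cm True \<phi> q w"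
proof -
  interpret X: complex X by (rule X)
  have "sym_map U X 0 \<Phi>" using Q(1) by (simp add: coalgebra_map_def)
  then have "\<Phi> (fgen w) \<in> sym_free X" by (rule sym_map_free[OF _ fgen_sym_free[OF w]])
  moreover have "\<Phi> (fgen w) - coal \<phi> (fgen w) \<in> sym_rel X"
    by (rule coalgebra_map_unique[OF X Q(1) coal_coalgebra_map[OF U X t] _ w])
      (simp add: Q(2) proj1_coal[OF X] words_iff)
  ultimately have "proj1 X (T (\<Phi> (fgen w))) = lin_ext (smul X) q (coal \<phi> (fgen w))"
    by (intro lin_ext_components[OF X X q T(1)] T(2))
  also have "\<dots> = cm True \<phi> (\<lambda>z. lin_ext (smul X) q (fgen z :: _ \<Rightarrow>\<^sub>0 'k)) w"
    unfolding coal(2)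
    by (rule cm_post[OF linear_addi[OF linear_lin_ext[OF X.vs.vector_space_axioms]]])
  finally show ?thesis by (simp add: X.vs.vector_space_axioms)
qed

section \<open>Lie algebras\<close>

abbreviation lie_maps :: "enat \<Rightarrow> ('k::field, 'v::ab_group_add) complex_data \<Rightarrow> (nat \<Rightarrow> 'v list \<Rightarrow> 'w::ab_group_add) \<Rightarrow> (int \<times> 'v) list \<Rightarrow> 'w"
  where "lie_maps K U F \<equiv> tagged U (\<lambda>_. 0) (mapsA K F)"

lemma lie_maps_eq: "lie_maps K U F w = (if enat (length w) \<le> K then F (length w) (args U w) else 0)"
  by (simp add: tagged_def mapsA_def ksgn_even)

lemma lie_maps_words:
  assumes "complex U" "w \<in> words U"
  shows "lie_maps K U F w = (if enat (length w) \<le> K then F (length w) (map snd w) else 0)"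
proof -
  have "args U w = map snd w"
    unfolding args_def by (rule map_cong) (use assms in \<open>auto simp: words_def complex.component_same\<close>)
  then show ?thesis by (simp add: lie_maps_eq)
qed

lemma adm_lie_maps:
  fixes U :: "('k::field, 'v::ab_group_add) complex_data" and X :: "('k, 'w::ab_group_add) complex_data"
  assumes U: "complex U" and X: "complex X"
    and F: "\<And>i. 1 \<le> i \<Longrightarrow> enat i \<le> K \<Longrightarrow> sym_hom U X i e (F i)"
  shows "adm Lie U X e (lie_maps K U F)"
proof (rule adm_tagged[OF U X])
  interpret U: complex U by (rule U)
  show "multi_hom U X n e (mapsA K F n)" if "1 \<le> n" for n
  proof (cases "enat n \<le> K")
    case True
    then have "mapsA K F n = F n" by (auto simp: mapsA_def)
    then show ?thesis using F[OF that True] by (simp add: sym_hom_def)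
  next
    case False
    then have "mapsA K F n = (\<lambda>_. 0)" by (auto simp: mapsA_def)
    then show ?thesis using multi_hom_zero[OF U X] by simp
  qed
  show "graded_sym (lie_maps K U F)"
  proof (rule graded_symI)
    fix u w :: "(int \<times> 'v) list" and a b
    let ?n = "length u + length w + 2"
    show "lie_maps K U F (u @ a # b # w) = ksgn (fst a * fst b) (lie_maps K U F (u @ b # a # w))"
    proof (cases "enat ?n \<le> K")
      case True
      have "sym_hom U X ?n e (F ?n)" by (rule F) (use True in auto)
      then have sw: "F ?n (us @ x # y # vs) = ksgn (c * d) (F ?n (us @ y # x # vs))"
        if "x \<in> grade U c" "y \<in> grade U d" "length us + length vs + 2 = ?n" for x y c d us vs
        using that unfolding sym_hom_def by blast
      have "F ?n (args U u @ component U (fst a) (snd a) # component U (fst b) (snd b) # args U w) =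
        ksgn (fst a * fst b) (F ?n (args U u @ component U (fst b) (snd b) # component U (fst a) (snd a) # args U w))"
        by (rule sw[OF U.component_grade U.component_grade]) simp
      then show ?thesis using True by (simp add: lie_maps_eq)
    next
      case False
      then show ?thesis by (simp add: lie_maps_eq)
    qed
  qed
qed simp

lemma has_components_lie_maps:
  assumes "complex U"
  shows "has_components K U X T F \<longleftrightarrow> (\<forall>w\<in>words U. proj1 X (T (fgen w)) = lie_maps K U F w)"
  using lie_maps_words[OF assms, of _ K F] by (simp add: has_components_def)

text \<open>Any coderivation with the given components computes the same first component of its square as the
  explicit one, so the existential quantifier in the definition can be eliminated.\<close>

lemma L_algebra_words:
  fixes W :: "('k::field_char_0, 'w::ab_group_add) complex_data"
  assumes W: "chain_complex W" and q: "\<And>i. 1 \<le> i \<Longrightarrow> enat i \<le> K \<Longrightarrow> sym_hom (susp W) (susp W) i (- 1) (q i)"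
    and q1: "\<And>x. q 1 [x] = bd (susp W) x"
  shows "L_algebra K W q \<longleftrightarrow> (\<forall>w. w \<noteq> [] \<and> enat (length w) \<le> K \<longrightarrow>
    ins True (- 1) (lie_maps K (susp W) q) (lie_maps K (susp W) q) w = 0)"
proof -
  let ?X = "susp W"
  let ?q = "lie_maps K ?X q"
  have X: "complex ?X" by (rule complex_susp[OF W])
  interpret X: complex ?X by (rule X)
  have aq: "adm Lie ?X ?X (- 1) ?q" by (rule adm_lie_maps[OF X X q])
  have hc: "has_components K ?X ?X Q q \<longleftrightarrow> (\<forall>w\<in>words ?X. proj1 ?X (Q (fgen w)) = ?q w)"
    for Q :: "((int \<times> 'w) list \<Rightarrow>\<^sub>0 'k) \<Rightarrow> _" by (rule has_components_lie_maps[OF X])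
  have sq: "proj1 ?X (Q (Q (fgen w))) = ins True (- 1) ?q ?q w"
    if Q: "coderivation ?X Q" "has_components K ?X ?X Q q" and w: "w \<in> words ?X" for Q w
  proof (rule proj1_codr_compose[OF X X aq aq Q(1) _ _ _ w])
    show "Vector_Spaces.linear fscale fscale Q" using Q(1) by (simp add: coderivation_def sym_map_def)
  qed (use Q(2)[unfolded hc] in blast)+
  have m: "mlin ?X (smul ?X) (ins True (- 1) ?q ?q)"
    by (rule mlin_ins[OF X.vs.vector_space_axioms adm_mlin[OF aq] adm_mlin[OF aq]])
  have all: "(\<forall>w\<in>words ?X. enat (length w) \<le> K \<longrightarrow> ins True (- 1) ?q ?q w = 0) \<longleftrightarrow>
    (\<forall>w. w \<noteq> [] \<and> enat (length w) \<le> K \<longrightarrow> ins True (- 1) ?q ?q w = 0)" (is "?l = ?r")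
  proof
    assume ?l
    then have "ins True (- 1) ?q ?q (normal_word ?X w) = 0" if "w \<noteq> []" "enat (length w) \<le> K" for w
      using normal_word_words[OF X that(1)] that(2) by simp
    then show ?r using mlin_normal_word[OF m, of "[]"] by simp
  qed (auto simp: words_def)
  have C: "coderivation ?X (codr ?q)" "has_components K ?X ?X (codr ?q) q"
    unfolding hc using codr_coderivation[OF X aq] proj1_codr[OF X] by blast+
  show ?thesis
    unfolding all[symmetric]
  proof
    assume "L_algebra K W q"
    then obtain Q where "coderivation ?X Q" "has_components K ?X ?X Q q"
      and "\<forall>w\<in>words ?X. enat (length w) \<le> K \<longrightarrow> proj1 ?X (Q (Q (fgen w))) = 0"
      unfolding L_algebra_def by blast
    then show ?l using sq by metis
  next
    assume ?l
    then have "\<forall>w\<in>words ?X. enat (length w) \<le> K \<longrightarrow> proj1 ?X (codr ?q (codr ?q (fgen w))) = 0"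
      using sq[OF C] by metis
    then show "L_algebra K W q" using W q q1 C unfolding L_algebra_def by blast
  qed
qed

lemma L_morphism_words:
  fixes V :: "('k::field_char_0, 'v::ab_group_add) complex_data"
    and W :: "('k, 'w::ab_group_add) complex_data"
  assumes V: "chain_complex V" and W: "chain_complex W"
    and p: "\<And>i. 1 \<le> i \<Longrightarrow> enat i \<le> K \<Longrightarrow> sym_hom (susp V) (susp V) i (- 1) (p i)"
    and q: "\<And>i. 1 \<le> i \<Longrightarrow> enat i \<le> K \<Longrightarrow> sym_hom (susp W) (susp W) i (- 1) (q i)"
    and \<phi>: "\<And>i. 1 \<le> i \<Longrightarrow> enat i \<le> K \<Longrightarrow> sym_hom (susp V) (susp W) i 0 (\<phi> i)"
  shows "L_morphism K V W p q \<phi> \<longleftrightarrow> (\<forall>w. w \<noteq> [] \<and> enat (length w) \<le> K \<longrightarrow>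
    ins True (- 1) (lie_maps K (susp V) p) (lie_maps K (susp V) \<phi>) w =
    cm True (lie_maps K (susp V) \<phi>) (lie_maps K (susp W) q) w)"
proof -
  let ?U = "susp V" and ?X = "susp W"
  let ?p = "lie_maps K ?U p" and ?q = "lie_maps K ?X q" and ?f = "lie_maps K ?U \<phi>"
  have U: "complex ?U" and X: "complex ?X" by (rule complex_susp[OF V], rule complex_susp[OF W])
  interpret X: complex ?X by (rule X)
  have ap: "adm Lie ?U ?U (- 1) ?p" and aq: "adm Lie ?X ?X (- 1) ?q" and af: "adm Lie ?U ?X 0 ?f"
    using adm_lie_maps[OF U U p] adm_lie_maps[OF X X q] adm_lie_maps[OF U X \<phi>] by blast+
  have hp: "has_components K ?U ?U Q p \<longleftrightarrow> (\<forall>w\<in>words ?U. proj1 ?U (Q (fgen w)) = ?p w)"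
    for Q :: "((int \<times> 'v) list \<Rightarrow>\<^sub>0 'k) \<Rightarrow> _" by (rule has_components_lie_maps[OF U])
  have hq: "has_components K ?X ?X Q q \<longleftrightarrow> (\<forall>w\<in>words ?X. proj1 ?X (Q (fgen w)) = ?q w)"
    for Q :: "((int \<times> 'w) list \<Rightarrow>\<^sub>0 'k) \<Rightarrow> _" by (rule has_components_lie_maps[OF X])
  have hf: "has_components K ?U ?X Q \<phi> \<longleftrightarrow> (\<forall>w\<in>words ?U. proj1 ?X (Q (fgen w)) = ?f w)"
    for Q :: "((int \<times> 'v) list \<Rightarrow>\<^sub>0 'k) \<Rightarrow> _" by (rule has_components_lie_maps[OF U])
  have diff: "proj1 ?X (\<Phi> (QV (fgen w)) - QW (\<Phi> (fgen w))) = ins True (- 1) ?p ?f w - cm True ?f ?q w"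
    if c: "coderivation ?U QV" "has_components K ?U ?U QV p" "coderivation ?X QW" "has_components K ?X ?X QW q"
      "coalgebra_map ?U ?X \<Phi>" "has_components K ?U ?X \<Phi> \<phi>" and w: "w \<in> words ?U" for QV QW \<Phi> w
  proof -
    have l: "Vector_Spaces.linear fscale fscale \<Phi>" "Vector_Spaces.linear fscale fscale QW"
      using c by (simp_all add: coderivation_def coalgebra_map_def sym_map_def)
    have "proj1 ?X (\<Phi> (QV (fgen w))) = ins True (- 1) ?p ?f w"
      by (rule proj1_codr_compose[OF U X ap af c(1) _ l(1) _ w]) (use c(2,6)[unfolded hp hf] in blast)+
    moreover have "proj1 ?X (QW (\<Phi> (fgen w))) = cm True ?f ?q w"
      by (rule proj1_coal_compose[OF U X af aq c(5) _ l(2) _ w]) (use c(4,6)[unfolded hq hf] in blast)+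
    ultimately show ?thesis by (simp add: linear_simps[OF linear_proj1[OF X]])
  qed
  have m: "mlin ?U (smul ?X) (ins True (- 1) ?p ?f)" "mlin ?U (smul ?X) (cm True ?f ?q)"
    by (rule mlin_ins[OF X.vs.vector_space_axioms adm_mlin[OF ap] adm_mlin[OF af]],
        rule mlin_cm[OF X.vs.vector_space_axioms adm_mlin[OF af] adm_mlin[OF aq]])
  have all: "(\<forall>w\<in>words ?U. enat (length w) \<le> K \<longrightarrow> ins True (- 1) ?p ?f w = cm True ?f ?q w) \<longleftrightarrow>
    (\<forall>w. w \<noteq> [] \<and> enat (length w) \<le> K \<longrightarrow> ins True (- 1) ?p ?f w = cm True ?f ?q w)" (is "?l = ?r")
  proof
    assume ?l
    then have "ins True (- 1) ?p ?f (normal_word ?U w) = cm True ?f ?q (normal_word ?U w)" if "w \<noteq> []" "enat (length w) \<le> K" for w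
      using normal_word_words[OF U that(1)] that(2) by simp
    then show ?r using mlin_normal_word[OF m(1), of "[]"] mlin_normal_word[OF m(2), of "[]"] by simp
  qed (auto simp: words_def)
  have C: "coderivation ?U (codr ?p)" "has_components K ?U ?U (codr ?p) p"
    "coderivation ?X (codr ?q)" "has_components K ?X ?X (codr ?q) q"
    "coalgebra_map ?U ?X (coal ?f)" "has_components K ?U ?X (coal ?f) \<phi>"
    unfolding hp hq hf using codr_coderivation[OF U ap] codr_coderivation[OF X aq] coal_coalgebra_map[OF U X af]
      proj1_codr[OF U] proj1_codr[OF X] proj1_coal[OF X] by (blast, blast, blast, blast, blast, auto simp: words_def)
  show ?thesis
    unfolding all[symmetric]
  proof
    assume "L_morphism K V W p q \<phi>"
    then obtain QV QW \<Phi> where *: "coderivation ?U QV" "has_components K ?U ?U QV p" "coderivation ?X QW"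
      "has_components K ?X ?X QW q" "coalgebra_map ?U ?X \<Phi>" "has_components K ?U ?X \<Phi> \<phi>"
      and e: "\<forall>w\<in>words ?U. enat (length w) \<le> K \<longrightarrow> proj1 ?X (\<Phi> (QV (fgen w)) - QW (\<Phi> (fgen w))) = 0"
      unfolding L_morphism_def by blast
    show ?l using e diff[OF *] by simp
  next
    assume ?l
    then have "\<forall>w\<in>words ?U. enat (length w) \<le> K \<longrightarrow>
      proj1 ?X (coal ?f (codr ?p (fgen w)) - codr ?q (coal ?f (fgen w))) = 0"
      using diff[OF C] by simp
    then show "L_morphism K V W p q \<phi>" using \<phi> C unfolding L_morphism_def by blast
  qed
qed

theorem L_extension:
  fixes V :: "('k::field_char_0, 'v::ab_group_add) complex_data"
    and W :: "('k, 'w::ab_group_add) complex_data"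
  assumes k: "1 \<le> k"
    and Va: "L_algebra \<infinity> V p" and Wa: "L_algebra (enat k) W q" and Fm: "L_morphism (enat k) V W p q \<phi>"
    and qi: "quasi_iso V W (\<lambda>x. \<phi> 1 [x])"
  shows "\<exists>q' \<phi>'. (\<forall>i. 1 \<le> i \<and> i \<le> k \<longrightarrow> q' i = q i) \<and> (\<forall>i. 1 \<le> i \<and> i \<le> k \<longrightarrow> \<phi>' i = \<phi> i) \<and>
     L_algebra \<infinity> W q' \<and> L_morphism \<infinity> V W p q' \<phi>'"
proof -
  let ?U = "susp V" and ?X = "susp W" and ?K = "enat k"
  have V: "chain_complex V" and W: "chain_complex W" using Va Wa by (simp_all add: L_algebra_def)
  have U: "complex ?U" and X: "complex ?X" by (rule complex_susp[OF V], rule complex_susp[OF W])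
  have p: "sym_hom ?U ?U i (- 1) (p i)" if "1 \<le> i" for i using Va that by (simp add: L_algebra_def)
  have q: "sym_hom ?X ?X i (- 1) (q i)" if "1 \<le> i" "enat i \<le> ?K" for i using Wa that by (simp add: L_algebra_def)
  have \<phi>: "sym_hom ?U ?X i 0 (\<phi> i)" if "1 \<le> i" "enat i \<le> ?K" for i using Fm that by (simp add: L_morphism_def)
  have p1: "p 1 [x] = bd ?U x" for x using Va unfolding L_algebra_def by blast
  have q1: "q 1 [x] = bd ?X x" for x using Wa unfolding L_algebra_def by blast
  have k1: "enat 1 \<le> ?K" using k by simp
  let ?p = "lie_maps \<infinity> ?U p" and ?q = "lie_maps ?K ?X q" and ?f = "lie_maps ?K ?U \<phi>"
  have ap: "adm Lie ?U ?U (- 1) ?p" and aq: "adm Lie ?X ?X (- 1) ?q" and af: "adm Lie ?U ?X 0 ?f"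
    using adm_lie_maps[OF U U p] adm_lie_maps[OF X X q] adm_lie_maps[OF U X \<phi>] by blast+
  have dp: "?p [(d, x)] = dU ?U d x" for d x
    using p1 by (simp add: lie_maps_eq dU_def)
  have dq: "?q [(d, x)] = dU ?X d x" for d x
    using q1 k by (simp add: lie_maps_eq dU_def one_enat_def[symmetric])
  have pp: "ins (sy Lie) (- 1) ?p ?p w = 0" if "w \<noteq> []" for w
    using L_algebra_words[where K = \<infinity>, OF V p p1] Va that by simp
  have "ins True (- 1) ?p ?f w = cm True ?f ?q w" if w: "w \<noteq> []" "enat (length w) \<le> ?K" for w
  proof -
    have "ins True (- 1) ?p ?f w = ins True (- 1) (lie_maps ?K ?U p) ?f w"
      by (rule ins_cong[where H = UNIV]) (use w(2) in \<open>auto simp: lie_maps_eq\<close>)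
    then show ?thesis using L_morphism_words[where K = ?K, OF V W p q \<phi>] Fm w by simp
  qed
  moreover have "ins True (- 1) ?q ?q w = 0" if w: "w \<noteq> []" "enat (length w) \<le> ?K" for w
    using L_algebra_words[where K = ?K, OF W q q1] Wa w by simp
  ultimately have st: "stage Lie ?U ?X ?p k ?q ?f"
    unfolding stage_def using aq af dq by simp
  have "?f [(d, x)] = \<phi> 1 [component ?U d x]" for d x
    using k by (simp add: lie_maps_eq one_enat_def[symmetric])
  then have "quism ?U ?X (\<lambda>d x. ?f [(d, x)])" using quism_susp[OF V W qi] by simp
  from extension_words[OF U X ap dp pp st k this]
  obtain q' \<phi>' where st': "\<And>M. stage Lie ?U ?X ?p M q' \<phi>'"
    and same: "\<And>w. length w \<le> k \<Longrightarrow> q' w = ?q w" "\<And>w. length w \<le> k \<Longrightarrow> \<phi>' w = ?f w" by blast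
  have q': "adm Lie ?X ?X (- 1) q'" and \<phi>': "adm Lie ?U ?X 0 \<phi>'"
    using st'[of 0] by (simp_all add: stage_def)
  define n where "n i = (if i \<le> k then q i else ext ?X q')" for i
  define F where "F i = (if i \<le> k then \<phi> i else ext ?U \<phi>')" for i
  have sh: "sym_hom A B i e (ext A f)" if "complex A" "complex B" "adm Lie A B e f" "1 \<le> i"
    for A :: "('k, 'a::ab_group_add) complex_data" and B :: "('k, 'b::ab_group_add) complex_data" and i e f
    unfolding sym_hom_def
    using multi_hom_ext[OF that] ext_sym[OF that(1) adm_mlin[OF that(3)] adm_graded_sym[OF that(3) refl]] by blast
  have ns: "sym_hom ?X ?X i (- 1) (n i)" if "1 \<le> i" for i
    using q[OF that] sh[OF X X q' that] by (simp add: n_def)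
  have Fs: "sym_hom ?U ?X i 0 (F i)" if "1 \<le> i" for i
    using \<phi>[OF that] sh[OF U X \<phi>' that] by (simp add: F_def)
  have n1: "n 1 [x] = bd ?X x" for x using q1 k by (simp add: n_def)
  have nw: "lie_maps \<infinity> ?X n = q'"
  proof
    fix w
    show "lie_maps \<infinity> ?X n w = q' w"
      using same(1)[of w] ext_args[OF X adm_mlin[OF q'], of w] by (simp add: lie_maps_eq n_def)
  qed
  have Fw: "lie_maps \<infinity> ?U F = \<phi>'"
  proof
    fix w
    show "lie_maps \<infinity> ?U F w = \<phi>' w"
      using same(2)[of w] ext_args[OF U adm_mlin[OF \<phi>'], of w] by (simp add: lie_maps_eq F_def)
  qed
  have i: "ins True (- 1) q' q' w = 0" "ins True (- 1) ?p \<phi>' v = cm True \<phi>' q' v"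
    if "w \<noteq> []" "v \<noteq> []" for w v
    using st'[of "length w"] st'[of "length v"] that by (simp_all add: stage_def)
  have "L_algebra \<infinity> W n" using L_algebra_words[where K = \<infinity>, OF W ns n1] i(1)[OF _ list.discI[OF refl]] by (simp add: nw)
  moreover have "L_morphism \<infinity> V W p n F" using L_morphism_words[where K = \<infinity>, OF V W p ns Fs] i(2)[OF list.discI[OF refl]] by (simp add: nw Fw)
  ultimately show ?thesis by (intro exI[of _ n] exI[of _ F]) (simp add: n_def F_def)
qed

theorem theorem15:
  fixes K :: enat
    and V :: "('k::field_char_0, 'v::ab_group_add) complex_data"
    and W :: "('k, 'w::ab_group_add) complex_data"
  assumes "1 \<le> K"
  shows
    "(\<forall>m n F. A_algebra \<infinity> V m \<and> A_algebra K W n \<and> A_morphism K V W m n F \<and>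
        quasi_iso V W (\<lambda>x. F 1 [x]) \<longrightarrow>
        (\<exists>n' F'. (\<forall>i. 2 \<le> i \<and> enat i \<le> K \<longrightarrow> n' i = n i) \<and>
           (\<forall>i. 1 \<le> i \<and> enat i \<le> K \<longrightarrow> F' i = F i) \<and>
           A_algebra \<infinity> W n' \<and> A_morphism \<infinity> V W m n' F'))
     \<and> (\<forall>m n F. C_algebra \<infinity> V m \<and> C_algebra K W n \<and> C_morphism K V W m n F \<and>
        quasi_iso V W (\<lambda>x. F 1 [x]) \<longrightarrow>
        (\<exists>n' F'. (\<forall>i. 2 \<le> i \<and> enat i \<le> K \<longrightarrow> n' i = n i) \<and>
           (\<forall>i. 1 \<le> i \<and> enat i \<le> K \<longrightarrow> F' i = F i) \<and>
           C_algebra \<infinity> W n' \<and> C_morphism \<infinity> V W m n' F'))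
     \<and> (\<forall>p q \<phi>. L_algebra \<infinity> V p \<and> L_algebra K W q \<and> L_morphism K V W p q \<phi> \<and>
        quasi_iso V W (\<lambda>x. \<phi> 1 [x]) \<longrightarrow>
        (\<exists>q' \<phi>'. (\<forall>i. 1 \<le> i \<and> enat i \<le> K \<longrightarrow> q' i = q i) \<and>
           (\<forall>i. 1 \<le> i \<and> enat i \<le> K \<longrightarrow> \<phi>' i = \<phi> i) \<and>
           L_algebra \<infinity> W q' \<and> L_morphism \<infinity> V W p q' \<phi>'))"
proof (intro conjI allI impI; elim conjE)
  fix m n F
  assume Va: "A_algebra \<infinity> V m" and Wa: "A_algebra K W n" and Fm: "A_morphism K V W m n F"
    and qi: "quasi_iso V W (\<lambda>x. F 1 [x])"
  show "\<exists>n' F'. (\<forall>i. 2 \<le> i \<and> enat i \<le> K \<longrightarrow> n' i = n i) \<and> (\<forall>i. 1 \<le> i \<and> enat i \<le> K \<longrightarrow> F' i = F i) \<and>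
    A_algebra \<infinity> W n' \<and> A_morphism \<infinity> V W m n' F'"
  proof (cases K)
    case (enat k)
    then have k: "1 \<le> k" using assms by (simp add: one_enat_def)
    show ?thesis
      using A_extension[of Assoc, OF _ k Va Wa[unfolded enat] Fm[unfolded enat] qi]
      unfolding enat enat_ord_simps(1) by blast
  next
    case infinity
    then show ?thesis using Wa Fm by blast
  qed
next
  fix m n F
  assume Va: "C_algebra \<infinity> V m" and Wa: "C_algebra K W n" and Fm: "C_morphism K V W m n F"
    and qi: "quasi_iso V W (\<lambda>x. F 1 [x])"
  show "\<exists>n' F'. (\<forall>i. 2 \<le> i \<and> enat i \<le> K \<longrightarrow> n' i = n i) \<and> (\<forall>i. 1 \<le> i \<and> enat i \<le> K \<longrightarrow> F' i = F i) \<and>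
    C_algebra \<infinity> W n' \<and> C_morphism \<infinity> V W m n' F'"
  proof (cases K)
    case (enat k)
    then have k: "1 \<le> k" using assms by (simp add: one_enat_def)
    have A: "A_algebra \<infinity> V m" "A_algebra (enat k) W n" "A_morphism (enat k) V W m n F"
      and c: "\<And>i. 2 \<le> i \<Longrightarrow> vanishes_on_shuffles V V i (m i)"
        "\<And>i. 2 \<le> i \<Longrightarrow> i \<le> k \<Longrightarrow> vanishes_on_shuffles W W i (n i)"
        "\<And>i. 1 \<le> i \<Longrightarrow> i \<le> k \<Longrightarrow> vanishes_on_shuffles V W i (F i)"
      using Va Wa Fm enat by (simp_all add: C_algebra_def C_morphism_def)
    show ?thesis
      using A_extension[of Comm, OF _ k A qi c]
      unfolding enat enat_ord_simps(1) C_algebra_def C_morphism_def by blast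
  next
    case infinity
    then show ?thesis using Wa Fm by blast
  qed
next
  fix p q \<phi>
  assume Va: "L_algebra \<infinity> V p" and Wa: "L_algebra K W q" and Fm: "L_morphism K V W p q \<phi>"
    and qi: "quasi_iso V W (\<lambda>x. \<phi> 1 [x])"
  show "\<exists>q' \<phi>'. (\<forall>i. 1 \<le> i \<and> enat i \<le> K \<longrightarrow> q' i = q i) \<and> (\<forall>i. 1 \<le> i \<and> enat i \<le> K \<longrightarrow> \<phi>' i = \<phi> i) \<and>
    L_algebra \<infinity> W q' \<and> L_morphism \<infinity> V W p q' \<phi>'"
  proof (cases K)
    case (enat k)
    then have k: "1 \<le> k" using assms by (simp add: one_enat_def)
    show ?thesis
      using L_extension[OF k Va Wa[unfolded enat] Fm[unfolded enat] qi]
      unfolding enat enat_ord_simps(1) .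
  next
    case infinity
    then show ?thesis using Wa Fm by blast
  qed
qed

end
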